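(* Let $G$ be a locally compact group. Then the group algebra $L^1(G)$ is a zero Lie product determined Banach algebra.
   Context: $L^1(G)$ is the complex Banach algebra of (classes of) functions integrable with respect to left Haar measure, with convolution product. A complex Banach algebra $A$ is a zero Lie product determined Banach algebra if for every continuous bilinear functional $\varphi\colon A\times A\to\mathbb{C}$ satisfying $\varphi(a,b)=0$ whenever $a,b\in A$ and $ab=ba$, there exists $\omega$ in the dual space $A^*$ such that $\varphi(a,b)=\omega(ab-ba)$ for all $a,b\in A$. *)

theory Defs
  imports "HOL-Analysis.Analysis"
begin

section \<open>Complex Banach algebras\<close>

text \<open>
  Algebras are neither unital nor commutative in general. They live on an explicit carrier, since
  the group algebra below depends on a measure and hence cannot be a type.
\<close>

record 'a normed_alg =
  carrier :: "'a set"
  zero :: 'a ("\<zero>\<index>")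
  add :: "'a \<Rightarrow> 'a \<Rightarrow> 'a" (infixl "\<oplus>\<index>" 65)
  smult :: "complex \<Rightarrow> 'a \<Rightarrow> 'a" (infixr "\<odot>\<index>" 75)
  mult :: "'a \<Rightarrow> 'a \<Rightarrow> 'a" (infixl "\<otimes>\<index>" 70)
  nrm :: "'a \<Rightarrow> real" ("\<parallel>_\<parallel>\<index>")

definition sub :: "('a, 'm) normed_alg_scheme \<Rightarrow> 'a \<Rightarrow> 'a \<Rightarrow> 'a" (infixl "\<ominus>\<index>" 65)
  where "a \<ominus>\<^bsub>A\<^esub> b = a \<oplus>\<^bsub>A\<^esub> (- 1) \<odot>\<^bsub>A\<^esub> b"

locale complex_algebra =
  fixes A :: "('a, 'm) normed_alg_scheme" (structure)
  assumes zero_closed: "\<zero> \<in> carrier A"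
    and add_closed: "\<lbrakk>a \<in> carrier A; b \<in> carrier A\<rbrakk> \<Longrightarrow> a \<oplus> b \<in> carrier A"
    and smult_closed: "a \<in> carrier A \<Longrightarrow> c \<odot> a \<in> carrier A"
    and mult_closed: "\<lbrakk>a \<in> carrier A; b \<in> carrier A\<rbrakk> \<Longrightarrow> a \<otimes> b \<in> carrier A"
    and add_assoc: "\<lbrakk>a \<in> carrier A; b \<in> carrier A; d \<in> carrier A\<rbrakk> \<Longrightarrow>
          (a \<oplus> b) \<oplus> d = a \<oplus> (b \<oplus> d)"
    and add_commute: "\<lbrakk>a \<in> carrier A; b \<in> carrier A\<rbrakk> \<Longrightarrow> a \<oplus> b = b \<oplus> a"
    and add_zero: "a \<in> carrier A \<Longrightarrow> a \<oplus> \<zero> = a"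
    and sub_self: "a \<in> carrier A \<Longrightarrow> a \<ominus> a = \<zero>"
    and smult_add_right: "\<lbrakk>a \<in> carrier A; b \<in> carrier A\<rbrakk> \<Longrightarrow> c \<odot> (a \<oplus> b) = c \<odot> a \<oplus> c \<odot> b"
    and smult_add_left: "a \<in> carrier A \<Longrightarrow> (c + c') \<odot> a = c \<odot> a \<oplus> c' \<odot> a"
    and smult_smult: "a \<in> carrier A \<Longrightarrow> c \<odot> (c' \<odot> a) = (c * c') \<odot> a"
    and smult_one: "a \<in> carrier A \<Longrightarrow> 1 \<odot> a = a"
    and mult_assoc: "\<lbrakk>a \<in> carrier A; b \<in> carrier A; d \<in> carrier A\<rbrakk> \<Longrightarrow>
          (a \<otimes> b) \<otimes> d = a \<otimes> (b \<otimes> d)"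
    and distrib_left: "\<lbrakk>a \<in> carrier A; b \<in> carrier A; d \<in> carrier A\<rbrakk> \<Longrightarrow>
          d \<otimes> (a \<oplus> b) = d \<otimes> a \<oplus> d \<otimes> b"
    and distrib_right: "\<lbrakk>a \<in> carrier A; b \<in> carrier A; d \<in> carrier A\<rbrakk> \<Longrightarrow>
          (a \<oplus> b) \<otimes> d = a \<otimes> d \<oplus> b \<otimes> d"
    and smult_mult_left: "\<lbrakk>a \<in> carrier A; b \<in> carrier A\<rbrakk> \<Longrightarrow> (c \<odot> a) \<otimes> b = c \<odot> (a \<otimes> b)"
    and smult_mult_right: "\<lbrakk>a \<in> carrier A; b \<in> carrier A\<rbrakk> \<Longrightarrow> a \<otimes> (c \<odot> b) = c \<odot> (a \<otimes> b)"

locale complex_banach_algebra = complex_algebra +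
  assumes norm_nonneg: "a \<in> carrier A \<Longrightarrow> 0 \<le> \<parallel>a\<parallel>"
    and norm_eq_0_iff: "a \<in> carrier A \<Longrightarrow> \<parallel>a\<parallel> = 0 \<longleftrightarrow> a = \<zero>"
    and norm_triangle: "\<lbrakk>a \<in> carrier A; b \<in> carrier A\<rbrakk> \<Longrightarrow> \<parallel>a \<oplus> b\<parallel> \<le> \<parallel>a\<parallel> + \<parallel>b\<parallel>"
    and norm_smult: "a \<in> carrier A \<Longrightarrow> \<parallel>c \<odot> a\<parallel> = cmod c * \<parallel>a\<parallel>"
    and norm_mult: "\<lbrakk>a \<in> carrier A; b \<in> carrier A\<rbrakk> \<Longrightarrow> \<parallel>a \<otimes> b\<parallel> \<le> \<parallel>a\<parallel> * \<parallel>b\<parallel>"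
    and complete: "\<lbrakk>\<And>n. s n \<in> carrier A; \<And>e. e > 0 \<Longrightarrow> \<exists>N. \<forall>m\<ge>N. \<forall>n\<ge>N. \<parallel>s m \<ominus> s n\<parallel> < e\<rbrakk> \<Longrightarrow>
          \<exists>a\<in>carrier A. (\<lambda>n::nat. \<parallel>s n \<ominus> a\<parallel>) \<longlonglongrightarrow> 0"

text \<open>
  Functionals are total functions on the ambient type, constrained on the carrier only.
\<close>

definition dual_space :: "('a, 'm) normed_alg_scheme \<Rightarrow> ('a \<Rightarrow> complex) set"
  where "dual_space A = {\<omega>.
    (\<forall>a\<in>carrier A. \<forall>b\<in>carrier A. \<omega> (a \<oplus>\<^bsub>A\<^esub> b) = \<omega> a + \<omega> b) \<and>
    (\<forall>c. \<forall>a\<in>carrier A. \<omega> (c \<odot>\<^bsub>A\<^esub> a) = c * \<omega> a) \<and>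
    (\<forall>a\<in>carrier A. \<forall>e>0. \<exists>d>0. \<forall>a'\<in>carrier A. \<parallel>a' \<ominus>\<^bsub>A\<^esub> a\<parallel>\<^bsub>A\<^esub> < d \<longrightarrow> cmod (\<omega> a' - \<omega> a) < e)}"

definition bilinear_functional :: "('a, 'm) normed_alg_scheme \<Rightarrow> ('a \<Rightarrow> 'a \<Rightarrow> complex) \<Rightarrow> bool"
  where "bilinear_functional A \<phi> \<longleftrightarrow>
    (\<forall>a\<in>carrier A. \<forall>b\<in>carrier A. \<forall>d\<in>carrier A.
       \<phi> (a \<oplus>\<^bsub>A\<^esub> b) d = \<phi> a d + \<phi> b d \<and> \<phi> d (a \<oplus>\<^bsub>A\<^esub> b) = \<phi> d a + \<phi> d b) \<and>
    (\<forall>c. \<forall>a\<in>carrier A. \<forall>b\<in>carrier A.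
       \<phi> (c \<odot>\<^bsub>A\<^esub> a) b = c * \<phi> a b \<and> \<phi> a (c \<odot>\<^bsub>A\<^esub> b) = c * \<phi> a b)"

definition jointly_continuous :: "('a, 'm) normed_alg_scheme \<Rightarrow> ('a \<Rightarrow> 'a \<Rightarrow> complex) \<Rightarrow> bool"
  where "jointly_continuous A \<phi> \<longleftrightarrow>
    (\<forall>a\<in>carrier A. \<forall>b\<in>carrier A. \<forall>e>0. \<exists>d>0. \<forall>a'\<in>carrier A. \<forall>b'\<in>carrier A.
       \<parallel>a' \<ominus>\<^bsub>A\<^esub> a\<parallel>\<^bsub>A\<^esub> < d \<longrightarrow> \<parallel>b' \<ominus>\<^bsub>A\<^esub> b\<parallel>\<^bsub>A\<^esub> < d \<longrightarrow> cmod (\<phi> a' b' - \<phi> a b) < e)"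

definition zero_Lie_product_determined_banach_algebra :: "('a, 'm) normed_alg_scheme \<Rightarrow> bool"
  where "zero_Lie_product_determined_banach_algebra A \<longleftrightarrow>
    complex_banach_algebra A \<and>
    (\<forall>\<phi>. bilinear_functional A \<phi> \<and> jointly_continuous A \<phi> \<and>
         (\<forall>a\<in>carrier A. \<forall>b\<in>carrier A. a \<otimes>\<^bsub>A\<^esub> b = b \<otimes>\<^bsub>A\<^esub> a \<longrightarrow> \<phi> a b = 0) \<longrightarrow>
         (\<exists>\<omega>\<in>dual_space A. \<forall>a\<in>carrier A. \<forall>b\<in>carrier A.
            \<phi> a b = \<omega> (a \<otimes>\<^bsub>A\<^esub> b \<ominus>\<^bsub>A\<^esub> b \<otimes>\<^bsub>A\<^esub> a)))"

section \<open>Haar measure and the group algebra\<close>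

text \<open>
  Topological groups are written additively, as in the class \<^class>\<open>topological_group_add\<close>, which does
  not assume commutativity: \<open>x + y\<close> stands for the product, \<open>- x\<close> for the inverse, \<open>0\<close> for
  the identity.

  A left Haar measure is a nonzero left-invariant Radon measure on the Borel sets. Outer regularity
  is required of all Borel sets, inner regularity of open sets only (on groups that are not
  sigma-compact, inner regularity of all Borel sets can fail).
\<close>

definition left_Haar_measure :: "'g::topological_group_add measure \<Rightarrow> bool"
  where "left_Haar_measure \<mu> \<longleftrightarrow>
    sets \<mu> = sets borel \<and>
    emeasure \<mu> UNIV \<noteq> 0 \<and>
    (\<forall>K. compact K \<longrightarrow> emeasure \<mu> K < \<infinity>) \<and>
    (\<forall>B\<in>sets borel. emeasure \<mu> B = (INF U\<in>{U. open U \<and> B \<subseteq> U}. emeasure \<mu> U)) \<and>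
    (\<forall>U. open U \<longrightarrow> emeasure \<mu> U = (SUP K\<in>{K. compact K \<and> K \<subseteq> U}. emeasure \<mu> K)) \<and>
    (\<forall>g. \<forall>B\<in>sets borel. emeasure \<mu> ((\<lambda>x. g + x) ` B) = emeasure \<mu> B)"

text \<open>
  In multiplicative notation \<open>(f * h) x = \<integral> f y h (y\<inverse> x) dy\<close>. Where the integrand
  is not integrable, which for integrable \<open>f\<close>, \<open>h\<close> happens only on a null set of \<open>x\<close>, the
  Bochner integral is \<open>0\<close>.
\<close>

definition convolve ::
    "'g::topological_group_add measure \<Rightarrow> ('g \<Rightarrow> complex) \<Rightarrow> ('g \<Rightarrow> complex) \<Rightarrow> 'g \<Rightarrow> complex"
  where "convolve \<mu> f h x = (\<integral>y. f y * h (- y + x) \<partial>\<mu>)"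

definition ae_rel :: "'g measure \<Rightarrow> (('g \<Rightarrow> complex) \<times> ('g \<Rightarrow> complex)) set"
  where "ae_rel \<mu> = {(f, h). integrable \<mu> f \<and> integrable \<mu> h \<and> (AE x in \<mu>. f x = h x)}"

definition ae_class :: "'g measure \<Rightarrow> ('g \<Rightarrow> complex) \<Rightarrow> ('g \<Rightarrow> complex) set"
  where "ae_class \<mu> f = ae_rel \<mu> `` {f}"

definition rep :: "('g \<Rightarrow> complex) set \<Rightarrow> 'g \<Rightarrow> complex"
  where "rep F = (SOME f. f \<in> F)"

text \<open>
  All operations are independent of the choice of representatives.
\<close>

definition L1_group_algebra ::
    "'g::topological_group_add measure \<Rightarrow> ('g \<Rightarrow> complex) set normed_alg"
  where "L1_group_algebra \<mu> = \<lparr>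
    carrier = {f. integrable \<mu> f} // ae_rel \<mu>,
    zero = ae_class \<mu> (\<lambda>x. 0),
    add = (\<lambda>F H. ae_class \<mu> (\<lambda>x. rep F x + rep H x)),
    smult = (\<lambda>c F. ae_class \<mu> (\<lambda>x. c * rep F x)),
    mult = (\<lambda>F H. ae_class \<mu> (convolve \<mu> (rep F) (rep H))),
    nrm = (\<lambda>F. \<integral>x. cmod (rep F x) \<partial>\<mu>)\<rparr>"

end

theory Submission
  imports Defs
begin

text \<open>
  Let \<open>\<phi>\<close> vanish on commuting pairs and let \<open>x * y = 0\<close>. For absolutely summable \<open>f\<close>, \<open>g\<close> on the integers
  with \<open>f * g = 0\<close>, the elements \<open>\<Sum> f m (\<delta>\<^bsub>mu\<^esub> * x)\<close> and \<open>\<Sum> g n (y * \<delta>\<^bsub>nu\<^esub>)\<close> have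
  product \<open>0\<close> in both orders, so \<open>\<phi>\<close> vanishes on them. By spectral synthesis for the diagonal of the
  torus, \<open>\<phi> (\<delta>\<^sub>u * x) y = \<phi> x (y * \<delta>\<^sub>u)\<close>. Thus the defect \<open>\<phi> (\<delta>\<^sub>u * f) h - \<phi> f (h * \<delta>\<^sub>u)\<close> vanishes
  whenever \<open>f * h = 0\<close>. The same argument then shows that it is balanced, so that, by an approximate
  identity, it is \<open>D\<^sub>u (f * h)\<close> for a bounded functional \<open>D\<^sub>u\<close>.

  Up to translation the \<open>D\<^sub>u\<close> form a bounded cocycle for conjugation with values in the dual of
  \<open>L\<^sup>1\<close>. The dual is an order complete lattice on which conjugation acts by automorphisms, so the
  supremum of the cocycle trivializes it: the defect is \<open>\<omega> (\<delta>\<^sub>u * f * h) - \<omega> (f * h * \<delta>\<^sub>u)\<close> for some \<open>\<omega>\<close>.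
  No amenability is needed. Now \<open>\<kappa> f h = \<phi> f h - \<omega> (f * h - h * f)\<close> satisfies
  \<open>\<kappa> (a * b) y = \<kappa> b (y * a)\<close> and is skew-symmetric, and these identities force \<open>\<kappa> = 0\<close>.
\<close>

section \<open>Spectral synthesis for the diagonal of the torus\<close>

text \<open>The defect isolates the right object. For a commutator form
  \<open>\<phi> f h = \<omega> (f * h - h * f)\<close> the two terms
  \<open>\<omega> (h * \<delta>\<^sub>u * f)\<close> cancel in it and \<open>\<omega>
  (\<delta>\<^sub>u * f * h) - \<omega> (f * h * \<delta>\<^sub>u)\<close> remains, which depends on
  the single element \<open>f * h\<close>. So the defect of a general \<open>\<phi>\<close> is first
  shown to depend on \<open>f * h\<close> alone, and \<open>\<omega>\<close> is then read off from
  the family of these functionals. The condition \<open>a * b = b * a\<close> is not linear, so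
  commuting pairs have to be manufactured. Translates by powers \<open>m\<close> and
  \<open>n\<close> of one group element that meet in the middle of a product give a term depending
  on \<open>m + n\<close> only, and scalar sequences with \<open>f * g = 0\<close> annihilate any
  such family. The obstacle is the generality of the group, which need be neither sigma-compact nor
  first countable. Fubini's theorem is therefore proved for functions living on countably many open
  sets of finite measure, identities in L^1 are tested against bounded Borel functions, and limits
  run along a filter of neighbourhoods of the identity.\<close>

lemma geometric_cos_sum:
  fixes r t :: real
  assumes "0 \<le> r" "r < 1"
  shows "(\<lambda>m. r ^ Suc m * cos (real (Suc m) * t)) sums
           ((1 - r\<^sup>2) / (2 * (1 - 2 * r * cos t + r\<^sup>2)) - 1 / 2)"
proof -
  \<comment> \<open>With \<open>z = r * exp (i t)\<close> the sum is the real part of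
    \<open>z / (1 - z) = 1 / (1 - z) - 1\<close>: half of the Poisson kernel, minus 1/2.\<close>
  define z where "z = of_real r * cis t"
  have nz: "norm z = r" using assms by (simp add: z_def norm_mult)
  have "(\<lambda>m. z ^ Suc m) sums (z * (1 / (1 - z)))"
    using sums_mult[OF geometric_sums[of z], of z] nz assms by simp
  then have "(\<lambda>m. Re (z ^ Suc m)) sums Re (z * (1 / (1 - z)))" by (rule sums_Re)
  moreover have "Re (z ^ Suc m) = r ^ Suc m * cos (real (Suc m) * t)" for m
    unfolding z_def power_mult_distrib Complex.DeMoivre
    by (simp add: Re_complex_of_real flip: of_real_power)
  moreover have "Re (z * (1 / (1 - z))) = (1 - r\<^sup>2) / (2 * (1 - 2 * r * cos t + r\<^sup>2)) - 1 / 2"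
  proof -
    have n: "(Re (1 - z))\<^sup>2 + (Im (1 - z))\<^sup>2 = 1 - 2 * r * cos t + r\<^sup>2"
    proof -
      have "(1 - r * cos t)\<^sup>2 + (r * sin t)\<^sup>2 = 1 - 2 * r * cos t + r\<^sup>2 * ((sin t)\<^sup>2 + (cos t)\<^sup>2)"
        by (simp only: power2_eq_square algebra_simps)
      then show ?thesis by (simp add: z_def)
    qed
    have pos: "1 - 2 * r * cos t + r\<^sup>2 > 0"
    proof -
      have "z \<noteq> 1" using nz assms by auto
      then have "(cmod (1 - z))\<^sup>2 > 0" by simp
      then show ?thesis using n by (simp add: cmod_power2)
    qed
    have "1 - z \<noteq> 0" using nz assms by auto
    then have "z * (1 / (1 - z)) = 1 / (1 - z) - 1" by (simp add: field_simps)
    then have "Re (z * (1 / (1 - z))) = Re (1 / (1 - z)) - 1" by simp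
    also have "Re (1 / (1 - z)) = Re (1 - z) / (1 - 2 * r * cos t + r\<^sup>2)"
      by (simp only: Re_divide n) simp
    also have "Re (1 - z) = 1 - r * cos t" by (simp add: z_def)
    finally show ?thesis using pos by (simp add: field_simps power2_eq_square)
  qed
  ultimately show ?thesis by simp
qed

lemma cos_less_1:
  assumes "0 < t" "t < 2 * pi" shows "cos t < 1"
proof -
  have "sin (t / 2) > 0" using assms by (intro sin_gt_zero) auto
  then have "(sin (t/2))\<^sup>2 > 0" by simp
  moreover have "cos t = 1 - 2 * (sin (t / 2))\<^sup>2" using cos_double_sin[of "t/2"] by simp
  ultimately show ?thesis by linarith
qed

text \<open>A second primitive of minus the Poisson series. The damping \<open>r < 1\<close> makes
  the differentiated series converge uniformly, which fails at \<open>r = 1\<close>; hence the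
  passage to radius 1 comes only after differencing.\<close>

lemma has_derivative_cos_series:
  fixes r :: real
  assumes "0 \<le> r" "r < 1"
  defines "g \<equiv> \<lambda>t. \<Sum>m. r ^ Suc m * cos (real (Suc m) * t) / (real (Suc m))\<^sup>2"
    and "g1 \<equiv> \<lambda>t. \<Sum>m. - (r ^ Suc m) * sin (real (Suc m) * t) / real (Suc m)"
    and "g2 \<equiv> \<lambda>t. \<Sum>m. - (r ^ Suc m) * cos (real (Suc m) * t)"
  shows "(g has_real_derivative g1 t) (at t)" "(g1 has_real_derivative g2 t) (at t)"
proof -
  have sm: "summable (\<lambda>m. r ^ Suc m)"
    using assms by (simp add: summable_geometric summable_mult)
  have b1: "norm (- (r ^ Suc m) * sin (real (Suc m) * x) / real (Suc m)) \<le> r ^ Suc m" for m x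
  proof -
    have "\<bar>r ^ Suc m * sin (real (Suc m) * x)\<bar> \<le> r ^ Suc m * 1"
      unfolding abs_mult using assms by (intro mult_mono) (auto simp del: of_nat_Suc)
    also have "\<dots> \<le> r ^ Suc m * real (Suc m)" using assms by (intro mult_left_mono) auto
    finally show ?thesis by (simp add: divide_le_eq del: of_nat_Suc power_Suc)
  qed
  have b2: "norm (- (r ^ Suc m) * cos (real (Suc m) * x)) \<le> r ^ Suc m" for m x
  proof -
    have "\<bar>r ^ Suc m * cos (real (Suc m) * x)\<bar> \<le> r ^ Suc m * 1"
      unfolding abs_mult using assms by (intro mult_mono) (auto simp del: of_nat_Suc)
    then show ?thesis by (simp del: of_nat_Suc power_Suc)
  qed
  have u1: "uniformly_convergent_on UNIV (\<lambda>n x. \<Sum>i<n. - (r ^ Suc i) * sin (real (Suc i) * x) / real (Suc i))"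
    by (rule Weierstrass_m_test'[OF _ sm]) (rule b1)
  have u2: "uniformly_convergent_on UNIV (\<lambda>n x. \<Sum>i<n. - (r ^ Suc i) * cos (real (Suc i) * x))"
    by (rule Weierstrass_m_test'[OF _ sm]) (rule b2)
  have b0: "norm (r ^ Suc m * cos (real (Suc m) * x) / (real (Suc m))\<^sup>2) \<le> r ^ Suc m" for m x
  proof -
    have "\<bar>r ^ Suc m * cos (real (Suc m) * x)\<bar> \<le> r ^ Suc m * 1"
      unfolding abs_mult using assms by (intro mult_mono) (auto simp del: of_nat_Suc)
    also have "\<dots> \<le> r ^ Suc m * (real (Suc m))\<^sup>2"
      using assms by (intro mult_left_mono) (auto simp del: of_nat_Suc intro!: one_le_power)
    finally show ?thesis by (simp add: divide_le_eq del: of_nat_Suc power_Suc)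
  qed
  show "(g has_real_derivative g1 t) (at t)" unfolding g_def g1_def
  proof (rule has_field_derivative_series'(2)[where S=UNIV and ?x0.0=0
      and f="\<lambda>m t. r ^ Suc m * cos (real (Suc m) * t) / (real (Suc m))\<^sup>2"
      and f'="\<lambda>m t. - (r ^ Suc m) * sin (real (Suc m) * t) / real (Suc m)"])
    show "summable (\<lambda>m. r ^ Suc m * cos (real (Suc m) * 0) / (real (Suc m))\<^sup>2)"
      by (rule summable_comparison_test'[OF sm, of 0]) (rule b0)
    show "((\<lambda>t. r ^ Suc n * cos (real (Suc n) * t) / (real (Suc n))\<^sup>2) has_real_derivative
         - (r ^ Suc n) * sin (real (Suc n) * x) / real (Suc n)) (at x within UNIV)" for n x
      by (auto intro!: derivative_eq_intros simp: power2_eq_square simp del: of_nat_Suc power_Suc)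
  qed (use u1 in auto)
  show "(g1 has_real_derivative g2 t) (at t)" unfolding g2_def g1_def
  proof (rule has_field_derivative_series'(2)[where S=UNIV and ?x0.0=0
      and f="\<lambda>m t. - (r ^ Suc m) * sin (real (Suc m) * t) / real (Suc m)"
      and f'="\<lambda>m t. - (r ^ Suc m) * cos (real (Suc m) * t)"])
    show "((\<lambda>t. - (r ^ Suc n) * sin (real (Suc n) * t) / real (Suc n)) has_real_derivative
         - (r ^ Suc n) * cos (real (Suc n) * x)) (at x within UNIV)" for n x
      by (auto intro!: derivative_eq_intros simp del: of_nat_Suc power_Suc)
  qed (use u2 in auto)
qed

text \<open>Taylor's theorem of order two on either side of \<open>t\<close>. The two intermediate
  points stay separate, since a bound for \<open>g2\<close> on the interval is all that is wanted
  later.\<close>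

lemma second_difference_mean_value:
  fixes g g1 g2 :: "real \<Rightarrow> real"
  assumes 1: "\<And>t. (g has_real_derivative g1 t) (at t)"
    and 2: "\<And>t. (g1 has_real_derivative g2 t) (at t)" and h: "h > 0"
  obtains a b where "a \<in> {t - h..t + h}" "b \<in> {t - h..t + h}"
    "g (t + h) + g (t - h) - 2 * g t = h\<^sup>2 / 2 * (g2 a + g2 b)"
proof -
  define D where "D = (\<lambda>k::nat. if k = 0 then g else if k = 1 then g1 else g2)"
  have D: "\<forall>m x. m < 2 \<and> t - h \<le> x \<and> x \<le> t + h \<longrightarrow> (D m has_real_derivative D (Suc m) x) (at x)"
    using 1 2 by (auto simp: D_def less_2_cases_iff)
  obtain a where a: "if t + h < t then t + h < a \<and> a < t else t < a \<and> a < t + h"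
    "g (t + h) = (\<Sum>m<2. (D m t / fact m) * (t + h - t) ^ m) + (D 2 a / fact 2) * (t + h - t) ^ 2"
    using Taylor[of 2 D g "t - h" "t + h" t "t + h", OF _ _ D] h by (auto simp: D_def)
  obtain b where b: "if t - h < t then t - h < b \<and> b < t else t < b \<and> b < t - h"
    "g (t - h) = (\<Sum>m<2. (D m t / fact m) * (t - h - t) ^ m) + (D 2 b / fact 2) * (t - h - t) ^ 2"
    using Taylor[of 2 D g "t - h" "t + h" t "t - h", OF _ _ D] h by (auto simp: D_def)
  have "g (t + h) + g (t - h) - 2 * g t = h\<^sup>2 / 2 * (g2 a + g2 b)"
    unfolding a b by (simp add: D_def numeral_2_eq_2 algebra_simps power2_eq_square)
  then show thesis using that[of a b] a b h by auto
qed

text \<open>A second difference of the Poisson kernel identity, in the limit of radius 1.\<close>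

lemma sinc_square_cos_sums:
  fixes d t :: real
  assumes "0 < d" "2 * d < t" "t < 2 * pi - 2 * d"
  shows "(\<Sum>m. (sin (real (Suc m) * d))\<^sup>2 * cos (real (Suc m) * t) / (real (Suc m))\<^sup>2) = - d\<^sup>2 / 2"
proof -
  define c where "c m = (sin (real (Suc m) * d))\<^sup>2 * cos (real (Suc m) * t) / (real (Suc m))\<^sup>2" for m
  define S where "S r = (\<Sum>m. r ^ Suc m * c m)" for r
  have sm: "summable (\<lambda>m. 1 / (real (Suc m))\<^sup>2)"
    using inverse_power_summable[of 2, where 'a=real]
    by (subst summable_Suc_iff[where f="\<lambda>m. 1 / (real m)\<^sup>2"]) (simp add: inverse_eq_divide)
  have cb: "\<bar>c m\<bar> \<le> 1 / (real (Suc m))\<^sup>2" for m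
  proof -
    have "\<bar>(sin (real (Suc m) * d))\<^sup>2 * cos (real (Suc m) * t)\<bar> \<le> 1 * 1"
      unfolding abs_mult by (intro mult_mono) (auto simp del: of_nat_Suc simp: abs_square_le_1)
    then show ?thesis unfolding c_def abs_divide by (simp add: divide_right_mono del: of_nat_Suc)
  qed
  have rc: "norm (r ^ Suc m * c m) \<le> 1 / (real (Suc m))\<^sup>2" if "r \<in> {0..1}" for r m
  proof -
    have "\<bar>r ^ Suc m\<bar> * \<bar>c m\<bar> \<le> 1 * (1 / (real (Suc m))\<^sup>2)"
      using that by (intro mult_mono cb) (auto simp: power_le_one simp del: power_Suc)
    then show ?thesis by (simp add: abs_mult del: power_Suc of_nat_Suc)
  qed
  \<comment> \<open>The series for \<open>S\<close> converges uniformly on the closed interval of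
    radii, so its value at 1 is the limit of the Abel sums.\<close>
  have cont: "continuous_on {0..1} S"
  proof (rule uniform_limit_theorem)
    show "uniform_limit {0..1} (\<lambda>n r. \<Sum>i<n. r ^ Suc i * c i) S sequentially"
      unfolding S_def by (rule Weierstrass_m_test[OF _ sm]) (rule rc)
    show "\<forall>\<^sub>F n in sequentially. continuous_on {0..1} (\<lambda>r. \<Sum>i<n. r ^ Suc i * c i)"
      by (intro always_eventually allI continuous_intros)
  qed simp
  have "continuous_on {t - 2 * d..t + 2 * d} cos" by (intro continuous_intros)
  then obtain x0 where x0: "x0 \<in> {t - 2 * d..t + 2 * d}" "\<And>x. x \<in> {t - 2 * d..t + 2 * d} \<Longrightarrow> cos x \<le> cos x0"
    using continuous_attains_sup[of "{t - 2 * d..t + 2 * d}" cos] assms by auto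
  \<comment> \<open>The hypotheses on \<open>t\<close> keep the whole interval strictly between
    \<open>0\<close> and \<open>2 * pi\<close>, away from the point where the Poisson kernel
    concentrates.\<close>
  have c0: "cos x0 < 1" using x0(1) assms by (intro cos_less_1) auto
  have bound: "\<bar>S r + d\<^sup>2 / 2\<bar> \<le> d\<^sup>2 * (1 - r\<^sup>2) / (4 * r * (1 - cos x0))" if r: "0 < r" "r < 1" for r
  proof -
    define g where "g \<equiv> \<lambda>t. \<Sum>m. r ^ Suc m * cos (real (Suc m) * t) / (real (Suc m))\<^sup>2"
    define g1 where "g1 \<equiv> \<lambda>t. \<Sum>m. - (r ^ Suc m) * sin (real (Suc m) * t) / real (Suc m)"
    define g2 where "g2 \<equiv> \<lambda>t. \<Sum>m. - (r ^ Suc m) * cos (real (Suc m) * t)"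
    have g2: "g2 x = 1 / 2 - (1 - r\<^sup>2) / (2 * (1 - 2 * r * cos x + r\<^sup>2))" for x
      using sums_minus[OF geometric_cos_sum[of r x]] r unfolding g2_def by (simp add: sums_iff)
    have d: "(g has_real_derivative g1 t) (at t)" "(g1 has_real_derivative g2 t) (at t)" for t
      using has_derivative_cos_series[of r t] r unfolding g_def g1_def g2_def by auto
    have gsum: "(\<lambda>m. r ^ Suc m * cos (real (Suc m) * x) / (real (Suc m))\<^sup>2) sums g x" for x
    proof -
      have "norm (r ^ Suc m * cos (real (Suc m) * x) / (real (Suc m))\<^sup>2) \<le> 1 / (real (Suc m))\<^sup>2" for m
      proof -
        have "\<bar>r ^ Suc m\<bar> * \<bar>cos (real (Suc m) * x)\<bar> \<le> 1 * 1"
          using r by (intro mult_mono) (auto simp: power_le_one simp del: power_Suc of_nat_Suc)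
        then show ?thesis by (simp add: abs_mult divide_right_mono del: power_Suc of_nat_Suc)
      qed
      then have "summable (\<lambda>m. r ^ Suc m * cos (real (Suc m) * x) / (real (Suc m))\<^sup>2)"
        by (intro summable_comparison_test'[OF sm, of 0])
      then show ?thesis unfolding g_def by (simp add: summable_sums)
    qed
    \<comment> \<open>The coefficient is -1/4 times a second difference of \<open>cos\<close> with
      step \<open>2 * d\<close>; this is how the squared sines arise from \<open>g\<close>.\<close>
    have trig: "(sin (n * d))\<^sup>2 * cos (n * t) =
       cos (n * t) / 2 - cos (n * (t + 2 * d)) / 4 - cos (n * (t - 2 * d)) / 4" for n :: real
    proof -
      have "cos (n * (t + 2 * d)) + cos (n * (t - 2 * d)) = 2 * cos (n * t) * cos (2 * (n * d))"
        by (simp add: distrib_left right_diff_distrib cos_add cos_diff mult.left_commute)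
      also have "cos (2 * (n * d)) = 1 - 2 * (sin (n * d))\<^sup>2" by (rule cos_double_sin)
      finally show ?thesis by (simp add: algebra_simps)
    qed
    have "(\<lambda>m. r ^ Suc m * c m) sums (g t / 2 - g (t + 2 * d) / 4 - g (t - 2 * d) / 4)"
    proof -
      have "r ^ Suc m * c m = r ^ Suc m * cos (real (Suc m) * t) / (real (Suc m))\<^sup>2 / 2
          - (r ^ Suc m) * cos (real (Suc m) * (t + 2 * d)) / (real (Suc m))\<^sup>2 / 4
          - (r ^ Suc m) * cos (real (Suc m) * (t - 2 * d)) / (real (Suc m))\<^sup>2 / 4" for m
        unfolding c_def trig by (simp add: field_simps del: of_nat_Suc power_Suc)
      then show ?thesis by (simp only:) (intro sums_diff sums_divide gsum)
    qed
    then have S: "S r = - (g (t + 2 * d) + g (t - 2 * d) - 2 * g t) / 4"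
      unfolding S_def by (simp add: sums_iff field_simps)
    obtain a b where ab: "a \<in> {t - 2 * d..t + 2 * d}" "b \<in> {t - 2 * d..t + 2 * d}"
      "g (t + 2 * d) + g (t - 2 * d) - 2 * g t = (2 * d)\<^sup>2 / 2 * (g2 a + g2 b)"
      using second_difference_mean_value[OF d, of "2 * d" t] assms by auto
    have e: "\<bar>(1 - r\<^sup>2) / (2 * (1 - 2 * r * cos x + r\<^sup>2))\<bar> \<le> (1 - r\<^sup>2) / (4 * r * (1 - cos x0))"
      if x: "x \<in> {t - 2 * d..t + 2 * d}" for x
    proof -
      have r1: "1 - r\<^sup>2 > 0" using r by (simp add: power_less_one_iff abs_square_less_1)
      \<comment> \<open>This form of the denominator shows it is at least
        \<open>2 * r * (1 - cos x0)\<close> on the interval, so the Poisson kernel is O(1 - r)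
        there, uniformly.\<close>
      have "1 - 2 * r * cos x + r\<^sup>2 = (1 - r)\<^sup>2 + 2 * r * (1 - cos x)"
        by (simp add: power2_eq_square algebra_simps)
      moreover have "2 * r * (1 - cos x) \<ge> 2 * r * (1 - cos x0)"
        using x0(2)[OF x] r by (intro mult_left_mono) auto
      ultimately have "1 - 2 * r * cos x + r\<^sup>2 \<ge> 2 * r * (1 - cos x0)" by (smt (verit) zero_le_power2)
      moreover have "2 * r * (1 - cos x0) > 0" using r c0 by simp
      ultimately show ?thesis using r1 by (auto simp: abs_of_nonneg intro!: divide_left_mono)
    qed
    \<comment> \<open>The constant 1/2 in \<open>g2\<close> produces exactly the value
      \<open>- d^2 / 2\<close>; what is left over consists of Poisson kernels.\<close>
    have alg: "- ((2 * d)\<^sup>2 / 2 * ((1 / 2 - A) + (1 / 2 - B))) / 4 + d\<^sup>2 / 2 = d\<^sup>2 / 2 * (A + B)" for A B :: real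
      by (simp add: field_simps power2_eq_square)
    have "S r + d\<^sup>2 / 2 = d\<^sup>2 / 2 * ((1 - r\<^sup>2) / (2 * (1 - 2 * r * cos a + r\<^sup>2)) + (1 - r\<^sup>2) / (2 * (1 - 2 * r * cos b + r\<^sup>2)))"
      unfolding S ab(3) g2 by (rule alg)
    also have "\<bar>\<dots>\<bar> \<le> d\<^sup>2 / 2 * ((1 - r\<^sup>2) / (4 * r * (1 - cos x0)) + (1 - r\<^sup>2) / (4 * r * (1 - cos x0)))"
      unfolding abs_mult using e[OF ab(1)] e[OF ab(2)]
      by (intro mult_mono order_trans[OF abs_triangle_ineq] add_mono) auto
    also have "\<dots> = d\<^sup>2 * (1 - r\<^sup>2) / (4 * r * (1 - cos x0))" by simp
    finally show ?thesis .
  qed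
  define R where "R k = 1 - 1 / real (k + 2)" for k :: nat
  have R01: "0 < R k" "R k < 1" for k by (auto simp: R_def field_simps)
  have Rlim: "R \<longlonglongrightarrow> 1"
  proof -
    have "(\<lambda>k. 1 - 1 / real (k + 2)) \<longlonglongrightarrow> 1 - 0"
      using LIMSEQ_ignore_initial_segment[OF lim_inverse_n', of 2] by (intro tendsto_intros)
    then show ?thesis unfolding R_def by simp
  qed
  have "(\<lambda>k. S (R k)) \<longlonglongrightarrow> S 1"
    using cont Rlim R01 by (intro continuous_on_tendsto_compose[OF cont]) (auto simp: less_imp_le)
  then have l1: "(\<lambda>k. S (R k) + d\<^sup>2 / 2) \<longlonglongrightarrow> S 1 + d\<^sup>2 / 2" by (intro tendsto_intros)
  have "(\<lambda>k. d\<^sup>2 * (1 - (R k)\<^sup>2) / (4 * R k * (1 - cos x0))) \<longlonglongrightarrow> d\<^sup>2 * (1 - 1\<^sup>2) / (4 * 1 * (1 - cos x0))"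
    using c0 by (intro tendsto_intros Rlim) auto
  then have "(\<lambda>k. d\<^sup>2 * (1 - (R k)\<^sup>2) / (4 * R k * (1 - cos x0))) \<longlonglongrightarrow> 0" by simp
  then have l2: "(\<lambda>k. S (R k) + d\<^sup>2 / 2) \<longlonglongrightarrow> 0"
    by (rule Lim_null_comparison[rotated]) (simp only: real_norm_def bound[OF R01] eventually_True)
  have "S 1 + d\<^sup>2 / 2 = 0" using LIMSEQ_unique[OF l1 l2] .
  then show ?thesis unfolding S_def c_def by simp
qed

lemma has_sum_int:
  fixes f :: "int \<Rightarrow> 'a::{topological_ab_group_add,t2_space}"
  assumes "((\<lambda>n. f (int (Suc n))) has_sum a) UNIV" "((\<lambda>n. f (- int (Suc n))) has_sum b) UNIV"
  shows "(f has_sum (f 0 + a + b)) UNIV"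
proof -
  have "(f has_sum a) (range (\<lambda>n. int (Suc n)))"
    using assms(1) by (subst has_sum_reindex) (auto simp: inj_on_def o_def)
  moreover have "(f has_sum b) (range (\<lambda>n. - int (Suc n)))"
    using assms(2) by (subst has_sum_reindex) (auto simp: inj_on_def o_def)
  moreover have "(f has_sum f 0) {0}" by (simp add: has_sum_finite_iff)
  ultimately have "(f has_sum (f 0 + a + b)) ({0} \<union> range (\<lambda>n. int (Suc n)) \<union> range (\<lambda>n. - int (Suc n)))"
    by (intro has_sum_Un_disjoint) auto
  moreover have "{0} \<union> range (\<lambda>n. int (Suc n)) \<union> range (\<lambda>n. - int (Suc n)) = UNIV"
  proof -
    have "x \<in> {0} \<union> range (\<lambda>n. int (Suc n)) \<union> range (\<lambda>n. - int (Suc n))" for x :: int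
    proof (cases x rule: int_cases3)
      case (pos n) then show ?thesis by (cases n) auto
    next
      case (neg n) then show ?thesis by (cases n) auto
    qed simp
    then show ?thesis by blast
  qed
  ultimately show ?thesis by simp
qed

section \<open>Squared sinc weights and their transform\<close>

text \<open>Up to a factor, the Fourier coefficients of the convolution square of the indicator of
  [-d, d] on the circle: a tent function carried by the arc [-2d, 2d]. The value at
  \<open>m = 0\<close> is the limit of the quotient.\<close>

definition sinc_square :: "real \<Rightarrow> int \<Rightarrow> real" where
  "sinc_square d m = (if m = 0 then 1 else (sin (of_int m * d) / (of_int m * d))\<^sup>2)"

lemma sinc_square_0 [simp]: "sinc_square d 0 = 1" by (simp add: sinc_square_def)

lemma sinc_square_nonneg [simp]: "sinc_square d m \<ge> 0" by (simp add: sinc_square_def)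

lemma sinc_square_minus: "sinc_square d (- m) = sinc_square d m"
  by (simp add: sinc_square_def)

lemma sinc_square_le_1: "sinc_square d m \<le> 1"
proof -
  have "\<bar>sin x / x\<bar> \<le> 1" for x :: real
    using abs_sin_x_le_abs_x[of x] by (cases "x = 0") (auto simp: divide_le_eq_1)
  then show ?thesis by (simp add: sinc_square_def abs_square_le_1)
qed

text \<open>A telescoping majorant valid on both sides of the cutoff: the weights are at most 1 for
  \<open>n < N\<close> and at most \<open>N^2 / (n + 1)^2\<close> beyond. It sums to
  \<open>4 * N\<close>, and this linear growth is what the shortness of the arc has to beat in
  \<open>synthesis\<close>.\<close>

lemma sinc_square_bound:
  assumes "N > (0::nat)"
  shows "sinc_square (1 / N) (int (Suc n)) \<le> 4 * real N * real N * (1 / real (N + n) - 1 / real (N + Suc n))"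
proof (cases "N \<le> n")
  case True
  have "sinc_square (1 / N) (int (Suc n)) = (sin (real (Suc n) / N))\<^sup>2 * (real N * real N / (real (Suc n))\<^sup>2)"
    using assms by (simp add: sinc_square_def power2_eq_square)
  also have "\<dots> \<le> 1 * (real N * real N / (real (Suc n))\<^sup>2)" by (intro mult_right_mono) (auto simp: abs_square_le_1)
  also have "\<dots> \<le> real N * real N * (4 / (real (N + n) * real (N + Suc n)))"
  proof -
    have "real (N + n) * real (N + Suc n) \<le> (2 * real (Suc n)) * (2 * real (Suc n))"
      using True by (intro mult_mono) auto
    then have "4 / (2 * real (Suc n) * (2 * real (Suc n))) \<le> 4 / (real (N + n) * real (N + Suc n))"
      using assms by (intro divide_left_mono mult_pos_pos) auto
    then have "1 / (real (Suc n))\<^sup>2 \<le> 4 / (real (N + n) * real (N + Suc n))"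
      by (simp add: power2_eq_square del: of_nat_Suc)
    then have "real N * real N * (1 / (real (Suc n))\<^sup>2) \<le> real N * real N * (4 / (real (N + n) * real (N + Suc n)))"
      by (intro mult_left_mono) auto
    then show ?thesis by simp
  qed
  also have "4 / (real (N + n) * real (N + Suc n)) = 4 * (1 / real (N + n) - 1 / real (N + Suc n))"
    using assms by (simp add: divide_simps)
  finally show ?thesis by (simp only: mult_ac)
next
  case False
  have "1 \<le> 4 * real N * real N * (1 / (real (N + n) * real (N + Suc n)))"
  proof -
    have "real (N + n) * real (N + Suc n) \<le> (2 * real N) * (2 * real N)"
      using False by (intro mult_mono) auto
    then show ?thesis using assms by (simp add: divide_simps)
  qed
  also have "1 / (real (N + n) * real (N + Suc n)) = 1 / real (N + n) - 1 / real (N + Suc n)"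
    using assms by (simp add: divide_simps)
  finally show ?thesis using sinc_square_le_1 order_trans by blast
qed

lemma sinc_square_sum:
  assumes "N > (0::nat)"
  shows "sinc_square (1 / N) summable_on UNIV" "(\<Sum>\<^sub>\<infinity>m. sinc_square (1 / N) m) \<le> 9 * real N"
proof -
  let ?b = "\<lambda>n. 4 * real N * real N * (1 / real (N + n) - 1 / real (N + Suc n))"
  have "(\<lambda>n. 1 / real (n + N)) \<longlonglongrightarrow> 0"
    using LIMSEQ_ignore_initial_segment[OF lim_inverse_n', of N] by simp
  then have lim: "(\<lambda>n. 1 / real (N + n)) \<longlonglongrightarrow> 0" by (simp add: add.commute)
  have bs: "?b sums (4 * real N * real N * (1 / real (N + 0) - 0))"
    by (intro sums_mult telescope_sums'[where f="\<lambda>n. 1 / real (N + n)"] lim)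
  have sm: "summable (\<lambda>n. sinc_square (1 / N) (int (Suc n)))"
    using sinc_square_bound[OF assms] sums_summable[OF bs]
    by (intro summable_comparison_test'[OF sums_summable[OF bs], of 0]) simp
  let ?a = "\<Sum>n. sinc_square (1 / N) (int (Suc n))"
  have "?a \<le> (\<Sum>n. ?b n)"
    using sinc_square_bound[OF assms] sm sums_summable[OF bs] by (intro suminf_le)
  also have "\<dots> = 4 * real N" using bs assms by (simp add: sums_iff)
  finally have a: "?a \<le> 4 * real N" .
  have hs: "((\<lambda>n. sinc_square (1 / N) (int (Suc n))) has_sum ?a) UNIV"
    using sm by (intro sums_nonneg_imp_has_sum) (auto simp: summable_sums)
  have *: "(sinc_square (1 / N) has_sum (sinc_square (1 / N) 0 + ?a + ?a)) UNIV"
    using hs by (intro has_sum_int) (simp_all only: sinc_square_minus)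
  then show "sinc_square (1 / N) summable_on UNIV" by (auto simp: summable_on_def)
  have "(\<Sum>\<^sub>\<infinity>m. sinc_square (1 / N) m) = 1 + ?a + ?a" using * by (simp add: infsumI)
  \<comment> \<open>\<open>4 * N\<close> from each side, and the central value 1 is at most
    \<open>N\<close>.\<close>
  also have "\<dots> \<le> 9 * real N" using a assms by auto
  finally show "(\<Sum>\<^sub>\<infinity>m. sinc_square (1 / N) m) \<le> 9 * real N" .
qed

text \<open>Pairing \<open>m\<close> with \<open>- m\<close> leaves the central term 1 plus
  \<open>2 * N^2\<close> times the series of \<open>sinc_square_cos_sums\<close>, whose value for
  \<open>d = 1 / N\<close> is \<open>- 1 / (2 * N^2)\<close>; the two cancel.\<close>

lemma sinc_square_transform_eq_0:
  assumes N: "N > (0::nat)" and t: "2 * (1 / N) < t" "t < 2 * pi - 2 * (1 / N)"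
  shows "(\<Sum>\<^sub>\<infinity>m. sinc_square (1 / N) m * cis (of_int m * t)) = 0"
proof -
  let ?d = "1 / real N"
  let ?f = "\<lambda>m. sinc_square ?d m * cis (of_int m * t)"
  have abs: "(\<lambda>m. norm (?f m)) summable_on UNIV"
    using sinc_square_sum(1)[OF N] by (simp add: norm_mult)
  have "(?f has_sum (?f 0 + (\<Sum>\<^sub>\<infinity>n. ?f (int (Suc n))) + (\<Sum>\<^sub>\<infinity>n. ?f (- int (Suc n))))) UNIV"
  proof (intro has_sum_int has_sum_infsum)
    have "(?f \<circ> g) summable_on UNIV" if "inj g" for g :: "nat \<Rightarrow> int"
      using summable_on_subset_banach[OF abs_summable_summable[OF abs], of "range g"] that
      by (simp add: summable_on_reindex)
    from this[of "\<lambda>n. int (Suc n)"] this[of "\<lambda>n. - int (Suc n)"]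
    show "(\<lambda>n. ?f (int (Suc n))) summable_on UNIV" "(\<lambda>n. ?f (- int (Suc n))) summable_on UNIV"
      by (auto simp: inj_on_def o_def)
  qed
  then have 1: "(\<Sum>\<^sub>\<infinity>m. ?f m) = ?f 0 + (\<Sum>\<^sub>\<infinity>n. ?f (int (Suc n))) + (\<Sum>\<^sub>\<infinity>n. ?f (- int (Suc n)))"
    by (rule infsumI)
  have abs': "(?f \<circ> g) summable_on UNIV" if "inj g" for g :: "nat \<Rightarrow> int"
    using summable_on_subset_banach[OF abs_summable_summable[OF abs], of "range g"] that
    by (simp add: summable_on_reindex)
  have s1: "(\<lambda>n. ?f (int (Suc n))) summable_on UNIV" "(\<lambda>n. ?f (- int (Suc n))) summable_on UNIV"
    using abs'[of "\<lambda>n. int (Suc n)"] abs'[of "\<lambda>n. - int (Suc n)"] by (auto simp: inj_on_def o_def)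
  have "(\<Sum>\<^sub>\<infinity>n. ?f (int (Suc n))) + (\<Sum>\<^sub>\<infinity>n. ?f (- int (Suc n))) = (\<Sum>\<^sub>\<infinity>n. ?f (int (Suc n)) + ?f (- int (Suc n)))"
    using s1 by (simp add: infsum_add)
  also have "(\<lambda>n. ?f (int (Suc n)) + ?f (- int (Suc n))) =
    (\<lambda>n. of_real (2 * real N * real N * ((sin (real (Suc n) * ?d))\<^sup>2 * cos (real (Suc n) * t) / (real (Suc n))\<^sup>2)))"
  proof
    fix n
    have e1: "?f (int (Suc n)) + ?f (- int (Suc n)) = of_real (sinc_square ?d (int (Suc n)) * (2 * cos (real (Suc n) * t)))"
      by (simp add: sinc_square_minus complex_eq_iff del: of_nat_Suc)
    have e2: "sinc_square ?d (int (Suc n)) = real N * real N * (sin (real (Suc n) * ?d))\<^sup>2 / (real (Suc n))\<^sup>2"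
      using N by (simp add: sinc_square_def power_divide power2_eq_square)
    show "?f (int (Suc n)) + ?f (- int (Suc n)) = of_real (2 * real N * real N * ((sin (real (Suc n) * ?d))\<^sup>2 * cos (real (Suc n) * t) / (real (Suc n))\<^sup>2))"
      by (subst e1, subst e2, intro arg_cong[where f=complex_of_real]) (simp del: of_nat_Suc)
  qed
  finally have 2: "(\<Sum>\<^sub>\<infinity>m. ?f m) = 1 + (\<Sum>\<^sub>\<infinity>n. of_real (2 * real N * real N * ((sin (real (Suc n) * ?d))\<^sup>2 * cos (real (Suc n) * t) / (real (Suc n))\<^sup>2)))"
    unfolding 1 by (simp add: add.assoc)
  let ?c = "\<lambda>n. 2 * real N * real N * ((sin (real (Suc n) * ?d))\<^sup>2 * cos (real (Suc n) * t) / (real (Suc n))\<^sup>2)"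
  have cs: "(\<lambda>n. complex_of_real (?c n)) summable_on UNIV"
    using summable_on_add[OF s1] \<open>(\<lambda>n. ?f (int (Suc n)) + ?f (- int (Suc n))) = _\<close> by simp
  then have "?c summable_on UNIV" using summable_on_Re[OF cs] by simp
  then have "?c sums (\<Sum>\<^sub>\<infinity>n. ?c n)" by (intro has_sum_imp_sums has_sum_infsum)
  then have "(\<Sum>\<^sub>\<infinity>n. ?c n) = (\<Sum>n. ?c n)" by (simp add: sums_iff)
  also have "\<dots> = 2 * real N * real N * (\<Sum>n. (sin (real (Suc n) * ?d))\<^sup>2 * cos (real (Suc n) * t) / (real (Suc n))\<^sup>2)"
  proof (rule suminf_mult)
    have "summable (\<lambda>n. ?c n / (2 * N * N))"
      using \<open>?c sums (\<Sum>\<^sub>\<infinity>n. ?c n)\<close> by (intro summable_divide) (auto simp: sums_iff)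
    then show "summable (\<lambda>n. (sin (real (Suc n) * ?d))\<^sup>2 * cos (real (Suc n) * t) / (real (Suc n))\<^sup>2)"
      using N by simp
  qed
  also have "\<dots> = 2 * real N * real N * (- ?d\<^sup>2 / 2)"
    using sinc_square_cos_sums[of ?d t] t N by simp
  also have "\<dots> = -1" using N by (simp add: power2_eq_square)
  finally have 3: "(\<Sum>\<^sub>\<infinity>n. ?c n) = -1" .
  have "(\<Sum>\<^sub>\<infinity>n. complex_of_real (?c n)) = of_real (\<Sum>\<^sub>\<infinity>n. ?c n)"
    using has_sum_of_real[OF has_sum_infsum[OF \<open>?c summable_on UNIV\<close>]] by (rule infsumI)
  then show ?thesis unfolding 2 3 by simp
qed

section \<open>Absolutely convergent Fourier series\<close>

lemma has_integral_cis:
  "((\<lambda>t. cis (of_int j * t)) has_integral (if j = 0 then complex_of_real (2 * pi) else 0)) {0..2 * pi}"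
proof (cases "j = 0")
  case True
  then show ?thesis using has_integral_const_real[of "1::complex" 0 "2 * pi"] by (simp add: scaleR_conv_of_real)
next
  case False
  have d: "((\<lambda>t. cis (of_int j * t) / (\<i> * of_int j)) has_vector_derivative cis (of_int j * t)) (at t within {0..2*pi})" for t
    using has_vector_derivative_divide[OF exp_scaleR_has_vector_derivative_right[of "\<i> * of_int j" t "{0..2*pi}"], of "\<i> * of_int j"] False
    by (simp add: cis_conv_exp scaleR_conv_of_real mult_ac)
  have c: "cis (of_int j * (2 * pi)) = 1" by (metis cis_multiple_2pi Ints_of_int mult.commute)
  have "((\<lambda>t. cis (of_int j * t)) has_integral (cis (of_int j * (2*pi)) / (\<i> * of_int j) - cis (of_int j * 0) / (\<i> * of_int j))) {0..2 * pi}"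
    by (rule fundamental_theorem_of_calculus) (use d in auto)
  then show ?thesis using False c by simp
qed

text \<open>Absolute summability gives uniform convergence along the finite sets of indices. By
  orthogonality the integrals of the partial sums are constant as soon as the set contains
  \<open>k\<close>.\<close>

lemma has_integral_fourier_coeff:
  fixes c :: "int \<Rightarrow> complex"
  assumes "(\<lambda>m. norm (c m)) summable_on UNIV"
  shows "((\<lambda>t. (\<Sum>\<^sub>\<infinity>m. c m * cis (of_int m * t)) * cis (- of_int k * t)) has_integral complex_of_real (2 * pi) * c k) {0..2 * pi}"
proof -
  let ?f = "\<lambda>X t. \<Sum>m\<in>X. c m * cis (of_int (m - k) * t)"
  have e: "c m * cis (of_int (m - k) * t) = c m * cis (of_int m * t) * cis (- of_int k * t)" for m t
    by (simp add: cis_mult left_diff_distrib)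
  have u: "uniform_limit {0..2*pi} ?f (\<lambda>t. \<Sum>\<^sub>\<infinity>m. c m * cis (of_int (m - k) * t)) (finite_subsets_at_top UNIV)"
    by (rule Weierstrass_m_test_general[where M="\<lambda>m. norm (c m)"]) (use assms in \<open>auto simp: norm_mult\<close>)
  obtain I J where IJ: "\<And>X. (?f X has_integral I X) {0..2*pi}"
     "((\<lambda>t. \<Sum>\<^sub>\<infinity>m. c m * cis (of_int (m - k) * t)) has_integral J) {0..2*pi}" "(I \<longlongrightarrow> J) (finite_subsets_at_top UNIV)"
    by (rule uniform_limit_integral[OF u]) (auto intro!: continuous_intros simp: cis_conv_exp)
  have I: "I X = complex_of_real (2 * pi) * c k" if "finite X" "k \<in> X" for X
  proof -
    have "(?f X has_integral (\<Sum>m\<in>X. c m * (if m - k = 0 then complex_of_real (2 * pi) else 0))) {0..2*pi}"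
      by (intro has_integral_sum that(1) has_integral_mult_right has_integral_cis)
    also have "(\<Sum>m\<in>X. c m * (if m - k = 0 then complex_of_real (2 * pi) else 0)) = (\<Sum>m\<in>X. if k = m then complex_of_real (2 * pi) * c m else 0)"
      by (intro sum.cong) auto
    also have "\<dots> = complex_of_real (2 * pi) * c k" using that by simp
    finally show ?thesis using IJ(1) has_integral_unique by blast
  qed
  have "eventually (\<lambda>X. I X = complex_of_real (2 * pi) * c k) (finite_subsets_at_top UNIV)"
    unfolding eventually_finite_subsets_at_top by (rule exI[of _ "{k}"]) (auto simp: I)
  then have "(I \<longlongrightarrow> complex_of_real (2 * pi) * c k) (finite_subsets_at_top UNIV)"
    by (simp add: tendsto_eventually)
  with IJ(3) have "J = complex_of_real (2 * pi) * c k" by (rule tendsto_unique[OF finite_subsets_at_top_neq_bot])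
  moreover have "(\<lambda>t. \<Sum>\<^sub>\<infinity>m. c m * cis (of_int (m - k) * t)) =
    (\<lambda>t. (\<Sum>\<^sub>\<infinity>m. c m * cis (of_int m * t)) * cis (- of_int k * t))"
    unfolding e by (simp add: infsum_cmult_left')
  ultimately show ?thesis using IJ(2) by simp
qed

lemma fourier_unique:
  fixes c :: "int \<Rightarrow> complex"
  assumes "(\<lambda>m. norm (c m)) summable_on UNIV" "\<And>t. (\<Sum>\<^sub>\<infinity>m. c m * cis (of_int m * t)) = 0"
  shows "c k = 0"
proof -
  have "((\<lambda>t. 0::complex) has_integral complex_of_real (2 * pi) * c k) {0..2 * pi}"
    using has_integral_fourier_coeff[OF assms(1), of k] assms(2) by simp
  then have "2 * pi * c k = 0" using has_integral_unique has_integral_0 by blast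
  then show ?thesis by simp
qed

lemma sinc_square_transform_support:
  assumes N: "N > (0::nat)" and nz: "(\<Sum>\<^sub>\<infinity>m. sinc_square (1 / N) m * cis (of_int m * t)) \<noteq> 0"
  obtains k :: int where "\<bar>t - 2 * pi * k\<bar> \<le> 2 / N"
proof -
  define k where "k = \<lfloor>t / (2 * pi)\<rfloor>"
  define s where "s = t - 2 * pi * k"
  have s: "0 \<le> s" "s < 2 * pi"
  proof -
    have "of_int k \<le> t / (2 * pi)" "t / (2 * pi) < of_int k + 1" unfolding k_def by linarith+
    then show "0 \<le> s" "s < 2 * pi" by (simp_all add: s_def field_simps)
  qed
  have "cis (of_int m * t) = cis (of_int m * s)" for m
  proof -
    have "cis (of_int m * t) = cis (of_int m * s) * cis (2 * pi * of_int (m * k))"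
      by (simp add: s_def cis_mult algebra_simps)
    then show ?thesis by (simp add: cis_multiple_2pi)
  qed
  then have "\<not> (2 * (1 / N) < s \<and> s < 2 * pi - 2 * (1 / N))"
    using nz sinc_square_transform_eq_0[OF N, of s] by auto
  then consider "s \<le> 2 / N" | "s \<ge> 2 * pi - 2 / N" by fastforce
  then show thesis
  proof cases
    case 1 then show thesis using s by (intro that[of k]) (simp add: s_def)
  next
    case 2
    have "t - 2 * pi * (k + 1) = s - 2 * pi" by (simp add: s_def algebra_simps)
    with 2 s show thesis by (intro that[of "k + 1"]) (simp add: algebra_simps)
  qed
qed

lemma summable_on_int_convolution:
  fixes f g :: "int \<Rightarrow> complex" and h :: "int \<Rightarrow> int \<Rightarrow> complex"
  assumes f: "(\<lambda>m. norm (f m)) summable_on UNIV" and g: "(\<lambda>m. norm (g m)) summable_on UNIV"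
    and h: "\<And>m n. norm (h m n) \<le> B"
  shows "(\<lambda>(m, n). norm (f m * (g n * h m n))) summable_on UNIV"
proof -
  have 1: "(\<lambda>x. norm (f (fst x) * g (snd x))) summable_on Sigma UNIV (\<lambda>_. UNIV)"
    unfolding Infinite_Sum.abs_summable_on_Sigma_iff
    using summable_on_cmult_right[OF g] summable_on_cmult_left[OF f]
    by (simp add: norm_mult infsum_cmult_right' abs_mult)
  have 2: "norm (f (fst x) * (g (snd x) * h (fst x) (snd x))) \<le> \<bar>B\<bar> * norm (f (fst x) * g (snd x))" for x
  proof -
    have "norm (h (fst x) (snd x)) \<le> \<bar>B\<bar>" using h order_trans abs_ge_self by blast
    then have "norm (f (fst x) * g (snd x)) * norm (h (fst x) (snd x)) \<le> norm (f (fst x) * g (snd x)) * \<bar>B\<bar>"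
      by (intro mult_left_mono) auto
    then show ?thesis by (simp add: norm_mult mult_ac)
  qed
  have "(\<lambda>x. norm (f (fst x) * (g (snd x) * h (fst x) (snd x)))) summable_on UNIV"
    by (rule summable_on_comparison_test[OF summable_on_cmult_right[OF 1[simplified], of "\<bar>B\<bar>"]])
      (use 2 in auto)
  then show ?thesis by (simp add: case_prod_unfold)
qed

text \<open>The substitution \<open>d = m + n\<close>. On the antidiagonal \<open>d\<close> sits the
  \<open>d\<close>-th coefficient of the convolution of \<open>f\<close> and \<open>g\<close>,
  weighted by \<open>h\<close>; boundedness of \<open>h\<close> makes the double series absolutely
  summable.\<close>

lemma infsum_int_antidiagonal:
  fixes f g :: "int \<Rightarrow> complex" and h :: "int \<Rightarrow> int \<Rightarrow> complex"
  assumes f: "(\<lambda>m. norm (f m)) summable_on UNIV" and g: "(\<lambda>m. norm (g m)) summable_on UNIV"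
    and h: "\<And>m n. norm (h m n) \<le> B"
  shows "(\<Sum>\<^sub>\<infinity>m. f m * (\<Sum>\<^sub>\<infinity>n. g n * h m n)) = (\<Sum>\<^sub>\<infinity>d. \<Sum>\<^sub>\<infinity>m. f m * g (d - m) * h m (d - m))"
    and "(\<lambda>d. norm (\<Sum>\<^sub>\<infinity>m. f m * g (d - m) * h m (d - m))) summable_on UNIV"
    and "(\<lambda>m. norm (f m * g (d - m) * h m (d - m))) summable_on UNIV"
proof -
  let ?F = "\<lambda>(m, n). f m * (g n * h m n)" and ?G = "\<lambda>(d, m). f m * g (d - m) * h m (d - m)"
  have sF: "(\<lambda>x. norm (?F x)) summable_on UNIV"
    using summable_on_int_convolution[OF f g h] by (simp add: case_prod_unfold)
  have bij: "bij_betw (\<lambda>(d, m). (m, d - m)) (UNIV :: (int \<times> int) set) UNIV"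
    by (rule bij_betwI[where g="\<lambda>(m, n). (m + n, m)"]) auto
  have FG: "?G = (\<lambda>x. ?F ((\<lambda>(d, m). (m, d - m)) x))" by (auto simp: fun_eq_iff)
  have sG: "(\<lambda>x. norm (?G x)) summable_on UNIV \<times> UNIV"
    unfolding FG using sF summable_on_reindex_bij_betw[OF bij, of "\<lambda>x. norm (?F x)"] by simp
  have "(\<Sum>\<^sub>\<infinity>m. f m * (\<Sum>\<^sub>\<infinity>n. g n * h m n)) = (\<Sum>\<^sub>\<infinity>m. \<Sum>\<^sub>\<infinity>n. ?F (m, n))"
    by (simp add: infsum_cmult_right')
  also have "\<dots> = infsum ?F (UNIV \<times> UNIV)"
    using abs_summable_summable[OF sF] by (intro infsum_Sigma_banach) simp
  also have "\<dots> = infsum ?G (UNIV \<times> UNIV)"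
    unfolding FG using infsum_reindex_bij_betw[OF bij, of ?F] by simp
  also have "\<dots> = (\<Sum>\<^sub>\<infinity>d. \<Sum>\<^sub>\<infinity>m. ?G (d, m))"
    using abs_summable_summable[OF sG] by (intro infsum_Sigma_banach[symmetric])
  finally show "(\<Sum>\<^sub>\<infinity>m. f m * (\<Sum>\<^sub>\<infinity>n. g n * h m n)) = (\<Sum>\<^sub>\<infinity>d. \<Sum>\<^sub>\<infinity>m. f m * g (d - m) * h m (d - m))"
    by simp
  have sGs: "(\<lambda>m. norm (?G (d, m))) summable_on UNIV" "(\<lambda>d. norm (\<Sum>\<^sub>\<infinity>m. norm (?G (d, m)))) summable_on UNIV" for d
    using sG Infinite_Sum.abs_summable_on_Sigma_iff[of ?G UNIV "\<lambda>_. UNIV"] by auto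
  show "(\<lambda>m. norm (f m * g (d - m) * h m (d - m))) summable_on UNIV" using sGs(1)[of d] by simp
  show "(\<lambda>d. norm (\<Sum>\<^sub>\<infinity>m. f m * g (d - m) * h m (d - m))) summable_on UNIV"
  proof (rule Infinite_Sum.abs_summable_on_comparison_test[OF sGs(2)])
    fix d
    show "norm (\<Sum>\<^sub>\<infinity>m. f m * g (d - m) * h m (d - m)) \<le> norm (\<Sum>\<^sub>\<infinity>m. norm (?G (d, m)))"
      using norm_infsum_bound[OF sGs(1)[of d]] unfolding real_norm_def by (intro order_trans[OF _ abs_ge_self]) simp
  qed
qed

text \<open>
  Sequences \<open>f\<close>, \<open>g\<close> with \<open>f * g = 0\<close> are produced by modulating \<open>sinc_square\<close>, whose transform is
  supported in a small arc. Hence \<open>r m = s m s (1 - m) Q m (1 - m)\<close> has its spectrum near \<open>0\<close>, and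
  \<open>r 1 - r 0\<close> is small.
\<close>

lemma synthesis:
  fixes Q :: "int \<Rightarrow> int \<Rightarrow> complex"
  assumes bdd: "\<And>m n. norm (Q m n) \<le> B"
    and zero: "\<And>f g. (\<lambda>m. norm (f m)) summable_on UNIV \<Longrightarrow> (\<lambda>m. norm (g m)) summable_on UNIV \<Longrightarrow>
      (\<And>h :: int \<Rightarrow> complex. bounded (range h) \<Longrightarrow> (\<Sum>\<^sub>\<infinity>m. f m * (\<Sum>\<^sub>\<infinity>n. g n * h (m + n))) = 0) \<Longrightarrow>
      (\<Sum>\<^sub>\<infinity>m. f m * (\<Sum>\<^sub>\<infinity>n. g n * Q m n)) = 0"
  shows "Q 1 0 = Q 0 1"
proof -
  have B0: "B \<ge> 0" using bdd[of 0 0] norm_ge_zero order_trans by blast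
  \<comment> \<open>The constant is 2 * 5 * 5 * 9: \<open>R\<close> below is bounded by
    \<open>9 * N * B\<close>, within a period it lives on two intervals of length
    \<open>5 / N\<close>, and there \<open>cis t - 1\<close> is at most
    \<open>5 / N\<close>.\<close>
  have main: "norm (sinc_square (1 / real N) 1 * (Q 1 0 - Q 0 1)) \<le> 450 * B / real N" if N: "N \<ge> 2" for N :: nat
  proof -
    define s where "s m = complex_of_real (sinc_square (1 / real N) m)" for m
    have N0: "N > 0" using N by simp
    have N1: "real N \<ge> 2" using N by simp
    have pi3: "pi > 3" using pi_gt3 by simp
    have ns: "(\<lambda>m. norm (s m)) summable_on UNIV"
      using sinc_square_sum(1)[OF N0] by (simp add: s_def)
    have nsc: "(\<lambda>m. norm (s m * cis (x m))) summable_on UNIV" for x :: "int \<Rightarrow> real"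
      using ns by (simp add: norm_mult)
    define T where "T t = (\<Sum>\<^sub>\<infinity>m. s m * cis (of_int m * t))" for t
    \<comment> \<open>Each factor is nonzero only within \<open>2 / N\<close> of a multiple of
      \<open>2 * pi\<close>. A common point would put \<open>a\<close> within \<open>4 / N\<close>
      of such a multiple, which the margin \<open>5 / N\<close> excludes.\<close>
    have T: "T t * T (t - a) = 0" if a: "5 / N \<le> a" "a \<le> 2 * pi - 5 / N" for t a
    proof (rule ccontr)
      assume "\<not> ?thesis"
      then have nz: "T t \<noteq> 0" "T (t - a) \<noteq> 0" by auto
      obtain k l :: int where kl: "\<bar>t - 2 * pi * k\<bar> \<le> 2 / N" "\<bar>t - a - 2 * pi * l\<bar> \<le> 2 / N"
        using sinc_square_transform_support[OF N0 nz(1)[unfolded T_def s_def]]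
          sinc_square_transform_support[OF N0 nz(2)[unfolded T_def s_def]] by metis
      then have "\<bar>a - 2 * pi * real_of_int (k - l)\<bar> \<le> 4 / N" by (simp add: algebra_simps abs_le_iff)
      moreover have "4 / N < 5 / N" using N0 by (simp add: divide_strict_right_mono)
      ultimately have "2 * pi * 0 < 2 * pi * real_of_int (k - l)" "2 * pi * real_of_int (k - l) < 2 * pi * 1"
        using a by linarith+
      then have "real_of_int (k - l) > 0" "real_of_int (k - l) < 1"
        unfolding mult_less_cancel_left_pos[OF pi_gt_zero[THEN mult_pos_pos[OF zero_less_numeral]]] .
      then have "0 < k - l" "k - l < 1" by (simp_all only: of_int_0_less_iff of_int_less_1_iff)
      then show False by linarith
    qed
    \<comment> \<open>On coefficients, the vanishing product of transforms says that
      \<open>s\<close> modulated by \<open>a\<close> has convolution zero with \<open>s\<close>.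
      This provides the pairs to which \<open>zero\<close> is applied.\<close>
    have conv0: "(\<Sum>\<^sub>\<infinity>m. s m * cis (- of_int m * a) * s (k - m)) = 0" if a: "5 / N \<le> a" "a \<le> 2 * pi - 5 / N" for a k
    proof (rule fourier_unique[where c="\<lambda>k. \<Sum>\<^sub>\<infinity>m. s m * cis (- of_int m * a) * s (k - m)"])
      show "(\<lambda>d. norm (\<Sum>\<^sub>\<infinity>m. s m * cis (- of_int m * a) * s (d - m))) summable_on UNIV"
        using infsum_int_antidiagonal(2)[OF nsc ns, where h="\<lambda>_ _. 1" and B=1] by simp
      fix t
      have "T (t - a) * T t = (\<Sum>\<^sub>\<infinity>m. s m * cis (of_int m * (t - a))) * T t" by (simp add: T_def)
      also have "\<dots> = (\<Sum>\<^sub>\<infinity>m. s m * cis (of_int m * (t - a)) * T t)" by (simp add: infsum_cmult_left')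
      also have "\<dots> = (\<Sum>\<^sub>\<infinity>m. s m * cis (- of_int m * a) * (\<Sum>\<^sub>\<infinity>n. s n * cis (of_int (m + n) * t)))"
      proof (intro infsum_cong)
        fix m
        have e1: "cis (of_int m * (t - a)) = cis (- of_int m * a) * cis (of_int m * t)"
          by (simp add: cis_mult algebra_simps)
        have e2: "cis (of_int m * t) * T t = (\<Sum>\<^sub>\<infinity>n. s n * cis (of_int (m + n) * t))"
          unfolding T_def by (subst infsum_cmult_right'[symmetric], rule infsum_cong) (simp add: cis_mult algebra_simps)
        show "s m * cis (of_int m * (t - a)) * T t = s m * cis (- of_int m * a) * (\<Sum>\<^sub>\<infinity>n. s n * cis (of_int (m + n) * t))"
          unfolding e1 e2[symmetric] by (simp only: mult_ac)
      qed
      also have "\<dots> = (\<Sum>\<^sub>\<infinity>d. \<Sum>\<^sub>\<infinity>m. s m * cis (- of_int m * a) * s (d - m) * cis (of_int (m + (d - m)) * t))"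
        by (rule infsum_int_antidiagonal(1)[OF nsc ns, where B=1]) simp
      also have "\<dots> = (\<Sum>\<^sub>\<infinity>d. (\<Sum>\<^sub>\<infinity>m. s m * cis (- of_int m * a) * s (d - m)) * cis (of_int d * t))"
        by (simp add: infsum_cmult_left')
      finally show "(\<Sum>\<^sub>\<infinity>d. (\<Sum>\<^sub>\<infinity>m. s m * cis (- of_int m * a) * s (d - m)) * cis (of_int d * t)) = 0"
        using T[OF a, of t] by (simp add: mult.commute)
    qed
    \<comment> \<open>The antidiagonal \<open>m + n = 1\<close> contains both points (1, 0) and (0,
      1) to be compared, and they carry the same weight \<open>s 0 * s 1\<close>.\<close>
    define r where "r m = s m * s (1 - m) * Q m (1 - m)" for m
    have Q0: "(\<Sum>\<^sub>\<infinity>m. r m * cis (- of_int m * a)) = 0" if a: "5 / N \<le> a" "a \<le> 2 * pi - 5 / N" for a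
    proof -
      have "(\<Sum>\<^sub>\<infinity>m. s m * cis (- of_int m * a) * s (1 - m) * Q m (1 - m)) = 0"
      \<comment> \<open>A further modulation of both factors by \<open>b\<close> multiplies the
        antidiagonal \<open>d\<close> by \<open>cis (d * b)\<close>. Since \<open>b\<close> is
        arbitrary, the antidiagonals are separated and each of them vanishes by itself.\<close>
      proof (rule fourier_unique[where k=1 and c="\<lambda>d. \<Sum>\<^sub>\<infinity>m. s m * cis (- of_int m * a) * s (d - m) * Q m (d - m)"])
        show "(\<lambda>d. norm (\<Sum>\<^sub>\<infinity>m. s m * cis (- of_int m * a) * s (d - m) * Q m (d - m))) summable_on UNIV"
          by (rule infsum_int_antidiagonal(2)[OF nsc ns bdd])
        fix b
        have "(\<Sum>\<^sub>\<infinity>d. (\<Sum>\<^sub>\<infinity>m. s m * cis (- of_int m * a) * s (d - m) * Q m (d - m)) * cis (of_int d * b))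
          = (\<Sum>\<^sub>\<infinity>d. \<Sum>\<^sub>\<infinity>m. s m * cis (of_int m * (b - a)) * (s (d - m) * cis (of_int (d - m) * b)) * Q m (d - m))"
        proof (intro infsum_cong, subst infsum_cmult_left'[symmetric], rule infsum_cong)
          fix d m
          have "cis (- of_int m * a) * cis (of_int d * b) = cis (of_int m * (b - a)) * cis (of_int (d - m) * b)"
            by (simp add: cis_mult algebra_simps)
          then show "s m * cis (- of_int m * a) * s (d - m) * Q m (d - m) * cis (of_int d * b) =
            s m * cis (of_int m * (b - a)) * (s (d - m) * cis (of_int (d - m) * b)) * Q m (d - m)"
            by (simp add: mult_ac)
        qed
        also have "\<dots> = (\<Sum>\<^sub>\<infinity>m. s m * cis (of_int m * (b - a)) * (\<Sum>\<^sub>\<infinity>n. s n * cis (of_int n * b) * Q m n))"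
          by (rule infsum_int_antidiagonal(1)[OF nsc nsc bdd, symmetric])
        also have "\<dots> = 0"
        proof (rule zero[OF nsc nsc])
          fix h :: "int \<Rightarrow> complex" assume "bounded (range h)"
          then obtain C where C: "\<And>k. norm (h k) \<le> C" by (auto simp: bounded_iff)
          have "(\<Sum>\<^sub>\<infinity>m. s m * cis (of_int m * (b - a)) * (\<Sum>\<^sub>\<infinity>n. s n * cis (of_int n * b) * h (m + n)))
             = (\<Sum>\<^sub>\<infinity>d. \<Sum>\<^sub>\<infinity>m. s m * cis (of_int m * (b - a)) * (s (d - m) * cis (of_int (d - m) * b)) * h (m + (d - m)))"
            by (rule infsum_int_antidiagonal(1)[OF nsc nsc C])
          also have "\<dots> = (\<Sum>\<^sub>\<infinity>d. (\<Sum>\<^sub>\<infinity>m. s m * cis (- of_int m * a) * s (d - m)) * (cis (of_int d * b) * h d))"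
          proof (intro infsum_cong, subst infsum_cmult_left'[symmetric], rule infsum_cong)
            fix d m
            have "cis (- of_int m * a) * cis (of_int d * b) = cis (of_int m * (b - a)) * cis (of_int (d - m) * b)"
              by (simp add: cis_mult algebra_simps)
            then show "s m * cis (of_int m * (b - a)) * (s (d - m) * cis (of_int (d - m) * b)) * h (m + (d - m)) =
              s m * cis (- of_int m * a) * s (d - m) * (cis (of_int d * b) * h d)"
              by (simp add: mult_ac)
          qed
          also have "\<dots> = 0" using conv0[OF a] by simp
          finally show "(\<Sum>\<^sub>\<infinity>m. s m * cis (of_int m * (b - a)) * (\<Sum>\<^sub>\<infinity>n. s n * cis (of_int n * b) * h (m + n))) = 0" .
        qed
        finally show "(\<Sum>\<^sub>\<infinity>d. (\<Sum>\<^sub>\<infinity>m. s m * cis (- of_int m * a) * s (d - m) * Q m (d - m)) * cis (of_int d * b)) = 0" .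
      qed
      moreover have "(\<lambda>m. r m * cis (- of_int m * a)) = (\<lambda>m. s m * cis (- of_int m * a) * s (1 - m) * Q m (1 - m))"
        by (simp add: r_def mult_ac fun_eq_iff)
      ultimately show ?thesis by (simp only:)
    qed
    have rb: "norm (r m) \<le> B * sinc_square (1 / real N) m" for m
    proof -
      have "norm (r m) = sinc_square (1 / real N) m * (sinc_square (1 / real N) (1 - m) * norm (Q m (1 - m)))"
        by (simp add: r_def s_def norm_mult)
      also have "\<dots> \<le> sinc_square (1 / real N) m * (1 * B)"
        by (intro mult_left_mono mult_mono bdd sinc_square_le_1) auto
      finally show ?thesis by (simp add: mult.commute)
    qed
    have sB: "(\<lambda>m. B * sinc_square (1 / real N) m) summable_on UNIV"
      by (intro summable_on_cmult_right sinc_square_sum(1)[OF N0])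
    have rs: "(\<lambda>m. norm (r m)) summable_on UNIV"
      by (rule summable_on_comparison_test[OF sB]) (auto simp: rb)
    \<comment> \<open>Reflected, because \<open>Q0\<close> concerns the characters
      \<open>cis (- m * t)\<close>. The values \<open>r 1\<close> and \<open>r 0\<close> come back
      as Fourier coefficients of \<open>R\<close>.\<close>
    define R where "R t = (\<Sum>\<^sub>\<infinity>m. r (- m) * cis (of_int m * t))" for t
    have Rr: "R t = (\<Sum>\<^sub>\<infinity>m. r m * cis (- of_int m * t))" for t
      unfolding R_def using infsum_reindex_bij_betw[of uminus UNIV UNIV "\<lambda>m. r m * cis (- of_int m * t)"]
      by (simp add: bij_uminus)
    have Rb: "norm (R t) \<le> 9 * N * B" for t
    proof -
      have "norm (R t) \<le> (\<Sum>\<^sub>\<infinity>m. norm (r m * cis (- of_int m * t)))"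
        unfolding Rr using rs by (intro norm_infsum_bound) (simp add: norm_mult)
      also have "\<dots> = (\<Sum>\<^sub>\<infinity>m. norm (r m))" by (simp add: norm_mult)
      also have "\<dots> \<le> (\<Sum>\<^sub>\<infinity>m. B * sinc_square (1 / real N) m)"
        by (intro infsum_mono rs sB rb)
      also have "\<dots> = B * (\<Sum>\<^sub>\<infinity>m. sinc_square (1 / real N) m)" by (simp add: infsum_cmult_right')
      also have "\<dots> \<le> B * (9 * N)" using sinc_square_sum(2)[OF N0] B0 by (intro mult_left_mono) auto
      finally show ?thesis by (simp add: mult_ac)
    qed
    have rs': "(\<lambda>m. norm (r (- m))) summable_on UNIV"
      using rs summable_on_reindex_bij_betw[of uminus UNIV UNIV "\<lambda>m. norm (r m)"] by (simp add: bij_uminus)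
    have i1: "((\<lambda>t. R t * cis t) has_integral complex_of_real (2 * pi) * r 1) {0..2*pi}"
      using has_integral_fourier_coeff[OF rs', of "-1"] by (simp add: R_def)
    have i0: "((\<lambda>t. R t) has_integral complex_of_real (2 * pi) * r 0) {0..2*pi}"
      using has_integral_fourier_coeff[OF rs', of 0] by (simp add: R_def)
    have i: "((\<lambda>t. R t * (cis t - 1)) has_integral complex_of_real (2 * pi) * (r 1 - r 0)) {0..2*pi}"
      using has_integral_diff[OF i1 i0] by (simp add: algebra_simps)
    let ?e = "5 / real N" and ?K = "9 * N * B * (5 / N)"
    have e: "0 < ?e" "?e < 2 * pi - ?e"
    proof -
      have "?e \<le> 5 / 2" using N1 by (intro divide_left_mono) auto
      then show "?e < 2 * pi - ?e" using pi3 by linarith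
    qed (use N0 in simp)
    have cb: "norm (cis t - 1) \<le> \<bar>t\<bar>" for t :: real
    proof -
      have "norm (cis t - 1) = 2 * \<bar>sin (t / 2)\<bar>"
        using dist_exp_i_1[of t] by (simp add: cis_conv_exp)
      then show ?thesis using abs_sin_x_le_abs_x[of "t/2"] by simp
    qed
    \<comment> \<open>Away from the ends of the period this is \<open>Q0\<close>. Near the ends only
      the factor \<open>cis t - 1\<close> is small, which is why the difference
      \<open>r 1 - r 0\<close> can be estimated.\<close>
    have pw: "norm (R t * (cis t - 1)) \<le> (if t \<in> {0..?e} then ?K else 0) + (if t \<in> {2*pi - ?e..2*pi} then ?K else 0)"
      if t: "t \<in> {0..2*pi}" for t
    proof -
      have K0: "?K \<ge> 0" using B0 by simp
      have small: "norm (R t * (cis t - 1)) \<le> ?K" if "norm (cis t - 1) \<le> ?e"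
        unfolding norm_mult using Rb[of t] that B0 by (intro mult_mono) auto
      consider "t \<le> ?e" | "t \<ge> 2*pi - ?e" | "?e < t" "t < 2 * pi - ?e" by linarith
      then show ?thesis
      proof cases
        case 1
        then have "norm (cis t - 1) \<le> ?e" using cb[of t] t by auto
        then show ?thesis using small 1 t K0 by auto
      next
        case 2
        have "cis (t - 2 * pi) = cis t" by (simp add: cis_divide[symmetric])
        then have "norm (cis t - 1) \<le> ?e" using cb[of "t - 2 * pi"] t 2 by auto
        then show ?thesis using small 2 t K0 by auto
      next
        case 3
        then have "R t = 0" using Q0[of t] by (simp add: Rr)
        then show ?thesis using K0 by simp
      qed
    qed
    have "norm (complex_of_real (2 * pi) * (r 1 - r 0)) \<le> ?e * ?K + ?e * ?K"
    proof -
      have h1: "((\<lambda>t. if t \<in> {0..?e} then ?K else 0) has_integral ?e * ?K) {0..2*pi}"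
        using has_integral_restrict[of "{0..?e}" "{0..2*pi}" "\<lambda>t. ?K"] has_integral_const_real[of ?K 0 ?e] e by auto
      have h2: "((\<lambda>t. if t \<in> {2*pi - ?e..2*pi} then ?K else 0) has_integral ?e * ?K) {0..2*pi}"
        using has_integral_restrict[of "{2*pi - ?e..2*pi}" "{0..2*pi}" "\<lambda>t. ?K"] has_integral_const_real[of ?K "2*pi-?e" "2*pi"] e by auto
      have "norm (integral {0..2*pi} (\<lambda>t. R t * (cis t - 1))) \<le> integral {0..2*pi}
          (\<lambda>t. (if t \<in> {0..?e} then ?K else 0) + (if t \<in> {2*pi - ?e..2*pi} then ?K else 0))"
        using i has_integral_add[OF h1 h2] pw by (intro integral_norm_bound_integral) (auto simp: has_integral_iff)
      then show ?thesis using i has_integral_add[OF h1 h2] by (simp add: has_integral_iff)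
    qed
    also have "?e * ?K + ?e * ?K = 450 * B / N" using N0 by (simp add: field_simps)
    finally have "2 * pi * norm (r 1 - r 0) \<le> 450 * B / N" by (simp add: norm_mult)
    moreover have "norm (r 1 - r 0) \<le> 2 * pi * norm (r 1 - r 0)"
      using pi3 mult_right_mono[of 1 "2 * pi" "norm (r 1 - r 0)"] by simp
    moreover have "r 1 - r 0 = sinc_square (1 / real N) 1 * (Q 1 0 - Q 0 1)"
      by (simp add: r_def s_def right_diff_distrib)
    ultimately show ?thesis by simp
  qed
  have l1: "(\<lambda>N. norm (sinc_square (1 / real (N + 2)) 1 * (Q 1 0 - Q 0 1))) \<longlonglongrightarrow> norm (complex_of_real 1 * (Q 1 0 - Q 0 1))"
  proof (intro tendsto_intros)
    have lim0: "(\<lambda>N. 1 / real (N + 2)) \<longlonglongrightarrow> 0"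
      using LIMSEQ_ignore_initial_segment[OF lim_inverse_n', of 2] by simp
    have "((\<lambda>x::real. sin x / x) \<longlongrightarrow> 1) (at 0)"
      using DERIV_sin[of "0::real"] by (simp add: has_field_derivative_iff)
    then have "(\<lambda>N. sin (1 / real (N + 2)) / (1 / real (N + 2))) \<longlonglongrightarrow> 1"
      by (rule filterlim_compose) (use lim0 in \<open>auto simp: filterlim_at\<close>)
    then have "(\<lambda>N. (sin (1 / real (N + 2)) / (1 / real (N + 2)))\<^sup>2) \<longlonglongrightarrow> 1\<^sup>2" by (intro tendsto_power)
    then show "(\<lambda>N. sinc_square (1 / real (N + 2)) 1) \<longlonglongrightarrow> 1" by (simp add: sinc_square_def)
  qed
  have l2: "(\<lambda>N. 450 * B * (1 / real (N + 2))) \<longlonglongrightarrow> 450 * B * 0"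
    using LIMSEQ_ignore_initial_segment[OF lim_inverse_n', of 2] by (intro tendsto_intros) simp
  have "norm (complex_of_real 1 * (Q 1 0 - Q 0 1)) \<le> 450 * B * 0"
  proof (rule LIMSEQ_le[OF l1 l2], intro exI[of _ 0] allI impI)
    fix n show "norm (sinc_square (1 / real (n + 2)) 1 * (Q 1 0 - Q 0 1)) \<le> 450 * B * (1 / real (n + 2))"
      using main[of "n + 2"] by simp
  qed
  then show ?thesis by simp
qed

text \<open>A strict inequality survives replacing open sets by compact subsets one at a time, as
  the supremum can be pulled out of the sum. The offset \<open>s\<close> carries the terms that are
  not being replaced at the moment.\<close>

lemma inner_regular_finite_family:
  fixes \<mu> :: "'a::topological_space measure"
  assumes inner: "\<And>U. open U \<Longrightarrow> emeasure \<mu> U = (SUP K\<in>{K. compact K \<and> K \<subseteq> U}. emeasure \<mu> K)"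
    and O: "\<And>j::nat. open (O' j)" and t: "t < s + (\<Sum>j<m. emeasure \<mu> (O' j))"
  shows "\<exists>K. (\<forall>j<m. compact (K j) \<and> K j \<subseteq> O' j) \<and> t < s + (\<Sum>j<m. emeasure \<mu> (K j))"
  using t
proof (induction m arbitrary: s)
  case 0 then show ?case by auto
next
  case (Suc m)
  have "t < (s + emeasure \<mu> (O' m)) + (\<Sum>j<m. emeasure \<mu> (O' j))" using Suc.prems by (simp add: ac_simps)
  from Suc.IH[OF this] obtain K where K: "\<And>j. j < m \<Longrightarrow> compact (K j) \<and> K j \<subseteq> O' j"
    "t < s + emeasure \<mu> (O' m) + (\<Sum>j<m. emeasure \<mu> (K j))" by blast
  have "t < (s + (\<Sum>j<m. emeasure \<mu> (K j))) + (SUP K\<in>{K. compact K \<and> K \<subseteq> O' m}. emeasure \<mu> K)"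
    using K(2) inner[OF O, of m] by (simp add: ac_simps)
  also have "\<dots> = (SUP K'\<in>{K. compact K \<and> K \<subseteq> O' m}. (s + (\<Sum>j<m. emeasure \<mu> (K j))) + emeasure \<mu> K')"
    by (rule ennreal_SUP_add_right) (auto intro: exI[of _ "{}"])
  finally obtain L where L: "compact L" "L \<subseteq> O' m" "t < (s + (\<Sum>j<m. emeasure \<mu> (K j))) + emeasure \<mu> L"
    by (auto simp: less_SUP_iff)
  have "t < s + (\<Sum>j<Suc m. emeasure \<mu> ((K(m := L)) j))"
  proof -
    have "(\<Sum>j<m. emeasure \<mu> ((K(m := L)) j)) = (\<Sum>j<m. emeasure \<mu> (K j))" by (intro sum.cong) auto
    then show ?thesis using L(3) by (simp add: ac_simps)
  qed
  moreover have "\<forall>j<Suc m. compact ((K(m := L)) j) \<and> (K(m := L)) j \<subseteq> O' j"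
    using K(1) L by (auto simp: less_Suc_eq)
  ultimately show ?case by blast
qed

section \<open>Fubini's theorem for Borel sets of a product\<close>

text \<open>
  On spaces that are not second countable the Borel sets of the product need not lie in the product
  of the Borel sigma-algebras, so that the library's version does not apply to convolutions.
\<close>

locale inner_regular_measure =
  fixes \<mu> :: "'a::t2_space measure"
  assumes sets_eq [measurable_cong, simp]: "sets \<mu> = sets borel"
    and inner_open: "\<And>U. open U \<Longrightarrow> emeasure \<mu> U = (SUP K\<in>{K. compact K \<and> K \<subseteq> U}. emeasure \<mu> K)"
begin

lemma space_eq [simp]: "space \<mu> = UNIV"
  using sets_eq_imp_space_eq[OF sets_eq] by simp

lemma measurable_eq: "measurable \<mu> N = measurable borel N" "measurable N \<mu> = measurable N borel"
  by (rule measurable_cong_sets; simp)+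

definition slice :: "'a \<Rightarrow> ('a \<times> 'a) set \<Rightarrow> 'a set" where "slice x E = {y. (x, y) \<in> E}"

lemma swap_borel [measurable]: "prod.swap \<in> borel \<rightarrow>\<^sub>M (borel :: ('b::topological_space \<times> 'c::topological_space) measure)"
  by (intro borel_measurable_continuous_onI continuous_on_swap)

lemma continuous_Pair: "continuous_on UNIV (Pair x)"
  using continuous_on_Pair[OF continuous_on_const continuous_on_id] by simp

lemma slice_borel: "E \<in> sets borel \<Longrightarrow> slice x E \<in> sets borel"
proof -
  assume "E \<in> sets borel"
  moreover have "Pair x \<in> borel_measurable borel"
    by (intro borel_measurable_continuous_onI continuous_Pair)
  ultimately show ?thesis unfolding slice_def by (auto dest: measurable_sets simp: vimage_def)
qed

lemma slice_open: "open E \<Longrightarrow> open (slice x E)"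
  unfolding slice_def by (rule open_vimage[OF _ continuous_Pair, unfolded vimage_def])

lemma open_vimage_swap: "open E \<Longrightarrow> open (prod.swap -` E)"
  by (intro open_vimage continuous_on_swap)

lemma inner_open_less:
  assumes "open U" "t < emeasure \<mu> U"
  obtains K where "compact K" "K \<subseteq> U" "t < emeasure \<mu> K"
proof -
  have "t < (SUP K\<in>{K. compact K \<and> K \<subseteq> U}. emeasure \<mu> K)"
    using assms(2) by (simp only: inner_open[OF assms(1)])
  then show thesis using that unfolding less_SUP_iff by blast
qed

text \<open>The tube lemma fattens a compact piece of one slice to a rectangle inside
  \<open>E\<close>. From this come both the lower semicontinuity of the slice measure and the
  rectangles that fill \<open>E\<close> from inside.\<close>

lemma slice_rectangle:
  assumes E: "open E" and t: "t < emeasure \<mu> (slice x E)"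
  obtains U C where "open U" "x \<in> U" "compact C" "U \<times> C \<subseteq> E" "C \<subseteq> slice x E" "t < emeasure \<mu> C"
proof -
  obtain C where C: "compact C" "C \<subseteq> slice x E" "t < emeasure \<mu> C"
    using inner_open_less[OF slice_open[OF E] t] by blast
  have "{x} \<times> C \<subseteq> E" using C(2) by (auto simp: slice_def)
  from Elementary_Topology.tube_lemma[OF C(1) E this] C that show thesis by blast
qed

lemma emeasure_borel_mono: "A \<subseteq> B \<Longrightarrow> B \<in> sets borel \<Longrightarrow> emeasure \<mu> A \<le> emeasure \<mu> B"
  by (simp add: emeasure_mono)

lemma slice_Times_subset:
  assumes "U \<times> C \<subseteq> E" "x \<in> U" shows "C \<subseteq> slice x E"
proof
  fix y assume "y \<in> C"
  then have "(x, y) \<in> U \<times> C" using assms by simp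
  then show "y \<in> slice x E" using assms(1) unfolding slice_def by (simp add: subset_iff)
qed

lemma open_superlevel_slice:
  assumes E: "open E" shows "open {x. t < emeasure \<mu> (slice x E)}"
proof (rule Topological_Spaces.openI)
  fix x assume "x \<in> {x. t < emeasure \<mu> (slice x E)}"
  then have tx: "t < emeasure \<mu> (slice x E)" by simp
  obtain U C where UC: "open U" "x \<in> U" "compact C" "U \<times> C \<subseteq> E" "C \<subseteq> slice x E" "t < emeasure \<mu> C"
    by (rule slice_rectangle[OF E tx])
  note U = UC(1,2,4,6)
  have "t < emeasure \<mu> (slice y E)" if "y \<in> U" for y
  proof -
    have "C \<subseteq> slice y E" using slice_Times_subset[OF U(3) that] .
    moreover have "slice y E \<in> sets borel" using E by (simp add: slice_borel borel_open)
    ultimately have "emeasure \<mu> C \<le> emeasure \<mu> (slice y E)" by (rule emeasure_borel_mono)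
    then show ?thesis using U(4) by simp
  qed
  then show "\<exists>T. open T \<and> x \<in> T \<and> T \<subseteq> {x. t < emeasure \<mu> (slice x E)}"
    using U(1,2) by (intro exI[of _ U]) auto
qed

lemma borel_measurable_slice_open:
  "open E \<Longrightarrow> (\<lambda>x. emeasure \<mu> (slice x E)) \<in> borel_measurable borel"
  by (rule borel_measurableI_greater) (simp add: open_superlevel_slice borel_open)

text \<open>The measure need not be sigma-finite, so it is cut down to the sets \<open>A\<close> and
  \<open>B\<close> of finite measure that carry all the sides. A finite union of rectangles does
  belong to the product sigma-algebra, and the classical theorem applies.\<close>

lemma rectangles_fubini:
  assumes P: "finite P" "\<And>U C. (U, C) \<in> P \<Longrightarrow> U \<in> sets borel \<and> C \<in> sets borel \<and> emeasure \<mu> U < \<infinity> \<and> emeasure \<mu> C < \<infinity>"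
  defines "R \<equiv> \<Union>(U, C)\<in>P. U \<times> C"
  shows "(\<integral>\<^sup>+x. emeasure \<mu> (slice x R) \<partial>\<mu>) = (\<integral>\<^sup>+y. emeasure \<mu> (slice y (prod.swap -` R)) \<partial>\<mu>)"
proof -
  define A where "A = (\<Union>(U, C)\<in>P. U)"
  define B where "B = (\<Union>(U, C)\<in>P. C)"
  have [measurable]: "A \<in> sets borel" "B \<in> sets borel"
    unfolding A_def B_def using P by (auto intro!: sets.finite_UN)
  have fin: "emeasure \<mu> A < \<infinity>" "emeasure \<mu> B < \<infinity>"
    unfolding A_def B_def using P
    by (auto intro!: fmeasurableD2[THEN top.not_eq_extremum[THEN iffD1]] fmeasurable.finite_UN simp: fmeasurable_def)
  have slA: "slice x R = {}" if "x \<notin> A" for x using that by (auto simp: A_def R_def slice_def)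
  have slB: "slice y (prod.swap -` R) = {}" if "y \<notin> B" for y using that by (auto simp: B_def R_def slice_def)
  let ?M1 = "density \<mu> (indicator A)" and ?M2 = "density \<mu> (indicator B)"
  have sM1: "sets ?M1 = sets borel" and sM2: "sets ?M2 = sets borel" by auto
  interpret M1: finite_measure ?M1
    by (rule finite_measureI) (use fin in \<open>auto simp: emeasure_density nn_integral_indicator\<close>)
  interpret M2: finite_measure ?M2
    by (rule finite_measureI) (use fin in \<open>auto simp: emeasure_density nn_integral_indicator\<close>)
  interpret pair_sigma_finite ?M1 ?M2 ..
  have R: "R \<in> sets (?M1 \<Otimes>\<^sub>M ?M2)"
    unfolding R_def using P by (intro sets.finite_UN) auto
  have "case_prod (\<lambda>x y. indicator R (x, y) :: ennreal) = indicator R" by auto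
  then have "(\<integral>\<^sup>+ y. (\<integral>\<^sup>+ x. indicator R (x, y) \<partial>?M1) \<partial>?M2) = (\<integral>\<^sup>+ x. (\<integral>\<^sup>+ y. indicator R (x, y) \<partial>?M2) \<partial>?M1)"
    using R by (intro Fubini') simp
  moreover have e1: "(\<integral>\<^sup>+ y. indicator R (x, y) \<partial>?M2) = emeasure \<mu> (slice x R)" for x
  proof -
    have "slice x R \<in> sets ?M2" using sets_Pair1[OF R, of x] by (simp add: slice_def vimage_def)
    then have [measurable]: "slice x R \<in> sets borel" by simp
    have "(\<integral>\<^sup>+ y. indicator R (x, y) \<partial>?M2) = (\<integral>\<^sup>+ y. indicator (slice x R) y \<partial>?M2)"
      by (intro nn_integral_cong) (auto simp: slice_def indicator_def)
    also have "\<dots> = (\<integral>\<^sup>+ y. indicator (B \<inter> slice x R) y \<partial>\<mu>)"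
      by (subst nn_integral_density) (auto intro!: nn_integral_cong simp: indicator_def simp del: nn_integral_indicator)
    also have "B \<inter> slice x R = slice x R" by (auto simp: B_def R_def slice_def)
    finally show ?thesis by simp
  qed
  moreover have e2: "(\<integral>\<^sup>+ x. indicator R (x, y) \<partial>?M1) = emeasure \<mu> (slice y (prod.swap -` R))" for y
  proof -
    have "slice y (prod.swap -` R) \<in> sets ?M1" using sets_Pair2[OF R, of y] by (simp add: slice_def vimage_def)
    then have [measurable]: "slice y (prod.swap -` R) \<in> sets borel" by simp
    have "(\<integral>\<^sup>+ x. indicator R (x, y) \<partial>?M1) = (\<integral>\<^sup>+ x. indicator (slice y (prod.swap -` R)) x \<partial>?M1)"
      by (intro nn_integral_cong) (auto simp: slice_def indicator_def)
    also have "\<dots> = (\<integral>\<^sup>+ x. indicator (A \<inter> slice y (prod.swap -` R)) x \<partial>\<mu>)"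
      by (subst nn_integral_density) (auto intro!: nn_integral_cong simp: indicator_def simp del: nn_integral_indicator)
    also have "A \<inter> slice y (prod.swap -` R) = slice y (prod.swap -` R)" by (auto simp: A_def R_def slice_def)
    finally show ?thesis by simp
  qed
  moreover have "(\<integral>\<^sup>+ x. emeasure \<mu> (slice x R) \<partial>?M1) = (\<integral>\<^sup>+ x. emeasure \<mu> (slice x R) \<partial>\<mu>)"
  proof -
    have "emeasure ?M2 (Pair x -` R) = (\<integral>\<^sup>+ y. indicator (Pair x -` R) y \<partial>?M2)" for x
      using sets_Pair1[OF R, of x] by simp
    also have "(\<integral>\<^sup>+ y. indicator (Pair x -` R) y \<partial>?M2) = (\<integral>\<^sup>+ y. indicator R (x, y) \<partial>?M2)" for x
      by (intro nn_integral_cong) (simp add: indicator_def)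
    finally have e: "emeasure ?M2 (Pair x -` R) = emeasure \<mu> (slice x R)" for x by (simp only: e1)
    have "(\<lambda>x. emeasure ?M2 (Pair x -` R)) \<in> borel_measurable ?M1" by (rule M2.measurable_emeasure_Pair[OF R])
    then have "(\<lambda>x. emeasure \<mu> (slice x R)) \<in> borel_measurable borel"
      unfolding e measurable_cong_sets[OF sM1 refl] .
    then show ?thesis
      using slA by (subst nn_integral_density) (auto simp: measurable_eq indicator_def intro!: nn_integral_cong)
  qed
  moreover have "(\<integral>\<^sup>+ y. emeasure \<mu> (slice y (prod.swap -` R)) \<partial>?M2) = (\<integral>\<^sup>+ y. emeasure \<mu> (slice y (prod.swap -` R)) \<partial>\<mu>)"
  proof -
    have "emeasure ?M1 ((\<lambda>x. (x, y)) -` R) = (\<integral>\<^sup>+ x. indicator ((\<lambda>x. (x, y)) -` R) x \<partial>?M1)" for y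
      using sets_Pair2[OF R, of y] by simp
    also have "(\<integral>\<^sup>+ x. indicator ((\<lambda>x. (x, y)) -` R) x \<partial>?M1) = (\<integral>\<^sup>+ x. indicator R (x, y) \<partial>?M1)" for y
      by (intro nn_integral_cong) (simp add: indicator_def)
    finally have e: "emeasure ?M1 ((\<lambda>x. (x, y)) -` R) = emeasure \<mu> (slice y (prod.swap -` R))" for y by (simp only: e2)
    have "(\<lambda>y. emeasure ?M1 ((\<lambda>x. (x, y)) -` R)) \<in> borel_measurable ?M2" by (rule measurable_emeasure_Pair2[OF R])
    then have "(\<lambda>y. emeasure \<mu> (slice y (prod.swap -` R))) \<in> borel_measurable borel"
      unfolding e measurable_cong_sets[OF sM2 refl] .
    then show ?thesis
      using slB by (subst nn_integral_density) (auto simp: measurable_eq indicator_def intro!: nn_integral_cong)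
  qed
  ultimately show ?thesis by simp
qed

text \<open>The slice function is exhausted from below. Its superlevel sets are open and contain
  compact sets of nearly the same measure, and each of these is covered by finitely many rectangles
  inside \<open>E\<close> of the required height. For the union of these rectangles the order of
  integration is already known to be irrelevant.\<close>

lemma fubini_open_le:
  assumes E: "open E" and fin: "\<And>x. emeasure \<mu> (slice x E) < \<infinity>" "\<And>y. emeasure \<mu> (slice y (prod.swap -` E)) < \<infinity>"
  shows "(\<integral>\<^sup>+x. emeasure \<mu> (slice x E) \<partial>\<mu>) \<le> (\<integral>\<^sup>+y. emeasure \<mu> (slice y (prod.swap -` E)) \<partial>\<mu>)"
proof (rule dense_le)
  fix t assume t: "t < (\<integral>\<^sup>+x. emeasure \<mu> (slice x E) \<partial>\<mu>)"
  define f where "f x = emeasure \<mu> (slice x E)" for x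
  have [measurable]: "f \<in> borel_measurable borel"
    unfolding f_def by (rule borel_measurable_slice_open[OF E])
  define r where "r x = enn2real (f x)" for x
  have fr: "f x = ennreal (r x)" for x using fin(1)[of x] by (simp add: f_def r_def)
  have r0: "r x \<ge> 0" for x by (simp add: r_def)
  \<comment> \<open>Ceiling minus one counts the levels \<open>(j + 1) / (n + 1)\<close> strictly
    below \<open>r x\<close>; strictness is what makes the level sets open.\<close>
  define k where "k n x = nat (\<lceil>real (Suc n) * r x\<rceil> - 1)" for n x
  have klow: "real (k n x) \<ge> real (Suc n) * r x - 1" for n x unfolding k_def by linarith
  have kup: "real (k n x) \<le> real (Suc n) * r x" for n x
  proof -
    have "0 \<le> real (Suc n) * r x" using r0 by simp
    then show ?thesis unfolding k_def by linarith
  qed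
  have kless: "j < k n x \<longleftrightarrow> ennreal (real (Suc j) / real (Suc n)) < f x" for j n x
  proof -
    have "j < k n x \<longleftrightarrow> real j + 1 < real (Suc n) * r x" unfolding k_def by linarith
    also have "\<dots> \<longleftrightarrow> real (Suc j) / real (Suc n) < r x" by (simp add: field_simps)
    finally show ?thesis unfolding fr using r0 by (subst ennreal_less_iff) (auto simp: add.commute)
  qed
  have lim: "(\<lambda>n. ennreal (real (k n x) / real (Suc n))) \<longlonglongrightarrow> f x" for x
    unfolding fr
  proof (rule tendsto_ennrealI, rule tendsto_sandwich[where h="\<lambda>n. r x" and f="\<lambda>n. r x - 1 / real (Suc n)"])
    show "(\<lambda>n. r x - 1 / real (Suc n)) \<longlonglongrightarrow> r x"
      using tendsto_diff[OF tendsto_const LIMSEQ_Suc[OF lim_inverse_n'], of "r x"] by simp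
    show "\<forall>\<^sub>F n in sequentially. r x - 1 / real (Suc n) \<le> real (k n x) / real (Suc n)"
    proof (intro always_eventually allI)
      fix n
      have "(real (Suc n) * r x - 1) / real (Suc n) \<le> real (k n x) / real (Suc n)"
        by (intro divide_right_mono klow) simp
      then show "r x - 1 / real (Suc n) \<le> real (k n x) / real (Suc n)" by (simp add: diff_divide_distrib del: of_nat_Suc)
    qed
    show "\<forall>\<^sub>F n in sequentially. real (k n x) / real (Suc n) \<le> r x"
    proof (intro always_eventually allI)
      fix n
      have "real (k n x) / real (Suc n) \<le> (real (Suc n) * r x) / real (Suc n)"
        by (intro divide_right_mono kup) simp
      then show "real (k n x) / real (Suc n) \<le> r x" by simp
    qed
  qed simp
  have kset: "{x. j < k n x} = {x. ennreal (real (Suc j) / real (Suc n)) < f x}" for n j by (simp add: kless)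
  have kopen: "open {x. j < k n x}" for n j
    unfolding kset f_def by (rule open_superlevel_slice[OF E])
  have kmeas [measurable]: "k n \<in> measurable borel (count_space UNIV)" for n
    unfolding k_def r_def by measurable
  have "(\<integral>\<^sup>+x. f x \<partial>\<mu>) = (\<integral>\<^sup>+x. liminf (\<lambda>n. ennreal (real (k n x) / real (Suc n))) \<partial>\<mu>)"
    by (intro nn_integral_cong) (simp only: lim_imp_Liminf[OF trivial_limit_sequentially lim])
  \<comment> \<open>Fatou's lemma, because the step functions do not increase with \<open>n\<close>;
    a single good \<open>n\<close> is enough.\<close>
  also have "\<dots> \<le> liminf (\<lambda>n. \<integral>\<^sup>+x. ennreal (real (k n x) / real (Suc n)) \<partial>\<mu>)"
    by (rule nn_integral_liminf) simp
  finally have "t < liminf (\<lambda>n. \<integral>\<^sup>+x. ennreal (real (k n x) / real (Suc n)) \<partial>\<mu>)"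
    by (rule less_le_trans[OF t[folded f_def]])
  from less_LiminfD[OF this] obtain n where n: "t < (\<integral>\<^sup>+x. ennreal (real (k n x) / real (Suc n)) \<partial>\<mu>)"
    by (auto simp: eventually_sequentially)
  define c where "c = ennreal (1 / real (Suc n))"
  define O' where "O' j = {x. j < k n x}" for j
  have O': "open (O' j)" for j unfolding O'_def by (rule kopen)
  have cn: "c * ennreal (real (Suc n)) = 1" unfolding c_def by (subst ennreal_mult[symmetric]) auto
  have "(\<integral>\<^sup>+x. ennreal (real (k n x) / real (Suc n)) \<partial>\<mu>) = (\<integral>\<^sup>+x. c * of_nat (k n x) \<partial>\<mu>)"
    unfolding c_def by (intro nn_integral_cong) (simp add: ennreal_mult[symmetric] ennreal_of_nat_eq_real_of_nat)
  also have "\<dots> = c * (\<integral>\<^sup>+x. of_nat (k n x) \<partial>\<mu>)" by (intro nn_integral_cmult) simp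
  also have "(\<integral>\<^sup>+x. of_nat (k n x) \<partial>\<mu>) = (\<Sum>j. emeasure \<mu> (O' j))"
    by (subst nn_integral_nat_function) (auto simp: O'_def measurable_eq)
  also have "\<dots> = (SUP m. \<Sum>j<m. emeasure \<mu> (O' j))" by (rule suminf_eq_SUP)
  finally have "t < c * (SUP m. \<Sum>j<m. emeasure \<mu> (O' j))" using n by simp
  then have "t < (SUP m. c * (\<Sum>j<m. emeasure \<mu> (O' j)))" by (simp add: SUP_mult_left_ennreal)
  then obtain m where "t < c * (\<Sum>j<m. emeasure \<mu> (O' j))" by (auto simp: less_SUP_iff)
  then have "t * ennreal (real (Suc n)) < 0 + (\<Sum>j<m. emeasure \<mu> (O' j))"
    using cn mult_left_mono[of "\<Sum>j<m. emeasure \<mu> (O' j)" "t * ennreal (real (Suc n))" c]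
    by (auto simp: not_less[symmetric] mult.left_commute[of c t] simp del: of_nat_Suc)
  from inner_regular_finite_family[OF inner_open O' this] obtain K where
    K: "\<And>j. j < m \<Longrightarrow> compact (K j) \<and> K j \<subseteq> O' j" and tK: "t * ennreal (real (Suc n)) < (\<Sum>j<m. emeasure \<mu> (K j))"
    by auto
  define good where "good j = {(U, C). open U \<and> compact C \<and> U \<times> C \<subseteq> E \<and> U \<noteq> {} \<and> ennreal (real (Suc j) / real (Suc n)) < emeasure \<mu> C}" for j :: nat
  have "\<exists>P. finite P \<and> P \<subseteq> good j \<and> K j \<subseteq> (\<Union>p\<in>P. fst p)" if j: "j < m" for j
  proof -
    have "K j \<subseteq> (\<Union>p\<in>good j. fst p)"
    proof
      fix x assume "x \<in> K j"
      then have "ennreal (real (Suc j) / real (Suc n)) < emeasure \<mu> (slice x E)"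
        using K[OF j] unfolding O'_def kset f_def by auto
      from slice_rectangle[OF E this] obtain U C where "open U" "x \<in> U" "compact C" "U \<times> C \<subseteq> E"
        "ennreal (real (Suc j) / real (Suc n)) < emeasure \<mu> C" by metis
      then have "(U, C) \<in> good j" by (auto simp: good_def)
      then show "x \<in> (\<Union>p\<in>good j. fst p)" using \<open>x \<in> U\<close> by force
    qed
    moreover have "open (fst p)" if "p \<in> good j" for p using that by (auto simp: good_def)
    ultimately obtain P where "P \<subseteq> good j" "finite P" "K j \<subseteq> (\<Union>p\<in>P. fst p)"
      using compactE_image[of "K j" "good j" fst] K[OF j] by metis
    then show ?thesis by (intro exI[of _ P]) simp
  qed
  then obtain P where P: "\<And>j. j < m \<Longrightarrow> finite (P j) \<and> P j \<subseteq> good j \<and> K j \<subseteq> (\<Union>p\<in>P j. fst p)"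
    by metis
  define PP where "PP = (\<Union>j<m. P j)"
  define R where "R = (\<Union>(U, C)\<in>PP. U \<times> C)"
  have PP: "open U" "compact C" "U \<times> C \<subseteq> E" "U \<noteq> {}" "C \<noteq> {}" if UC: "(U, C) \<in> PP" for U C
  proof -
    obtain j where j: "j < m" "(U, C) \<in> P j" using UC by (auto simp: PP_def)
    then have g: "(U, C) \<in> good j" using P by (meson subsetD)
    then show "open U" "compact C" "U \<times> C \<subseteq> E" "U \<noteq> {}" by (simp_all add: good_def)
    show "C \<noteq> {}" using g by (auto simp: good_def)
  qed
  have RE: "R \<subseteq> E" unfolding R_def by (rule UN_least) (use PP(3) in auto)
  have finPP: "finite PP" unfolding PP_def using P by auto
  have Rb: "(\<integral>\<^sup>+x. emeasure \<mu> (slice x R) \<partial>\<mu>) = (\<integral>\<^sup>+y. emeasure \<mu> (slice y (prod.swap -` R)) \<partial>\<mu>)"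
    unfolding R_def
  proof (rule rectangles_fubini[OF finPP])
    fix U C assume UC: "(U, C) \<in> PP"
    obtain x y where xy: "x \<in> U" "y \<in> C" using PP[OF UC] by auto
    have e1: "emeasure \<mu> U \<le> emeasure \<mu> (slice y (prod.swap -` E))"
    proof (intro emeasure_borel_mono slice_borel borel_open open_vimage_swap E slice_Times_subset[OF _ xy(2)])
      show "C \<times> U \<subseteq> prod.swap -` E" using PP(3)[OF UC] by (auto simp: subset_iff)
    qed
    have e2: "emeasure \<mu> C \<le> emeasure \<mu> (slice x E)"
      by (intro emeasure_borel_mono slice_borel borel_open E slice_Times_subset[OF PP(3)[OF UC] xy(1)])
    show "U \<in> sets borel \<and> C \<in> sets borel \<and> emeasure \<mu> U < \<infinity> \<and> emeasure \<mu> C < \<infinity>"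
      using PP(1,2)[OF UC] le_less_trans[OF e1 fin(2)] le_less_trans[OF e2 fin(1)]
      by (simp add: borel_closed compact_imp_closed borel_open)
  qed
  have Rset: "R \<in> sets borel" unfolding R_def
  proof (rule sets.finite_UN[OF finPP])
    fix p assume p: "p \<in> PP"
    then have "(fst p, snd p) \<in> PP" by simp
    from PP(1,2)[OF this] show "(case p of (U, C) \<Rightarrow> U \<times> C) \<in> sets borel"
      by (simp add: case_prod_unfold borel_Times borel_open borel_closed compact_imp_closed)
  qed
  have pw: "c * (\<Sum>j<m. indicator (K j) x) \<le> emeasure \<mu> (slice x R)" for x
  proof (cases "\<exists>j<m. x \<in> K j")
    case False
    then have "(\<Sum>j<m. indicator (K j) x) = (0::ennreal)" by (intro sum.neutral) (auto simp: indicator_def)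
    then show ?thesis by simp
  next
    case True
    define J where "J = {j. j < m \<and> x \<in> K j}"
    have J: "finite J" "J \<noteq> {}" using True by (auto simp: J_def)
    \<comment> \<open>The compact sets \<open>K j\<close> need not be nested, so \<open>J\<close>
      need not be an initial segment. Counting suffices: \<open>J\<close> has at most
      \<open>i + 1\<close> elements, and a rectangle chosen for the largest index \<open>i\<close>
      already has height above \<open>(i + 1) / (n + 1)\<close>.\<close>
    define i where "i = Max J"
    have i: "i \<in> J" "J \<subseteq> {..i}" using J by (auto simp: i_def)
    obtain p where p: "p \<in> P i" "x \<in> fst p" using P[of i] i(1) by (auto simp: J_def)
    obtain U C where [simp]: "p = (U, C)" by force
    have UC: "(U, C) \<in> PP" "ennreal (real (Suc i) / real (Suc n)) < emeasure \<mu> C" "x \<in> U"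
    proof -
      have i': "i < m" using i(1) by (simp add: J_def)
      show "(U, C) \<in> PP" using p i' by (auto simp: PP_def)
      have "(U, C) \<in> good i" using p P[OF i'] by (simp add: subset_iff)
      then show "ennreal (real (Suc i) / real (Suc n)) < emeasure \<mu> C" by (simp add: good_def)
      show "x \<in> U" using p by simp
    qed
    have "(\<Sum>j<m. indicator (K j) x) = (\<Sum>j\<in>J. (1::ennreal))"
      by (rule sum.mono_neutral_cong_right) (auto simp: J_def)
    also have "\<dots> = of_nat (card J)" by simp
    also have "\<dots> \<le> of_nat (Suc i)" using card_mono[OF _ i(2)] by (simp only: of_nat_le_iff) simp
    finally have "c * (\<Sum>j<m. indicator (K j) x) \<le> c * of_nat (Suc i)" by (rule mult_left_mono) simp
    also have "\<dots> = ennreal (real (Suc i) / real (Suc n))"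
      unfolding c_def ennreal_of_nat_eq_real_of_nat by (subst ennreal_mult[symmetric]) auto
    also have "\<dots> \<le> emeasure \<mu> C" using UC by simp
    also have "\<dots> \<le> emeasure \<mu> (slice x R)"
      using UC by (intro emeasure_borel_mono slice_borel Rset) (auto simp: slice_def R_def)
    finally show ?thesis .
  qed
  have "t = c * (t * ennreal (real (Suc n)))" unfolding mult.left_commute[of c t] cn by simp
  also have "\<dots> \<le> c * (\<Sum>j<m. emeasure \<mu> (K j))" using tK by (intro mult_left_mono) auto
  also have "\<dots> = (\<integral>\<^sup>+x. c * (\<Sum>j<m. indicator (K j) x) \<partial>\<mu>)"
  proof -
    have Kb: "K j \<in> sets \<mu>" if "j < m" for j using K[OF that] by (auto intro!: borel_closed compact_imp_closed)
    then have "(\<integral>\<^sup>+x. (\<Sum>j<m. indicator (K j) x) \<partial>\<mu>) = (\<Sum>j<m. emeasure \<mu> (K j))"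
      by (subst nn_integral_sum) auto
    moreover have "(\<lambda>x. \<Sum>j<m. indicator (K j) x :: ennreal) \<in> borel_measurable \<mu>"
      using Kb by (intro borel_measurable_sum borel_measurable_indicator) simp
    ultimately show ?thesis by (simp add: nn_integral_cmult)
  qed
  also have "\<dots> \<le> (\<integral>\<^sup>+x. emeasure \<mu> (slice x R) \<partial>\<mu>)" by (intro nn_integral_mono pw)
  also have "\<dots> = (\<integral>\<^sup>+y. emeasure \<mu> (slice y (prod.swap -` R)) \<partial>\<mu>)" by (rule Rb)
  also have "\<dots> \<le> (\<integral>\<^sup>+y. emeasure \<mu> (slice y (prod.swap -` E)) \<partial>\<mu>)"
    using RE by (intro nn_integral_mono emeasure_borel_mono slice_borel borel_open open_vimage_swap E) (auto simp: slice_def)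
  finally show "t \<le> (\<integral>\<^sup>+y. emeasure \<mu> (slice y (prod.swap -` E)) \<partial>\<mu>)" .
qed

lemma fubini_open:
  assumes E: "open E" and fin: "\<And>x. emeasure \<mu> (slice x E) < \<infinity>" "\<And>y. emeasure \<mu> (slice y (prod.swap -` E)) < \<infinity>"
  shows "(\<integral>\<^sup>+x. emeasure \<mu> (slice x E) \<partial>\<mu>) = (\<integral>\<^sup>+y. emeasure \<mu> (slice y (prod.swap -` E)) \<partial>\<mu>)"
proof (rule antisym)
  have "prod.swap -` prod.swap -` E = E" by auto
  then show "(\<integral>\<^sup>+y. emeasure \<mu> (slice y (prod.swap -` E)) \<partial>\<mu>) \<le> (\<integral>\<^sup>+x. emeasure \<mu> (slice x E) \<partial>\<mu>)"
    using fubini_open_le[OF open_vimage_swap[OF E]] fin by simp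
qed (rule fubini_open_le[OF assms])

text \<open>Open sets standing in for sets of finite product measure. The finiteness conditions are
  what permits subtraction in the complement step of the Dynkin argument.\<close>

definition tame :: "('a \<times> 'a) set \<Rightarrow> bool" where
  "tame W \<longleftrightarrow> open W \<and> (\<forall>x. emeasure \<mu> (slice x W) < \<infinity>) \<and> (\<forall>y. emeasure \<mu> (slice y (prod.swap -` W)) < \<infinity>)
     \<and> (\<integral>\<^sup>+x. emeasure \<mu> (slice x W) \<partial>\<mu>) < \<infinity>"

definition fubini_fun :: "('a \<times> 'a \<Rightarrow> ennreal) \<Rightarrow> bool" where
  "fubini_fun F \<longleftrightarrow> (\<lambda>x. \<integral>\<^sup>+y. F (x, y) \<partial>\<mu>) \<in> borel_measurable borel \<and> (\<lambda>y. \<integral>\<^sup>+x. F (x, y) \<partial>\<mu>) \<in> borel_measurable borel \<and>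
     (\<integral>\<^sup>+x. \<integral>\<^sup>+y. F (x, y) \<partial>\<mu> \<partial>\<mu>) = (\<integral>\<^sup>+y. \<integral>\<^sup>+x. F (x, y) \<partial>\<mu> \<partial>\<mu>)"

lemma vimage_swap_borel: "E \<in> sets borel \<Longrightarrow> prod.swap -` E \<in> sets (borel :: ('b::topological_space \<times> 'c::topological_space) measure)"
  using measurable_sets[OF swap_borel, of E] by simp

lemma nn_integral_slice:
  assumes "E \<in> sets borel"
  shows "(\<integral>\<^sup>+y. indicator E (x, y) \<partial>\<mu>) = emeasure \<mu> (slice x E)"
    "(\<integral>\<^sup>+x. indicator E (x, y) \<partial>\<mu>) = emeasure \<mu> (slice y (prod.swap -` E))"
proof -
  have "(\<integral>\<^sup>+y. indicator E (x, y) \<partial>\<mu>) = (\<integral>\<^sup>+y. indicator (slice x E) y \<partial>\<mu>)"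
    by (intro nn_integral_cong) (simp add: indicator_def slice_def)
  then show "(\<integral>\<^sup>+y. indicator E (x, y) \<partial>\<mu>) = emeasure \<mu> (slice x E)"
    using slice_borel[OF assms] by simp
  have "(\<integral>\<^sup>+x. indicator E (x, y) \<partial>\<mu>) = (\<integral>\<^sup>+x. indicator (slice y (prod.swap -` E)) x \<partial>\<mu>)"
    by (intro nn_integral_cong) (simp add: indicator_def slice_def)
  then show "(\<integral>\<^sup>+x. indicator E (x, y) \<partial>\<mu>) = emeasure \<mu> (slice y (prod.swap -` E))"
    using slice_borel[OF vimage_swap_borel[OF assms]] by simp
qed

lemma slice_Diff: "slice x (A - B) = slice x A - slice x B" by (auto simp: slice_def)

lemma slice_UN: "slice x (\<Union>i. A i) = (\<Union>i. slice x (A i))" by (auto simp: slice_def)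

lemma slice_mono: "A \<subseteq> B \<Longrightarrow> slice x A \<subseteq> slice x B" by (auto simp: slice_def)

text \<open>Dynkin's argument relative to \<open>W\<close>: the open sets form an
  intersection-stable generator on which \<open>fubini_open\<close> applies, and finiteness of the
  slices and integrals of \<open>W\<close> handles complements.\<close>

lemma fubini_fun_indicator:
  assumes W: "tame W" and B: "B \<in> sets borel"
  shows "fubini_fun (indicator (B \<inter> W))"
proof -
  define m where "m E x = emeasure \<mu> (slice x (E \<inter> W))" for E x
  define m' where "m' E y = emeasure \<mu> (slice y (prod.swap -` (E \<inter> W)))" for E y
  have oW: "open W" and Wb: "W \<in> sets borel" using W unfolding tame_def by (simp_all add: borel_open)
  have sb: "slice x (E \<inter> W) \<in> sets borel" "slice x (prod.swap -` (E \<inter> W)) \<in> sets borel" if "E \<in> sets borel" for E x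
    using Wb that by (simp_all add: slice_borel vimage_swap_borel)
  have mle: "m E x \<le> m UNIV x" "m' E x \<le> m' UNIV x" for E x
    unfolding m_def m'_def by (intro emeasure_borel_mono sb slice_mono vimage_mono; simp)+
  have mfin: "m UNIV x < \<infinity>" "m' UNIV x < \<infinity>" for x
    using W by (simp_all add: tame_def m_def m'_def)
  have diff: "m (UNIV - E) x = m UNIV x - m E x" "m' (UNIV - E) x = m' UNIV x - m' E x" if "E \<in> sets borel" for E x
  proof -
    have "(UNIV - E) \<inter> W = (UNIV \<inter> W) - (E \<inter> W)" by blast
    then show "m (UNIV - E) x = m UNIV x - m E x" "m' (UNIV - E) x = m' UNIV x - m' E x"
      unfolding m_def m'_def vimage_Diff slice_Diff
      using mle(1)[of E x] mle(2)[of E x] mfin[of x] sb[OF that] sb[of UNIV] unfolding m_def m'_def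
      by (simp_all only: vimage_Diff slice_Diff, (subst emeasure_Diff; auto simp: slice_def)+)
  qed
  have un: "m (\<Union>i. A i) x = (\<Sum>i. m (A i) x)" "m' (\<Union>i. A i) x = (\<Sum>i. m' (A i) x)"
    if A: "disjoint_family A" "range A \<subseteq> sets borel" for A :: "nat \<Rightarrow> _" and x
  proof -
    have Ai: "A i \<in> sets borel" for i using A(2) by auto
    have u: "(\<Union>i. A i) \<inter> W = (\<Union>i. A i \<inter> W)" by blast
    have d: "disjoint_family (\<lambda>i. slice x (A i \<inter> W))" "disjoint_family (\<lambda>i. slice x (prod.swap -` (A i \<inter> W)))"
      using A(1) by (auto simp: disjoint_family_on_def slice_def)
    show "m (\<Union>i. A i) x = (\<Sum>i. m (A i) x)" unfolding m_def u slice_UN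
      by (rule suminf_emeasure[symmetric]) (use sb(1)[OF Ai] d in auto)
    show "m' (\<Union>i. A i) x = (\<Sum>i. m' (A i) x)" unfolding m'_def u vimage_UN slice_UN
      by (rule suminf_emeasure[symmetric]) (use sb(2)[OF Ai] d in auto)
  qed
  let ?P = "\<lambda>E. m E \<in> borel_measurable borel \<and> m' E \<in> borel_measurable borel \<and> (\<integral>\<^sup>+x. m E x \<partial>\<mu>) = (\<integral>\<^sup>+y. m' E y \<partial>\<mu>)"
  have op: "?P E" if E: "open E" for E
  proof -
    have o: "open (E \<inter> W)" using E oW by blast
    show ?thesis unfolding m_def[abs_def] m'_def[abs_def]
    proof (intro conjI borel_measurable_slice_open o open_vimage_swap fubini_open)
      show "emeasure \<mu> (slice x (E \<inter> W)) < \<infinity>" "emeasure \<mu> (slice x (prod.swap -` (E \<inter> W))) < \<infinity>" for x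
        using le_less_trans[OF mle(1)[of E x] mfin(1)[of x]] le_less_trans[OF mle(2)[of E x] mfin(2)[of x]]
        by (simp_all add: m_def m'_def)
    qed
  qed
  have sets_b: "sigma_sets UNIV {S :: ('a \<times> 'a) set. open S} = sets borel" by (simp add: borel_def)
  have st: "Int_stable {S :: ('a \<times> 'a) set. open S}" by (auto simp: Int_stable_def)
  have Bs: "B \<in> sigma_sets UNIV {S. open S}" using B by (simp only: sets_b)
  have main: "?P B"
  proof (rule sigma_sets_induct_disjoint[OF st _ Bs, where P="?P"])
    show "?P E" if "E \<in> {S. open S}" for E using op[of E] that by simp
    show "?P {}" using op[of "{}"] by simp
    show "?P (UNIV - E)" if "E \<in> sigma_sets UNIV {S. open S}" and P: "?P E" for E
    proof -
      have E: "E \<in> sets borel" using that(1) by (simp only: sets_b)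
      have d: "m (UNIV - E) = (\<lambda>x. m UNIV x - m E x)" "m' (UNIV - E) = (\<lambda>x. m' UNIV x - m' E x)"
        by (simp_all add: diff[OF E] fun_eq_iff)
      have U: "?P UNIV" by (rule op) simp
      have [measurable]: "m UNIV \<in> borel_measurable borel" "m' UNIV \<in> borel_measurable borel"
          "m E \<in> borel_measurable borel" "m' E \<in> borel_measurable borel" using U P by blast+
      have fin: "(\<integral>\<^sup>+x. m E x \<partial>\<mu>) < \<infinity>"
      proof -
        have "(\<integral>\<^sup>+x. m E x \<partial>\<mu>) \<le> (\<integral>\<^sup>+x. m UNIV x \<partial>\<mu>)" by (intro nn_integral_mono mle)
        also have "\<dots> < \<infinity>" using W by (simp add: m_def tame_def)
        finally show ?thesis .
      qed
      have "(\<integral>\<^sup>+x. m UNIV x - m E x \<partial>\<mu>) = (\<integral>\<^sup>+x. m UNIV x \<partial>\<mu>) - (\<integral>\<^sup>+x. m E x \<partial>\<mu>)"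
        by (rule nn_integral_diff) (use fin mle in \<open>auto simp: less_top[symmetric]\<close>)
      moreover have "(\<integral>\<^sup>+x. m' UNIV x - m' E x \<partial>\<mu>) = (\<integral>\<^sup>+x. m' UNIV x \<partial>\<mu>) - (\<integral>\<^sup>+x. m' E x \<partial>\<mu>)"
        by (rule nn_integral_diff) (use fin mle P in \<open>auto simp: less_top[symmetric]\<close>)
      ultimately show ?thesis unfolding d using U P by simp
    qed
    show "?P (\<Union>i. A i)" if "disjoint_family A" "range A \<subseteq> sigma_sets UNIV {S. open S}" "\<And>i. ?P (A i)" for A :: "nat \<Rightarrow> _"
    proof -
      have [measurable]: "m (A i) \<in> borel_measurable borel" "m' (A i) \<in> borel_measurable borel" for i using that(3) by blast+
      have "range A \<subseteq> sets borel" using that(2) by (simp only: sets_b)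
      from un[OF that(1) this] have u: "m (\<Union>i. A i) = (\<lambda>x. \<Sum>i. m (A i) x)" "m' (\<Union>i. A i) = (\<lambda>x. \<Sum>i. m' (A i) x)"
        by (simp_all add: fun_eq_iff)
      have "(\<integral>\<^sup>+x. (\<Sum>i. m (A i) x) \<partial>\<mu>) = (\<Sum>i. \<integral>\<^sup>+x. m (A i) x \<partial>\<mu>)" by (rule nn_integral_suminf) simp
      moreover have "(\<integral>\<^sup>+x. (\<Sum>i. m' (A i) x) \<partial>\<mu>) = (\<Sum>i. \<integral>\<^sup>+x. m' (A i) x \<partial>\<mu>)" by (rule nn_integral_suminf) simp
      ultimately show ?thesis unfolding u using that(3) by simp
    qed
  qed simp
  have BW: "B \<inter> W \<in> sets borel" using B Wb by simp
  show ?thesis unfolding fubini_fun_def nn_integral_slice[OF BW] using main unfolding m_def[abs_def] m'_def[abs_def] .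
qed

lemma measurable_pair_fun:
  assumes "F \<in> borel_measurable borel"
  shows "(\<lambda>y. F (x, y)) \<in> borel_measurable borel" "(\<lambda>x. F (x, y)) \<in> borel_measurable borel"
proof -
  have "continuous_on UNIV (\<lambda>x. (x, y))" by (intro continuous_on_Pair continuous_on_const continuous_on_id)
  from measurable_compose[OF borel_measurable_continuous_onI[OF this] assms]
  show "(\<lambda>x. F (x, y)) \<in> borel_measurable borel" .
  from measurable_compose[OF borel_measurable_continuous_onI[OF continuous_Pair[of x]] assms]
  show "(\<lambda>y. F (x, y)) \<in> borel_measurable borel" .
qed

lemma fubini_fun_SUP:
  assumes F: "\<And>i. F i \<in> borel_measurable borel" "\<And>i. fubini_fun (F i)" "incseq F"
  shows "fubini_fun (\<lambda>z. SUP i::nat. F i z)"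
proof -
  have inc: "incseq (\<lambda>i y. F i (x, y))" "incseq (\<lambda>i x. F i (x, y))" for x y
    using F(3) by (auto simp: incseq_def le_fun_def)
  have 1: "(\<integral>\<^sup>+y. (SUP i. F i (x, y)) \<partial>\<mu>) = (SUP i. \<integral>\<^sup>+y. F i (x, y) \<partial>\<mu>)" for x
    by (rule nn_integral_monotone_convergence_SUP[OF inc(1)]) (simp add: measurable_eq measurable_pair_fun F)
  have 2: "(\<integral>\<^sup>+x. (SUP i. F i (x, y)) \<partial>\<mu>) = (SUP i. \<integral>\<^sup>+x. F i (x, y) \<partial>\<mu>)" for y
    by (rule nn_integral_monotone_convergence_SUP[OF inc(2)]) (simp add: measurable_eq measurable_pair_fun F)
  have m [measurable]: "(\<lambda>x. \<integral>\<^sup>+y. F i (x, y) \<partial>\<mu>) \<in> borel_measurable borel" "(\<lambda>y. \<integral>\<^sup>+x. F i (x, y) \<partial>\<mu>) \<in> borel_measurable borel" for i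
    using F(2)[of i] by (simp_all add: fubini_fun_def)
  have inc2: "incseq (\<lambda>i x. \<integral>\<^sup>+y. F i (x, y) \<partial>\<mu>)" "incseq (\<lambda>i y. \<integral>\<^sup>+x. F i (x, y) \<partial>\<mu>)"
    using F(3) by (auto simp: incseq_def le_fun_def intro!: nn_integral_mono)
  have "(\<integral>\<^sup>+x. (SUP i. \<integral>\<^sup>+y. F i (x, y) \<partial>\<mu>) \<partial>\<mu>) = (SUP i. \<integral>\<^sup>+x. \<integral>\<^sup>+y. F i (x, y) \<partial>\<mu> \<partial>\<mu>)"
    by (rule nn_integral_monotone_convergence_SUP[OF inc2(1)]) simp
  moreover have "(\<integral>\<^sup>+y. (SUP i. \<integral>\<^sup>+x. F i (x, y) \<partial>\<mu>) \<partial>\<mu>) = (SUP i. \<integral>\<^sup>+y. \<integral>\<^sup>+x. F i (x, y) \<partial>\<mu> \<partial>\<mu>)"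
    by (rule nn_integral_monotone_convergence_SUP[OF inc2(2)]) simp
  moreover have "(\<integral>\<^sup>+x. \<integral>\<^sup>+y. F i (x, y) \<partial>\<mu> \<partial>\<mu>) = (\<integral>\<^sup>+y. \<integral>\<^sup>+x. F i (x, y) \<partial>\<mu> \<partial>\<mu>)" for i
    using F(2)[of i] by (simp add: fubini_fun_def)
  ultimately show ?thesis unfolding fubini_fun_def 1 2 by (simp add: m)
qed

lemma fubini_fun_tame:
  assumes W: "tame W" and F: "F \<in> borel_measurable borel"
  shows "fubini_fun (\<lambda>z. F z * indicator W z)"
  using F
proof (induction rule: borel_measurable_induct)
  case (cong f g)
  then show ?case by (simp add: fubini_fun_def)
next
  case (set A)
  have "(\<lambda>z. indicator A z * indicator W z) = (indicator (A \<inter> W) :: _ \<Rightarrow> ennreal)" by (auto simp: indicator_def)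
  then show ?case using fubini_fun_indicator[OF W set] by simp
next
  case (mult u c)
  have Wb [measurable]: "indicator W \<in> borel_measurable borel" using W by (simp add: tame_def borel_open)
  have um [measurable]: "(\<lambda>z. u z * indicator W z) \<in> borel_measurable borel" using mult by simp
  have p: "(\<lambda>y. u (x, y) * indicator W (x, y)) \<in> borel_measurable \<mu>" "(\<lambda>x. u (x, y) * indicator W (x, y)) \<in> borel_measurable \<mu>" for x y
    using measurable_pair_fun[OF um] by (simp_all add: measurable_eq)
  have m: "(\<lambda>x. \<integral>\<^sup>+y. u (x, y) * indicator W (x, y) \<partial>\<mu>) \<in> borel_measurable \<mu>" "(\<lambda>y. \<integral>\<^sup>+x. u (x, y) * indicator W (x, y) \<partial>\<mu>) \<in> borel_measurable \<mu>"
    using mult(4) by (simp_all add: fubini_fun_def measurable_eq)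
  show ?case using mult(4) m unfolding fubini_fun_def
    by (simp add: mult.assoc nn_integral_cmult[OF p(1)] nn_integral_cmult[OF p(2)] nn_integral_cmult[OF m(1)] nn_integral_cmult[OF m(2)] measurable_eq)
next
  case (add u v)
  have Wb [measurable]: "indicator W \<in> borel_measurable borel" using W by (simp add: tame_def borel_open)
  have um: "(\<lambda>z. u z * indicator W z) \<in> borel_measurable borel" "(\<lambda>z. v z * indicator W z) \<in> borel_measurable borel" using add by simp_all
  have p: "(\<lambda>y. u (x, y) * indicator W (x, y)) \<in> borel_measurable \<mu>" "(\<lambda>x. u (x, y) * indicator W (x, y)) \<in> borel_measurable \<mu>"
    "(\<lambda>y. v (x, y) * indicator W (x, y)) \<in> borel_measurable \<mu>" "(\<lambda>x. v (x, y) * indicator W (x, y)) \<in> borel_measurable \<mu>" for x y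
    using measurable_pair_fun[OF um(1)] measurable_pair_fun[OF um(2)] by (simp_all add: measurable_eq)
  have m: "(\<lambda>x. \<integral>\<^sup>+y. u (x, y) * indicator W (x, y) \<partial>\<mu>) \<in> borel_measurable \<mu>" "(\<lambda>y. \<integral>\<^sup>+x. u (x, y) * indicator W (x, y) \<partial>\<mu>) \<in> borel_measurable \<mu>"
    "(\<lambda>x. \<integral>\<^sup>+y. v (x, y) * indicator W (x, y) \<partial>\<mu>) \<in> borel_measurable \<mu>" "(\<lambda>y. \<integral>\<^sup>+x. v (x, y) * indicator W (x, y) \<partial>\<mu>) \<in> borel_measurable \<mu>"
    using add.IH by (simp_all add: fubini_fun_def measurable_eq)
  show ?case using add.IH m unfolding fubini_fun_def
    by (simp add: distrib_right nn_integral_add[OF p(3,1)] nn_integral_add[OF p(4,2)] nn_integral_add[OF m(3,1)] nn_integral_add[OF m(4,2)] measurable_eq)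
next
  case (seq U)
  have Wb [measurable]: "indicator W \<in> borel_measurable borel" using W by (simp add: tame_def borel_open)
  have "fubini_fun (\<lambda>z. SUP i. U i z * indicator W z)"
    using seq by (intro fubini_fun_SUP) (auto simp: incseq_def le_fun_def intro!: mult_right_mono)
  also have "(\<lambda>z. SUP i. U i z * indicator W z) = (\<lambda>z. (SUP i. U i) z * indicator W z)"
    by (simp add: SUP_mult_right_ennreal image_comp)
  finally show ?case .
qed

text \<open>A replacement for sigma-finiteness of the square: the support is exhausted by countably
  many tame sets. Convolution integrands have this property on every locally compact group.\<close>

definition tame_support :: "('a \<times> 'a \<Rightarrow> 'b::zero) \<Rightarrow> bool" where
  "tame_support F \<longleftrightarrow> (\<exists>W :: nat \<Rightarrow> _. incseq W \<and> (\<forall>n. tame (W n)) \<and> (\<forall>z. F z \<noteq> 0 \<longrightarrow> z \<in> (\<Union>n. W n)))"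

lemma tame_support_mono: "tame_support F \<Longrightarrow> (\<And>z. F z = 0 \<Longrightarrow> G z = 0) \<Longrightarrow> tame_support G"
  unfolding tame_support_def by metis

theorem fubini_tame_support:
  assumes F: "F \<in> borel_measurable borel" and s: "tame_support F"
  shows "fubini_fun F"
proof -
  obtain W :: "nat \<Rightarrow> _" where W: "incseq W" "\<And>n. tame (W n)" "\<And>z. F z \<noteq> 0 \<Longrightarrow> z \<in> (\<Union>n. W n)"
    using s unfolding tame_support_def by metis
  have Wb: "(indicator (W n) :: _ \<Rightarrow> ennreal) \<in> borel_measurable borel" for n using W(2)[of n] by (simp add: tame_def borel_open)
  have "fubini_fun (\<lambda>z. SUP i. F z * indicator (W i) z)"
  proof (rule fubini_fun_SUP)
    show "(\<lambda>z. F z * indicator (W i) z) \<in> borel_measurable borel" for i using F Wb[of i] by simp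
    show "fubini_fun (\<lambda>z. F z * indicator (W i) z)" for i by (rule fubini_fun_tame[OF W(2) F])
    show "incseq (\<lambda>i z. F z * indicator (W i) z)"
      using W(1) by (auto simp: incseq_def le_fun_def indicator_def subset_iff)
  qed
  also have "(\<lambda>z. SUP i. F z * indicator (W i) z) = F"
  proof
    fix z
    show "(SUP i. F z * indicator (W i) z) = F z"
    proof (cases "F z = 0")
      case False
      then obtain n where n: "z \<in> W n" using W(3)[OF False] by blast
      show ?thesis
      proof (rule antisym)
        show "(SUP i. F z * indicator (W i) z) \<le> F z" by (intro SUP_least) (auto simp: indicator_def)
        show "F z \<le> (SUP i. F z * indicator (W i) z)" using n by (intro SUP_upper2[of n]) auto
      qed
    qed simp
  qed
  finally show ?thesis .
qed

end

section \<open>Iterated integrals of complex functions\<close>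

text \<open>The iterated integral is expressed through the positive and negative parts of the real
  and imaginary parts. Applied in both orders, this reduces the exchange of complex integrals to
  four exchanges of nonnegative ones.\<close>

lemma iterated_integral_complex:
  fixes G :: "'b \<Rightarrow> 'a \<Rightarrow> complex"
  assumes G: "\<And>x. G x \<in> borel_measurable N"
    and n: "(\<lambda>x. \<integral>\<^sup>+y. norm (G x y) \<partial>N) \<in> borel_measurable M"
    and a: "(\<lambda>x. \<integral>\<^sup>+y. ennreal (Re (G x y)) \<partial>N) \<in> borel_measurable M" "(\<lambda>x. \<integral>\<^sup>+y. ennreal (- Re (G x y)) \<partial>N) \<in> borel_measurable M"
      "(\<lambda>x. \<integral>\<^sup>+y. ennreal (Im (G x y)) \<partial>N) \<in> borel_measurable M" "(\<lambda>x. \<integral>\<^sup>+y. ennreal (- Im (G x y)) \<partial>N) \<in> borel_measurable M"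
    and fin: "(\<integral>\<^sup>+x. \<integral>\<^sup>+y. norm (G x y) \<partial>N \<partial>M) < \<infinity>"
  shows "integrable M (\<lambda>x. \<integral>y. G x y \<partial>N)"
    "(\<integral>\<^sup>+x. norm (\<integral>y. G x y \<partial>N) \<partial>M) \<le> (\<integral>\<^sup>+x. \<integral>\<^sup>+y. norm (G x y) \<partial>N \<partial>M)"
    "(\<integral>x. (\<integral>y. G x y \<partial>N) \<partial>M) =
      Complex (enn2real (\<integral>\<^sup>+x. \<integral>\<^sup>+y. ennreal (Re (G x y)) \<partial>N \<partial>M) - enn2real (\<integral>\<^sup>+x. \<integral>\<^sup>+y. ennreal (- Re (G x y)) \<partial>N \<partial>M))
       (enn2real (\<integral>\<^sup>+x. \<integral>\<^sup>+y. ennreal (Im (G x y)) \<partial>N \<partial>M) - enn2real (\<integral>\<^sup>+x. \<integral>\<^sup>+y. ennreal (- Im (G x y)) \<partial>N \<partial>M))"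
proof -
  define nn where "nn x = (\<integral>\<^sup>+y. norm (G x y) \<partial>N)" for x
  note [measurable] = n[folded nn_def] a G
  have int: "integrable N (G x)" if "nn x < \<infinity>" for x
    using that G by (intro integrableI_bounded) (auto simp: nn_def)
  have nonint: "\<not> integrable N (G x)" if "\<not> nn x < \<infinity>" for x
    using that by (auto simp: nn_def integrable_iff_bounded)
  have ae: "AE x in M. nn x < \<infinity>"
  proof -
    have "nn \<in> borel_measurable M" "integral\<^sup>N M nn \<noteq> \<infinity>"
      using n fin unfolding nn_def[abs_def] by simp_all
    from nn_integral_PInf_AE[OF this] show ?thesis by (simp add: less_top)
  qed
  have le: "(\<integral>\<^sup>+y. ennreal (Re (G x y)) \<partial>N) \<le> nn x" "(\<integral>\<^sup>+y. ennreal (- Re (G x y)) \<partial>N) \<le> nn x"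
    "(\<integral>\<^sup>+y. ennreal (Im (G x y)) \<partial>N) \<le> nn x" "(\<integral>\<^sup>+y. ennreal (- Im (G x y)) \<partial>N) \<le> nn x" for x
    unfolding nn_def using complex_Re_le_cmod abs_Re_le_cmod abs_Im_le_cmod
    by (auto intro!: nn_integral_mono ennreal_leI simp: abs_le_iff)
  define I where "I x = (\<integral>y. G x y \<partial>N)" for x
  define J where "J x = Complex (enn2real (\<integral>\<^sup>+y. ennreal (Re (G x y)) \<partial>N) - enn2real (\<integral>\<^sup>+y. ennreal (- Re (G x y)) \<partial>N))
     (enn2real (\<integral>\<^sup>+y. ennreal (Im (G x y)) \<partial>N) - enn2real (\<integral>\<^sup>+y. ennreal (- Im (G x y)) \<partial>N))" for x
  have IJ: "I x = J x" if "nn x < \<infinity>" for x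
    using int[OF that] unfolding I_def J_def
    by (simp add: complex_eq_iff real_lebesgue_integral_def flip: integral_Re integral_Im)
  \<comment> \<open>Where the inner integral diverges the Bochner integral is \<open>0\<close>. This
    default is made explicit because measurability of the outer integrand concerns every point, not
    almost every one.\<close>
  have I_eq: "I x = (if nn x < \<infinity> then J x else 0)" for x
    using IJ not_integrable_integral_eq[OF nonint] by (auto simp: I_def)
  have Jm: "J \<in> borel_measurable M"
    unfolding J_def complex_eq Complex_eq by measurable
  have Im: "I \<in> borel_measurable M" unfolding I_eq[abs_def] using Jm by measurable
  have nI: "norm (I x) \<le> nn x" for x
  proof (cases "nn x < \<infinity>")
    case True
    have "ennreal (norm (I x)) \<le> ennreal (\<integral>y. norm (G x y) \<partial>N)"
      unfolding I_def by (intro ennreal_leI integral_norm_bound)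
    also have "\<dots> = nn x" unfolding nn_def
      using int[OF True] by (intro nn_integral_eq_integral[symmetric]) auto
    finally show ?thesis .
  qed (simp add: I_eq)
  show nb: "(\<integral>\<^sup>+x. norm (\<integral>y. G x y \<partial>N) \<partial>M) \<le> (\<integral>\<^sup>+x. \<integral>\<^sup>+y. norm (G x y) \<partial>N \<partial>M)"
    unfolding I_def[symmetric] nn_def[symmetric] by (intro nn_integral_mono nI)
  show Ii: "integrable M (\<lambda>x. \<integral>y. G x y \<partial>N)"
    using le_less_trans[OF nb fin] Im unfolding I_def[abs_def] by (intro integrableI_bounded) auto
  have part: "integrable M (\<lambda>x. enn2real (b x)) \<and> (\<integral>x. enn2real (b x) \<partial>M) = enn2real (\<integral>\<^sup>+x. b x \<partial>M)"
    if b [measurable]: "b \<in> borel_measurable M" and "\<And>x. b x \<le> nn x" for b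
  proof -
    have bfin: "AE x in M. b x < \<infinity>" using ae by eventually_elim (use that(2) le_less_trans in blast)
    have e: "(\<integral>\<^sup>+x. ennreal (enn2real (b x)) \<partial>M) = (\<integral>\<^sup>+x. b x \<partial>M)"
      by (rule nn_integral_cong_AE) (use bfin in \<open>eventually_elim, simp\<close>)
    also have "\<dots> \<le> (\<integral>\<^sup>+x. nn x \<partial>M)" by (intro nn_integral_mono that)
    also have "\<dots> < \<infinity>" using fin by (simp add: nn_def)
    finally have i: "integrable M (\<lambda>x. enn2real (b x))" by (intro integrableI_nonneg) auto
    moreover have "(\<integral>x. enn2real (b x) \<partial>M) = enn2real (\<integral>\<^sup>+x. ennreal (enn2real (b x)) \<partial>M)"
      by (rule integral_eq_nn_integral) auto
    ultimately show ?thesis using e by simp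
  qed
  note p = part[OF a(1) le(1)] part[OF a(2) le(2)] part[OF a(3) le(3)] part[OF a(4) le(4)]
  have "integral\<^sup>L M I = integral\<^sup>L M J"
    by (rule integral_cong_AE) (use ae Im Jm IJ in \<open>auto elim: eventually_mono\<close>)
  moreover have Ji: "integrable M J"
    using Ii ae Jm Im IJ unfolding I_def[symmetric] by (subst integrable_cong_AE[of J M I]) (auto elim: eventually_mono)
  ultimately show "(\<integral>x. (\<integral>y. G x y \<partial>N) \<partial>M) =
      Complex (enn2real (\<integral>\<^sup>+x. \<integral>\<^sup>+y. ennreal (Re (G x y)) \<partial>N \<partial>M) - enn2real (\<integral>\<^sup>+x. \<integral>\<^sup>+y. ennreal (- Re (G x y)) \<partial>N \<partial>M))
       (enn2real (\<integral>\<^sup>+x. \<integral>\<^sup>+y. ennreal (Im (G x y)) \<partial>N \<partial>M) - enn2real (\<integral>\<^sup>+x. \<integral>\<^sup>+y. ennreal (- Im (G x y)) \<partial>N \<partial>M))"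
  proof -
    assume IJ: "integral\<^sup>L M I = integral\<^sup>L M J"
    have "(\<integral>x. Re (J x) \<partial>M) = enn2real (\<integral>\<^sup>+x. \<integral>\<^sup>+y. ennreal (Re (G x y)) \<partial>N \<partial>M) - enn2real (\<integral>\<^sup>+x. \<integral>\<^sup>+y. ennreal (- Re (G x y)) \<partial>N \<partial>M)"
      "(\<integral>x. Im (J x) \<partial>M) = enn2real (\<integral>\<^sup>+x. \<integral>\<^sup>+y. ennreal (Im (G x y)) \<partial>N \<partial>M) - enn2real (\<integral>\<^sup>+x. \<integral>\<^sup>+y. ennreal (- Im (G x y)) \<partial>N \<partial>M)"
      using p by (simp_all add: J_def)
    then show ?thesis unfolding I_def[symmetric] IJ
      by (intro complex_eqI) (simp_all only: integral_Re[OF Ji] integral_Im[OF Ji] complex.sel)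
  qed
qed

context inner_regular_measure begin

lemma
  fixes F :: "'a \<times> 'a \<Rightarrow> complex"
  assumes F [measurable]: "F \<in> borel_measurable borel" and s: "tame_support F"
    and fin: "(\<integral>\<^sup>+x. \<integral>\<^sup>+y. norm (F (x, y)) \<partial>\<mu> \<partial>\<mu>) < \<infinity>"
  shows fubini_complex_integrable: "integrable \<mu> (\<lambda>x. \<integral>y. F (x, y) \<partial>\<mu>)"
    and fubini_complex_norm: "(\<integral>\<^sup>+x. norm (\<integral>y. F (x, y) \<partial>\<mu>) \<partial>\<mu>) \<le> (\<integral>\<^sup>+x. \<integral>\<^sup>+y. norm (F (x, y)) \<partial>\<mu> \<partial>\<mu>)"
    and fubini_complex: "(\<integral>x. (\<integral>y. F (x, y) \<partial>\<mu>) \<partial>\<mu>) = (\<integral>y. (\<integral>x. F (x, y) \<partial>\<mu>) \<partial>\<mu>)"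
proof -
  have f: "fubini_fun (\<lambda>z. ennreal (norm (F z)))" "fubini_fun (\<lambda>z. ennreal (Re (F z)))" "fubini_fun (\<lambda>z. ennreal (- Re (F z)))"
    "fubini_fun (\<lambda>z. ennreal (Im (F z)))" "fubini_fun (\<lambda>z. ennreal (- Im (F z)))"
    by (intro fubini_tame_support tame_support_mono[OF s]; simp)+
  note m = f[unfolded fubini_fun_def]
  note p = measurable_pair_fun[OF F]
  show "integrable \<mu> (\<lambda>x. \<integral>y. F (x, y) \<partial>\<mu>)"
    "(\<integral>\<^sup>+x. norm (\<integral>y. F (x, y) \<partial>\<mu>) \<partial>\<mu>) \<le> (\<integral>\<^sup>+x. \<integral>\<^sup>+y. norm (F (x, y)) \<partial>\<mu> \<partial>\<mu>)"
    by (rule iterated_integral_complex; use m p fin in \<open>simp add: measurable_eq\<close>)+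
  have "(\<integral>x. (\<integral>y. F (x, y) \<partial>\<mu>) \<partial>\<mu>) = Complex (enn2real (\<integral>\<^sup>+x. \<integral>\<^sup>+y. ennreal (Re (F (x, y))) \<partial>\<mu> \<partial>\<mu>) - enn2real (\<integral>\<^sup>+x. \<integral>\<^sup>+y. ennreal (- Re (F (x, y))) \<partial>\<mu> \<partial>\<mu>))
       (enn2real (\<integral>\<^sup>+x. \<integral>\<^sup>+y. ennreal (Im (F (x, y))) \<partial>\<mu> \<partial>\<mu>) - enn2real (\<integral>\<^sup>+x. \<integral>\<^sup>+y. ennreal (- Im (F (x, y))) \<partial>\<mu> \<partial>\<mu>))"
    by (rule iterated_integral_complex; use m p fin in \<open>simp add: measurable_eq\<close>)
  moreover have "(\<integral>y. (\<integral>x. F (x, y) \<partial>\<mu>) \<partial>\<mu>) = Complex (enn2real (\<integral>\<^sup>+y. \<integral>\<^sup>+x. ennreal (Re (F (x, y))) \<partial>\<mu> \<partial>\<mu>) - enn2real (\<integral>\<^sup>+y. \<integral>\<^sup>+x. ennreal (- Re (F (x, y))) \<partial>\<mu> \<partial>\<mu>))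
       (enn2real (\<integral>\<^sup>+y. \<integral>\<^sup>+x. ennreal (Im (F (x, y))) \<partial>\<mu> \<partial>\<mu>) - enn2real (\<integral>\<^sup>+y. \<integral>\<^sup>+x. ennreal (- Im (F (x, y))) \<partial>\<mu> \<partial>\<mu>))"
    by (rule iterated_integral_complex; use m p fin in \<open>simp add: measurable_eq\<close>)
  ultimately show "(\<integral>x. (\<integral>y. F (x, y) \<partial>\<mu>) \<partial>\<mu>) = (\<integral>y. (\<integral>x. F (x, y) \<partial>\<mu>) \<partial>\<mu>)"
    using m by simp
qed

end

section \<open>Haar measure: the modular function\<close>

locale haar_group =
  fixes \<mu> :: "'g::{topological_group_add, t2_space} measure"
  assumes locally_compact: "locally_compact_space (euclidean :: 'g topology)"
    and left_Haar: "left_Haar_measure \<mu>"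
begin

lemmas left_Haar_conj = left_Haar[unfolded left_Haar_measure_def]

sublocale inner_regular_measure \<mu>
proof
  show "sets \<mu> = sets borel" by (rule left_Haar_conj[THEN conjunct1])
  show "emeasure \<mu> U = (SUP K\<in>{K. compact K \<and> K \<subseteq> U}. emeasure \<mu> K)" if "open U" for U
    using left_Haar_conj[THEN conjunct2, THEN conjunct2, THEN conjunct2, THEN conjunct2, THEN conjunct1, rule_format, OF that] .
qed

lemma emeasure_UNIV: "emeasure \<mu> UNIV \<noteq> 0"
  by (rule left_Haar_conj[THEN conjunct2, THEN conjunct1])

lemma emeasure_compact: "compact K \<Longrightarrow> emeasure \<mu> K < \<infinity>"
  by (rule left_Haar_conj[THEN conjunct2, THEN conjunct2, THEN conjunct1, rule_format])

lemma outer_regular: "B \<in> sets borel \<Longrightarrow> emeasure \<mu> B = (INF U\<in>{U. open U \<and> B \<subseteq> U}. emeasure \<mu> U)"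
  by (rule left_Haar_conj[THEN conjunct2, THEN conjunct2, THEN conjunct2, THEN conjunct1, rule_format])

lemma emeasure_image_left: "B \<in> sets borel \<Longrightarrow> emeasure \<mu> ((\<lambda>x. g + x) ` B) = emeasure \<mu> B"
  by (rule left_Haar_conj[THEN conjunct2, THEN conjunct2, THEN conjunct2, THEN conjunct2, THEN conjunct2, rule_format])

lemma outer_less:
  assumes "B \<in> sets borel" "emeasure \<mu> B < t"
  obtains U where "open U" "B \<subseteq> U" "emeasure \<mu> U < t"
proof -
  have "(INF U\<in>{U. open U \<and> B \<subseteq> U}. emeasure \<mu> U) < t"
    using assms(2) by (simp only: outer_regular[OF assms(1)])
  then show thesis using that unfolding INF_less_iff by blast
qed

lemma borel_compact: "compact K \<Longrightarrow> K \<in> sets borel" for K :: "'g set"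
  by (simp add: borel_closed compact_imp_closed)

lemma measurable_group [measurable]:
  "(\<lambda>x. g + x) \<in> borel_measurable borel" "(\<lambda>x. x + g) \<in> borel_measurable borel"
  "(\<lambda>x::'g. - x) \<in> borel_measurable borel" "(\<lambda>x. x - g) \<in> borel_measurable borel" for g :: 'g
proof -
  have "continuous_on UNIV (uminus :: 'g \<Rightarrow> 'g)" using continuous_on_minus[OF continuous_on_id[of UNIV]] by (simp add: id_def)
  then show "(\<lambda>x. - x) \<in> borel_measurable (borel :: 'g measure)" by (rule borel_measurable_continuous_onI)
qed (intro borel_measurable_continuous_onI continuous_intros)+

lemma vimage_borel:
  fixes f :: "'b::topological_space \<Rightarrow> 'c::topological_space"
  shows "continuous_on UNIV f \<Longrightarrow> B \<in> sets borel \<Longrightarrow> {x. f x \<in> B} \<in> sets borel"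
  using measurable_sets[OF borel_measurable_continuous_onI, of f B] by (simp add: vimage_def)

lemma emeasure_left:
  assumes "B \<in> sets borel" shows "emeasure \<mu> {x. g + x \<in> B} = emeasure \<mu> B"
proof -
  have "{x. g + x \<in> B} = (\<lambda>x. - g + x) ` B"
    by (auto simp: image_iff add.assoc[symmetric] intro!: bexI[of _ "g + _"])
  then show ?thesis using emeasure_image_left[OF assms] by simp
qed

lemma distr_left: "distr \<mu> borel (\<lambda>x. g + x) = \<mu>"
proof (rule measure_eqI)
  fix A assume "A \<in> sets (distr \<mu> borel (\<lambda>x. g + x))"
  then have A: "A \<in> sets borel" by simp
  then show "emeasure (distr \<mu> borel (\<lambda>x. g + x)) A = emeasure \<mu> A"
    by (subst emeasure_distr) (use emeasure_left[OF A, of g] in \<open>simp_all add: measurable_eq vimage_def\<close>)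
qed simp

lemma nn_integral_left:
  assumes "f \<in> borel_measurable borel" shows "(\<integral>\<^sup>+x. f (g + x) \<partial>\<mu>) = (\<integral>\<^sup>+x. f x \<partial>\<mu>)"
  using nn_integral_distr[of "\<lambda>x. g + x" \<mu> borel f] assms unfolding distr_left by (simp add: measurable_eq)

lemma integral_left:
  fixes f :: "'g \<Rightarrow> 'b::{banach, second_countable_topology}"
  assumes "f \<in> borel_measurable borel" shows "(\<integral>x. f (g + x) \<partial>\<mu>) = (\<integral>x. f x \<partial>\<mu>)"
  using integral_distr[of "\<lambda>x. g + x" \<mu> borel f] assms unfolding distr_left by (simp add: measurable_eq)

lemma integrable_left:
  fixes f :: "'g \<Rightarrow> 'b::{banach, second_countable_topology}"
  assumes "integrable \<mu> f" shows "integrable \<mu> (\<lambda>x. f (g + x))"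
  using integrable_distr[of "\<lambda>x. g + x" \<mu> borel f] assms unfolding distr_left by (simp add: measurable_eq)

text \<open>Finitely many translates of a nonempty open set cover any given compact set. If they
  were null, so would be every compact set, and by inner regularity the whole group.\<close>

lemma emeasure_open_pos:
  assumes "open U" "U \<noteq> {}" shows "emeasure \<mu> U > 0"
proof (rule ccontr)
  assume "\<not> ?thesis"
  then have U0: "emeasure \<mu> U = 0" by simp
  obtain a where a: "a \<in> U" using assms by auto
  have "emeasure \<mu> K = 0" if K: "compact K" for K
  proof -
    have "open {x. g + x \<in> U}" for g
      by (rule open_vimage[OF assms(1), unfolded vimage_def]) (intro continuous_intros)
    moreover have "K \<subseteq> (\<Union>g\<in>UNIV. {x. g + x \<in> U})"
    proof
      fix x
      have "(a - x) + x \<in> U" using a by simp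
      then show "x \<in> (\<Union>g\<in>UNIV. {x. g + x \<in> U})" by blast
    qed
    ultimately obtain D where D: "finite D" "K \<subseteq> (\<Union>g\<in>D. {x. g + x \<in> U})"
      using compactE_image[OF K, of UNIV "\<lambda>g. {x. g + x \<in> U}"] by metis
    have Ub: "U \<in> sets borel" using assms by (simp add: borel_open)
    have null: "{x. g + x \<in> U} \<in> null_sets \<mu>" for g
    proof -
      have "continuous_on UNIV ((+) g)" by (intro continuous_intros)
      from vimage_borel[OF this Ub] emeasure_left[OF Ub, of g] U0 show ?thesis by (simp add: null_sets_def)
    qed
    then have "(\<Union>g\<in>D. {x. g + x \<in> U}) \<in> null_sets \<mu>" using D(1) by (intro null_sets.finite_UN) auto
    moreover have "K \<in> sets \<mu>" using borel_compact[OF K] by simp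
    ultimately have "K \<in> null_sets \<mu>" using D(2) by (rule null_sets_subset)
    then show ?thesis by auto
  qed
  then have "emeasure \<mu> UNIV = 0" unfolding inner_open[OF open_UNIV] by (intro antisym SUP_least) auto
  then show False using emeasure_UNIV by simp
qed

lemma compact_nbhd: obtains V K where "open V" "compact K" "(0::'g) \<in> V" "V \<subseteq> K"
proof -
  have "\<exists>V K. open V \<and> compact K \<and> (0::'g) \<in> V \<and> V \<subseteq> K"
    using locally_compact unfolding locally_compact_space_def by simp
  then show thesis by (elim exE conjE) (rule that)
qed

definition good_nbhd :: "'g set \<Rightarrow> bool" where
  "good_nbhd V \<longleftrightarrow> open V \<and> 0 \<in> V \<and> (\<forall>x. - x \<in> V \<longleftrightarrow> x \<in> V) \<and> emeasure \<mu> V < \<infinity>"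

lemma good_nbhd_exists:
  assumes "open U" "0 \<in> U"
  obtains V where "good_nbhd V" "V \<subseteq> U"
proof -
  obtain V K where V: "open V" "compact K" "(0::'g) \<in> V" "V \<subseteq> K" by (rule compact_nbhd)
  define W where "W = {x. x \<in> U \<inter> V \<and> - x \<in> U \<inter> V}"
  have o: "open (U \<inter> V)" using assms V by auto
  have "open ((\<lambda>x. - x) -` (U \<inter> V))" by (rule open_vimage[OF o continuous_on_minus[OF continuous_on_id]])
  moreover have W: "W = (U \<inter> V) \<inter> ((\<lambda>x. - x) -` (U \<inter> V))" by (auto simp: W_def)
  ultimately have "open W" using o by auto
  moreover have "0 \<in> W" using assms V by (simp add: W_def)
  moreover have "emeasure \<mu> W < \<infinity>"
  proof -
    have "W \<subseteq> K" using V(4) by (auto simp: W_def)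
    then have "emeasure \<mu> W \<le> emeasure \<mu> K" by (rule emeasure_borel_mono[OF _ borel_compact[OF V(2)]])
    then show ?thesis using emeasure_compact[OF V(2)] by (rule le_less_trans)
  qed
  moreover have "\<forall>x. - x \<in> W \<longleftrightarrow> x \<in> W" by (auto simp: W_def)
  ultimately have "good_nbhd W" by (simp add: good_nbhd_def)
  moreover have "W \<subseteq> U" by (auto simp: W_def)
  ultimately show thesis by (rule that)
qed

lemma tame_rectangle:
  assumes "open U" "open V" "emeasure \<mu> U < \<infinity>" "emeasure \<mu> V < \<infinity>"
  shows "tame (U \<times> V)"
proof -
  have s: "slice x (U \<times> V) = (if x \<in> U then V else {})" "slice x (prod.swap -` (U \<times> V)) = (if x \<in> V then U else {})" for x
    by (simp_all add: slice_def)
  have "(\<integral>\<^sup>+x. emeasure \<mu> (slice x (U \<times> V)) \<partial>\<mu>) = (\<integral>\<^sup>+x. emeasure \<mu> V * indicator U x \<partial>\<mu>)"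
    by (intro nn_integral_cong) (simp add: s)
  also have "\<dots> = emeasure \<mu> V * emeasure \<mu> U"
    using assms by (intro nn_integral_cmult_indicator) (simp add: borel_open)
  also have "\<dots> < \<infinity>" using assms by (simp add: ennreal_mult_less_top)
  finally show ?thesis using assms unfolding tame_def s by (simp add: open_Times)
qed

lemma tame_support_compact:
  assumes "compact K" "compact L" "\<And>x y. F (x, y) \<noteq> 0 \<Longrightarrow> x \<in> K \<and> y \<in> L"
  shows "tame_support F"
proof -
  obtain U where U: "open U" "K \<subseteq> U" "emeasure \<mu> U < \<infinity>"
    by (rule outer_less[OF borel_compact[OF assms(1)] emeasure_compact[OF assms(1)]])
  obtain V where V: "open V" "L \<subseteq> V" "emeasure \<mu> V < \<infinity>"
    by (rule outer_less[OF borel_compact[OF assms(2)] emeasure_compact[OF assms(2)]])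
  show ?thesis unfolding tame_support_def
  proof (intro exI[of _ "\<lambda>_. U \<times> V"] conjI allI impI)
    show "tame (U \<times> V)" using U V by (intro tame_rectangle)
    fix z assume "F z \<noteq> 0"
    then have "fst z \<in> K \<and> snd z \<in> L" using assms(3)[of "fst z" "snd z"] by simp
    then have "z \<in> U \<times> V" using U(2) V(2) by (simp add: mem_Times_iff subset_iff)
    then show "z \<in> (\<Union>n::nat. U \<times> V)" by simp
  qed (simp add: incseq_def)
qed

text \<open>
  The right translates of a left Haar measure are left Haar measures. Rather than invoking uniqueness
  we compare them with a fixed relatively compact \<open>V\<close>: the constant \<open>c\<close> below does not depend on \<open>u\<close>.
\<close>

lemma right_translate_compact:
  assumes V: "open V" "V \<subseteq> L" "compact L" "V \<noteq> {}" and A: "compact A"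
  shows "\<exists>c. \<forall>u. emeasure \<mu> {x. x - u \<in> A} = c * emeasure \<mu> {x. x - u \<in> V}"
proof -
  \<comment> \<open>The slice of \<open>E\<close> at \<open>x\<close> is the right translate
    \<open>V - x\<close>. Its measure \<open>H x\<close> is positive because the slice is open and
    nonempty, and finite because it is relatively compact.\<close>
  define E where "E = {(x, t). t + x \<in> V}"
  have "continuous_on UNIV (\<lambda>z :: 'g \<times> 'g. snd z + fst z)"
    by (intro continuous_on_add continuous_on_snd continuous_on_fst continuous_on_id)
  then have "open ((\<lambda>z. snd z + fst z) -` V)" by (rule open_vimage[OF V(1)])
  moreover have "(\<lambda>z. snd z + fst z) -` V = E" by (simp add: E_def vimage_def case_prod_unfold)
  ultimately have oE: "open E" by simp
  define H where "H x = emeasure \<mu> (slice x E)" for x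
  have Hm [measurable]: "H \<in> borel_measurable borel"
    unfolding H_def[abs_def] by (rule borel_measurable_slice_open[OF oE])
  have H0: "H x \<noteq> 0" and Hfin: "H x \<noteq> top" for x
  proof -
    obtain v where v: "v \<in> V" using V by auto
    have "v - x \<in> slice x E" using v by (simp add: E_def slice_def)
    then have "slice x E \<noteq> {}" by auto
    from emeasure_open_pos[OF slice_open[OF oE] this] show "H x \<noteq> 0" unfolding H_def by simp
    have c: "compact ((\<lambda>y. y - x) ` L)" by (intro compact_continuous_image V continuous_intros)
    have "slice x E \<subseteq> (\<lambda>y. y - x) ` L"
    proof
      fix t assume "t \<in> slice x E"
      then have "t + x \<in> L" using V(2) unfolding slice_def E_def by (simp add: subset_iff)
      then show "t \<in> (\<lambda>y. y - x) ` L" by (intro image_eqI[of _ _ "t + x"]) simp_all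
    qed
    then have "H x \<le> emeasure \<mu> ((\<lambda>y. y - x) ` L)" unfolding H_def by (rule emeasure_borel_mono[OF _ borel_compact[OF c]])
    then show "H x \<noteq> top" using emeasure_compact[OF c] by (auto simp: top_unique)
  qed
  \<comment> \<open>Dividing by \<open>H\<close> normalizes: integrating \<open>w (x - u)\<close>
    times the indicator of \<open>V\<close> at \<open>t + (x - u)\<close> over \<open>t\<close>
    gives back the indicator of \<open>A\<close> at \<open>x - u\<close>.\<close>
  define w where "w x = indicator A x / H x" for x
  have Ab [measurable]: "A \<in> sets borel" by (rule borel_compact[OF A])
  have Vb [measurable]: "V \<in> sets borel" using V by (simp add: borel_open)
  have wm [measurable]: "w \<in> borel_measurable borel" unfolding w_def[abs_def] by measurable
  have wA: "w x \<noteq> 0 \<Longrightarrow> x \<in> A" for x by (auto simp: w_def indicator_def)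
  have indV: "(\<integral>\<^sup>+t. indicator V (t + x) \<partial>\<mu>) = H x" for x
  proof -
    have "(\<integral>\<^sup>+t. indicator V (t + x) \<partial>\<mu>) = (\<integral>\<^sup>+t. indicator (slice x E) t \<partial>\<mu>)"
      by (intro nn_integral_cong) (simp add: indicator_def slice_def E_def)
    also have "\<dots> = H x" using slice_open[OF oE] by (simp add: H_def borel_open)
    finally show ?thesis .
  qed
  define c where "c = (\<integral>\<^sup>+t. w (- t) \<partial>\<mu>)"
  have "emeasure \<mu> {x. x - u \<in> A} = c * emeasure \<mu> {x. x - u \<in> V}" for u
  proof -
    have b: "{x. x - u \<in> B} \<in> sets borel" if "B \<in> sets borel" for B
      by (rule vimage_borel[OF _ that]) (intro continuous_intros)
    have cK: "compact ((\<lambda>x. x + u) ` B)" if "compact B" for B :: "'g set"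
      by (intro compact_continuous_image that continuous_intros)
    have inK: "x - u \<in> B \<Longrightarrow> x \<in> (\<lambda>x. x + u) ` B" for x B
      by (rule image_eqI[of _ _ "x - u"]) simp_all
    have cLA: "compact ((\<lambda>z. fst z - snd z) ` (L \<times> A))"
      by (intro compact_continuous_image compact_Times V A continuous_intros)
    \<comment> \<open>\<open>F\<close> becomes \<open>F'\<close> under the left translation of
      \<open>x\<close> by \<open>- t\<close>, which is carried out between two exchanges of the
      order of integration. Afterwards \<open>w\<close> is evaluated at
      \<open>- t + (x - u)\<close>, and left translation of \<open>t\<close> by \<open>x - u\<close>
      removes both \<open>x\<close> and \<open>u\<close>, leaving the constant
      \<open>c\<close>.\<close>
    define F where "F z = w (fst z - u) * indicator V (snd z + (fst z - u))" for z
    define F' where "F' z = w (- snd z + (fst z - u)) * indicator V (fst z - u)" for z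
    have cont: "continuous_on UNIV (\<lambda>z::'g\<times>'g. fst z - u)" "continuous_on UNIV (\<lambda>z::'g\<times>'g. snd z + (fst z - u))"
       "continuous_on UNIV (\<lambda>z::'g\<times>'g. - snd z + (fst z - u))" by (intro continuous_intros)+
    note [measurable] = cont[THEN borel_measurable_continuous_onI]
    have "fubini_fun F"
    proof (rule fubini_tame_support)
      show "F \<in> borel_measurable borel" unfolding F_def[abs_def] by measurable
      show "tame_support F"
      proof (rule tame_support_compact[OF cK[OF A] cLA])
        fix x t assume "F (x, t) \<noteq> 0"
        then have 1: "x - u \<in> A" "t + (x - u) \<in> L"
          using wA V(2) by (auto simp: F_def indicator_def split: if_splits)
        have "t = fst (t + (x - u), x - u) - snd (t + (x - u), x - u)" by simp
        then show "x \<in> (\<lambda>x. x + u) ` A \<and> t \<in> (\<lambda>z. fst z - snd z) ` (L \<times> A)"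
          using 1 inK by blast
      qed
    qed
    then have sw: "(\<integral>\<^sup>+x. \<integral>\<^sup>+t. F (x, t) \<partial>\<mu> \<partial>\<mu>) = (\<integral>\<^sup>+t. \<integral>\<^sup>+x. F (x, t) \<partial>\<mu> \<partial>\<mu>)" by (simp add: fubini_fun_def)
    have "fubini_fun F'"
    proof (rule fubini_tame_support)
      show "F' \<in> borel_measurable borel" unfolding F'_def[abs_def] by measurable
      show "tame_support F'"
      proof (rule tame_support_compact[OF cK[OF V(3)] cLA])
        fix x t assume "F' (x, t) \<noteq> 0"
        then have 1: "- t + (x - u) \<in> A" "x - u \<in> L"
          using wA V(2) by (auto simp: F'_def indicator_def split: if_splits)
        have "t = fst (x - u, - t + (x - u)) - snd (x - u, - t + (x - u))"
          unfolding fst_conv snd_conv diff_conv_add_uminus[of "x - u"] minus_add minus_minus add_minus_cancel ..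
        then show "x \<in> (\<lambda>x. x + u) ` L \<and> t \<in> (\<lambda>z. fst z - snd z) ` (L \<times> A)"
          using 1 inK by blast
      qed
    qed
    then have sw': "(\<integral>\<^sup>+x. \<integral>\<^sup>+t. F' (x, t) \<partial>\<mu> \<partial>\<mu>) = (\<integral>\<^sup>+t. \<integral>\<^sup>+x. F' (x, t) \<partial>\<mu> \<partial>\<mu>)" by (simp add: fubini_fun_def)
    have "emeasure \<mu> {x. x - u \<in> A} = (\<integral>\<^sup>+x. indicator A (x - u) \<partial>\<mu>)"
      by (subst nn_integral_indicator[symmetric]) (use b[OF Ab] in \<open>auto intro!: nn_integral_cong simp: indicator_def simp del: nn_integral_indicator\<close>)
    also have "\<dots> = (\<integral>\<^sup>+x. \<integral>\<^sup>+t. F (x, t) \<partial>\<mu> \<partial>\<mu>)"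
    proof (intro nn_integral_cong)
      fix x
      have "(\<integral>\<^sup>+t. F (x, t) \<partial>\<mu>) = w (x - u) * (\<integral>\<^sup>+t. indicator V (t + (x - u)) \<partial>\<mu>)"
        unfolding F_def fst_conv snd_conv by (rule nn_integral_cmult) (simp add: measurable_eq)
      also have "\<dots> = w (x - u) * H (x - u)" by (simp only: indV)
      also have "\<dots> = indicator A (x - u)"
        unfolding w_def using H0[of "x - u"] Hfin[of "x - u"]
        by (simp add: ennreal_divide_times ennreal_times_divide[symmetric] top.not_eq_extremum)
      finally show "indicator A (x - u) = (\<integral>\<^sup>+t. F (x, t) \<partial>\<mu>)" ..
    qed
    also have "\<dots> = (\<integral>\<^sup>+t. \<integral>\<^sup>+x. F' (x, t) \<partial>\<mu> \<partial>\<mu>)"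
    proof (subst sw, rule nn_integral_cong)
      fix t
      have "(\<integral>\<^sup>+x. F (x, t) \<partial>\<mu>) = (\<integral>\<^sup>+x. F (- t + x, t) \<partial>\<mu>)"
        by (rule nn_integral_left[symmetric]) (simp add: F_def)
      also have "\<dots> = (\<integral>\<^sup>+x. F' (x, t) \<partial>\<mu>)"
        by (intro nn_integral_cong) (simp add: F_def F'_def diff_conv_add_uminus add.assoc del: add_uminus_conv_diff)
      finally show "(\<integral>\<^sup>+x. F (x, t) \<partial>\<mu>) = (\<integral>\<^sup>+x. F' (x, t) \<partial>\<mu>)" .
    qed
    also have "\<dots> = (\<integral>\<^sup>+x. c * indicator {x. x - u \<in> V} x \<partial>\<mu>)"
    proof (subst sw'[symmetric], rule nn_integral_cong)
      fix x
      have "(\<integral>\<^sup>+t. F' (x, t) \<partial>\<mu>) = (\<integral>\<^sup>+t. w (- t + (x - u)) \<partial>\<mu>) * indicator V (x - u)"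
        unfolding F'_def fst_conv snd_conv by (rule nn_integral_multc) (simp add: measurable_eq)
      also have "(\<integral>\<^sup>+t. w (- t + (x - u)) \<partial>\<mu>) = (\<integral>\<^sup>+t. w (- ((x - u) + t) + (x - u)) \<partial>\<mu>)"
        by (rule nn_integral_left[symmetric]) simp
      also have "\<dots> = c" unfolding c_def by (intro nn_integral_cong) (simp only: minus_add[of "x - u"] add.assoc left_minus add_0_right)
      finally show "(\<integral>\<^sup>+t. F' (x, t) \<partial>\<mu>) = c * indicator {x. x - u \<in> V} x" by (simp add: indicator_def)
    qed
    also have "\<dots> = c * emeasure \<mu> {x. x - u \<in> V}"
      using b[OF Vb] by (intro nn_integral_cmult_indicator) simp
    finally show ?thesis .
  qed
  then show ?thesis by blast
qed

text \<open>The ratio of the measures of \<open>V + u\<close> and \<open>V\<close> serves as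
  definition. The scaling law passes from compact to open sets by inner regularity and on to Borel
  sets by outer regularity; multiplicativity is the law for open sets applied to a translate of
  \<open>V\<close>.\<close>

lemma modular_exists:
  "\<exists>\<Delta> :: 'g \<Rightarrow> real. (\<forall>u. \<Delta> u > 0) \<and> (\<forall>u v. \<Delta> (u + v) = \<Delta> u * \<Delta> v) \<and>
     (\<forall>u. \<forall>B\<in>sets borel. emeasure \<mu> {x. x - u \<in> B} = ennreal (\<Delta> u) * emeasure \<mu> B)"
proof -
  obtain V L where VL: "open V" "compact L" "(0::'g) \<in> V" "V \<subseteq> L" by (rule compact_nbhd)
  have Vb: "V \<in> sets borel" using VL by (simp add: borel_open)
  have op: "open {x. x - u \<in> U}" if "open U" for u :: 'g and U
    by (rule open_vimage[OF that, unfolded vimage_def]) (intro continuous_intros)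
  have cp: "compact {x. x - u \<in> K}" if "compact K" for u :: 'g and K
  proof -
    have "{x. x - u \<in> K} = (\<lambda>x. x + u) ` K"
    proof (intro equalityI subsetI)
      fix x assume "x \<in> {x. x - u \<in> K}"
      then show "x \<in> (\<lambda>x. x + u) ` K" by (intro image_eqI[of _ _ "x - u"]) simp_all
    qed auto
    then show ?thesis using that by (simp add: compact_continuous_image continuous_intros)
  qed
  have bo: "{x. x - u \<in> B} \<in> sets borel" if "B \<in> sets borel" for u :: 'g and B
    by (rule vimage_borel[OF _ that]) (intro continuous_intros)
  define m where "m u = emeasure \<mu> {x. x - u \<in> V}" for u
  have mfin: "m u < top" for u
  proof -
    have "m u \<le> emeasure \<mu> {x. x - u \<in> L}" unfolding m_def
      by (rule emeasure_borel_mono[OF _ borel_compact[OF cp[OF VL(2)]]]) (use VL in auto)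
    then show ?thesis using emeasure_compact[OF cp[OF VL(2)], of u] by (simp add: le_less_trans)
  qed
  have m0: "m u > 0" for u unfolding m_def
    by (rule emeasure_open_pos[OF op[OF VL(1)]]) (use VL(3) in \<open>auto intro!: exI[of _ u]\<close>)
  define \<Delta> where "\<Delta> u = enn2real (m u) / enn2real (m 0)" for u
  have pos: "\<Delta> u > 0" for u using m0 mfin by (auto simp: \<Delta>_def enn2real_positive_iff)
  have m_eq: "m u = ennreal (\<Delta> u) * m 0" for u
  proof -
    have "m w = ennreal (enn2real (m w))" for w using mfin[of w] by (simp add: less_top)
    moreover have "ennreal (enn2real (m u)) = ennreal (\<Delta> u) * ennreal (enn2real (m 0))"
      using m0[of 0] mfin[of 0] by (subst ennreal_mult[symmetric]) (auto simp: \<Delta>_def enn2real_positive_iff less_imp_neq[symmetric] enn2real_eq_0_iff)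
    ultimately show ?thesis by metis
  qed
  have K: "emeasure \<mu> {x. x - u \<in> K} = ennreal (\<Delta> u) * emeasure \<mu> K" if "compact K" for u K
  proof -
    have "V \<noteq> {}" using VL by auto
    from right_translate_compact[OF VL(1,4,2) this that] obtain c
      where c: "\<And>u. emeasure \<mu> {x. x - u \<in> K} = c * m u" unfolding m_def by auto
    show ?thesis using c[of u] c[of 0] by (simp add: m_eq[of u] mult_ac)
  qed
  have sub: "{x. x - u \<in> {y. y - v \<in> B}} = {x. x - (v + u) \<in> B}" for u v :: 'g and B
    by (simp only: mem_Collect_eq diff_conv_add_uminus minus_add add.assoc)
  have O': "emeasure \<mu> {x. x - u \<in> U} = ennreal (\<Delta> u) * emeasure \<mu> U" if U: "open U" for u U
  proof (rule antisym)
    have "emeasure \<mu> C \<le> ennreal (\<Delta> u) * emeasure \<mu> U" if C: "compact C" "C \<subseteq> {x. x - u \<in> U}" for C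
    proof -
      have "C = {x. x - u \<in> {y. y - (- u) \<in> C}}" by simp
      then have "emeasure \<mu> C = emeasure \<mu> {x. x - u \<in> {y. y - (- u) \<in> C}}" by simp
      also have "\<dots> = ennreal (\<Delta> u) * emeasure \<mu> {y. y - (- u) \<in> C}" by (rule K[OF cp[OF C(1)]])
      also have "{y. y - (- u) \<in> C} \<subseteq> U"
      proof
        fix y assume "y \<in> {y. y - (- u) \<in> C}"
        then have "(y - (- u)) - u \<in> U" using C(2) by blast
        then show "y \<in> U" by simp
      qed
      then have "ennreal (\<Delta> u) * emeasure \<mu> {y. y - (- u) \<in> C} \<le> ennreal (\<Delta> u) * emeasure \<mu> U"
        using U by (intro mult_left_mono emeasure_borel_mono borel_open) auto
      finally show ?thesis .
    qed
    then show "emeasure \<mu> {x. x - u \<in> U} \<le> ennreal (\<Delta> u) * emeasure \<mu> U"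
      unfolding inner_open[OF op[OF U]] by (intro SUP_least) auto
    have "ennreal (\<Delta> u) * emeasure \<mu> U = (SUP C\<in>{C. compact C \<and> C \<subseteq> U}. ennreal (\<Delta> u) * emeasure \<mu> C)"
      unfolding inner_open[OF U] by (simp add: SUP_mult_left_ennreal)
    also have "\<dots> \<le> emeasure \<mu> {x. x - u \<in> U}"
    proof (intro SUP_least)
      fix C assume "C \<in> {C. compact C \<and> C \<subseteq> U}"
      then have C: "compact C" "C \<subseteq> U" by auto
      show "ennreal (\<Delta> u) * emeasure \<mu> C \<le> emeasure \<mu> {x. x - u \<in> U}"
        unfolding K[OF C(1), symmetric] using C(2) by (intro emeasure_borel_mono borel_open op[OF U]) auto
    qed
    finally show "ennreal (\<Delta> u) * emeasure \<mu> U \<le> emeasure \<mu> {x. x - u \<in> U}" .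
  qed
  have mult: "\<Delta> (v + u) = \<Delta> u * \<Delta> v" for u v
  proof -
    have "m (v + u) = ennreal (\<Delta> u) * m v" unfolding m_def sub[symmetric] by (rule O'[OF op[OF VL(1)]])
    then have "enn2real (m (v + u)) = \<Delta> u * enn2real (m v)" using pos[of u] by (simp add: enn2real_mult less_imp_le)
    then show ?thesis by (simp add: \<Delta>_def)
  qed
  \<comment> \<open>Outer regularity gives one inequality; the reverse follows from it by
    translating back with \<open>- u\<close>.\<close>
  have le: "emeasure \<mu> {x. x - u \<in> B} \<le> ennreal (\<Delta> u) * emeasure \<mu> B" if B: "B \<in> sets borel" for u B
  proof (cases "emeasure \<mu> B = top")
    case True
    then show ?thesis using pos[of u] by (simp add: ennreal_mult_top)
  next
    case False
    show ?thesis
    proof (rule ennreal_le_epsilon)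
      fix e :: real assume "0 < e"
      then have ed: "e / \<Delta> u > 0" using pos by simp
      then have "emeasure \<mu> B < emeasure \<mu> B + ennreal (e / \<Delta> u)" using False
        by (cases "emeasure \<mu> B") (simp_all flip: ennreal_plus add: ennreal_less_iff)
      from outer_less[OF B this] obtain U where U: "open U" "B \<subseteq> U" "emeasure \<mu> U < emeasure \<mu> B + ennreal (e / \<Delta> u)" by metis
      have "emeasure \<mu> {x. x - u \<in> B} \<le> emeasure \<mu> {x. x - u \<in> U}"
        using U by (intro emeasure_borel_mono borel_open op) auto
      also have "\<dots> = ennreal (\<Delta> u) * emeasure \<mu> U" by (rule O'[OF U(1)])
      also have "\<dots> \<le> ennreal (\<Delta> u) * (emeasure \<mu> B + ennreal (e / \<Delta> u))" using U by (intro mult_left_mono) auto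
      also have "\<dots> = ennreal (\<Delta> u) * emeasure \<mu> B + ennreal e"
        using pos[of u] ed by (simp add: distrib_left ennreal_mult[symmetric])
      finally show "emeasure \<mu> {x. x - u \<in> B} \<le> ennreal (\<Delta> u) * emeasure \<mu> B + ennreal e" .
    qed
  qed
  have "\<Delta> 0 = 1" using m0[of 0] mfin[of 0] by (simp add: \<Delta>_def enn2real_positive_iff less_imp_neq[symmetric] enn2real_eq_0_iff)
  then have inv: "\<Delta> u * \<Delta> (- u) = 1" for u using mult[of "- u" u] by (simp add: mult.commute)
  have "emeasure \<mu> {x. x - u \<in> B} = ennreal (\<Delta> u) * emeasure \<mu> B" if B: "B \<in> sets borel" for u B
  proof (rule antisym[OF le[OF B]])
    have "emeasure \<mu> B = emeasure \<mu> {x. x - (- u) \<in> {y. y - u \<in> B}}" by (simp add: add.assoc)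
    also have "\<dots> \<le> ennreal (\<Delta> (- u)) * emeasure \<mu> {y. y - u \<in> B}" by (rule le[OF bo[OF B]])
    finally have "ennreal (\<Delta> u) * emeasure \<mu> B \<le> ennreal (\<Delta> u) * (ennreal (\<Delta> (- u)) * emeasure \<mu> {y. y - u \<in> B})"
      by (intro mult_left_mono) auto
    also have "\<dots> = emeasure \<mu> {y. y - u \<in> B}"
      using inv[of u] pos[of u] pos[of "- u"] by (simp add: mult.assoc[symmetric] ennreal_mult[symmetric])
    finally show "ennreal (\<Delta> u) * emeasure \<mu> B \<le> emeasure \<mu> {x. x - u \<in> B}" .
  qed
  then show ?thesis using pos mult by (intro exI[of _ \<Delta>]) (simp add: mult.commute)
qed

definition modular :: "'g \<Rightarrow> real" where
  "modular = (SOME \<Delta>. (\<forall>u. \<Delta> u > 0) \<and> (\<forall>u v. \<Delta> (u + v) = \<Delta> u * \<Delta> v) \<and>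
     (\<forall>u. \<forall>B\<in>sets borel. emeasure \<mu> {x. x - u \<in> B} = ennreal (\<Delta> u) * emeasure \<mu> B))"

lemma modular_pos: "modular u > 0"
  and modular_add: "modular (u + v) = modular u * modular v"
  and emeasure_right: "B \<in> sets borel \<Longrightarrow> emeasure \<mu> {x. x - u \<in> B} = ennreal (modular u) * emeasure \<mu> B"
  using someI_ex[OF modular_exists] unfolding modular_def[symmetric] by simp_all

lemma modular_0 [simp]: "modular 0 = 1"
  using modular_add[of 0 0] modular_pos[of 0] by simp

lemma modular_minus: "modular (- u) = 1 / modular u"
  using modular_add[of u "- u"] modular_pos[of u] by (simp add: field_simps)

lemma distr_right: "distr \<mu> borel (\<lambda>x. x - u) = density \<mu> (\<lambda>_. ennreal (modular u))"
proof (rule measure_eqI)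
  fix A assume "A \<in> sets (distr \<mu> borel (\<lambda>x. x - u))"
  then have A: "A \<in> sets borel" by simp
  have "emeasure (distr \<mu> borel (\<lambda>x. x - u)) A = emeasure \<mu> {x. x - u \<in> A}"
    using A by (subst emeasure_distr) (simp_all add: measurable_eq vimage_def)
  also have "\<dots> = emeasure (density \<mu> (\<lambda>_. ennreal (modular u))) A"
    using A by (simp add: emeasure_right emeasure_density nn_integral_cmult_indicator)
  finally show "emeasure (distr \<mu> borel (\<lambda>x. x - u)) A = emeasure (density \<mu> (\<lambda>_. ennreal (modular u))) A" .
qed simp

lemma integral_right:
  fixes f :: "'g \<Rightarrow> 'b::{banach, second_countable_topology}"
  assumes "f \<in> borel_measurable borel"
  shows "(\<integral>x. f (x - u) \<partial>\<mu>) = modular u *\<^sub>R (\<integral>x. f x \<partial>\<mu>)"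
proof -
  have "(\<integral>x. f (x - u) \<partial>\<mu>) = (\<integral>x. f x \<partial>distr \<mu> borel (\<lambda>x. x - u))"
    by (rule integral_distr[symmetric]) (use assms in \<open>simp_all add: measurable_eq\<close>)
  then show ?thesis unfolding distr_right using assms modular_pos[of u]
    by (subst (asm) integral_density) (simp_all add: measurable_eq less_imp_le)
qed

lemma integrable_right:
  fixes f :: "'g \<Rightarrow> 'b::{banach, second_countable_topology}"
  assumes "integrable \<mu> f" shows "integrable \<mu> (\<lambda>x. f (x - u))"
proof -
  have fm: "f \<in> borel_measurable borel" using borel_measurable_integrable[OF assms] by (simp add: measurable_eq)
  have "integrable (density \<mu> (\<lambda>_. ennreal (modular u))) f"
    using fm modular_pos[of u] assms by (subst integrable_density) (simp_all add: measurable_eq less_imp_le)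
  then have "integrable (distr \<mu> borel (\<lambda>x. x - u)) f" by (simp only: distr_right)
  then show ?thesis by (rule integrable_distr[rotated]) (simp add: measurable_eq)
qed

section \<open>Convolution of integrable functions\<close>

definition L1 :: "('g \<Rightarrow> complex) set" where "L1 = {f. integrable \<mu> f}"

definition N :: "('g \<Rightarrow> complex) \<Rightarrow> real" where "N f = (\<integral>x. norm (f x) \<partial>\<mu>)"

abbreviation conv :: "('g \<Rightarrow> complex) \<Rightarrow> ('g \<Rightarrow> complex) \<Rightarrow> 'g \<Rightarrow> complex" where "conv \<equiv> convolve \<mu>"

text \<open>The products \<open>\<delta>\<^sub>u * f\<close> and \<open>f * \<delta>\<^sub>u\<close>.\<close>

definition lt :: "'g \<Rightarrow> ('g \<Rightarrow> complex) \<Rightarrow> 'g \<Rightarrow> complex" where "lt u f = (\<lambda>x. f (- u + x))"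

definition rt :: "'g \<Rightarrow> ('g \<Rightarrow> complex) \<Rightarrow> 'g \<Rightarrow> complex" where "rt u f = (\<lambda>x. of_real (modular (- u)) * f (x - u))"

lemma L1_integrable: "f \<in> L1 \<Longrightarrow> integrable \<mu> f" by (simp add: L1_def)

lemma L1_measurable: "f \<in> L1 \<Longrightarrow> f \<in> borel_measurable borel"
  using borel_measurable_integrable[of \<mu> f] by (simp add: L1_def measurable_eq)

lemma L1_nn: "f \<in> L1 \<Longrightarrow> (\<integral>\<^sup>+x. norm (f x) \<partial>\<mu>) = ennreal (N f)"
  unfolding N_def by (rule nn_integral_eq_integral) (auto simp: L1_def)

lemma N_nonneg: "N f \<ge> 0" by (simp add: N_def)

lemma L1_add: "f \<in> L1 \<Longrightarrow> g \<in> L1 \<Longrightarrow> (\<lambda>x. f x + g x) \<in> L1"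
  and L1_diff: "f \<in> L1 \<Longrightarrow> g \<in> L1 \<Longrightarrow> (\<lambda>x. f x - g x) \<in> L1"
  and L1_cmult: "f \<in> L1 \<Longrightarrow> (\<lambda>x. c * f x) \<in> L1"
  and L1_zero: "(\<lambda>x. 0) \<in> L1"
  by (auto simp: L1_def)

lemma N_triangle: "f \<in> L1 \<Longrightarrow> g \<in> L1 \<Longrightarrow> N (\<lambda>x. f x + g x) \<le> N f + N g"
proof -
  assume fg: "f \<in> L1" "g \<in> L1"
  have "N (\<lambda>x. f x + g x) \<le> (\<integral>x. norm (f x) + norm (g x) \<partial>\<mu>)"
    unfolding N_def using fg by (intro integral_mono) (auto simp: L1_def norm_triangle_ineq)
  also have "\<dots> = N f + N g" unfolding N_def using fg by (intro Bochner_Integration.integral_add) (auto simp: L1_def)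
  finally show ?thesis .
qed

lemma N_cmult: "N (\<lambda>x. c * f x) = norm c * N f"
  by (simp add: N_def norm_mult)

lemma N_cong_AE: "f \<in> L1 \<Longrightarrow> g \<in> L1 \<Longrightarrow> (AE x in \<mu>. f x = g x) \<Longrightarrow> N f = N g"
  unfolding N_def by (intro integral_cong_AE) (auto dest!: L1_measurable simp: measurable_eq)

lemma N_eq_0_iff: "f \<in> L1 \<Longrightarrow> N f = 0 \<longleftrightarrow> (AE x in \<mu>. f x = 0)"
  unfolding N_def by (subst integral_nonneg_eq_0_iff_AE) (auto simp: L1_def)

lemma N_diff_eq_0_iff: "f \<in> L1 \<Longrightarrow> g \<in> L1 \<Longrightarrow> N (\<lambda>x. f x - g x) = 0 \<longleftrightarrow> (AE x in \<mu>. f x = g x)"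
  using N_eq_0_iff[OF L1_diff] by simp

lemma lt_L1: "f \<in> L1 \<Longrightarrow> lt u f \<in> L1"
  unfolding L1_def lt_def by (simp add: integrable_left)

lemma rt_L1: "f \<in> L1 \<Longrightarrow> rt u f \<in> L1"
  unfolding L1_def rt_def by (simp add: integrable_right)

lemma N_lt: "f \<in> L1 \<Longrightarrow> N (lt u f) = N f"
proof -
  assume "f \<in> L1"
  then have [measurable]: "f \<in> borel_measurable borel" by (rule L1_measurable)
  show ?thesis unfolding N_def lt_def by (rule integral_left[where f="\<lambda>x. norm (f x)"]) measurable
qed

lemma N_rt: "f \<in> L1 \<Longrightarrow> N (rt u f) = N f"
proof -
  assume f: "f \<in> L1"
  have "(\<integral>x. norm (f (x - u)) \<partial>\<mu>) = modular u *\<^sub>R (\<integral>x. norm (f x) \<partial>\<mu>)"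
    by (rule integral_right) (use L1_measurable[OF f] in simp)
  then show ?thesis using modular_pos[of u] by (simp add: N_def rt_def norm_mult norm_divide modular_minus)
qed

lemma lt_lt: "lt u (lt v f) = lt (u + v) f"
  unfolding lt_def minus_add add.assoc ..

lemma rt_rt: "rt v (rt u f) = rt (u + v) f"
  unfolding rt_def minus_add modular_add of_real_mult diff_conv_add_uminus add.assoc mult.assoc ..

lemma lt_rt: "lt u (rt v f) = rt v (lt u f)"
  by (simp only: lt_def rt_def add_diff_eq)

lemma lt_0 [simp]: "lt 0 f = f" and rt_0 [simp]: "rt 0 f = f"
  by (simp_all add: lt_def rt_def)

text \<open>The sets where \<open>norm (f x)\<close> exceeds \<open>1 / (n + 1)\<close> have finite
  measure and, by outer regularity, open neighbourhoods of finite measure. This is the source of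
  every tame support in convolution integrals.\<close>

lemma L1_cover:
  assumes "f \<in> L1"
  obtains U :: "nat \<Rightarrow> 'g set" where "incseq U" "\<And>n. open (U n)" "\<And>n. emeasure \<mu> (U n) < \<infinity>" "\<And>x. f x \<noteq> 0 \<Longrightarrow> x \<in> (\<Union>n. U n)"
proof -
  define A where "A n = {x. norm (f x) > 1 / real (Suc n)}" for n
  have [measurable]: "f \<in> borel_measurable borel" by (rule L1_measurable[OF assms])
  have Ab: "A n \<in> sets borel" for n unfolding A_def by measurable
  have Afin: "emeasure \<mu> (A n) < \<infinity>" for n
  proof -
    have "emeasure \<mu> (A n) = (\<integral>\<^sup>+x. indicator (A n) x \<partial>\<mu>)" using Ab by simp
    also have "\<dots> \<le> (\<integral>\<^sup>+x. ennreal (real (Suc n)) * ennreal (norm (f x)) \<partial>\<mu>)"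
    proof (intro nn_integral_mono)
      fix x
      have "x \<in> A n \<Longrightarrow> 1 \<le> real (Suc n) * norm (f x)" by (simp add: A_def divide_less_eq mult.commute)
      then show "indicator (A n) x \<le> ennreal (real (Suc n)) * ennreal (norm (f x))"
        by (cases "x \<in> A n") (simp_all add: ennreal_mult[symmetric] del: of_nat_Suc)
    qed
    also have "\<dots> = ennreal (real (Suc n)) * ennreal (N f)"
      by (subst nn_integral_cmult) (simp_all add: measurable_eq L1_nn[OF assms])
    also have "\<dots> < \<infinity>" by (simp add: ennreal_mult_less_top)
    finally show ?thesis .
  qed
  have "\<exists>U. open U \<and> A n \<subseteq> U \<and> emeasure \<mu> U < \<infinity>" for n
    by (rule outer_less[OF Ab Afin]) (use Ab in blast)
  then obtain U where U: "\<And>n. open (U n)" "\<And>n. A n \<subseteq> U n" "\<And>n. emeasure \<mu> (U n) < \<infinity>" by metis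
  show thesis
  proof (rule that[of "\<lambda>n. \<Union>i\<le>n. U i"])
    show "incseq (\<lambda>n. \<Union>i\<le>n. U i)" by (intro incseq_SucI) (auto intro: le_SucI)
    show "open (\<Union>i\<le>n. U i)" for n using U by auto
    show "emeasure \<mu> (\<Union>i\<le>n. U i) < \<infinity>" for n
      using U by (intro fmeasurableD2[THEN top.not_eq_extremum[THEN iffD1], unfolded infinity_ennreal_def[symmetric]] fmeasurable.finite_UN) (auto simp: fmeasurable_def borel_open)
    fix x assume "f x \<noteq> 0"
    then have "norm (f x) > 0" by simp
    then obtain n where "1 / real (Suc n) < norm (f x)" using nat_approx_posE by blast
    then have "x \<in> A n" by (simp add: A_def)
    then show "x \<in> (\<Union>n. \<Union>i\<le>n. U i)" using U(2)[of n] by blast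
  qed
qed

text \<open>A sheared rectangle: \<open>y\<close> ranges over \<open>U\<close> and \<open>x\<close>
  over \<open>y + V\<close>. Its total measure is computed in the other order of integration, where
  each slice is a left translate of \<open>V\<close>.\<close>

lemma tame_convolution:
  assumes U: "open U" "emeasure \<mu> U < \<infinity>" and V: "open V" "emeasure \<mu> V < \<infinity>"
  shows "tame {z. snd z \<in> U \<and> - snd z + fst z \<in> V}"
proof -
  let ?W = "{z. snd z \<in> U \<and> - snd z + fst z \<in> V}"
  have c: "continuous_on UNIV (\<lambda>z::'g\<times>'g. snd z)" "continuous_on UNIV (\<lambda>z::'g\<times>'g. - snd z + fst z)"
    by (intro continuous_on_add continuous_on_minus continuous_on_snd continuous_on_fst continuous_on_id)+
  have "?W = (\<lambda>z. snd z) -` U \<inter> (\<lambda>z. - snd z + fst z) -` V" by auto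
  then have oW: "open ?W" using open_vimage[OF U(1) c(1)] open_vimage[OF V(1) c(2)] by (simp only: open_Int)
  have Ub: "U \<in> sets borel" and Vb: "V \<in> sets borel" using U V by (auto simp: borel_open)
  have s1: "slice x ?W \<subseteq> U" for x by (auto simp: slice_def)
  have s2: "slice y (prod.swap -` ?W) = (if y \<in> U then {x. - y + x \<in> V} else {})" for y by (simp add: slice_def)
  have e2: "emeasure \<mu> (slice y (prod.swap -` ?W)) = emeasure \<mu> V * indicator U y" for y
    unfolding s2 using emeasure_left[OF Vb, of "- y"] by (simp add: indicator_def)
  have f1: "emeasure \<mu> (slice x ?W) < \<infinity>" for x using emeasure_borel_mono[OF s1 Ub] U(2) le_less_trans by blast
  have f2: "emeasure \<mu> (slice y (prod.swap -` ?W)) < \<infinity>" for y unfolding e2 using V by (simp add: indicator_def)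
  have "(\<integral>\<^sup>+x. emeasure \<mu> (slice x ?W) \<partial>\<mu>) = (\<integral>\<^sup>+y. emeasure \<mu> V * indicator U y \<partial>\<mu>)"
    using fubini_open[OF oW f1 f2] by (simp only: e2)
  also have "\<dots> = emeasure \<mu> V * emeasure \<mu> U" using Ub by (intro nn_integral_cmult_indicator) simp
  also have "\<dots> < \<infinity>" using U V by (simp add: ennreal_mult_less_top)
  finally show ?thesis unfolding tame_def using oW f1 f2 by blast
qed

lemma tame_support_convolution:
  assumes f: "f \<in> L1" and h: "h \<in> L1" and F: "\<And>x y. F (x, y) \<noteq> 0 \<Longrightarrow> f y \<noteq> 0 \<and> h (- y + x) \<noteq> 0"
  shows "tame_support F"
proof -
  obtain U where U: "incseq U" "\<And>n. open (U n)" "\<And>n. emeasure \<mu> (U n) < \<infinity>" "\<And>x. f x \<noteq> 0 \<Longrightarrow> x \<in> (\<Union>n::nat. U n)"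
    by (rule L1_cover[OF f]) blast
  obtain V where V: "incseq V" "\<And>n. open (V n)" "\<And>n. emeasure \<mu> (V n) < \<infinity>" "\<And>x. h x \<noteq> 0 \<Longrightarrow> x \<in> (\<Union>n::nat. V n)"
    by (rule L1_cover[OF h]) blast
  show ?thesis unfolding tame_support_def
  proof (intro exI[of _ "\<lambda>n. {z. snd z \<in> U n \<and> - snd z + fst z \<in> V n}"] conjI allI impI)
    show "incseq (\<lambda>n. {z. snd z \<in> U n \<and> - snd z + fst z \<in> V n})"
      using U(1) V(1) unfolding incseq_def by blast
    show "tame {z. snd z \<in> U n \<and> - snd z + fst z \<in> V n}" for n by (intro tame_convolution U V)
    fix z assume "F z \<noteq> 0"
    then have "f (snd z) \<noteq> 0" "h (- snd z + fst z) \<noteq> 0" using F[of "fst z" "snd z"] by auto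
    then obtain m n where "snd z \<in> U m" "- snd z + fst z \<in> V n" using U(4) V(4) by blast
    then have "snd z \<in> U (max m n)" "- snd z + fst z \<in> V (max m n)"
      using incseqD[OF U(1), of m "max m n"] incseqD[OF V(1), of n "max m n"] by auto
    then show "z \<in> (\<Union>n. {z. snd z \<in> U n \<and> - snd z + fst z \<in> V n})" by blast
  qed
qed

lemma tame_support_product:
  assumes f: "f \<in> L1" and h: "h \<in> L1" and F: "\<And>x y. F (x, y) \<noteq> 0 \<Longrightarrow> f x \<noteq> 0 \<and> h y \<noteq> 0"
  shows "tame_support F"
proof -
  obtain U where U: "incseq U" "\<And>n. open (U n)" "\<And>n. emeasure \<mu> (U n) < \<infinity>" "\<And>x. f x \<noteq> 0 \<Longrightarrow> x \<in> (\<Union>n::nat. U n)"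
    by (rule L1_cover[OF f]) blast
  obtain V where V: "incseq V" "\<And>n. open (V n)" "\<And>n. emeasure \<mu> (V n) < \<infinity>" "\<And>x. h x \<noteq> 0 \<Longrightarrow> x \<in> (\<Union>n::nat. V n)"
    by (rule L1_cover[OF h]) blast
  show ?thesis unfolding tame_support_def
  proof (intro exI[of _ "\<lambda>n. U n \<times> V n"] conjI allI impI)
    show "incseq (\<lambda>n. U n \<times> V n)"
      using U(1) V(1) unfolding incseq_def by (simp add: Sigma_mono)
    show "tame (U n \<times> V n)" for n by (intro tame_rectangle U V)
    fix z assume "F z \<noteq> 0"
    then have "f (fst z) \<noteq> 0" "h (snd z) \<noteq> 0" using F[of "fst z" "snd z"] by auto
    then obtain m n where "fst z \<in> U m" "snd z \<in> V n" using U(4) V(4) by blast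
    then have "fst z \<in> U (max m n)" "snd z \<in> V (max m n)"
      using incseqD[OF U(1), of m "max m n"] incseqD[OF V(1), of n "max m n"] by auto
    then show "z \<in> (\<Union>n. U n \<times> V n)" by (intro UN_I[of "max m n"]) (simp_all add: mem_Times_iff)
  qed
qed

section \<open>Weak description of convolutions\<close>

definition pairing :: "('g \<Rightarrow> complex) \<Rightarrow> ('g \<Rightarrow> complex) \<Rightarrow> complex" where "pairing k f = (\<integral>x. k x * f x \<partial>\<mu>)"

text \<open>The unit ball of the bounded Borel functions. By \<open>N_eq_pairing\<close> it
  determines the norm, so identities almost everywhere may be verified after integration, where the
  order of integrals can be exchanged.\<close>

definition test :: "('g \<Rightarrow> complex) set" where "test = {k. k \<in> borel_measurable borel \<and> (\<forall>x. norm (k x) \<le> 1)}"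

lemma test_mult_L1: "k \<in> test \<Longrightarrow> f \<in> L1 \<Longrightarrow> (\<lambda>x. k x * f x) \<in> L1"
proof -
  assume k: "k \<in> test" and f: "f \<in> L1"
  have [measurable]: "k \<in> borel_measurable borel" "f \<in> borel_measurable borel" using k L1_measurable[OF f] by (auto simp: test_def)
  have "integrable \<mu> (\<lambda>x. k x * f x)"
  proof (rule Bochner_Integration.integrable_bound[OF L1_integrable[OF f]])
    show "AE x in \<mu>. norm (k x * f x) \<le> norm (f x)"
      using k by (intro AE_I2) (simp add: test_def norm_mult mult_left_le_one_le)
  qed (simp add: measurable_eq)
  then show ?thesis by (simp add: L1_def)
qed

lemma pairing_bound: "k \<in> test \<Longrightarrow> f \<in> L1 \<Longrightarrow> norm (pairing k f) \<le> N f"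
proof -
  assume k: "k \<in> test" and f: "f \<in> L1"
  have "norm (pairing k f) \<le> N (\<lambda>x. k x * f x)" unfolding pairing_def N_def by (rule integral_norm_bound)
  also have "\<dots> \<le> N f" unfolding N_def
  proof (rule integral_mono)
    show "norm (k x * f x) \<le> norm (f x)" for x
      using k by (simp add: test_def norm_mult mult_left_le_one_le)
  qed (use f test_mult_L1[OF k f] in \<open>auto simp: L1_def intro!: integrable_norm\<close>)
  finally show ?thesis .
qed

lemma pairing_add: "k \<in> test \<Longrightarrow> f \<in> L1 \<Longrightarrow> g \<in> L1 \<Longrightarrow> pairing k (\<lambda>x. f x + g x) = pairing k f + pairing k g"
  unfolding pairing_def distrib_left using test_mult_L1 by (intro Bochner_Integration.integral_add) (auto simp: L1_def)

lemma pairing_diff: "k \<in> test \<Longrightarrow> f \<in> L1 \<Longrightarrow> g \<in> L1 \<Longrightarrow> pairing k (\<lambda>x. f x - g x) = pairing k f - pairing k g"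
  unfolding pairing_def right_diff_distrib using test_mult_L1 by (intro Bochner_Integration.integral_diff) (auto simp: L1_def)

lemma pairing_cmult: "pairing k (\<lambda>x. c * f x) = c * pairing k f"
  unfolding pairing_def mult.left_commute[of _ c] by simp

lemma N_eq_pairing:
  assumes "f \<in> L1" obtains k where "k \<in> test" "pairing k f = of_real (N f)"
proof (rule that)
  have [measurable]: "f \<in> borel_measurable borel" by (rule L1_measurable[OF assms])
  let ?k = "\<lambda>x. if f x = 0 then 0 else of_real (norm (f x)) / f x"
  show "?k \<in> test" by (auto simp: test_def norm_divide)
  have "?k x * f x = of_real (norm (f x))" for x by simp
  then show "pairing ?k f = of_real (N f)" by (simp add: pairing_def N_def)
qed

lemma N_le_pairing:
  assumes "f \<in> L1" "\<And>k. k \<in> test \<Longrightarrow> norm (pairing k f) \<le> c" shows "N f \<le> c"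
proof -
  obtain k where k: "k \<in> test" "pairing k f = of_real (N f)" by (rule N_eq_pairing[OF assms(1)])
  from assms(2)[OF k(1)] show ?thesis using N_nonneg[of f] by (simp add: k(2))
qed

lemma pairing_eqI:
  assumes "f \<in> L1" "g \<in> L1" "\<And>k. k \<in> test \<Longrightarrow> pairing k f = pairing k g" shows "AE x in \<mu>. f x = g x"
proof -
  have "N (\<lambda>x. f x - g x) \<le> 0"
    using assms by (intro N_le_pairing L1_diff) (auto simp: pairing_diff)
  then show ?thesis using N_diff_eq_0_iff[OF assms(1,2)] N_nonneg[of "\<lambda>x. f x - g x"] by simp
qed

lemma conv_nn:
  assumes f: "f \<in> L1" and h: "h \<in> L1"
  shows "(\<integral>\<^sup>+x. \<integral>\<^sup>+y. norm (f y * h (- y + x)) \<partial>\<mu> \<partial>\<mu>) = ennreal (N f * N h)"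
proof -
  have [measurable]: "f \<in> borel_measurable borel" "h \<in> borel_measurable borel" by (intro L1_measurable f h)+
  define F where "F z = ennreal (norm (f (snd z) * h (- snd z + fst z)))" for z
  have c: "continuous_on UNIV (\<lambda>z::'g\<times>'g. snd z)" "continuous_on UNIV (\<lambda>z::'g\<times>'g. - snd z + fst z)"
    by (intro continuous_on_add continuous_on_minus continuous_on_snd continuous_on_fst continuous_on_id)+
  note [measurable] = c[THEN borel_measurable_continuous_onI]
  have "fubini_fun F"
    by (rule fubini_tame_support, unfold F_def[abs_def], measurable)
      (rule tame_support_convolution[OF f h], auto)
  then have "(\<integral>\<^sup>+x. \<integral>\<^sup>+y. norm (f y * h (- y + x)) \<partial>\<mu> \<partial>\<mu>) = (\<integral>\<^sup>+y. \<integral>\<^sup>+x. norm (f y * h (- y + x)) \<partial>\<mu> \<partial>\<mu>)"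
    by (simp add: fubini_fun_def F_def)
  also have "\<dots> = (\<integral>\<^sup>+y. ennreal (norm (f y)) * ennreal (N h) \<partial>\<mu>)"
  proof (rule nn_integral_cong)
    fix y
    have "(\<integral>\<^sup>+x. norm (f y * h (- y + x)) \<partial>\<mu>) = ennreal (norm (f y)) * (\<integral>\<^sup>+x. norm (h (- y + x)) \<partial>\<mu>)"
      unfolding norm_mult ennreal_mult'[OF norm_ge_zero] by (rule nn_integral_cmult) (simp add: measurable_eq)
    also have "(\<integral>\<^sup>+x. norm (h (- y + x)) \<partial>\<mu>) = ennreal (N h)"
      unfolding L1_nn[OF h, symmetric] by (rule nn_integral_left) simp
    finally show "(\<integral>\<^sup>+x. norm (f y * h (- y + x)) \<partial>\<mu>) = ennreal (norm (f y)) * ennreal (N h)" .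
  qed
  also have "\<dots> = ennreal (N f * N h)"
    by (subst nn_integral_multc) (simp_all add: measurable_eq L1_nn[OF f] ennreal_mult N_nonneg)
  finally show ?thesis .
qed

lemma conv_kernel:
  assumes f: "f \<in> L1" and h: "h \<in> L1" and k: "k \<in> test"
  defines "F \<equiv> \<lambda>z. k (fst z) * (f (snd z) * h (- snd z + fst z))"
  shows "F \<in> borel_measurable borel" "tame_support F" "(\<integral>\<^sup>+x. \<integral>\<^sup>+y. norm (F (x, y)) \<partial>\<mu> \<partial>\<mu>) \<le> ennreal (N f * N h)"
proof -
  have [measurable]: "f \<in> borel_measurable borel" "h \<in> borel_measurable borel" "k \<in> borel_measurable borel"
    using k by (auto simp: test_def intro: L1_measurable f h)
  have c: "continuous_on UNIV (\<lambda>z::'g\<times>'g. fst z)" "continuous_on UNIV (\<lambda>z::'g\<times>'g. snd z)" "continuous_on UNIV (\<lambda>z::'g\<times>'g. - snd z + fst z)"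
    by (intro continuous_on_add continuous_on_minus continuous_on_snd continuous_on_fst continuous_on_id)+
  note [measurable] = c[THEN borel_measurable_continuous_onI]
  show "F \<in> borel_measurable borel" unfolding F_def by measurable
  show "tame_support F" by (rule tame_support_convolution[OF f h]) (auto simp: F_def)
  have "norm (F (x, y)) \<le> norm (f y * h (- y + x))" for x y
    using k by (simp add: F_def test_def norm_mult mult_left_le_one_le)
  then have "(\<integral>\<^sup>+x. \<integral>\<^sup>+y. norm (F (x, y)) \<partial>\<mu> \<partial>\<mu>) \<le> (\<integral>\<^sup>+x. \<integral>\<^sup>+y. norm (f y * h (- y + x)) \<partial>\<mu> \<partial>\<mu>)"
    by (intro nn_integral_mono ennreal_leI)
  then show "(\<integral>\<^sup>+x. \<integral>\<^sup>+y. norm (F (x, y)) \<partial>\<mu> \<partial>\<mu>) \<le> ennreal (N f * N h)" by (simp only: conv_nn[OF f h])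
qed

lemma one_test: "(\<lambda>x. 1) \<in> test" by (simp add: test_def)

lemma
  assumes f: "f \<in> L1" and h: "h \<in> L1"
  shows conv_L1: "conv f h \<in> L1" and N_conv: "N (conv f h) \<le> N f * N h"
proof -
  note K = conv_kernel[OF f h one_test]
  have fin: "(\<integral>\<^sup>+x. \<integral>\<^sup>+y. norm (f y * h (- y + x)) \<partial>\<mu> \<partial>\<mu>) < \<infinity>" by (simp add: conv_nn[OF f h])
  show c: "conv f h \<in> L1"
    using fubini_complex_integrable[OF K(1,2)] fin by (simp add: L1_def convolve_def[abs_def])
  have "ennreal (N (conv f h)) = (\<integral>\<^sup>+x. norm (conv f h x) \<partial>\<mu>)" by (rule L1_nn[OF c, symmetric])
  also have "\<dots> \<le> (\<integral>\<^sup>+x. \<integral>\<^sup>+y. norm (f y * h (- y + x)) \<partial>\<mu> \<partial>\<mu>)"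
    using fubini_complex_norm[OF K(1,2)] fin by (simp add: convolve_def[abs_def])
  finally have "ennreal (N (conv f h)) \<le> ennreal (N f * N h)" by (simp only: conv_nn[OF f h])
  then show "N (conv f h) \<le> N f * N h" by (simp add: N_nonneg)
qed

text \<open>Exchanging the integrals exhibits \<open>conv f h\<close>, weakly, as the average of the
  left translates of \<open>h\<close> with density \<open>f\<close>.\<close>

lemma pairing_conv_left:
  assumes f: "f \<in> L1" and h: "h \<in> L1" and k: "k \<in> test"
  shows "pairing k (conv f h) = (\<integral>y. f y * pairing k (lt y h) \<partial>\<mu>)"
proof -
  note K = conv_kernel[OF f h k]
  have "(\<integral>\<^sup>+x. \<integral>\<^sup>+y. norm (k (fst (x, y)) * (f (snd (x, y)) * h (- snd (x, y) + fst (x, y)))) \<partial>\<mu> \<partial>\<mu>) < \<infinity>"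
    using le_less_trans[OF K(3)] by simp
  from fubini_complex[OF K(1,2) this]
  have "(\<integral>x. (\<integral>y. k x * (f y * h (- y + x)) \<partial>\<mu>) \<partial>\<mu>) = (\<integral>y. (\<integral>x. k x * (f y * h (- y + x)) \<partial>\<mu>) \<partial>\<mu>)" by simp
  moreover have "(\<integral>x. k x * (f y * h (- y + x)) \<partial>\<mu>) = f y * pairing k (lt y h)" for y
    unfolding mult.left_commute[of "k _" "f y"] by (simp add: pairing_def lt_def)
  ultimately show ?thesis by (simp add: pairing_def convolve_def)
qed

text \<open>The same convolution as an average of right translates of \<open>f\<close> with density
  \<open>h\<close>. The factor \<open>modular (- v)\<close> built into \<open>rt\<close> is the one
  produced by the right substitution of the integration variable.\<close>

lemma pairing_conv_right:
  assumes f: "f \<in> L1" and h: "h \<in> L1" and k: "k \<in> test"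
  shows "pairing k (conv f h) = (\<integral>v. h v * pairing k (rt v f) \<partial>\<mu>)"
proof -
  have [measurable]: "f \<in> borel_measurable borel" "h \<in> borel_measurable borel" "k \<in> borel_measurable borel"
    using k by (auto simp: test_def intro: L1_measurable f h)
  define F where "F z = f (fst z) * h (snd z) * k (fst z + snd z)" for z
  have c: "continuous_on UNIV (\<lambda>z::'g\<times>'g. fst z)" "continuous_on UNIV (\<lambda>z::'g\<times>'g. snd z)" "continuous_on UNIV (\<lambda>z::'g\<times>'g. fst z + snd z)"
    by (intro continuous_on_add continuous_on_snd continuous_on_fst continuous_on_id)+
  note [measurable] = c[THEN borel_measurable_continuous_onI]
  have Fm: "F \<in> borel_measurable borel" unfolding F_def[abs_def] by measurable
  have Fs: "tame_support F" by (rule tame_support_product[OF f h]) (auto simp: F_def)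
  have "norm (F (x, y)) \<le> norm (f x) * norm (h y)" for x y
    using k by (simp add: F_def test_def norm_mult mult_left_le)
  then have "(\<integral>\<^sup>+x. \<integral>\<^sup>+y. norm (F (x, y)) \<partial>\<mu> \<partial>\<mu>) \<le> (\<integral>\<^sup>+x. \<integral>\<^sup>+y. ennreal (norm (f x)) * ennreal (norm (h y)) \<partial>\<mu> \<partial>\<mu>)"
    by (intro nn_integral_mono) (simp add: ennreal_mult[symmetric])
  also have "\<dots> = ennreal (N f) * ennreal (N h)"
    by (simp add: nn_integral_cmult nn_integral_multc measurable_eq L1_nn f h)
  finally have fin: "(\<integral>\<^sup>+x. \<integral>\<^sup>+y. norm (F (x, y)) \<partial>\<mu> \<partial>\<mu>) < \<infinity>" by (rule le_less_trans) (simp add: ennreal_mult_less_top)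
  have "pairing k (conv f h) = (\<integral>y. f y * pairing k (lt y h) \<partial>\<mu>)" by (rule pairing_conv_left[OF f h k])
  also have "\<dots> = (\<integral>y. (\<integral>v. F (y, v) \<partial>\<mu>) \<partial>\<mu>)"
  proof (rule Bochner_Integration.integral_cong[OF refl])
    fix y
    have "pairing k (lt y h) = (\<integral>x. k (y + x) * lt y h (y + x) \<partial>\<mu>)"
      unfolding pairing_def by (rule integral_left[symmetric]) (simp add: lt_def)
    also have "\<dots> = (\<integral>x. k (y + x) * h x \<partial>\<mu>)" by (simp add: lt_def add.assoc[symmetric])
    finally have "f y * pairing k (lt y h) = (\<integral>x. f y * (k (y + x) * h x) \<partial>\<mu>)" by simp
    then show "f y * pairing k (lt y h) = (\<integral>v. F (y, v) \<partial>\<mu>)" by (simp add: F_def mult_ac)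
  qed
  also have "\<dots> = (\<integral>v. (\<integral>y. F (y, v) \<partial>\<mu>) \<partial>\<mu>)" by (rule fubini_complex[OF Fm Fs fin])
  also have "\<dots> = (\<integral>v. h v * pairing k (rt v f) \<partial>\<mu>)"
  proof (rule Bochner_Integration.integral_cong[OF refl])
    fix v
    have "(\<integral>x. f (x - v) * k (x - v + v) \<partial>\<mu>) = modular v *\<^sub>R (\<integral>y. f y * k (y + v) \<partial>\<mu>)"
      by (rule integral_right) simp
    then have "(\<integral>y. f y * k (y + v) \<partial>\<mu>) = of_real (modular (- v)) * (\<integral>x. f (x - v) * k x \<partial>\<mu>)"
      using modular_pos[of v] by (simp add: modular_minus scaleR_conv_of_real)
    also have "\<dots> = pairing k (rt v f)"
      unfolding pairing_def rt_def by (subst integral_mult_right_zero[symmetric]) (simp only: mult_ac)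
    finally have "h v * (\<integral>y. f y * k (y + v) \<partial>\<mu>) = h v * pairing k (rt v f)" by simp
    moreover have "(\<integral>y. F (y, v) \<partial>\<mu>) = h v * (\<integral>y. f y * k (y + v) \<partial>\<mu>)"
      unfolding F_def by (subst integral_mult_right_zero[symmetric]) (simp add: mult_ac)
    ultimately show "(\<integral>y. F (y, v) \<partial>\<mu>) = h v * pairing k (rt v f)" by simp
  qed
  finally show ?thesis .
qed

lemma continuous_reflect: "continuous_on UNIV (\<lambda>y :: 'g. - y + x)"
  by (rule continuous_on_add[OF continuous_on_minus[OF continuous_on_id] continuous_on_const])

text \<open>Together with \<open>conv_rt\<close> and \<open>conv_rt_lt\<close> this is associativity
  with a point mass as one factor. The identities hold at every point, since translation of the
  variable is valid for the Bochner integral also where the integrand is not integrable.\<close>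

lemma conv_lt: "conv (lt u f) h = lt u (conv f h)" if "f \<in> L1" "h \<in> L1"
proof
  fix x
  have [measurable]: "f \<in> borel_measurable borel" "h \<in> borel_measurable borel" by (intro L1_measurable that)+
  note cx = continuous_reflect[of x]
  note [measurable] = borel_measurable_continuous_onI[OF cx]
  have "conv (lt u f) h x = (\<integral>y. lt u f (u + y) * h (- (u + y) + x) \<partial>\<mu>)"
    unfolding convolve_def by (rule integral_left[symmetric]) (simp add: lt_def)
  also have "\<dots> = lt u (conv f h) x"
    unfolding convolve_def lt_def minus_add add.assoc minus_add_cancel ..
  finally show "conv (lt u f) h x = lt u (conv f h) x" .
qed

lemma conv_rt: "conv f (rt u h) = rt u (conv f h)"
proof
  fix x
  have "conv f (rt u h) x = (\<integral>y. of_real (modular (- u)) * (f y * h (- y + (x - u))) \<partial>\<mu>)"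
    unfolding convolve_def rt_def add_diff_eq by (simp only: mult.left_commute)
  then show "conv f (rt u h) x = rt u (conv f h) x" by (simp add: convolve_def rt_def)
qed

lemma conv_rt_lt: "conv (rt u f) h = conv f (lt u h)" if "f \<in> L1" "h \<in> L1"
proof
  fix x
  have [measurable]: "f \<in> borel_measurable borel" "h \<in> borel_measurable borel" by (intro L1_measurable that)+
  note cx = continuous_reflect[of x] continuous_on_add[OF continuous_on_const[of _ "- u"] continuous_reflect[of x]]
  note [measurable] = cx[THEN borel_measurable_continuous_onI]
  have "(\<integral>y. f (y - u) * h (- u + (- (y - u) + x)) \<partial>\<mu>) = modular u *\<^sub>R (\<integral>y. f y * h (- u + (- y + x)) \<partial>\<mu>)"
    by (rule integral_right[where f="\<lambda>y. f y * h (- u + (- y + x))"]) simp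
  moreover have "- u + (- (y - u) + x) = - y + x" for y
    unfolding diff_conv_add_uminus minus_add minus_minus add.assoc minus_add_cancel ..
  ultimately have "(\<integral>y. f (y - u) * h (- y + x) \<partial>\<mu>) = modular u *\<^sub>R conv f (lt u h) x"
    by (simp add: convolve_def lt_def)
  then have "of_real (modular (- u)) * (\<integral>y. f (y - u) * h (- y + x) \<partial>\<mu>) = conv f (lt u h) x"
    using modular_pos[of u] by (simp add: modular_minus scaleR_conv_of_real)
  then show "conv (rt u f) h x = conv f (lt u h) x"
    by (simp add: convolve_def rt_def mult.assoc)
qed

section \<open>Density of compactly supported indicators and approximate identities\<close>

abbreviation ind :: "'g set \<Rightarrow> 'g \<Rightarrow> complex" where "ind \<equiv> indicator"

lemma measure_fin: "emeasure \<mu> A < \<infinity> \<Longrightarrow> emeasure \<mu> A = ennreal (measure \<mu> A)"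
  by (simp add: emeasure_eq_ennreal_measure)

lemma ind_L1: "A \<in> sets borel \<Longrightarrow> emeasure \<mu> A < \<infinity> \<Longrightarrow> ind A \<in> L1"
proof -
  assume A: "A \<in> sets borel" "emeasure \<mu> A < \<infinity>"
  have "ind A = (\<lambda>x. complex_of_real (indicator A x))" by (auto simp: indicator_def)
  moreover have "integrable \<mu> (indicator A :: 'g \<Rightarrow> real)" using A by (simp add: integrable_indicator_iff)
  ultimately show ?thesis by (simp add: L1_def)
qed

lemma ind_compact_L1: "compact K \<Longrightarrow> ind K \<in> L1"
  by (intro ind_L1 borel_compact emeasure_compact)

lemma N_ind: "A \<in> sets borel \<Longrightarrow> N (ind A) = measure \<mu> A"
  proof -
  assume A: "A \<in> sets borel"
  have "norm (ind A x) = indicator A x" for x by (simp add: indicator_def)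
  then show ?thesis using A by (simp add: N_def)
qed

text \<open>Inner regularity is given for open sets, so \<open>K\<close> is chosen inside an open
  \<open>U\<close> around \<open>A\<close> and need not lie in \<open>A\<close>; both
  \<open>A\<close> and \<open>K\<close> nearly fill \<open>U\<close>.\<close>

lemma compact_approx:
  assumes A: "A \<in> sets borel" "emeasure \<mu> A < \<infinity>" and e: "e > 0"
  obtains K where "compact K" "N (\<lambda>x. ind A x - ind K x) < e"
proof -
  have "emeasure \<mu> A < emeasure \<mu> A + ennreal (e / 2)"
    using A e by (cases "emeasure \<mu> A") (simp_all flip: ennreal_plus add: ennreal_less_iff)
  from outer_less[OF A(1) this] obtain U where U: "open U" "A \<subseteq> U" "emeasure \<mu> U < emeasure \<mu> A + ennreal (e / 2)" by metis
  have Ub [measurable]: "U \<in> sets borel" using U by (simp add: borel_open)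
  have Ufin: "emeasure \<mu> U < \<infinity>" using U(3) A(2) by (metis ennreal_add_less_top ennreal_less_top infinity_ennreal_def order.strict_trans)
  have mU: "measure \<mu> U < measure \<mu> A + e / 2"
    using U(3) e unfolding measure_fin[OF Ufin] measure_fin[OF A(2)] by (simp flip: ennreal_plus add: ennreal_less_iff)
  obtain K where K: "compact K" "K \<subseteq> U" "measure \<mu> K > measure \<mu> U - e / 2"
  \<comment> \<open>If \<open>U\<close> is null, then \<open>measure \<mu> U - e / 2\<close> is
    negative and \<open>ennreal\<close> truncates it to \<open>0\<close>, which is not strictly
    below the measure of \<open>U\<close>.\<close>
  proof (cases "measure \<mu> U = 0")
    case True
    then show ?thesis using that[of "{}"] e by simp
  next
    case False
    then have "ennreal (measure \<mu> U - e / 2) < emeasure \<mu> U"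
      unfolding measure_fin[OF Ufin] using e by (cases "measure \<mu> U - e / 2 \<ge> 0") (simp_all add: ennreal_less_iff ennreal_neg zero_less_measure_iff measure_nonneg less_le)
    from inner_open_less[OF U(1) this] obtain K where K: "compact K" "K \<subseteq> U" "ennreal (measure \<mu> U - e / 2) < emeasure \<mu> K" by metis
    from K(3) have "measure \<mu> U - e / 2 < measure \<mu> K"
      unfolding measure_fin[OF emeasure_compact[OF K(1)]] by (metis ennreal_leI leD leI)
    with K that show ?thesis by blast
  qed
  have [measurable]: "K \<in> sets borel" by (rule borel_compact[OF K(1)])
  have fU: "U \<in> fmeasurable \<mu>" "A \<in> fmeasurable \<mu>" "K \<in> fmeasurable \<mu>"
    using Ufin A emeasure_compact[OF K(1)] by (auto simp: fmeasurable_def borel_compact[OF K(1)])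
  have "N (\<lambda>x. ind A x - ind K x) \<le> (\<integral>x. indicator (U - A) x + indicator (U - K) x \<partial>\<mu>)"
    unfolding N_def
  proof (rule integral_mono)
    show "integrable \<mu> (\<lambda>x. norm (ind A x - ind K x))"
      using L1_integrable[OF L1_diff[OF ind_L1[OF A] ind_compact_L1[OF K(1)]]] by (rule integrable_norm)
    show "integrable \<mu> (\<lambda>x. indicator (U - A) x + indicator (U - K) x :: real)"
      using fU by (intro Bochner_Integration.integrable_add) (auto simp: integrable_indicator_iff fmeasurable_def intro: emeasure_borel_mono[THEN le_less_trans, OF _ Ub Ufin[unfolded infinity_ennreal_def]])
    show "norm (ind A x - ind K x) \<le> indicator (U - A) x + indicator (U - K) x" for x
      using U(2) K(2) by (auto simp: indicator_def)
  qed
  also have "\<dots> = measure \<mu> (U - A) + measure \<mu> (U - K)"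
    using fU by (subst Bochner_Integration.integral_add) (auto simp: integrable_indicator_iff fmeasurable_def intro: emeasure_borel_mono[THEN le_less_trans, OF _ Ub Ufin[unfolded infinity_ennreal_def]])
  also have "\<dots> = (measure \<mu> U - measure \<mu> A) + (measure \<mu> U - measure \<mu> K)"
    using fU U(2) K(2) by (simp add: measure_Diff fmeasurable_def A)
  also have "\<dots> < e" using mU K(3) by simp
  finally show thesis using that K(1) by blast
qed

lemma L1_dense_induct [consumes 1, case_names compact add cmult closed]:
  assumes f: "f \<in> L1"
    and compact: "\<And>K. compact K \<Longrightarrow> P (ind K)"
    and add: "\<And>f g. f \<in> L1 \<Longrightarrow> g \<in> L1 \<Longrightarrow> P f \<Longrightarrow> P g \<Longrightarrow> P (\<lambda>x. f x + g x)"
    and cmult: "\<And>c f. f \<in> L1 \<Longrightarrow> P f \<Longrightarrow> P (\<lambda>x. c * f x)"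
    and closed: "\<And>f. f \<in> L1 \<Longrightarrow> (\<And>e. e > 0 \<Longrightarrow> \<exists>g\<in>L1. P g \<and> N (\<lambda>x. f x - g x) < e) \<Longrightarrow> P f"
  shows "P f"
  using L1_integrable[OF f]
proof (induction f rule: integrable_induct)
  case (base A c)
  then have A: "A \<in> sets borel" "emeasure \<mu> A < \<infinity>" by simp_all
  have "P (ind A)"
  proof (rule closed[OF ind_L1[OF A]])
    fix e :: real assume "e > 0"
    from compact_approx[OF A this] obtain K where "compact K" "N (\<lambda>x. ind A x - ind K x) < e" by blast
    then show "\<exists>g\<in>L1. P g \<and> N (\<lambda>x. ind A x - g x) < e" using compact ind_compact_L1 by blast
  qed
  from cmult[OF ind_L1[OF A] this, of c]
  have "P (\<lambda>x. c * ind A x)" .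
  also have "(\<lambda>x. c * ind A x) = (\<lambda>x. indicator A x *\<^sub>R c)" by (auto simp: indicator_def)
  finally show ?case .
next
  case (add f g)
  then show ?case using assms(3)[of f g] by (simp add: L1_def)
next
  case (lim f s)
  have sL: "s i \<in> L1" and fL: "f \<in> L1" for i using lim by (auto simp: L1_def)
  have "(\<lambda>i. \<integral>x. norm (f x - s i x) \<partial>\<mu>) \<longlonglongrightarrow> (\<integral>x. norm (0::complex) \<partial>\<mu>)"
  proof (rule integral_dominated_convergence[where w="\<lambda>x. 3 * norm (f x)"])
    show "integrable \<mu> (\<lambda>x. 3 * norm (f x))" using lim by simp
    show "AE x in \<mu>. (\<lambda>i. norm (f x - s i x)) \<longlonglongrightarrow> norm (0::complex)"
    proof (intro AE_I2)
      fix x assume "x \<in> space \<mu>"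
      from tendsto_norm[OF tendsto_diff[OF tendsto_const[of "f x"] lim.hyps(2)[OF this]]]
      show "(\<lambda>i. norm (f x - s i x)) \<longlonglongrightarrow> norm (0::complex)" by simp
    qed
    show "AE x in \<mu>. norm (norm (f x - s i x)) \<le> 3 * norm (f x)" for i
    proof (intro AE_I2)
      fix x assume "x \<in> space \<mu>"
      from lim.hyps(3)[OF this, of i] norm_triangle_ineq4[of "f x" "s i x"]
      show "norm (norm (f x - s i x)) \<le> 3 * norm (f x)" by simp
    qed
  qed (use lim in \<open>auto intro!: borel_measurable_norm borel_measurable_diff\<close>)
  then have l: "(\<lambda>i. N (\<lambda>x. f x - s i x)) \<longlonglongrightarrow> 0" by (simp add: N_def)
  show ?case
  proof (rule closed[OF fL])
    fix e :: real assume "e > 0"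
    then have "eventually (\<lambda>i. N (\<lambda>x. f x - s i x) < e) sequentially" using l by (rule order_tendstoD(2)[rotated])
    then obtain i where "N (\<lambda>x. f x - s i x) < e" by (auto simp: eventually_sequentially)
    then show "\<exists>g\<in>L1. P g \<and> N (\<lambda>x. f x - g x) < e" using lim.IH[of i] sL[of i] by blast
  qed
qed

text \<open>The \<open>D i\<close> behave like seminorms bounded by \<open>2 * N\<close> uniformly
  in \<open>i\<close>, so convergence on indicators of compact sets spreads to all of
  \<open>L1\<close> by approximation.\<close>

lemma tendsto_dense:
  assumes f: "f \<in> L1" and ev: "eventually P F"
    and D: "\<And>i f g. P i \<Longrightarrow> f \<in> L1 \<Longrightarrow> g \<in> L1 \<Longrightarrow> D i (\<lambda>x. f x + g x) \<le> D i f + (D i g :: real)"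
      "\<And>i f c. P i \<Longrightarrow> f \<in> L1 \<Longrightarrow> D i (\<lambda>x. c * f x) \<le> norm c * D i f"
      "\<And>i f. P i \<Longrightarrow> f \<in> L1 \<Longrightarrow> D i f \<le> 2 * N f" "\<And>i f. P i \<Longrightarrow> f \<in> L1 \<Longrightarrow> 0 \<le> D i f"
    and base: "\<And>K. compact K \<Longrightarrow> ((\<lambda>i. D i (ind K)) \<longlongrightarrow> 0) F"
  shows "((\<lambda>i. D i f) \<longlongrightarrow> 0) F"
  using f
proof (induction rule: L1_dense_induct)
  case (compact K)
  then show ?case by (rule base)
next
  case (add f g)
  have "((\<lambda>i. D i f + D i g) \<longlongrightarrow> 0) F" using tendsto_add[OF add.IH] by simp
  then show ?case
    by (rule Lim_null_comparison[rotated], use ev in eventually_elim) (use D(1,4) L1_add add.hyps in auto)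
next
  case (cmult c f)
  have "((\<lambda>i. norm c * D i f) \<longlongrightarrow> 0) F" using tendsto_mult_left[OF cmult.IH, of "norm c"] by simp
  then show ?case
    by (rule Lim_null_comparison[rotated], use ev in eventually_elim) (use D(2,4) L1_cmult cmult.hyps in auto)
next
  case (closed f)
  show ?case
  proof (rule tendstoI)
    fix e :: real assume e: "e > 0"
    then obtain g where g: "g \<in> L1" "((\<lambda>i. D i g) \<longlongrightarrow> 0) F" "N (\<lambda>x. f x - g x) < e / 4"
      using closed.IH[of "e / 4"] by auto
    have "eventually (\<lambda>i. D i g < e / 2) F" using order_tendstoD(2)[OF g(2), of "e / 2"] e by simp
    with ev show "eventually (\<lambda>i. dist (D i f) 0 < e) F"
    proof eventually_elim
      case (elim i)
      have "D i f \<le> D i g + D i (\<lambda>x. f x - g x)"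
        using D(1)[OF elim(1) g(1) L1_diff[OF closed.hyps g(1)]] by simp
      also have "\<dots> < e" using D(3)[OF elim(1) L1_diff[OF closed.hyps g(1)]] g(3) elim(2) by linarith
      finally show ?case using D(4)[OF elim(1) closed.hyps] by simp
    qed
  qed
qed

section \<open>Continuity of translation in the mean\<close>

text \<open>An absolute value is twice the positive part minus the value. As \<open>r\<close> and
  the indicator of \<open>K\<close> have the same integral, the norm is twice the integral of the
  positive part, so only the excess of \<open>r\<close> has to be controlled.\<close>

lemma near_indicator:
  assumes K: "compact K" and U: "open U" "K \<subseteq> U" "emeasure \<mu> U < \<infinity>" and eta: "\<eta> \<ge> 0"
    and g: "\<And>x. g x = complex_of_real (r x)" "integrable \<mu> r" "\<And>x. 0 \<le> r x" "\<And>x. r x \<le> 1 + \<eta>" "\<And>x. x \<notin> U \<Longrightarrow> r x = 0"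
    and int: "(\<integral>x. r x \<partial>\<mu>) = measure \<mu> K"
  shows "N (\<lambda>x. g x - ind K x) \<le> 2 * (\<eta> * measure \<mu> U + (measure \<mu> U - measure \<mu> K))"
proof -
  have Kb [measurable]: "K \<in> sets borel" by (rule borel_compact[OF K])
  have Ub [measurable]: "U \<in> sets borel" using U by (simp add: borel_open)
  have i1: "integrable \<mu> (indicator K :: _ \<Rightarrow> real)" "integrable \<mu> (indicator U :: _ \<Rightarrow> real)"
    using emeasure_compact[OF K] U(3) by (auto simp: integrable_indicator_iff)
  have eq: "norm (g x - ind K x) = \<bar>r x - indicator K x\<bar>" for x
  proof -
    have "g x - ind K x = of_real (r x - indicator K x)" by (simp add: g(1) indicator_def)
    then show ?thesis by (simp only: norm_of_real)
  qed
  have "N (\<lambda>x. g x - ind K x) = (\<integral>x. \<bar>r x - indicator K x\<bar> \<partial>\<mu>)" unfolding N_def eq ..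
  also have "\<dots> \<le> (\<integral>x. 2 * (\<eta> * indicator U x + (indicator U x - indicator K x)) - (r x - indicator K x) \<partial>\<mu>)"
  proof (rule integral_mono)
    show "\<bar>r x - indicator K x\<bar> \<le> 2 * (\<eta> * indicator U x + (indicator U x - indicator K x)) - (r x - indicator K x)" for x
      using g(3-5)[of x] U(2) eta by (auto simp: indicator_def)
  qed (use i1 g(2) in auto)
  also have "\<dots> = 2 * (\<eta> * measure \<mu> U + (measure \<mu> U - measure \<mu> K)) - ((\<integral>x. r x \<partial>\<mu>) - measure \<mu> K)"
    using i1 g(2) by simp
  finally show ?thesis by (simp add: int)
qed

lemma compact_thicken:
  assumes K: "compact K" "open U" "K \<subseteq> U"
  obtains W where "open W" "(0::'g) \<in> W" "\<And>w x. w \<in> W \<Longrightarrow> x \<in> K \<Longrightarrow> w + x \<in> U \<and> x + w \<in> U"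
proof -
  let ?W = "(\<lambda>z. fst z + snd z) -` U \<inter> (\<lambda>z. snd z + fst z) -` U"
  have c: "continuous_on UNIV (\<lambda>z::'g\<times>'g. fst z + snd z)" "continuous_on UNIV (\<lambda>z::'g\<times>'g. snd z + fst z)"
    by (intro continuous_on_add continuous_on_snd continuous_on_fst continuous_on_id)+
  have o: "open ?W" using open_vimage[OF K(2) c(1)] open_vimage[OF K(2) c(2)] by (rule open_Int)
  have "{0} \<times> K \<subseteq> ?W"
  proof
    fix z assume "z \<in> {0::'g} \<times> K"
    then have "fst z = 0" "snd z \<in> K" by (auto simp: mem_Times_iff)
    then show "z \<in> ?W" using K(3) by auto
  qed
  from Elementary_Topology.tube_lemma[OF K(1) o this] obtain W where W: "0 \<in> W" "open W" "W \<times> K \<subseteq> ?W" by metis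
  show thesis
  proof (rule that[OF W(2,1)])
    fix w x assume "w \<in> W" "x \<in> K"
    then have "(w, x) \<in> ?W" using W(3) by (meson SigmaI subsetD)
    then show "w + x \<in> U \<and> x + w \<in> U" by simp
  qed
qed

lemma compact_outer:
  assumes K: "compact K" and e: "e > 0"
  obtains U where "open U" "K \<subseteq> U" "emeasure \<mu> U < \<infinity>" "measure \<mu> U - measure \<mu> K < e"
proof -
  have f: "emeasure \<mu> K < \<infinity>" by (rule emeasure_compact[OF K])
  have "emeasure \<mu> K < emeasure \<mu> K + ennreal e"
    using f e by (cases "emeasure \<mu> K") (simp_all flip: ennreal_plus add: ennreal_less_iff)
  from outer_less[OF borel_compact[OF K] this] obtain U where U: "open U" "K \<subseteq> U" "emeasure \<mu> U < emeasure \<mu> K + ennreal e" by metis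
  have Uf: "emeasure \<mu> U < \<infinity>" using U(3) f by (metis ennreal_add_less_top ennreal_less_top infinity_ennreal_def order.strict_trans)
  have "measure \<mu> U < measure \<mu> K + e"
    using U(3) e unfolding measure_fin[OF f] measure_fin[OF Uf] by (simp flip: ennreal_plus add: ennreal_less_iff)
  then show thesis using that[OF U(1,2) Uf] by simp
qed

lemma integral_ind:
  assumes "A \<in> sets borel" "emeasure \<mu> A < \<infinity>"
  shows "(\<integral>x. ind A x \<partial>\<mu>) = of_real (measure \<mu> A)"
proof -
  have "ind A = (\<lambda>x. complex_of_real (indicator A x))" by (auto simp: indicator_def)
  then show ?thesis using assms by simp
qed

text \<open>Common core of three limits: left translates, right translates, and averages by the
  approximate identity. Each of them keeps the mass of \<open>K\<close>, exceeds height 1 at most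
  slightly and stays near \<open>K\<close>, which \<open>near_indicator\<close> turns into
  convergence in norm.\<close>

lemma tendsto_translate_ind:
  assumes K: "compact K"
    and T: "\<And>\<eta>. \<eta> > 0 \<Longrightarrow> eventually (\<lambda>w. \<exists>r. (\<forall>x. T w x = complex_of_real (r x)) \<and> integrable \<mu> r \<and> (\<forall>x. 0 \<le> r x) \<and>
      (\<forall>x. r x \<le> 1 + \<eta>) \<and> (\<integral>x. r x \<partial>\<mu>) = measure \<mu> K) F"
    and S: "\<And>U. open U \<Longrightarrow> K \<subseteq> U \<Longrightarrow> eventually (\<lambda>w. \<forall>x. T w x \<noteq> 0 \<longrightarrow> x \<in> U) F"
  shows "((\<lambda>w. N (\<lambda>x. T w x - ind K x)) \<longlongrightarrow> 0) F"
proof (rule tendstoI)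
  fix e :: real assume e: "e > 0"
  then have "e / 4 > 0" by simp
  from compact_outer[OF K this] obtain U where U: "open U" "K \<subseteq> U" "emeasure \<mu> U < \<infinity>" "measure \<mu> U - measure \<mu> K < e / 4" by metis
  \<comment> \<open>The summand 1 guards against \<open>measure \<mu> U = 0\<close>; the factor 4
    splits \<open>e\<close> between \<open>\<eta>\<close> and the surplus of
    \<open>U\<close>.\<close>
  define \<eta> where "\<eta> = e / (4 * (measure \<mu> U + 1))"
  have pos: "measure \<mu> U + 1 > 0" using measure_nonneg[of \<mu> U] by linarith
  have eta: "\<eta> > 0" using e pos by (simp add: \<eta>_def)
  have etaU: "\<eta> * measure \<mu> U < e / 4"
  proof -
    have "e / (4 * M) * M = e / 4" if "M > 0" for M :: real using that by simp
    from this[OF pos] have "\<eta> * (measure \<mu> U + 1) = e / 4" by (simp only: \<eta>_def)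
    moreover have "\<eta> * measure \<mu> U < \<eta> * (measure \<mu> U + 1)" using eta by (intro mult_strict_left_mono) auto
    ultimately show ?thesis by simp
  qed
  from T[OF eta] S[OF U(1,2)] show "eventually (\<lambda>w. dist (N (\<lambda>x. T w x - ind K x)) 0 < e) F"
  proof eventually_elim
    case (elim w)
    then obtain r where r: "\<And>x. T w x = complex_of_real (r x)" "integrable \<mu> r" "\<And>x. 0 \<le> r x" "\<And>x. r x \<le> 1 + \<eta>" "(\<integral>x. r x \<partial>\<mu>) = measure \<mu> K"
      by blast
    have "r x = 0" if "x \<notin> U" for x using elim(2) r(1)[of x] that by (metis of_real_eq_0_iff)
    from near_indicator[OF K U(1-3) less_imp_le[OF eta] r(1-4) this r(5)] U(4) etaU
    show ?case using N_nonneg by simp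
  qed
qed

text \<open>For small \<open>w\<close> the translate \<open>K + w\<close> fits into an open
  \<open>U\<close> around \<open>K\<close> whose measure is at most \<open>1 + eta\<close> times
  that of \<open>K\<close>.\<close>

lemma eventually_modular: "eta > 0 \<Longrightarrow> eventually (\<lambda>w. modular w \<le> 1 + eta) (nhds 0)"
proof -
  assume eta: "eta > 0"
  obtain V K where VK: "open V" "compact K" "(0::'g) \<in> V" "V \<subseteq> K" by (rule compact_nbhd)
  have f: "emeasure \<mu> K < \<infinity>" by (rule emeasure_compact[OF VK(2)])
  have "0 < emeasure \<mu> V" using VK by (intro emeasure_open_pos) auto
  also have "\<dots> \<le> emeasure \<mu> K" by (rule emeasure_borel_mono[OF VK(4) borel_compact[OF VK(2)]])
  finally have mK: "measure \<mu> K > 0" unfolding measure_fin[OF f] by simp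
  then have "eta * measure \<mu> K > 0" using eta by simp
  from compact_outer[OF VK(2) this] obtain U where U: "open U" "K \<subseteq> U" "emeasure \<mu> U < \<infinity>" "measure \<mu> U - measure \<mu> K < eta * measure \<mu> K" by metis
  obtain W where W: "open W" "(0::'g) \<in> W" "\<And>w x. w \<in> W \<Longrightarrow> x \<in> K \<Longrightarrow> w + x \<in> U \<and> x + w \<in> U"
    by (rule compact_thicken[OF VK(2) U(1,2)]) blast
  have "modular w \<le> 1 + eta" if w: "w \<in> W" for w
  proof -
    have "{x. x - w \<in> K} \<subseteq> U" using W(3)[OF w] by (metis (no_types, lifting) diff_add_cancel mem_Collect_eq subsetI)
    then have "emeasure \<mu> {x. x - w \<in> K} \<le> emeasure \<mu> U" by (rule emeasure_borel_mono[OF _ borel_open[OF U(1)]])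
    then have "ennreal (modular w) * ennreal (measure \<mu> K) \<le> ennreal (measure \<mu> U)"
      unfolding emeasure_right[OF borel_compact[OF VK(2)]] measure_fin[OF f] measure_fin[OF U(3)] .
    then have "modular w * measure \<mu> K \<le> measure \<mu> U"
      using modular_pos[of w] by (simp add: ennreal_mult[symmetric] less_imp_le)
    also have "\<dots> \<le> (1 + eta) * measure \<mu> K" using U(4) by (simp add: distrib_right)
    finally show ?thesis using mK by simp
  qed
  then show ?thesis using W(1,2) by (auto simp: eventually_nhds)
qed

lemma eventually_minus_nhds_0: "eventually P (nhds (0::'g)) \<Longrightarrow> eventually (\<lambda>w. P (- w)) (nhds 0)"
proof -
  assume "eventually P (nhds (0::'g))"
  moreover have "filterlim uminus (nhds (- 0 :: 'g)) (nhds 0)" by (rule tendsto_uminus_nhds)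
  ultimately show ?thesis by (simp add: filterlim_iff)
qed

lemma eventually_thicken:
  fixes K :: "'g set"
  assumes "compact K" "open U" "K \<subseteq> U"
  shows "eventually (\<lambda>w. \<forall>x\<in>K. w + x \<in> U \<and> x + w \<in> U) (nhds 0)"
proof -
  obtain W where "open W" "(0::'g) \<in> W" "\<And>w x. w \<in> W \<Longrightarrow> x \<in> K \<Longrightarrow> w + x \<in> U \<and> x + w \<in> U"
    by (rule compact_thicken[OF assms]) blast
  then show ?thesis unfolding eventually_nhds by blast
qed

lemma lt_linear: "lt u (\<lambda>x. f x + g x) = (\<lambda>x. lt u f x + lt u g x)" "lt u (\<lambda>x. c * f x) = (\<lambda>x. c * lt u f x)" "lt u (\<lambda>x. f x - g x) = (\<lambda>x. lt u f x - lt u g x)"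
  by (simp_all add: lt_def)

lemma rt_linear: "rt u (\<lambda>x. f x + g x) = (\<lambda>x. rt u f x + rt u g x)" "rt u (\<lambda>x. c * f x) = (\<lambda>x. c * rt u f x)" "rt u (\<lambda>x. f x - g x) = (\<lambda>x. rt u f x - rt u g x)"
  by (simp_all add: rt_def fun_eq_iff algebra_simps)

lemma tendsto_N_isometry:
  assumes f: "f \<in> L1"
    and T: "\<And>w f. f \<in> L1 \<Longrightarrow> T w f \<in> L1" "\<And>w f. f \<in> L1 \<Longrightarrow> N (T w f) = N f"
      "\<And>w f g. T w (\<lambda>x. f x + g x) = (\<lambda>x. T w f x + T w g x)" "\<And>w c f. T w (\<lambda>x. c * f x) = (\<lambda>x. c * T w f x)"
    and base: "\<And>K. compact K \<Longrightarrow> ((\<lambda>w. N (\<lambda>x. T w (ind K) x - ind K x)) \<longlongrightarrow> 0) F"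
  shows "((\<lambda>w. N (\<lambda>x. T w f x - f x)) \<longlongrightarrow> 0) F"
proof (rule tendsto_dense[OF f eventually_True])
  fix w f g assume fg: "f \<in> L1" "g \<in> L1"
  have "(\<lambda>x. T w (\<lambda>x. f x + g x) x - (f x + g x)) = (\<lambda>x. (T w f x - f x) + (T w g x - g x))"
    by (simp add: T(3) fun_eq_iff)
  then show "N (\<lambda>x. T w (\<lambda>x. f x + g x) x - (f x + g x)) \<le> N (\<lambda>x. T w f x - f x) + N (\<lambda>x. T w g x - g x)"
    using N_triangle[OF L1_diff[OF T(1)[OF fg(1)] fg(1)] L1_diff[OF T(1)[OF fg(2)] fg(2)]] by simp
next
  fix w f c
  have "(\<lambda>x. T w (\<lambda>x. c * f x) x - c * f x) = (\<lambda>x. c * (T w f x - f x))"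
    by (simp add: T(4) fun_eq_iff right_diff_distrib)
  then show "N (\<lambda>x. T w (\<lambda>x. c * f x) x - c * f x) \<le> cmod c * N (\<lambda>x. T w f x - f x)" by (simp add: N_cmult)
next
  fix w f assume f: "f \<in> L1"
  show "N (\<lambda>x. T w f x - f x) \<le> 2 * N f"
    using N_triangle[OF T(1)[OF f] L1_cmult[OF f, of "-1"], of w] N_cmult[of "-1" f] T(2)[OF f, of w] by simp
qed (use base N_nonneg in auto)

lemma tendsto_lt: "f \<in> L1 \<Longrightarrow> ((\<lambda>w. N (\<lambda>x. lt w f x - f x)) \<longlongrightarrow> 0) (nhds 0)"
proof (rule tendsto_N_isometry[OF _ lt_L1 N_lt lt_linear(1,2)])
  fix K :: "'g set" assume K: "compact K"
  show "((\<lambda>w. N (\<lambda>x. lt w (ind K) x - ind K x)) \<longlongrightarrow> 0) (nhds 0)"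
  proof (rule tendsto_translate_ind[OF K])
    fix eta :: real assume eta: "eta > 0"
    have i: "integrable \<mu> (indicator K :: 'g \<Rightarrow> real)"
      using emeasure_compact[OF K] borel_compact[OF K] by (simp add: integrable_indicator_iff)
    have "\<exists>r. (\<forall>x. lt w (ind K) x = complex_of_real (r x)) \<and> integrable \<mu> r \<and> (\<forall>x. 0 \<le> r x) \<and>
      (\<forall>x. r x \<le> 1 + eta) \<and> (\<integral>x. r x \<partial>\<mu>) = measure \<mu> K" for w
    proof (intro exI[of _ "\<lambda>x. indicator K (- w + x)"] conjI allI)
      show "integrable \<mu> (\<lambda>x. indicator K (- w + x) :: real)" by (rule integrable_left[OF i])
      show "(\<integral>x. indicator K (- w + x) \<partial>\<mu>) = measure \<mu> K"
        using integral_left[of "indicator K :: _ \<Rightarrow> real" "- w"] borel_compact[OF K] by simp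
    qed (use eta in \<open>auto simp: lt_def indicator_def\<close>)
    then show "eventually (\<lambda>w. \<exists>r. (\<forall>x. lt w (ind K) x = complex_of_real (r x)) \<and> integrable \<mu> r \<and> (\<forall>x. 0 \<le> r x) \<and>
      (\<forall>x. r x \<le> 1 + eta) \<and> (\<integral>x. r x \<partial>\<mu>) = measure \<mu> K) (nhds 0)" by simp
  next
    fix U assume "open U" "K \<subseteq> U"
    from eventually_thicken[OF K this] show "eventually (\<lambda>w. \<forall>x. lt w (ind K) x \<noteq> 0 \<longrightarrow> x \<in> U) (nhds 0)"
    proof eventually_elim
      case (elim w)
      show ?case
      proof (intro allI impI)
        fix x assume "lt w (ind K) x \<noteq> 0"
        then have "- w + x \<in> K" by (simp add: lt_def indicator_def split: if_splits)
        then have "w + (- w + x) \<in> U" using elim by blast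
        then show "x \<in> U" by simp
      qed
    qed
  qed
qed

lemma tendsto_rt: "f \<in> L1 \<Longrightarrow> ((\<lambda>w. N (\<lambda>x. rt w f x - f x)) \<longlongrightarrow> 0) (nhds 0)"
proof (rule tendsto_N_isometry[OF _ rt_L1 N_rt rt_linear(1,2)])
  fix K :: "'g set" assume K: "compact K"
  show "((\<lambda>w. N (\<lambda>x. rt w (ind K) x - ind K x)) \<longlongrightarrow> 0) (nhds 0)"
  proof (rule tendsto_translate_ind[OF K])
    fix eta :: real assume eta: "eta > 0"
    have i: "integrable \<mu> (indicator K :: 'g \<Rightarrow> real)"
      using emeasure_compact[OF K] borel_compact[OF K] by (simp add: integrable_indicator_iff)
    \<comment> \<open>Here the slack \<open>1 + eta\<close> is genuine: the height of the translate
      is \<open>modular (- w)\<close>, which may exceed 1.\<close>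
    show "eventually (\<lambda>w. \<exists>r. (\<forall>x. rt w (ind K) x = complex_of_real (r x)) \<and> integrable \<mu> r \<and> (\<forall>x. 0 \<le> r x) \<and>
      (\<forall>x. r x \<le> 1 + eta) \<and> (\<integral>x. r x \<partial>\<mu>) = measure \<mu> K) (nhds 0)"
      using eventually_minus_nhds_0[OF eventually_modular[OF eta]]
    proof eventually_elim
      case (elim w)
      show ?case
      proof (intro exI[of _ "\<lambda>x. modular (- w) * indicator K (x - w)"] conjI allI)
        show "integrable \<mu> (\<lambda>x. modular (- w) * indicator K (x - w))" using integrable_right[OF i, of w] by simp
        show "(\<integral>x. modular (- w) * indicator K (x - w) \<partial>\<mu>) = measure \<mu> K"
          using integral_right[of "indicator K :: _ \<Rightarrow> real" w] borel_compact[OF K] modular_pos[of w] by (simp add: modular_minus)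
        show "modular (- w) * indicator K (x - w) \<le> 1 + eta" for x
          using elim eta by (simp add: indicator_def)
      qed (use modular_pos[of "- w"] in \<open>auto simp: rt_def indicator_def\<close>)
    qed
  next
    fix U assume "open U" "K \<subseteq> U"
    from eventually_thicken[OF K this] show "eventually (\<lambda>w. \<forall>x. rt w (ind K) x \<noteq> 0 \<longrightarrow> x \<in> U) (nhds 0)"
    proof eventually_elim
      case (elim w)
      show ?case
      proof (intro allI impI)
        fix x assume "rt w (ind K) x \<noteq> 0"
        then have "x - w \<in> K" by (simp add: rt_def indicator_def split: if_splits)
        then have "(x - w) + w \<in> U" using elim by blast
        then show "x \<in> U" by simp
      qed
    qed
  qed
qed

section \<open>Bounded functionals and vector-valued integrals\<close>

text \<open>Defined on functions rather than classes; the bound by \<open>N\<close> forces equal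
  values on functions that agree almost everywhere, see \<open>bdd_lin_cong_AE\<close>.\<close>

definition bdd_lin :: "(('g \<Rightarrow> complex) \<Rightarrow> complex) \<Rightarrow> bool" where
  "bdd_lin w \<longleftrightarrow> (\<forall>f\<in>L1. \<forall>g\<in>L1. w (\<lambda>x. f x + g x) = w f + w g) \<and> (\<forall>c. \<forall>f\<in>L1. w (\<lambda>x. c * f x) = c * w f) \<and>
    (\<exists>C\<ge>0. \<forall>f\<in>L1. norm (w f) \<le> C * N f)"

lemma bdd_linI:
  assumes "\<And>f g. f \<in> L1 \<Longrightarrow> g \<in> L1 \<Longrightarrow> w (\<lambda>x. f x + g x) = w f + w g" "\<And>c f. f \<in> L1 \<Longrightarrow> w (\<lambda>x. c * f x) = c * w f"
    "\<And>f. f \<in> L1 \<Longrightarrow> norm (w f) \<le> C * N f"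
  shows "bdd_lin w"
  unfolding bdd_lin_def
proof (intro conjI exI[of _ "\<bar>C\<bar>"] ballI allI)
  fix f assume f: "f \<in> L1"
  show "norm (w f) \<le> \<bar>C\<bar> * N f" using assms(3)[OF f] mult_right_mono[OF abs_ge_self[of C] N_nonneg[of f]] by linarith
qed (use assms in auto)

lemma bdd_lin_add: "bdd_lin w \<Longrightarrow> f \<in> L1 \<Longrightarrow> g \<in> L1 \<Longrightarrow> w (\<lambda>x. f x + g x) = w f + w g"
  and bdd_lin_cmult: "bdd_lin w \<Longrightarrow> f \<in> L1 \<Longrightarrow> w (\<lambda>x. c * f x) = c * w f"
  by (simp_all add: bdd_lin_def)

lemma bdd_lin_diff: "bdd_lin w \<Longrightarrow> f \<in> L1 \<Longrightarrow> g \<in> L1 \<Longrightarrow> w (\<lambda>x. f x - g x) = w f - w g"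
  using bdd_lin_add[of w f "\<lambda>x. -1 * g x"] bdd_lin_cmult[of w g "-1"] L1_cmult[of g "-1"] by simp

lemma bdd_lin_bound: "bdd_lin w \<Longrightarrow> \<exists>C\<ge>0. \<forall>f\<in>L1. norm (w f) \<le> C * N f"
  by (simp add: bdd_lin_def)

lemma bdd_lin_N0: "bdd_lin w \<Longrightarrow> f \<in> L1 \<Longrightarrow> N f = 0 \<Longrightarrow> w f = 0"
  using bdd_lin_bound[of w] by fastforce

lemma bdd_lin_cong_AE: "bdd_lin w \<Longrightarrow> f \<in> L1 \<Longrightarrow> g \<in> L1 \<Longrightarrow> (AE x in \<mu>. f x = g x) \<Longrightarrow> w f = w g"
  using bdd_lin_N0[of w "\<lambda>x. f x - g x"] N_diff_eq_0_iff[of f g] bdd_lin_diff[of w f g] L1_diff[of f g] by simp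

lemma bdd_lin_tendsto:
  assumes "bdd_lin w" "\<And>i. f i \<in> L1" "g \<in> L1" "((\<lambda>i. N (\<lambda>x. f i x - g x)) \<longlongrightarrow> 0) F"
  shows "((\<lambda>i. w (f i)) \<longlongrightarrow> w g) F"
proof -
  obtain C where C: "\<And>f. f \<in> L1 \<Longrightarrow> norm (w f) \<le> C * N f" using bdd_lin_bound[OF assms(1)] by blast
  have "((\<lambda>i. w (f i) - w g) \<longlongrightarrow> 0) F"
  proof (rule Lim_null_comparison)
    show "\<forall>\<^sub>F i in F. norm (w (f i) - w g) \<le> C * N (\<lambda>x. f i x - g x)"
      using C[OF L1_diff[OF assms(2,3)]] by (simp add: bdd_lin_diff[OF assms(1-3)])
    show "((\<lambda>i. C * N (\<lambda>x. f i x - g x)) \<longlongrightarrow> 0) F" using tendsto_mult_left[OF assms(4), of C] by simp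
  qed
  then show ?thesis by (simp add: LIM_zero_iff)
qed

lemma pairing_bdd_lin: "k \<in> test \<Longrightarrow> bdd_lin (pairing k)"
  by (rule bdd_linI[where C=1]) (auto simp: pairing_add pairing_cmult pairing_bound)

text \<open>
  Functionals are not represented by bounded functions here, since such a representation can fail on
  groups that are not sigma-compact.
\<close>

lemma bdd_lin_weak_integral:
  assumes p: "\<And>v. p v \<in> L1" "\<And>v. N (p v) \<le> B" "\<And>v0. ((\<lambda>v. N (\<lambda>x. p v x - p v0 x)) \<longlongrightarrow> 0) (nhds v0)"
    and T: "\<And>a. a \<in> L1 \<Longrightarrow> T a \<in> L1" "\<And>a k. a \<in> L1 \<Longrightarrow> k \<in> test \<Longrightarrow> pairing k (T a) = (\<integral>v. a v * pairing k (p v) \<partial>\<mu>)"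
    and w: "bdd_lin w" and a: "a \<in> L1"
  shows "w (T a) = (\<integral>v. a v * w (p v) \<partial>\<mu>)" "(\<lambda>v. w (p v)) \<in> borel_measurable borel"
proof -
  have cont: "(\<lambda>v. w' (p v)) \<in> borel_measurable borel" if "bdd_lin w'" for w'
  proof (rule borel_measurable_continuous_onI)
    have "((\<lambda>v. w' (p v)) \<longlongrightarrow> w' (p v0)) (nhds v0)" for v0
      by (rule bdd_lin_tendsto[OF that p(1) p(1) p(3)])
    then show "continuous_on UNIV (\<lambda>v. w' (p v))"
      by (auto simp: continuous_on_def intro: tendsto_mono[OF at_le] filterlim_mono[OF _ order_refl at_within_le_nhds])
  qed
  show "(\<lambda>v. w (p v)) \<in> borel_measurable borel" by (rule cont[OF w])
  have int: "integrable \<mu> (\<lambda>v. a v * w' (p v))" "norm (\<integral>v. a v * w' (p v) \<partial>\<mu>) \<le> C * B * N a"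
    if w': "bdd_lin w'" and a: "a \<in> L1" and C: "\<And>f. f \<in> L1 \<Longrightarrow> norm (w' f) \<le> C * N f" "C \<ge> 0" for w' a C
  proof -
    have b: "norm (a v * w' (p v)) \<le> norm (a v) * (C * B)" for v
      unfolding norm_mult using C(1)[OF p(1)[of v]] mult_left_mono[OF p(2)[of v] C(2)] by (intro mult_left_mono) auto
    have i: "integrable \<mu> (\<lambda>v. norm (a v) * (C * B))" using L1_integrable[OF a] by simp
    show i': "integrable \<mu> (\<lambda>v. a v * w' (p v))"
    proof (rule Bochner_Integration.integrable_bound[OF i])
      show "(\<lambda>v. a v * w' (p v)) \<in> borel_measurable \<mu>" using cont[OF w'] L1_measurable[OF a] by (simp add: measurable_eq)
      show "AE v in \<mu>. norm (a v * w' (p v)) \<le> norm (norm (a v) * (C * B))"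
        using b by (intro AE_I2) (simp add: order_trans[OF b abs_ge_self])
    qed
    have "norm (\<integral>v. a v * w' (p v) \<partial>\<mu>) \<le> (\<integral>v. norm (a v * w' (p v)) \<partial>\<mu>)" by (rule integral_norm_bound)
    also have "\<dots> \<le> (\<integral>v. norm (a v) * (C * B) \<partial>\<mu>)" using i i' b by (intro integral_mono integrable_norm)
    finally show "norm (\<integral>v. a v * w' (p v) \<partial>\<mu>) \<le> C * B * N a" by (simp add: N_def mult_ac)
  qed
  have omC: "norm (pairing k f) \<le> 1 * N f" if "k \<in> test" "f \<in> L1" for k f using pairing_bound[OF that] by simp
  have B0: "B \<ge> 0" using p(2)[of 0] N_nonneg[of "p 0"] by linarith
  obtain C where C: "\<And>f. f \<in> L1 \<Longrightarrow> norm (w f) \<le> C * N f" "C \<ge> 0" using bdd_lin_bound[OF w] by blast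
  note intw = int(1)[OF w _ C]
  \<comment> \<open>\<open>T\<close> is not assumed to be linear. Its weak description determines
    \<open>T a\<close> up to a null set, and \<open>w\<close> does not see more.\<close>
  have Tadd: "w (T (\<lambda>x. a x + b x)) = w (T a) + w (T b)" if a: "a \<in> L1" and b: "b \<in> L1" for a b
  proof -
    have "AE x in \<mu>. T (\<lambda>x. a x + b x) x = T a x + T b x"
    proof (rule pairing_eqI[OF T(1)[OF L1_add[OF a b]] L1_add[OF T(1)[OF a] T(1)[OF b]]])
      fix k assume k: "k \<in> test"
      note i = int(1)[OF pairing_bdd_lin[OF k] _ omC[OF k]]
      show "pairing k (T (\<lambda>x. a x + b x)) = pairing k (\<lambda>x. T a x + T b x)"
        using i[OF a] i[OF b] by (simp add: pairing_add[OF k T(1)[OF a] T(1)[OF b]] T(2)[OF _ k] a b L1_add distrib_right)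
    qed
    from bdd_lin_cong_AE[OF w T(1)[OF L1_add[OF a b]] L1_add[OF T(1)[OF a] T(1)[OF b]] this]
    show ?thesis by (simp add: bdd_lin_add[OF w T(1)[OF a] T(1)[OF b]])
  qed
  have Tcmult: "w (T (\<lambda>x. c * a x)) = c * w (T a)" if a: "a \<in> L1" for c a
  proof -
    have "AE x in \<mu>. T (\<lambda>x. c * a x) x = c * T a x"
    proof (rule pairing_eqI[OF T(1)[OF L1_cmult[OF a]] L1_cmult[OF T(1)[OF a]]])
      fix k assume k: "k \<in> test"
      show "pairing k (T (\<lambda>x. c * a x)) = pairing k (\<lambda>x. c * T a x)"
        by (simp add: pairing_cmult T(2)[OF _ k] a L1_cmult mult.assoc)
    qed
    from bdd_lin_cong_AE[OF w T(1)[OF L1_cmult[OF a]] L1_cmult[OF T(1)[OF a]] this]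
    show ?thesis by (simp add: bdd_lin_cmult[OF w T(1)[OF a]])
  qed
  have TN: "N (T a) \<le> B * N a" if a: "a \<in> L1" for a
  proof (rule N_le_pairing[OF T(1)[OF a]])
    fix k assume k: "k \<in> test"
    show "norm (pairing k (T a)) \<le> B * N a"
      using int(2)[OF pairing_bdd_lin[OF k] a omC[OF k]] by (simp add: T(2)[OF a k])
  qed
  \<comment> \<open>The error of the formula is itself a bounded functional of \<open>a\<close>, so
    by density it is enough to see it vanish on indicators of compact sets.\<close>
  define \<Psi> where "\<Psi> a = w (T a) - (\<integral>v. a v * w (p v) \<partial>\<mu>)" for a
  have \<Psi>: "bdd_lin \<Psi>"
  proof (rule bdd_linI[where C="2 * C * B"])
    show "\<Psi> (\<lambda>x. f x + g x) = \<Psi> f + \<Psi> g" if "f \<in> L1" "g \<in> L1" for f g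
      using intw[OF that(1)] intw[OF that(2)] by (simp add: \<Psi>_def Tadd[OF that] distrib_right)
    show "\<Psi> (\<lambda>x. c * f x) = c * \<Psi> f" if "f \<in> L1" for f c
      by (simp add: \<Psi>_def Tcmult[OF that] mult.assoc right_diff_distrib)
    show "norm (\<Psi> f) \<le> 2 * C * B * N f" if "f \<in> L1" for f
    proof -
      have "norm (w (T f)) \<le> C * (B * N f)" using C(1)[OF T(1)[OF that]] mult_left_mono[OF TN[OF that] C(2)] by linarith
      then show ?thesis using int(2)[OF w that C] norm_triangle_ineq4[of "w (T f)" "\<integral>v. f v * w (p v) \<partial>\<mu>"]
        unfolding \<Psi>_def by (simp add: mult.assoc)
    qed
  qed
  \<comment> \<open>On a set \<open>A\<close> where \<open>p\<close> stays within \<open>e\<close>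
    of \<open>p v0\<close>, both sides of the formula lie within
    \<open>C * e * measure \<mu> A\<close> of \<open>measure \<mu> A * w (p v0)\<close>.\<close>
  have small: "norm (\<Psi> (ind A)) \<le> 2 * C * e * measure \<mu> A"
    if A: "A \<in> sets borel" "emeasure \<mu> A < \<infinity>" and v0: "\<And>v. v \<in> A \<Longrightarrow> N (\<lambda>x. p v x - p v0 x) \<le> e" for A v0 e
  proof -
    have AL: "ind A \<in> L1" by (rule ind_L1[OF A])
    have m: "(\<integral>v. ind A v * c \<partial>\<mu>) = measure \<mu> A * c" for c :: complex
      using integral_ind[OF A] by simp
    have bd: "norm (\<integral>v. ind A v * (w' (p v) - w' (p v0)) \<partial>\<mu>) \<le> D * e * measure \<mu> A"
      if w': "bdd_lin w'" and D: "\<And>f. f \<in> L1 \<Longrightarrow> norm (w' f) \<le> D * N f" "D \<ge> 0" for w' :: "('g \<Rightarrow> complex) \<Rightarrow> complex" and D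
    proof -
      have "norm (\<integral>v. ind A v * (w' (p v) - w' (p v0)) \<partial>\<mu>) \<le> (\<integral>v. norm (ind A v * (w' (p v) - w' (p v0))) \<partial>\<mu>)"
        by (rule integral_norm_bound)
      also have "\<dots> \<le> (\<integral>v. indicator A v * (D * e) \<partial>\<mu>)"
      proof (rule integral_mono)
        have "integrable \<mu> (\<lambda>v. ind A v * w' (p v) - ind A v * w' (p v0))"
          using int(1)[OF w' AL D] L1_integrable[OF AL] by simp
        then show "integrable \<mu> (\<lambda>v. norm (ind A v * (w' (p v) - w' (p v0))))"
          by (intro integrable_norm) (simp add: right_diff_distrib)
        show "integrable \<mu> (\<lambda>v. indicator A v * (D * e) :: real)" using A by (simp add: integrable_indicator_iff)
        show "norm (ind A v * (w' (p v) - w' (p v0))) \<le> indicator A v * (D * e)" for v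
        proof (cases "v \<in> A")
          case True
          have "norm (w' (p v) - w' (p v0)) \<le> D * N (\<lambda>x. p v x - p v0 x)"
            using D(1)[OF L1_diff[OF p(1) p(1)]] by (simp add: bdd_lin_diff[OF w' p(1) p(1)])
          also have "\<dots> \<le> D * e" using v0[OF True] D(2) by (rule mult_left_mono)
          finally show ?thesis using True by simp
        qed simp
      qed
      also have "\<dots> = D * e * measure \<mu> A" using A by simp
      finally show ?thesis .
    qed
    have split: "(\<integral>v. ind A v * (w' (p v) - w' (p v0)) \<partial>\<mu>) = (\<integral>v. ind A v * w' (p v) \<partial>\<mu>) - measure \<mu> A * w' (p v0)"
      if w': "bdd_lin w'" for w' :: "('g \<Rightarrow> complex) \<Rightarrow> complex"
    proof -
      obtain D where D: "\<And>f. f \<in> L1 \<Longrightarrow> norm (w' f) \<le> D * N f" "D \<ge> 0" using bdd_lin_bound[OF w'] by blast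
      show ?thesis unfolding right_diff_distrib m[symmetric]
        by (intro Bochner_Integration.integral_diff int(1)[OF w' AL D] integrable_mult_left L1_integrable[OF AL])
    qed
    have mL: "(\<lambda>x. measure \<mu> A * p v0 x) \<in> L1" by (rule L1_cmult[OF p(1)])
    have "N (\<lambda>x. T (ind A) x - measure \<mu> A * p v0 x) \<le> e * measure \<mu> A"
    proof (rule N_le_pairing[OF L1_diff[OF T(1)[OF AL] mL]])
      fix k assume k: "k \<in> test"
      show "norm (pairing k (\<lambda>x. T (ind A) x - measure \<mu> A * p v0 x)) \<le> e * measure \<mu> A"
        using bd[OF pairing_bdd_lin[OF k] omC[OF k]] by (simp add: pairing_diff[OF k T(1)[OF AL] mL] T(2)[OF AL k] pairing_cmult split[OF pairing_bdd_lin[OF k]])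
    qed
    then have "norm (w (T (ind A)) - measure \<mu> A * w (p v0)) \<le> C * (e * measure \<mu> A)"
      using C(1)[OF L1_diff[OF T(1)[OF AL] mL]] mult_left_mono[OF _ C(2)] order_trans
      unfolding bdd_lin_diff[OF w T(1)[OF AL] mL] bdd_lin_cmult[OF w p(1)] by blast
    moreover have "norm ((\<integral>v. ind A v * w (p v) \<partial>\<mu>) - measure \<mu> A * w (p v0)) \<le> C * e * measure \<mu> A"
      using bd[OF w C] by (simp add: split[OF w])
    ultimately have "norm ((w (T (ind A)) - measure \<mu> A * w (p v0)) - ((\<integral>v. ind A v * w (p v) \<partial>\<mu>) - measure \<mu> A * w (p v0))) \<le> C * (e * measure \<mu> A) + C * e * measure \<mu> A"
      by (rule order_trans[OF norm_triangle_ineq4 add_mono])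
    then show ?thesis by (simp add: \<Psi>_def)
  qed
  have "\<Psi> a = 0"
    using a
  proof (induction rule: L1_dense_induct)
    case (compact K)
    have Kf: "emeasure \<mu> K < \<infinity>" and Kb: "K \<in> sets borel" by (rule emeasure_compact[OF compact], rule borel_compact[OF compact])
    have K2: "norm (\<Psi> (ind K)) \<le> 2 * C * e * measure \<mu> K" if e: "e > 0" for e
    proof -
      have "\<exists>O'. open O' \<and> v0 \<in> O' \<and> (\<forall>v\<in>O'. N (\<lambda>x. p v x - p v0 x) \<le> e)" for v0
        using order_tendstoD(2)[OF p(3)[of v0] e] unfolding eventually_nhds by (metis less_imp_le)
      then obtain O' where O': "\<And>v0. open (O' v0)" "\<And>v0. v0 \<in> O' v0" "\<And>v0 v. v \<in> O' v0 \<Longrightarrow> N (\<lambda>x. p v x - p v0 x) \<le> e" by metis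
      have "K \<subseteq> (\<Union>v0\<in>UNIV. O' v0)" using O'(2) by blast
      then obtain D where D: "finite D" "K \<subseteq> (\<Union>v0\<in>D. O' v0)"
        using compactE_image[OF compact, of UNIV O'] O'(1) by metis
      \<comment> \<open>Splitting off one member of the cover at a time keeps the pieces disjoint,
        so the errors add up to a multiple of the total measure and not of the number of
        pieces.\<close>
      have "norm (\<Psi> (ind A)) \<le> 2 * C * e * measure \<mu> A" if "A \<subseteq> (\<Union>v0\<in>D. O' v0)" "A \<in> sets borel" "emeasure \<mu> A < \<infinity>" for A
        using D(1) that
      proof (induction D arbitrary: A rule: finite_induct)
        case empty
        then have "A = {}" by simp
        then show ?case using bdd_lin_N0[OF \<Psi> L1_zero] by (simp add: N_def)
      next
        case (insert d D)
        have Ob: "O' d \<in> sets borel" using O'(1) by (simp add: borel_open)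
        have sub: "A \<inter> O' d \<in> sets borel" "A - O' d \<in> sets borel" using insert.prems(2) Ob by auto
        have fin: "emeasure \<mu> (A \<inter> O' d) < \<infinity>" "emeasure \<mu> (A - O' d) < \<infinity>"
          using emeasure_borel_mono[of "A \<inter> O' d" A] emeasure_borel_mono[of "A - O' d" A] insert.prems(2,3) by (auto intro: le_less_trans)
        have eq: "ind A = (\<lambda>x. ind (A \<inter> O' d) x + ind (A - O' d) x)" by (auto simp: indicator_def)
        have "\<Psi> (ind A) = \<Psi> (ind (A \<inter> O' d)) + \<Psi> (ind (A - O' d))"
          by (subst eq) (rule bdd_lin_add[OF \<Psi> ind_L1[OF sub(1) fin(1)] ind_L1[OF sub(2) fin(2)]])
        moreover have "norm (\<Psi> (ind (A \<inter> O' d))) \<le> 2 * C * e * measure \<mu> (A \<inter> O' d)"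
          by (rule small[OF sub(1) fin(1), of d]) (use O'(3) in blast)
        moreover have "norm (\<Psi> (ind (A - O' d))) \<le> 2 * C * e * measure \<mu> (A - O' d)"
          using insert.prems(1) by (intro insert.IH sub fin) auto
        moreover have "measure \<mu> A = measure \<mu> (A \<inter> O' d) + measure \<mu> (A - O' d)"
        proof -
          have "measure \<mu> ((A \<inter> O' d) \<union> (A - O' d)) = measure \<mu> (A \<inter> O' d) + measure \<mu> (A - O' d)"
            by (rule measure_Union) (use sub fin in auto)
          then show ?thesis by (simp add: Int_Diff_Un)
        qed
        ultimately show ?case using norm_triangle_ineq[of "\<Psi> (ind (A \<inter> O' d))" "\<Psi> (ind (A - O' d))"] by (simp add: distrib_left)
      qed
      from this[OF D(2) Kb Kf] show ?thesis .
    qed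
    have *: "norm (\<Psi> (ind K)) \<le> e * (2 * C * measure \<mu> K)" if "e > 0" for e using K2[OF that] by (simp add: mult_ac)
    have "((\<lambda>e. e * (2 * C * measure \<mu> K)) \<longlongrightarrow> 0 * (2 * C * measure \<mu> K)) (at_right 0)" by (intro tendsto_intros)
    then have "norm (\<Psi> (ind K)) \<le> 0 * (2 * C * measure \<mu> K)"
      by (rule tendsto_lowerbound) (use * in \<open>auto simp: eventually_at_filter\<close>)
    then show ?case by simp
  next
    case (add f g)
    then show ?case by (simp add: bdd_lin_add[OF \<Psi>])
  next
    case (cmult c f)
    then show ?case by (simp add: bdd_lin_cmult[OF \<Psi>])
  next
    case (closed f)
    obtain D where D: "\<And>f. f \<in> L1 \<Longrightarrow> norm (\<Psi> f) \<le> D * N f" "D \<ge> 0" using bdd_lin_bound[OF \<Psi>] by blast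
    have *: "norm (\<Psi> f) \<le> e * D" if e: "e > 0" for e
    proof -
      obtain g where g: "g \<in> L1" "\<Psi> g = 0" "N (\<lambda>x. f x - g x) < e" using closed.IH[OF e] by blast
      have "norm (\<Psi> f) = norm (\<Psi> (\<lambda>x. f x - g x))" by (simp add: bdd_lin_diff[OF \<Psi> closed.hyps g(1)] g(2))
      also have "\<dots> \<le> D * N (\<lambda>x. f x - g x)" by (rule D(1)[OF L1_diff[OF closed.hyps g(1)]])
      also have "\<dots> \<le> D * e" using g(3) D(2) by (intro mult_left_mono) auto
      finally show ?thesis by (simp add: mult.commute)
    qed
    have "((\<lambda>e. e * D) \<longlongrightarrow> 0 * D) (at_right 0)" by (intro tendsto_intros)
    then have "norm (\<Psi> f) \<le> 0 * D"
      by (rule tendsto_lowerbound) (use * in \<open>auto simp: eventually_at_filter\<close>)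
    then show ?case by simp
  qed
  then show "w (T a) = (\<integral>v. a v * w (p v) \<partial>\<mu>)" by (simp add: \<Psi>_def)
qed

lemma tendsto_shift_0:
  assumes "((\<lambda>w. F (w :: 'g)) \<longlongrightarrow> L) (nhds 0)" shows "((\<lambda>v. F (- v0 + v)) \<longlongrightarrow> L) (nhds v0)"
proof (rule filterlim_compose[OF assms])
  have "((\<lambda>v. - v0 + v) \<longlongrightarrow> - v0 + v0) (nhds v0)" by (intro tendsto_add tendsto_const) (simp add: filterlim_ident)
  then show "filterlim (\<lambda>v. - v0 + v) (nhds 0) (nhds v0)" by simp
qed

lemma tendsto_shift_0':
  assumes "((\<lambda>w. F (w :: 'g)) \<longlongrightarrow> L) (nhds 0)" shows "((\<lambda>v. F (v - v0)) \<longlongrightarrow> L) (nhds v0)"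
proof (rule filterlim_compose[OF assms])
  have "((\<lambda>v. v + - v0) \<longlongrightarrow> v0 + - v0) (nhds v0)" by (intro tendsto_add tendsto_const) (simp add: filterlim_ident)
  then show "filterlim (\<lambda>v. v - v0) (nhds 0) (nhds v0)" by simp
qed

lemma lt_continuous: "f \<in> L1 \<Longrightarrow> ((\<lambda>v. N (\<lambda>x. lt v f x - lt v0 f x)) \<longlongrightarrow> 0) (nhds v0)"
proof -
  assume f: "f \<in> L1"
  have "N (\<lambda>x. lt v f x - lt v0 f x) = N (\<lambda>x. lt (- v0 + v) f x - f x)" for v
  proof -
    have "(\<lambda>x. lt v f x - lt v0 f x) = lt v0 (\<lambda>x. lt (- v0 + v) f x - f x)"
      unfolding lt_linear lt_lt by simp
    then show ?thesis using N_lt[OF L1_diff[OF lt_L1[OF f] f]] by simp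
  qed
  then show ?thesis using tendsto_shift_0[OF tendsto_lt[OF f]] by simp
qed

lemma rt_continuous: "f \<in> L1 \<Longrightarrow> ((\<lambda>v. N (\<lambda>x. rt v f x - rt v0 f x)) \<longlongrightarrow> 0) (nhds v0)"
proof -
  assume f: "f \<in> L1"
  have "N (\<lambda>x. rt v f x - rt v0 f x) = N (\<lambda>x. rt (v - v0) f x - f x)" for v
  proof -
    have "(\<lambda>x. rt v f x - rt v0 f x) = rt v0 (\<lambda>x. rt (v - v0) f x - f x)"
      unfolding rt_linear rt_rt by simp
    then show ?thesis using N_rt[OF L1_diff[OF rt_L1[OF f] f]] by simp
  qed
  then show ?thesis using tendsto_shift_0'[OF tendsto_rt[OF f]] by simp
qed

section \<open>Convolutions as integrals of translates\<close>

lemma bdd_lin_conv_left: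
  assumes w: "bdd_lin w" and a: "a \<in> L1" and y: "y \<in> L1"
  shows "w (conv a y) = (\<integral>v. a v * w (lt v y) \<partial>\<mu>)" "(\<lambda>v. w (lt v y)) \<in> borel_measurable borel"
proof -
  have n: "N (lt v y) \<le> N y" for v by (simp add: N_lt[OF y])
  note * = bdd_lin_weak_integral[where p="\<lambda>v. lt v y" and T="\<lambda>a. conv a y", OF lt_L1[OF y] n lt_continuous[OF y] conv_L1[OF _ y] pairing_conv_left[OF _ y] w a]
  show "w (conv a y) = (\<integral>v. a v * w (lt v y) \<partial>\<mu>)" by (rule *(1))
  show "(\<lambda>v. w (lt v y)) \<in> borel_measurable borel" by (rule *(2))
qed

lemma bdd_lin_conv_right:
  assumes w: "bdd_lin w" and a: "a \<in> L1" and y: "y \<in> L1"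
  shows "w (conv y a) = (\<integral>v. a v * w (rt v y) \<partial>\<mu>)" "(\<lambda>v. w (rt v y)) \<in> borel_measurable borel"
proof -
  have n: "N (rt v y) \<le> N y" for v by (simp add: N_rt[OF y])
  note * = bdd_lin_weak_integral[where p="\<lambda>v. rt v y" and T="\<lambda>a. conv y a", OF rt_L1[OF y] n rt_continuous[OF y] conv_L1[OF y] pairing_conv_right[OF y] w a]
  show "w (conv y a) = (\<integral>v. a v * w (rt v y) \<partial>\<mu>)" by (rule *(1))
  show "(\<lambda>v. w (rt v y)) \<in> borel_measurable borel" by (rule *(2))
qed

lemma integrable_bdd_lin_lt:
  assumes w: "bdd_lin w" and a: "a \<in> L1" and y: "y \<in> L1"
  shows "integrable \<mu> (\<lambda>v. a v * w (lt v y))"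
proof -
  obtain C where C: "\<And>f. f \<in> L1 \<Longrightarrow> norm (w f) \<le> C * N f" using bdd_lin_bound[OF w] by blast
  have i: "integrable \<mu> (\<lambda>v. C * N y * norm (a v))" using L1_integrable[OF a] by simp
  show ?thesis
  proof (rule Bochner_Integration.integrable_bound[OF i])
    show "(\<lambda>v. a v * w (lt v y)) \<in> borel_measurable \<mu>"
      using bdd_lin_conv_left(2)[OF w a y] L1_measurable[OF a] by (simp add: measurable_eq)
    show "AE v in \<mu>. norm (a v * w (lt v y)) \<le> norm (C * N y * norm (a v))"
    proof (intro AE_I2)
      fix v
      have "norm (w (lt v y)) \<le> C * N y" using C[OF lt_L1[OF y]] by (simp add: N_lt[OF y])
      then have "norm (a v) * norm (w (lt v y)) \<le> norm (a v) * (C * N y)" by (intro mult_left_mono) auto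
      also have "\<dots> \<le> norm (C * N y * norm (a v))" by (simp add: mult.commute)
      finally show "norm (a v * w (lt v y)) \<le> norm (C * N y * norm (a v))" by (simp add: norm_mult)
    qed
  qed
qed

lemma bdd_lin_conv_add_left:
  assumes "bdd_lin w" "f \<in> L1" "g \<in> L1" "h \<in> L1"
  shows "w (conv (\<lambda>x. f x + g x) h) = w (conv f h) + w (conv g h)"
  using integrable_bdd_lin_lt[OF assms(1,2,4)] integrable_bdd_lin_lt[OF assms(1,3,4)]
  by (simp add: bdd_lin_conv_left assms L1_add distrib_right)

lemma bdd_lin_conv_cmult_left: "conv (\<lambda>x. c * f x) h = (\<lambda>x. c * conv f h x)"
  by (simp add: convolve_def fun_eq_iff mult.assoc)

lemma bdd_lin_conv_cmult_right: "conv f (\<lambda>x. c * h x) = (\<lambda>x. c * conv f h x)"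
  by (simp add: convolve_def fun_eq_iff mult.left_commute[of _ c])

lemma bdd_lin_conv_add_right:
  assumes w: "bdd_lin w" and f: "f \<in> L1" and g: "g \<in> L1" and h: "h \<in> L1"
  shows "w (conv h (\<lambda>x. f x + g x)) = w (conv h f) + w (conv h g)"
  using integrable_bdd_lin_lt[OF w h f] integrable_bdd_lin_lt[OF w h g]
  by (simp add: bdd_lin_conv_left w f g h L1_add distrib_left lt_linear bdd_lin_add[OF w lt_L1[OF f] lt_L1[OF g]])

lemma bdd_lin_comp_conv:
  assumes w: "bdd_lin w" and h: "h \<in> L1"
  shows "bdd_lin (\<lambda>f. w (conv f h))" "bdd_lin (\<lambda>f. w (conv h f))"
proof -
  obtain C where C: "\<And>f. f \<in> L1 \<Longrightarrow> norm (w f) \<le> C * N f" "C \<ge> 0" using bdd_lin_bound[OF w] by blast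
  have b: "norm (w (conv f g)) \<le> C * (N f * N g)" if "f \<in> L1" "g \<in> L1" for f g
    using C(1)[OF conv_L1[OF that]] mult_left_mono[OF N_conv[OF that] C(2)] by linarith
  show "bdd_lin (\<lambda>f. w (conv f h))"
  proof (rule bdd_linI[where C="C * N h"])
    show "norm (w (conv f h)) \<le> C * N h * N f" if "f \<in> L1" for f using b[OF that h] by (simp add: mult_ac)
  qed (use h in \<open>simp_all add: bdd_lin_conv_add_left[OF w _ _ h] bdd_lin_conv_cmult_left bdd_lin_cmult[OF w conv_L1]\<close>)
  show "bdd_lin (\<lambda>f. w (conv h f))"
  proof (rule bdd_linI[where C="C * N h"])
    show "norm (w (conv h f)) \<le> C * N h * N f" if "f \<in> L1" for f using b[OF h that] by (simp add: mult_ac)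
  qed (use h in \<open>simp_all add: bdd_lin_conv_add_right[OF w _ _ h] bdd_lin_conv_cmult_right bdd_lin_cmult[OF w conv_L1]\<close>)
qed

lemma bdd_lin_comp_lt: assumes w: "bdd_lin w" shows "bdd_lin (\<lambda>f. w (lt u f))"
proof -
  obtain C where C: "\<And>f. f \<in> L1 \<Longrightarrow> norm (w f) \<le> C * N f" using bdd_lin_bound[OF w] by blast
  show ?thesis
  proof (rule bdd_linI)
    show "norm (w (lt u f)) \<le> C * N f" if "f \<in> L1" for f using C[OF lt_L1[OF that]] by (simp add: N_lt[OF that])
  qed (simp_all add: lt_linear bdd_lin_add[OF w] bdd_lin_cmult[OF w] lt_L1)
qed

lemma bdd_lin_comp_rt: assumes w: "bdd_lin w" shows "bdd_lin (\<lambda>f. w (rt u f))"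
proof -
  obtain C where C: "\<And>f. f \<in> L1 \<Longrightarrow> norm (w f) \<le> C * N f" using bdd_lin_bound[OF w] by blast
  show ?thesis
  proof (rule bdd_linI)
    show "norm (w (rt u f)) \<le> C * N f" if "f \<in> L1" for f using C[OF rt_L1[OF that]] by (simp add: N_rt[OF that])
  qed (simp_all add: rt_linear bdd_lin_add[OF w] bdd_lin_cmult[OF w] rt_L1)
qed

text \<open>Convolution by \<open>f\<close> from the left is an average of left translations, and
  these commute with convolution by \<open>h\<close> from the right.\<close>

lemma bdd_lin_conv_assoc:
  assumes w: "bdd_lin w" and f: "f \<in> L1" and g: "g \<in> L1" and h: "h \<in> L1"
  shows "w (conv (conv f g) h) = w (conv f (conv g h))"
proof -
  have "w (conv (conv f g) h) = (\<integral>v. f v * w (conv (lt v g) h) \<partial>\<mu>)"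
    by (rule bdd_lin_conv_left(1)[OF bdd_lin_comp_conv(1)[OF w h] f g])
  also have "\<dots> = (\<integral>v. f v * w (lt v (conv g h)) \<partial>\<mu>)" by (simp only: conv_lt[OF g h])
  also have "\<dots> = w (conv f (conv g h))" by (rule bdd_lin_conv_left(1)[OF w f conv_L1[OF g h], symmetric])
  finally show ?thesis .
qed

section \<open>The approximate identity\<close>

text \<open>A filter in place of a sequence, since the identity need not have a countable base of
  neighbourhoods.\<close>

definition nbhd_filter :: "'g set filter" where
  "nbhd_filter = (INF U\<in>{U. open U \<and> 0 \<in> U}. principal {V. good_nbhd V \<and> V \<subseteq> U})"

lemma eventually_nbhd_filter:
  "eventually P nbhd_filter \<longleftrightarrow> (\<exists>U. open U \<and> 0 \<in> U \<and> (\<forall>V. good_nbhd V \<and> V \<subseteq> U \<longrightarrow> P V))"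
  unfolding nbhd_filter_def
proof (subst eventually_INF_base)
  show "{U :: 'g set. open U \<and> 0 \<in> U} \<noteq> {}" by (auto intro: exI[of _ UNIV])
  fix A B assume "A \<in> {U :: 'g set. open U \<and> 0 \<in> U}" "B \<in> {U :: 'g set. open U \<and> 0 \<in> U}"
  then show "\<exists>x\<in>{U. open U \<and> 0 \<in> U}. principal {V. good_nbhd V \<and> V \<subseteq> x} \<le> inf (principal {V. good_nbhd V \<and> V \<subseteq> A}) (principal {V. good_nbhd V \<and> V \<subseteq> B})"
    by (intro bexI[of _ "A \<inter> B"]) auto
qed (auto simp: eventually_principal)

lemma nbhd_filter_neq_bot: "nbhd_filter \<noteq> bot"
proof
  assume "nbhd_filter = bot"
  then have "eventually (\<lambda>V. False) nbhd_filter" by simp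
  then obtain U where "open U" "0 \<in> U" "\<And>V. good_nbhd V \<Longrightarrow> \<not> V \<subseteq> U" unfolding eventually_nbhd_filter by blast
  then show False using good_nbhd_exists by metis
qed

lemma eventually_good_nbhd: "eventually good_nbhd nbhd_filter"
  unfolding eventually_nbhd_filter by (intro exI[of _ UNIV]) simp

definition approx_one :: "'g set \<Rightarrow> 'g \<Rightarrow> complex" where
  "approx_one V = (\<lambda>x. of_real (1 / measure \<mu> V) * ind V x)"

lemma good_nbhdD:
  assumes "good_nbhd V"
  shows "open V" "0 \<in> V" "- x \<in> V \<longleftrightarrow> x \<in> V" "emeasure \<mu> V < \<infinity>" "V \<in> sets borel" "measure \<mu> V > 0"
proof -
  show V: "open V" "0 \<in> V" "- x \<in> V \<longleftrightarrow> x \<in> V" "emeasure \<mu> V < \<infinity>" "V \<in> sets borel"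
    using assms by (auto simp: good_nbhd_def borel_open)
  have "emeasure \<mu> V > 0" using V by (intro emeasure_open_pos) auto
  then show "measure \<mu> V > 0" unfolding measure_fin[OF V(4)] by simp
qed

lemma approx_one_L1: "good_nbhd V \<Longrightarrow> approx_one V \<in> L1"
  unfolding approx_one_def by (intro L1_cmult ind_L1 good_nbhdD(4,5))

lemma N_approx_one: "good_nbhd V \<Longrightarrow> N (approx_one V) = 1"
  unfolding approx_one_def N_cmult using good_nbhdD[of V] by (simp add: N_ind norm_divide)

lemma pairing_one_lt: "f \<in> L1 \<Longrightarrow> pairing (\<lambda>x. 1) (lt u f) = pairing (\<lambda>x. 1) f"
  unfolding pairing_def lt_def using integral_left[of f "- u"] L1_measurable[of f] by simp

lemma pairing_one_conv: "f \<in> L1 \<Longrightarrow> g \<in> L1 \<Longrightarrow> pairing (\<lambda>x. 1) (conv f g) = pairing (\<lambda>x. 1) f * pairing (\<lambda>x. 1) g"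
  by (simp add: pairing_conv_left[OF _ _ one_test] pairing_one_lt) (simp add: pairing_def)

lemma pairing_one_approx_one: "good_nbhd V \<Longrightarrow> pairing (\<lambda>x. 1) (approx_one V) = 1"
  using good_nbhdD[of V] integral_ind[of V] by (simp add: approx_one_def pairing_def)

lemma pairing_one_ind: "compact K \<Longrightarrow> pairing (\<lambda>x. 1) (ind K) = of_real (measure \<mu> K)"
  using integral_ind[OF borel_compact emeasure_compact, of K] by (simp add: pairing_def)

lemma conv_approx_one_ind:
  assumes V: "good_nbhd V" and K: "compact K"
  defines "r \<equiv> \<lambda>x. measure \<mu> {y. y \<in> V \<and> - y + x \<in> K} / measure \<mu> V"
  shows "conv (approx_one V) (ind K) x = of_real (r x)" "0 \<le> r x" "r x \<le> 1"
proof -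
  note V' = good_nbhdD[OF V]
  have b: "{y. - y + x \<in> A} \<in> sets borel" if "A \<in> sets borel" for A :: "'g set" and x by (rule vimage_borel[OF continuous_reflect that])
  have b1: "{y. y \<in> A \<and> - y + x \<in> B} \<in> sets borel" if "A \<in> sets borel" "B \<in> sets borel" for A B :: "'g set" and x
    using sets.Int[OF that(1) b[OF that(2), of x]] by (simp add: Int_def)
  have fV: "emeasure \<mu> {y. y \<in> V \<and> - y + x \<in> B} < \<infinity>" for B
    by (rule le_less_trans[OF emeasure_borel_mono[OF _ V'(5)] V'(4)]) auto
  have "conv (approx_one V) (ind K) x = (\<integral>y. of_real (1 / measure \<mu> V) * ind {y. y \<in> V \<and> - y + x \<in> K} y \<partial>\<mu>)"
    unfolding convolve_def approx_one_def by (intro Bochner_Integration.integral_cong) (auto simp: indicator_def)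
  also have "\<dots> = of_real (r x)" using integral_ind[OF b1[OF V'(5) borel_compact[OF K]] fV] by (simp add: r_def)
  finally show "conv (approx_one V) (ind K) x = of_real (r x)" .
  show "0 \<le> r x" by (simp add: r_def)
  have "measure \<mu> {y. y \<in> V \<and> - y + x \<in> K} \<le> measure \<mu> V"
    by (rule measure_mono_fmeasurable) (use V' b1[OF V'(5) borel_compact[OF K]] in \<open>auto simp: fmeasurable_def\<close>)
  then show "r x \<le> 1" using V'(6) by (simp add: r_def)
qed

lemma conv_nonzeroD: "conv f g x \<noteq> 0 \<Longrightarrow> \<exists>y. f y \<noteq> 0 \<and> g (- y + x) \<noteq> 0"
proof (rule ccontr)
  assume "conv f g x \<noteq> 0" "\<not> (\<exists>y. f y \<noteq> 0 \<and> g (- y + x) \<noteq> 0)"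
  then have "(\<lambda>y. f y * g (- y + x)) = (\<lambda>y. 0)" by auto
  with \<open>conv f g x \<noteq> 0\<close> show False by (simp add: convolve_def)
qed

lemma eventually_nbhd_filterI:
  assumes "eventually P (nhds (0::'g))" "\<And>V. good_nbhd V \<Longrightarrow> (\<And>x. x \<in> V \<Longrightarrow> P x) \<Longrightarrow> Q V"
  shows "eventually Q nbhd_filter"
proof -
  obtain U where U: "open U" "0 \<in> U" "\<And>x. x \<in> U \<Longrightarrow> P x" using assms(1) unfolding eventually_nhds by blast
  show ?thesis unfolding eventually_nbhd_filter
    by (intro exI[of _ U] conjI U(1,2) allI impI assms(2)) (use U(3) in auto)
qed

text \<open>For the indicator of a compact set the average keeps the mass, because integration is
  multiplicative on convolutions, and its values are proportions of \<open>V\<close>, hence at most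
  1; so \<open>tendsto_translate_ind\<close> applies. The unit norm of \<open>approx_one V\<close>
  gives the uniform bound for the extension to \<open>L1\<close>.\<close>

lemma tendsto_approx_one_left:
  assumes f: "f \<in> L1"
  shows "((\<lambda>V. N (\<lambda>x. conv (approx_one V) f x - f x)) \<longlongrightarrow> 0) nbhd_filter"
proof -
  have int_r: "integrable \<mu> r \<and> (\<integral>x. r x \<partial>\<mu>) = measure \<mu> K"
    if "g \<in> L1" "\<And>x. g x = complex_of_real (r x)" "pairing (\<lambda>x. 1) g = of_real (measure \<mu> K)" for g r K
  proof -
    have "integrable \<mu> (\<lambda>x. Re (g x))" using L1_integrable[OF that(1)] by simp
    then have i: "integrable \<mu> r" by (simp add: that(2))
    have "complex_of_real (\<integral>x. r x \<partial>\<mu>) = pairing (\<lambda>x. 1) g" by (simp add: pairing_def that(2))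
    then show ?thesis using i by (simp add: that(3))
  qed
  have base: "((\<lambda>V. N (\<lambda>x. conv (approx_one V) (ind K) x - ind K x)) \<longlongrightarrow> 0) nbhd_filter" if K: "compact K" for K
  proof -
    note KL = ind_compact_L1[OF K]
    show ?thesis
    proof (rule tendsto_translate_ind[OF K])
      fix eta :: real assume eta: "eta > 0"
      show "eventually (\<lambda>V. \<exists>r. (\<forall>x. conv (approx_one V) (ind K) x = complex_of_real (r x)) \<and> integrable \<mu> r \<and> (\<forall>x. 0 \<le> r x) \<and>
        (\<forall>x. r x \<le> 1 + eta) \<and> (\<integral>x. r x \<partial>\<mu>) = measure \<mu> K) nbhd_filter"
        using eventually_good_nbhd
      proof eventually_elim
        case (elim V)
        note c = conv_approx_one_ind[OF elim K]
        have oc: "pairing (\<lambda>x. 1) (conv (approx_one V) (ind K)) = of_real (measure \<mu> K)"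
          by (simp add: pairing_one_conv[OF approx_one_L1[OF elim] KL] pairing_one_approx_one[OF elim] pairing_one_ind[OF K])
        note ir = int_r[OF conv_L1[OF approx_one_L1[OF elim] KL] c(1) oc]
        show ?case
        proof (intro exI[of _ "\<lambda>x. measure \<mu> {y. y \<in> V \<and> - y + x \<in> K} / measure \<mu> V"] conjI allI)
          show "measure \<mu> {y. y \<in> V \<and> - y + x \<in> K} / measure \<mu> V \<le> 1 + eta" for x
            using c(3)[of x] eta by linarith
        qed (use ir in \<open>simp_all only: c(1) c(2)\<close>)
      qed
    next
      fix U assume "open U" "K \<subseteq> U"
      from eventually_thicken[OF K this] show "eventually (\<lambda>V. \<forall>x. conv (approx_one V) (ind K) x \<noteq> 0 \<longrightarrow> x \<in> U) nbhd_filter"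
      proof (rule eventually_nbhd_filterI, intro allI impI)
        fix V x assume V: "good_nbhd V" "\<And>w. w \<in> V \<Longrightarrow> \<forall>x\<in>K. w + x \<in> U \<and> x + w \<in> U" and "conv (approx_one V) (ind K) x \<noteq> 0"
        then obtain y where "approx_one V y \<noteq> 0" "ind K (- y + x) \<noteq> 0" using conv_nonzeroD by blast
        then have "y \<in> V" "- y + x \<in> K" by (auto simp: approx_one_def indicator_def split: if_splits)
        then have "y + (- y + x) \<in> U" using V(2) by blast
        then show "x \<in> U" by simp
      qed
    qed
  qed
  show ?thesis
  proof (rule tendsto_dense[OF f eventually_good_nbhd])
    fix V f h assume V: "good_nbhd V" and fh: "f \<in> L1" "h \<in> L1"
    \<comment> \<open>Additivity is claimed almost everywhere only: where one of the integrals
      diverges, its default value \<open>0\<close> can spoil it.\<close>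
    have "AE x in \<mu>. conv (approx_one V) (\<lambda>x. f x + h x) x = conv (approx_one V) f x + conv (approx_one V) h x"
      by (rule pairing_eqI; simp add: L1_add conv_L1 approx_one_L1 V fh pairing_add pairing_bdd_lin bdd_lin_conv_add_right)
    then have "N (\<lambda>x. conv (approx_one V) (\<lambda>x. f x + h x) x - (f x + h x)) = N (\<lambda>x. (conv (approx_one V) f x - f x) + (conv (approx_one V) h x - h x))"
      by (intro N_cong_AE L1_diff L1_add conv_L1 approx_one_L1 V fh) auto
    also have "\<dots> \<le> N (\<lambda>x. conv (approx_one V) f x - f x) + N (\<lambda>x. conv (approx_one V) h x - h x)"
      by (intro N_triangle L1_diff conv_L1 approx_one_L1 V fh)
    finally show "N (\<lambda>x. conv (approx_one V) (\<lambda>x. f x + h x) x - (f x + h x)) \<le>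
        N (\<lambda>x. conv (approx_one V) f x - f x) + N (\<lambda>x. conv (approx_one V) h x - h x)" .
  next
    fix V f c
    have "(\<lambda>x. conv (approx_one V) (\<lambda>x. c * f x) x - c * f x) = (\<lambda>x. c * (conv (approx_one V) f x - f x))"
      by (simp add: bdd_lin_conv_cmult_right fun_eq_iff right_diff_distrib)
    then show "N (\<lambda>x. conv (approx_one V) (\<lambda>x. c * f x) x - c * f x) \<le> cmod c * N (\<lambda>x. conv (approx_one V) f x - f x)"
      by (simp add: N_cmult)
  next
    fix V f assume V: "good_nbhd V" and f: "f \<in> L1"
    show "N (\<lambda>x. conv (approx_one V) f x - f x) \<le> 2 * N f"
      using N_triangle[OF conv_L1[OF approx_one_L1[OF V] f] L1_cmult[OF f, of "-1"]] N_cmult[of "-1" f]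
        N_conv[OF approx_one_L1[OF V] f] N_approx_one[OF V] by simp
  qed (use base N_nonneg in auto)
qed

section \<open>Series in L^1\<close>

lemma L1_series:
  assumes f: "\<And>n::nat. f n \<in> L1" and s: "summable (\<lambda>n. N (f n))"
  obtains z where "z \<in> L1" "(\<lambda>n. N (\<lambda>x. (\<Sum>i<n. f i x) - z x)) \<longlonglongrightarrow> 0"
proof -
  have [measurable]: "f n \<in> borel_measurable borel" for n by (rule L1_measurable[OF f])
  have fm: "f n \<in> borel_measurable \<mu>" for n by (simp add: measurable_eq)
  have "(\<integral>\<^sup>+x. (\<Sum>n. ennreal (norm (f n x))) \<partial>\<mu>) = (\<Sum>n. ennreal (N (f n)))"
    by (subst nn_integral_suminf) (use fm in \<open>simp_all add: L1_nn[OF f]\<close>)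
  also have "\<dots> \<noteq> \<infinity>" using s by (simp add: suminf_ennreal_eq[OF N_nonneg summable_sums[OF s]])
  finally have fin: "(\<integral>\<^sup>+x. (\<Sum>n. ennreal (norm (f n x))) \<partial>\<mu>) \<noteq> \<infinity>" .
  have "(\<lambda>x. \<Sum>n. ennreal (norm (f n x))) \<in> borel_measurable \<mu>"
    by (rule borel_measurable_suminf_order) (use fm in measurable)
  from nn_integral_PInf_AE[OF this fin] have "AE x in \<mu>. (\<Sum>n. ennreal (norm (f n x))) \<noteq> \<infinity>" .
  then have ae: "AE x in \<mu>. summable (\<lambda>n. norm (f n x))"
  proof eventually_elim
    case (elim x)
    then show ?case by (intro summable_suminf_not_top) simp_all
  qed
  have i: "integrable \<mu> (\<lambda>x. \<Sum>n. f n x)" "integrable \<mu> (\<lambda>x. \<Sum>n. norm (f n x))"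
    by (intro integrable_suminf; use f ae s in \<open>simp add: L1_def N_def\<close>)+
  have "(\<lambda>n. \<integral>x. norm ((\<Sum>i<n. f i x) - (\<Sum>n. f n x)) \<partial>\<mu>) \<longlonglongrightarrow> (\<integral>x. 0 \<partial>\<mu>)"
  proof (rule integral_dominated_convergence[where w="\<lambda>x. 2 * (\<Sum>n. norm (f n x))"])
    show "integrable \<mu> (\<lambda>x. 2 * (\<Sum>n. norm (f n x)))" using i(2) by simp
    show "AE x in \<mu>. (\<lambda>n. norm ((\<Sum>i<n. f i x) - (\<Sum>n. f n x))) \<longlonglongrightarrow> 0"
      using ae
    proof eventually_elim
      case (elim x)
      have "(\<lambda>n. \<Sum>i<n. f i x) \<longlonglongrightarrow> (\<Sum>n. f n x)" using summable_norm_cancel[OF elim] by (rule summable_LIMSEQ)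
      then show ?case by (intro tendsto_norm_zero) (simp add: LIM_zero_iff)
    qed
    show "AE x in \<mu>. norm (norm ((\<Sum>i<n. f i x) - (\<Sum>n. f n x))) \<le> 2 * (\<Sum>n. norm (f n x))" for n
      using ae
    proof eventually_elim
      case (elim x)
      have "norm (\<Sum>i<n. f i x) \<le> (\<Sum>i<n. norm (f i x))" by (rule norm_sum)
      also have "\<dots> \<le> (\<Sum>n. norm (f n x))" by (rule sum_le_suminf[OF elim]) auto
      finally show ?case
        using summable_norm[OF elim] norm_triangle_ineq4[of "\<Sum>i<n. f i x" "\<Sum>n. f n x"] by simp
    qed
  qed (use i fm in \<open>auto intro!: borel_measurable_norm borel_measurable_diff borel_measurable_sum\<close>)
  then show thesis using that[of "\<lambda>x. \<Sum>n. f n x"] i(1) by (simp add: L1_def N_def)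
qed

lemma L1_sum: "(\<And>i::nat. f i \<in> L1) \<Longrightarrow> (\<lambda>x. \<Sum>i<n. f i x) \<in> L1"
  by (auto simp: L1_def)

lemma bdd_lin_sum: "bdd_lin w \<Longrightarrow> (\<And>i::nat. f i \<in> L1) \<Longrightarrow> w (\<lambda>x. \<Sum>i<n. f i x) = (\<Sum>i<n. w (f i))"
proof (induction n)
  case 0
  then show ?case using bdd_lin_cmult[of w "\<lambda>x. 0" 0] L1_zero by simp
next
  case (Suc n)
  then show ?case using bdd_lin_add[OF Suc.prems(1) L1_sum[OF Suc.prems(2)] Suc.prems(2)] by simp
qed

text \<open>One element that represents the series for every bounded functional at once. The series
  is formed along an enumeration of the integers, and absolute summability turns the result into an
  unordered sum.\<close>

lemma int_series:
  fixes c :: "int \<Rightarrow> complex"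
  assumes c: "(\<lambda>m. norm (c m)) summable_on UNIV" and a: "\<And>m. a m \<in> L1" "\<And>m. N (a m) \<le> M"
  obtains z where "z \<in> L1" "\<And>w. bdd_lin w \<Longrightarrow> w z = (\<Sum>\<^sub>\<infinity>m. c m * w (a m))"
proof -
  let ?f = "\<lambda>n x. c (int_decode n) * a (int_decode n) x"
  have bij: "bij_betw int_decode UNIV UNIV" by (rule bij_int_decode)
  have fL: "?f n \<in> L1" for n by (rule L1_cmult[OF a(1)])
  have "(\<lambda>n. norm (c (int_decode n))) summable_on UNIV"
    using c summable_on_reindex_bij_betw[OF bij, of "\<lambda>m. norm (c m)"] by simp
  then have sc: "summable (\<lambda>n. norm (c (int_decode n)))" by (rule summable_on_imp_summable)
  have M0: "M \<ge> 0" using a(2)[of 0] N_nonneg[of "a 0"] by linarith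
  have "summable (\<lambda>n. N (?f n))"
  proof (rule summable_comparison_test'[OF summable_mult2[OF sc, of M], of 0])
    show "norm (N (?f n)) \<le> norm (c (int_decode n)) * M" for n
      using a(2) N_nonneg by (simp add: N_cmult mult_left_mono)
  qed
  from L1_series[of ?f, OF fL this] obtain z where z: "z \<in> L1" "(\<lambda>n. N (\<lambda>x. (\<Sum>i<n. ?f i x) - z x)) \<longlonglongrightarrow> 0" by blast
  have "w z = (\<Sum>\<^sub>\<infinity>m. c m * w (a m))" if w: "bdd_lin w" for w
  proof -
    obtain C where C: "\<And>f. f \<in> L1 \<Longrightarrow> norm (w f) \<le> C * N f" "C \<ge> 0" using bdd_lin_bound[OF w] by blast
    have "(\<lambda>n. w (\<lambda>x. \<Sum>i<n. ?f i x)) \<longlonglongrightarrow> w z"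
      by (rule bdd_lin_tendsto[OF w L1_sum[OF fL] z])
    also have "(\<lambda>n. w (\<lambda>x. \<Sum>i<n. ?f i x)) = (\<lambda>n. \<Sum>i<n. c (int_decode i) * w (a (int_decode i)))"
      by (simp only: bdd_lin_sum[OF w fL] bdd_lin_cmult[OF w a(1)])
    finally have s1: "(\<lambda>n. c (int_decode n) * w (a (int_decode n))) sums w z" by (simp add: sums_def)
    have "summable (\<lambda>n. norm (c (int_decode n) * w (a (int_decode n))))"
    proof (rule summable_comparison_test'[OF summable_mult2[OF sc, of "C * M"], of 0])
      fix n
      have "norm (w (a (int_decode n))) \<le> C * M"
        using C(1)[OF a(1)] mult_left_mono[OF a(2) C(2)] order_trans by blast
      then show "norm (norm (c (int_decode n) * w (a (int_decode n)))) \<le> norm (c (int_decode n)) * (C * M)"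
        by (simp add: norm_mult mult_left_mono)
    qed
    from norm_summable_imp_has_sum[OF this s1]
    have "((\<lambda>n. c (int_decode n) * w (a (int_decode n))) has_sum w z) UNIV" .
    then have "((\<lambda>m. c m * w (a m)) has_sum w z) UNIV"
      using has_sum_reindex_bij_betw[OF bij, of "\<lambda>m. c m * w (a m)"] by simp
    then show ?thesis by (simp add: infsumI)
  qed
  then show thesis using that z(1) by blast
qed

section \<open>Forms vanishing on commuting pairs\<close>

definition bdd_bilin :: "(('g \<Rightarrow> complex) \<Rightarrow> ('g \<Rightarrow> complex) \<Rightarrow> complex) \<Rightarrow> real \<Rightarrow> bool" where
  "bdd_bilin \<beta> C \<longleftrightarrow> (\<forall>h\<in>L1. bdd_lin (\<lambda>f. \<beta> f h)) \<and> (\<forall>f\<in>L1. bdd_lin (\<lambda>h. \<beta> f h)) \<and> C \<ge> 0 \<and> (\<forall>f\<in>L1. \<forall>h\<in>L1. norm (\<beta> f h) \<le> C * N f * N h)"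

lemma bdd_bilin_left: "bdd_bilin \<beta> C \<Longrightarrow> h \<in> L1 \<Longrightarrow> bdd_lin (\<lambda>f. \<beta> f h)"
  and bdd_bilin_right: "bdd_bilin \<beta> C \<Longrightarrow> f \<in> L1 \<Longrightarrow> bdd_lin (\<lambda>h. \<beta> f h)"
  and bdd_bilin_bound: "bdd_bilin \<beta> C \<Longrightarrow> f \<in> L1 \<Longrightarrow> h \<in> L1 \<Longrightarrow> norm (\<beta> f h) \<le> C * N f * N h"
  and bdd_bilin_nonneg: "bdd_bilin \<beta> C \<Longrightarrow> C \<ge> 0"
  by (simp_all add: bdd_bilin_def)

text \<open>The integer powers of \<open>u\<close> in additive notation, formed by iterated left
  translation; all of them lie in one commutative subgroup, whence \<open>zpow_add\<close>.\<close>

definition zpow :: "'g \<Rightarrow> int \<Rightarrow> 'g" where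
  "zpow u m = (if m \<ge> 0 then ((\<lambda>x. u + x) ^^ nat m) 0 else ((\<lambda>x. - u + x) ^^ nat (- m)) 0)"

lemma zpow_0 [simp]: "zpow u 0 = 0" and zpow_1 [simp]: "zpow u 1 = u"
  by (simp_all add: zpow_def)

lemma zpow_succ: "zpow u (m + 1) = u + zpow u m"
proof (cases "m \<ge> 0")
  case True
  then have "nat (m + 1) = Suc (nat m)" by simp
  then show ?thesis using True by (simp add: zpow_def)
next
  case False
  then have n: "nat (- m) = Suc (nat (- (m + 1)))" by simp
  show ?thesis
  proof (cases "m + 1 = 0")
    case True
    then have "m = -1" by simp
    then show ?thesis by (simp add: zpow_def)
  next
    case F: False
    then have "\<not> m + 1 \<ge> 0" using False by simp
    then have "zpow u (m + 1) = ((\<lambda>x. - u + x) ^^ nat (- (m + 1))) 0" unfolding zpow_def by (simp only: if_False)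
    moreover have "zpow u m = - u + ((\<lambda>x. - u + x) ^^ nat (- (m + 1))) 0"
      unfolding zpow_def n using False by simp
    ultimately show ?thesis by (simp add: add.assoc[symmetric])
  qed
qed

lemma zpow_add: "zpow u (m + n) = zpow u m + zpow u n"
proof (induction m rule: int_induct[where k=0])
  case base then show ?case by simp
next
  case (step1 i)
  have "zpow u (i + 1 + n) = zpow u ((i + n) + 1)" by (simp add: ac_simps)
  also have "\<dots> = u + (zpow u i + zpow u n)" unfolding zpow_succ step1.IH ..
  finally show ?case unfolding zpow_succ add.assoc .
next
  case (step2 i)
  have 1: "zpow u (i + n) = u + zpow u (i - 1 + n)" using zpow_succ[of u "i - 1 + n"] by (simp add: algebra_simps)
  have 2: "zpow u i = u + zpow u (i - 1)" using zpow_succ[of u "i - 1"] by simp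
  have "u + zpow u (i - 1 + n) = u + (zpow u (i - 1) + zpow u n)"
    using step2.IH unfolding 1 2 by (simp only: add.assoc)
  then show ?case by simp
qed

lemma conv_zeroI: "f \<in> L1 \<Longrightarrow> g \<in> L1 \<Longrightarrow> (\<And>k. k \<in> test \<Longrightarrow> pairing k (conv f g) = 0) \<Longrightarrow> AE x in \<mu>. conv f g x = 0"
  by (rule pairing_eqI[where g="\<lambda>x. 0"]) (simp_all add: conv_L1 L1_zero pairing_def)

lemma bdd_lin_zero_AE: "bdd_lin w \<Longrightarrow> f \<in> L1 \<Longrightarrow> (AE x in \<mu>. f x = 0) \<Longrightarrow> w f = 0"
  by (rule bdd_lin_N0) (simp_all add: N_eq_0_iff)

definition comm_zero :: "(('g \<Rightarrow> complex) \<Rightarrow> ('g \<Rightarrow> complex) \<Rightarrow> complex) \<Rightarrow> bool" where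
  "comm_zero \<phi> \<longleftrightarrow> (\<forall>a\<in>L1. \<forall>b\<in>L1. (AE x in \<mu>. conv a b x = conv b a x) \<longrightarrow> \<phi> a b = 0)"

lemma comm_zero_product:
  assumes \<phi>: "bdd_bilin \<phi> C" "comm_zero \<phi>" and x: "x \<in> L1" and y: "y \<in> L1" and xy: "AE t in \<mu>. conv x y t = 0"
  shows "\<phi> (lt u x) y = \<phi> x (rt u y)"
proof -
  \<comment> \<open>The translates are put on the outer sides of the pair. In \<open>a * b\<close>
    they surround \<open>x * y\<close>, which is zero; in \<open>b * a\<close> they meet in the
    middle, between \<open>y\<close> and \<open>x\<close>.\<close>
  define Q where "Q m q = \<phi> (lt (zpow u m) x) (rt (zpow u q) y)" for m q
  have "Q 1 0 = Q 0 1"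
  proof (rule synthesis[where B="C * N x * N y"])
    show "norm (Q m q) \<le> C * N x * N y" for m q
      unfolding Q_def using bdd_bilin_bound[OF \<phi>(1) lt_L1[OF x] rt_L1[OF y]] by (simp add: N_lt[OF x] N_rt[OF y])
    fix f g :: "int \<Rightarrow> complex"
    assume f: "(\<lambda>m. norm (f m)) summable_on UNIV" and g: "(\<lambda>m. norm (g m)) summable_on UNIV"
      and fg: "\<And>h :: int \<Rightarrow> complex. bounded (range h) \<Longrightarrow> (\<Sum>\<^sub>\<infinity>m. f m * (\<Sum>\<^sub>\<infinity>n. g n * h (m + n))) = 0"
    have Nx: "N (lt (zpow u m) x) \<le> N x" and Ny: "N (rt (zpow u m) y) \<le> N y" for m by (simp_all add: N_lt[OF x] N_rt[OF y])
    obtain a where a: "a \<in> L1" "\<And>w. bdd_lin w \<Longrightarrow> w a = (\<Sum>\<^sub>\<infinity>m. f m * w (lt (zpow u m) x))"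
      by (rule int_series[OF f lt_L1[OF x] Nx]) (rule that; assumption)
    obtain b where b: "b \<in> L1" "\<And>w. bdd_lin w \<Longrightarrow> w b = (\<Sum>\<^sub>\<infinity>m. g m * w (rt (zpow u m) y))"
      by (rule int_series[OF g rt_L1[OF y] Ny]) (rule that; assumption)
    have ab: "AE t in \<mu>. conv a b t = 0"
    proof (rule conv_zeroI[OF a(1) b(1)])
      fix k assume k: "k \<in> test"
      note w = pairing_bdd_lin[OF k]
      have z: "pairing k (conv (lt (zpow u m) x) (rt (zpow u q) y)) = 0" for m q
      proof -
        have "pairing k (lt (zpow u m) (rt (zpow u q) (conv x y))) = 0"
          by (rule bdd_lin_zero_AE[OF bdd_lin_comp_rt[OF bdd_lin_comp_lt[OF w]] conv_L1[OF x y] xy])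
        then show ?thesis by (simp only: conv_rt conv_lt[OF x y] lt_rt)
      qed
      have "pairing k (conv a b) = (\<Sum>\<^sub>\<infinity>m. f m * pairing k (conv (lt (zpow u m) x) b))" by (rule a(2)[OF bdd_lin_comp_conv(1)[OF w b(1)]])
      also have "\<dots> = (\<Sum>\<^sub>\<infinity>m. f m * (\<Sum>\<^sub>\<infinity>q. g q * pairing k (conv (lt (zpow u m) x) (rt (zpow u q) y))))"
        by (simp only: b(2)[OF bdd_lin_comp_conv(2)[OF w lt_L1[OF x]]])
      finally show "pairing k (conv a b) = 0" by (simp add: z)
    qed
    have ba: "AE t in \<mu>. conv b a t = 0"
    proof (rule conv_zeroI[OF b(1) a(1)])
      fix k assume k: "k \<in> test"
      note w = pairing_bdd_lin[OF k]
      have "pairing k (conv b a) = (\<Sum>\<^sub>\<infinity>m. f m * pairing k (conv b (lt (zpow u m) x)))" by (rule a(2)[OF bdd_lin_comp_conv(2)[OF w b(1)]])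
      also have "\<dots> = (\<Sum>\<^sub>\<infinity>m. f m * (\<Sum>\<^sub>\<infinity>q. g q * pairing k (conv (rt (zpow u q) y) (lt (zpow u m) x))))"
        by (simp only: b(2)[OF bdd_lin_comp_conv(1)[OF w lt_L1[OF x]]])
      also have "\<dots> = (\<Sum>\<^sub>\<infinity>m. f m * (\<Sum>\<^sub>\<infinity>q. g q * pairing k (conv y (lt (zpow u (m + q)) x))))"
        by (simp only: conv_rt_lt[OF y lt_L1[OF x]] lt_lt zpow_add[symmetric] add.commute)
      \<comment> \<open>The remaining family depends on \<open>m + q\<close> alone and is bounded,
        so it is an admissible test for \<open>f * g = 0\<close>.\<close>
      also have "\<dots> = 0"
      proof (rule fg)
        have "norm (pairing k (conv y (lt (zpow u j) x))) \<le> N y * N x" for j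
          using pairing_bound[OF k conv_L1[OF y lt_L1[OF x]], of "zpow u j"] N_conv[OF y lt_L1[OF x], of "zpow u j"] by (simp add: N_lt[OF x])
        then show "bounded (range (\<lambda>j. pairing k (conv y (lt (zpow u j) x))))" by (auto simp: bounded_iff)
      qed
      finally show "pairing k (conv b a) = 0" .
    qed
    have ab_ba: "AE x in \<mu>. conv a b x = conv b a x" using ab ba by eventually_elim simp
    have "\<phi> a b = 0" using \<phi>(2) a(1) b(1) ab_ba unfolding comm_zero_def by blast
    moreover have "\<phi> a b = (\<Sum>\<^sub>\<infinity>m. f m * \<phi> (lt (zpow u m) x) b)" by (rule a(2)[OF bdd_bilin_left[OF \<phi>(1) b(1)]])
    moreover have "\<dots> = (\<Sum>\<^sub>\<infinity>m. f m * (\<Sum>\<^sub>\<infinity>n. g n * Q m n))"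
      by (simp only: Q_def b(2)[OF bdd_bilin_right[OF \<phi>(1) lt_L1[OF x]]])
    ultimately show "(\<Sum>\<^sub>\<infinity>m. f m * (\<Sum>\<^sub>\<infinity>n. g n * Q m n)) = 0" by simp
  qed
  then show ?thesis by (simp add: Q_def)
qed

definition defect :: "(('g \<Rightarrow> complex) \<Rightarrow> ('g \<Rightarrow> complex) \<Rightarrow> complex) \<Rightarrow> 'g \<Rightarrow> ('g \<Rightarrow> complex) \<Rightarrow> ('g \<Rightarrow> complex) \<Rightarrow> complex" where
  "defect \<phi> u f h = \<phi> (lt u f) h - \<phi> f (rt u h)"

lemma bdd_lin_minus: assumes "bdd_lin v" "bdd_lin w" shows "bdd_lin (\<lambda>f. v f - w f)"
proof -
  obtain C where C: "\<And>f. f \<in> L1 \<Longrightarrow> norm (v f) \<le> C * N f" using bdd_lin_bound[OF assms(1)] by blast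
  obtain D where D: "\<And>f. f \<in> L1 \<Longrightarrow> norm (w f) \<le> D * N f" using bdd_lin_bound[OF assms(2)] by blast
  show ?thesis
  proof (rule bdd_linI)
    show "norm (v f - w f) \<le> (C + D) * N f" if "f \<in> L1" for f
      using C[OF that] D[OF that] norm_triangle_ineq4[of "v f" "w f"] by (simp add: distrib_right)
  qed (simp_all add: bdd_lin_add[OF assms(1)] bdd_lin_add[OF assms(2)] bdd_lin_cmult[OF assms(1)] bdd_lin_cmult[OF assms(2)] right_diff_distrib)
qed

lemma bdd_bilin_defect: assumes \<phi>: "bdd_bilin \<phi> C" shows "bdd_bilin (defect \<phi> u) (2 * C)"
  unfolding bdd_bilin_def
proof (intro conjI ballI)
  fix h assume h: "h \<in> L1"
  show "bdd_lin (\<lambda>f. defect \<phi> u f h)" unfolding defect_def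
    by (intro bdd_lin_minus bdd_lin_comp_lt[of "\<lambda>f. \<phi> f h"] bdd_bilin_left[OF \<phi>] h rt_L1)
  show "bdd_lin (\<lambda>f. defect \<phi> u h f)" unfolding defect_def
    by (intro bdd_lin_minus bdd_lin_comp_rt[of "\<lambda>f. \<phi> h f"] bdd_bilin_right[OF \<phi>] h lt_L1)
  fix f assume f: "f \<in> L1"
  show "norm (defect \<phi> u f h) \<le> 2 * C * N f * N h"
    using bdd_bilin_bound[OF \<phi> lt_L1[OF f] h, of u] bdd_bilin_bound[OF \<phi> f rt_L1[OF h], of u] norm_triangle_ineq4[of "\<phi> (lt u f) h" "\<phi> f (rt u h)"]
    unfolding defect_def by (simp add: N_lt[OF f] N_rt[OF h] mult.assoc)
qed (use bdd_bilin_nonneg[OF \<phi>] in simp)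

text \<open>Now the translates are put on the inner sides of the pair, so that already
  \<open>a * b\<close> consists of terms depending on the sum of the exponents and vanishes. Then
  \<open>comm_zero_product\<close> kills the defect at the pair, and \<open>synthesis\<close>
  compares the exponents (1, 0) and (0, 1).\<close>

lemma defect_balanced_group:
  assumes \<phi>: "bdd_bilin \<phi> C" "comm_zero \<phi>" and x: "x \<in> L1" and y: "y \<in> L1"
  shows "defect \<phi> u (rt v x) y = defect \<phi> u x (lt v y)"
proof -
  note B = bdd_bilin_defect[OF \<phi>(1), of u]
  define Q where "Q m q = defect \<phi> u (rt (zpow v m) x) (lt (zpow v q) y)" for m q
  have "Q 1 0 = Q 0 1"
  proof (rule synthesis[where B="2 * C * N x * N y"])
    show "norm (Q m q) \<le> 2 * C * N x * N y" for m q
      unfolding Q_def using bdd_bilin_bound[OF B rt_L1[OF x] lt_L1[OF y]] by (simp add: N_rt[OF x] N_lt[OF y])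
    fix f g :: "int \<Rightarrow> complex"
    assume f: "(\<lambda>m. norm (f m)) summable_on UNIV" and g: "(\<lambda>m. norm (g m)) summable_on UNIV"
      and fg: "\<And>h :: int \<Rightarrow> complex. bounded (range h) \<Longrightarrow> (\<Sum>\<^sub>\<infinity>m. f m * (\<Sum>\<^sub>\<infinity>n. g n * h (m + n))) = 0"
    have Nx: "N (rt (zpow v m) x) \<le> N x" and Ny: "N (lt (zpow v m) y) \<le> N y" for m by (simp_all add: N_rt[OF x] N_lt[OF y])
    obtain a where a: "a \<in> L1" "\<And>w. bdd_lin w \<Longrightarrow> w a = (\<Sum>\<^sub>\<infinity>m. f m * w (rt (zpow v m) x))"
      by (rule int_series[OF f rt_L1[OF x] Nx]) (rule that; assumption)
    obtain b where b: "b \<in> L1" "\<And>w. bdd_lin w \<Longrightarrow> w b = (\<Sum>\<^sub>\<infinity>m. g m * w (lt (zpow v m) y))"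
      by (rule int_series[OF g lt_L1[OF y] Ny]) (rule that; assumption)
    have "AE t in \<mu>. conv a b t = 0"
    proof (rule conv_zeroI[OF a(1) b(1)])
      fix k assume k: "k \<in> test"
      note w = pairing_bdd_lin[OF k]
      have "pairing k (conv a b) = (\<Sum>\<^sub>\<infinity>m. f m * pairing k (conv (rt (zpow v m) x) b))" by (rule a(2)[OF bdd_lin_comp_conv(1)[OF w b(1)]])
      also have "\<dots> = (\<Sum>\<^sub>\<infinity>m. f m * (\<Sum>\<^sub>\<infinity>q. g q * pairing k (conv (rt (zpow v m) x) (lt (zpow v q) y))))"
        by (simp only: b(2)[OF bdd_lin_comp_conv(2)[OF w rt_L1[OF x]]])
      also have "\<dots> = (\<Sum>\<^sub>\<infinity>m. f m * (\<Sum>\<^sub>\<infinity>q. g q * pairing k (conv x (lt (zpow v (m + q)) y))))"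
        by (simp only: conv_rt_lt[OF x lt_L1[OF y]] lt_lt zpow_add)
      also have "\<dots> = 0"
      proof (rule fg)
        have "norm (pairing k (conv x (lt (zpow v j) y))) \<le> N x * N y" for j
          using pairing_bound[OF k conv_L1[OF x lt_L1[OF y]], of "zpow v j"] N_conv[OF x lt_L1[OF y], of "zpow v j"] by (simp add: N_lt[OF y])
        then show "bounded (range (\<lambda>j. pairing k (conv x (lt (zpow v j) y))))" by (auto simp: bounded_iff)
      qed
      finally show "pairing k (conv a b) = 0" .
    qed
    from comm_zero_product[OF \<phi> a(1) b(1) this, of u] have "defect \<phi> u a b = 0" by (simp add: defect_def)
    moreover have "defect \<phi> u a b = (\<Sum>\<^sub>\<infinity>m. f m * defect \<phi> u (rt (zpow v m) x) b)" by (rule a(2)[OF bdd_bilin_left[OF B b(1)]])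
    moreover have "\<dots> = (\<Sum>\<^sub>\<infinity>m. f m * (\<Sum>\<^sub>\<infinity>n. g n * Q m n))"
      by (simp only: Q_def b(2)[OF bdd_bilin_right[OF B rt_L1[OF x]]])
    ultimately show "(\<Sum>\<^sub>\<infinity>m. f m * (\<Sum>\<^sub>\<infinity>n. g n * Q m n)) = 0" by simp
  qed
  then show ?thesis by (simp add: Q_def)
qed

text \<open>\<open>conv x a\<close> and \<open>conv a y\<close> are averages, with the same density
  \<open>a\<close>, of the translates compared in \<open>defect_balanced_group\<close>.\<close>

lemma defect_balanced:
  assumes \<phi>: "bdd_bilin \<phi> C" "comm_zero \<phi>" and x: "x \<in> L1" and y: "y \<in> L1" and a: "a \<in> L1"
  shows "defect \<phi> u (conv x a) y = defect \<phi> u x (conv a y)"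
proof -
  note B = bdd_bilin_defect[OF \<phi>(1), of u]
  have "defect \<phi> u (conv x a) y = (\<integral>v. a v * defect \<phi> u (rt v x) y \<partial>\<mu>)" by (rule bdd_lin_conv_right(1)[OF bdd_bilin_left[OF B y] a x])
  also have "\<dots> = (\<integral>v. a v * defect \<phi> u x (lt v y) \<partial>\<mu>)" by (simp only: defect_balanced_group[OF \<phi> x y])
  also have "\<dots> = defect \<phi> u x (conv a y)" by (rule bdd_lin_conv_left(1)[OF bdd_bilin_right[OF B x] a y, symmetric])
  finally show ?thesis .
qed

section \<open>Balanced forms factor through convolution\<close>

text \<open>A Cauchy criterion for filters: the constants that approximate within
  \<open>1 / (n + 1)\<close> form a Cauchy sequence, and its limit is the limit along the
  filter.\<close>

lemma tendsto_of_approx: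
  fixes f :: "'b \<Rightarrow> complex"
  assumes F: "F \<noteq> bot" and approx_one: "\<And>e. e > 0 \<Longrightarrow> \<exists>d. eventually (\<lambda>i. norm (f i - d) < e) F"
  shows "\<exists>l. (f \<longlongrightarrow> l) F"
proof -
  have "\<forall>n::nat. \<exists>d. eventually (\<lambda>i. norm (f i - d) < 1 / real (Suc n)) F" using approx_one by simp
  then obtain d where d: "\<And>n. eventually (\<lambda>i. norm (f i - d n) < 1 / real (Suc n)) F" by metis
  have dd: "norm (d m - d n) < 1 / real (Suc m) + 1 / real (Suc n)" for m n
  proof -
    have "eventually (\<lambda>i. norm (d m - d n) < 1 / real (Suc m) + 1 / real (Suc n)) F"
      using d[of m] d[of n]
    proof eventually_elim
      case (elim i)
      have "norm (d m - d n) \<le> norm (f i - d m) + norm (f i - d n)"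
        using norm_triangle_ineq4[of "f i - d n" "f i - d m"] by simp
      then show ?case using elim by linarith
    qed
    then show ?thesis using F eventually_happens by blast
  qed
  have lim0: "(\<lambda>n. 1 / real (Suc n)) \<longlonglongrightarrow> 0" using LIMSEQ_Suc[OF lim_inverse_n'] by simp
  have "Cauchy d"
  proof (rule metric_CauchyI)
    fix e :: real assume e: "e > 0"
    then have "eventually (\<lambda>n. 1 / real (Suc n) < e / 2) sequentially" using order_tendstoD(2)[OF lim0, of "e / 2"] by simp
    then obtain M where M: "\<And>n. n \<ge> M \<Longrightarrow> 1 / real (Suc n) < e / 2" by (auto simp: eventually_sequentially)
    show "\<exists>M. \<forall>m\<ge>M. \<forall>n\<ge>M. dist (d m) (d n) < e"
    proof (intro exI[of _ M] allI impI)
      fix m n assume "M \<le> m" "M \<le> n"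
      then show "dist (d m) (d n) < e" using M[of m] M[of n] dd[of m n] unfolding dist_norm by linarith
    qed
  qed
  then obtain l where l: "d \<longlonglongrightarrow> l" using Cauchy_convergent convergent_def by blast
  have "(f \<longlongrightarrow> l) F"
  proof (rule tendstoI)
    fix e :: real assume e: "e > 0"
    then have "eventually (\<lambda>n. 1 / real (Suc n) < e / 2) sequentially" "eventually (\<lambda>n. dist (d n) l < e / 2) sequentially"
      using order_tendstoD(2)[OF lim0, of "e / 2"] tendstoD[OF l, of "e / 2"] by simp_all
    then have "eventually (\<lambda>n. 1 / real (Suc n) < e / 2 \<and> dist (d n) l < e / 2) sequentially" by (rule eventually_conj)
    then obtain n where n: "1 / real (Suc n) < e / 2" "dist (d n) l < e / 2" by (auto simp: eventually_sequentially)
    from d[of n] show "eventually (\<lambda>i. dist (f i) l < e) F"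
    proof eventually_elim
      case (elim i)
      then show ?case using n dist_triangle[of "f i" l "d n"] unfolding dist_norm by linarith
    qed
  qed
  then show ?thesis by blast
qed

text \<open>\<open>D z\<close> is the limit of \<open>\<beta> e z\<close> as \<open>e\<close> runs
  through the approximate identity. On a product,
  \<open>\<beta> e (conv a y) = \<beta> (conv e a) y\<close> tends to \<open>\<beta> a y\<close>; a
  general \<open>z\<close> is close to products, which is enough for the limit to exist.\<close>

lemma balanced_factor:
  assumes B: "bdd_bilin \<beta> C" and bal: "\<And>x a y. x \<in> L1 \<Longrightarrow> a \<in> L1 \<Longrightarrow> y \<in> L1 \<Longrightarrow> \<beta> (conv x a) y = \<beta> x (conv a y)"
  shows "\<exists>D. bdd_lin D \<and> (\<forall>z\<in>L1. norm (D z) \<le> C * N z) \<and> (\<forall>a\<in>L1. \<forall>y\<in>L1. D (conv a y) = \<beta> a y)"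
proof -
  have C0: "C \<ge> 0" by (rule bdd_bilin_nonneg[OF B])
  \<comment> \<open>Set to \<open>0\<close> off the good neighbourhoods, so that membership in
    \<open>L1\<close> and the norm bound hold for every index and not only eventually.\<close>
  define approx_one' where "approx_one' V = (if good_nbhd V then approx_one V else (\<lambda>x. 0))" for V
  have approx_one'L: "approx_one' V \<in> L1" for V by (simp add: approx_one'_def approx_one_L1 L1_zero)
  have apN: "N (approx_one' V) \<le> 1" for V using N_approx_one[of V] by (simp add: approx_one'_def) (simp add: N_def)
  have bd: "norm (\<beta> (approx_one' V) z) \<le> C * N z" if z: "z \<in> L1" for V z
  proof -
    have "C * N (approx_one' V) * N z \<le> C * 1 * N z" by (intro mult_right_mono mult_left_mono apN C0 N_nonneg)
    then show ?thesis using bdd_bilin_bound[OF B approx_one'L z, of V] by simp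
  qed
  have prod: "((\<lambda>V. \<beta> (approx_one' V) (conv a y)) \<longlongrightarrow> \<beta> a y) nbhd_filter" if a: "a \<in> L1" and y: "y \<in> L1" for a y
  proof -
    have "((\<lambda>V. N (\<lambda>x. conv (approx_one' V) a x - a x)) \<longlongrightarrow> 0) nbhd_filter"
      by (rule Lim_transform_eventually[OF tendsto_approx_one_left[OF a]])
        (use eventually_good_nbhd in eventually_elim, simp add: approx_one'_def)
    from bdd_lin_tendsto[OF bdd_bilin_left[OF B y] conv_L1[OF approx_one'L a] a this]
    show ?thesis by (simp only: bal[OF approx_one'L a y])
  qed
  have "\<exists>d. ((\<lambda>V. \<beta> (approx_one' V) z) \<longlongrightarrow> d) nbhd_filter" if z: "z \<in> L1" for z
  proof (rule tendsto_of_approx[OF nbhd_filter_neq_bot])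
    fix e :: real assume e: "e > 0"
    \<comment> \<open>The denominator uses \<open>C + 1\<close> because \<open>C\<close> may be
      \<open>0\<close>.\<close>
    define e' where "e' = e / (2 * (C + 1))"
    have e': "e' > 0" "C * e' < e / 2"
    proof -
      show "e' > 0" using e C0 by (simp add: e'_def)
      then have "C * e' < (C + 1) * e'" by (intro mult_strict_right_mono) auto
      also have "(C + 1) * e' = e / 2" using C0 by (simp add: e'_def field_split_simps)
      finally show "C * e' < e / 2" .
    qed
    have "eventually (\<lambda>V. N (\<lambda>x. conv (approx_one V) z x - z x) < e' \<and> good_nbhd V) nbhd_filter"
      by (rule eventually_conj[OF order_tendstoD(2)[OF tendsto_approx_one_left[OF z] e'(1)] eventually_good_nbhd])
    then obtain V0 where V0: "N (\<lambda>x. conv (approx_one V0) z x - z x) < e'" "good_nbhd V0"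
      using eventually_happens nbhd_filter_neq_bot by blast
    note z0 = conv_L1[OF approx_one_L1[OF V0(2)] z]
    have "eventually (\<lambda>V. dist (\<beta> (approx_one' V) (conv (approx_one V0) z)) (\<beta> (approx_one V0) z) < e / 2) nbhd_filter"
      using e by (intro tendstoD[OF prod[OF approx_one_L1[OF V0(2)] z]]) simp
    then have "eventually (\<lambda>V. norm (\<beta> (approx_one' V) z - \<beta> (approx_one V0) z) < e) nbhd_filter"
    proof eventually_elim
      case (elim V)
      have "norm (\<beta> (approx_one' V) (conv (approx_one V0) z) - \<beta> (approx_one' V) z) \<le> C * N (\<lambda>x. conv (approx_one V0) z x - z x)"
        using bd[OF L1_diff[OF z0 z], of V] by (simp add: bdd_lin_diff[OF bdd_bilin_right[OF B approx_one'L] z0 z])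
      also have "\<dots> \<le> C * e'" using V0(1) C0 by (intro mult_left_mono) auto
      finally have "norm (\<beta> (approx_one' V) (conv (approx_one V0) z) - \<beta> (approx_one' V) z) < e / 2" using e'(2) by simp
      then have "dist (\<beta> (approx_one' V) z) (\<beta> (approx_one' V) (conv (approx_one V0) z)) < e / 2" by (simp add: dist_norm norm_minus_commute)
      then show ?case using elim dist_triangle[of "\<beta> (approx_one' V) z" "\<beta> (approx_one V0) z" "\<beta> (approx_one' V) (conv (approx_one V0) z)"]
        by (simp add: dist_norm)
    qed
    then show "\<exists>d. eventually (\<lambda>V. norm (\<beta> (approx_one' V) z - d) < e) nbhd_filter" by blast
  qed
  then obtain D where D: "\<And>z. z \<in> L1 \<Longrightarrow> ((\<lambda>V. \<beta> (approx_one' V) z) \<longlongrightarrow> D z) nbhd_filter" by metis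
  have DN: "norm (D z) \<le> C * N z" if z: "z \<in> L1" for z
    by (rule tendsto_upperbound[OF tendsto_norm[OF D[OF z]] _ nbhd_filter_neq_bot]) (simp add: bd[OF z])
  have "bdd_lin D"
  proof (rule bdd_linI[OF _ _ DN])
    fix f g assume f: "f \<in> L1" and g: "g \<in> L1"
    have "((\<lambda>V. \<beta> (approx_one' V) (\<lambda>x. f x + g x)) \<longlongrightarrow> D f + D g) nbhd_filter"
      using tendsto_add[OF D[OF f] D[OF g]] by (simp only: bdd_lin_add[OF bdd_bilin_right[OF B approx_one'L] f g])
    then show "D (\<lambda>x. f x + g x) = D f + D g" by (rule tendsto_unique[OF nbhd_filter_neq_bot D[OF L1_add[OF f g]]])
  next
    fix c f assume f: "f \<in> L1"
    have "((\<lambda>V. \<beta> (approx_one' V) (\<lambda>x. c * f x)) \<longlongrightarrow> c * D f) nbhd_filter"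
      using tendsto_mult_left[OF D[OF f], of c] by (simp only: bdd_lin_cmult[OF bdd_bilin_right[OF B approx_one'L] f])
    then show "D (\<lambda>x. c * f x) = c * D f" by (rule tendsto_unique[OF nbhd_filter_neq_bot D[OF L1_cmult[OF f]]])
  qed
  moreover have "D (conv a y) = \<beta> a y" if "a \<in> L1" "y \<in> L1" for a y
    by (rule tendsto_unique[OF nbhd_filter_neq_bot D[OF conv_L1[OF that]] prod[OF that]])
  ultimately show ?thesis using DN by blast
qed

text \<open>Convolving with the approximate identity approximates every \<open>z\<close> by
  products, on which the functionals agree.\<close>

lemma bdd_lin_eq_products:
  assumes v: "bdd_lin v" and w: "bdd_lin w" and e: "\<And>a y. a \<in> L1 \<Longrightarrow> y \<in> L1 \<Longrightarrow> v (conv a y) = w (conv a y)" and z: "z \<in> L1"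
  shows "v z = w z"
proof -
  define approx_one' where "approx_one' V = (if good_nbhd V then approx_one V else (\<lambda>x. 0))" for V
  have approx_one'L: "approx_one' V \<in> L1" for V by (simp add: approx_one'_def approx_one_L1 L1_zero)
  have l: "((\<lambda>V. N (\<lambda>x. conv (approx_one' V) z x - z x)) \<longlongrightarrow> 0) nbhd_filter"
    by (rule Lim_transform_eventually[OF tendsto_approx_one_left[OF z]])
      (use eventually_good_nbhd in eventually_elim, simp add: approx_one'_def)
  have "((\<lambda>V. v (conv (approx_one' V) z)) \<longlongrightarrow> v z) nbhd_filter" "((\<lambda>V. w (conv (approx_one' V) z)) \<longlongrightarrow> w z) nbhd_filter"
    by (rule bdd_lin_tendsto[OF v conv_L1[OF approx_one'L z] z l], rule bdd_lin_tendsto[OF w conv_L1[OF approx_one'L z] z l])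
  then show ?thesis using tendsto_unique[OF nbhd_filter_neq_bot] by (simp only: e[OF approx_one'L z]) blast
qed

section \<open>Suprema of functionals and bounded cocycles\<close>

text \<open>The positive cone, defined by conditions at every point, so that the decompositions
  below are literal equalities of functions.\<close>

definition cone :: "('g \<Rightarrow> complex) set" where
  "cone = {f \<in> L1. \<forall>x. Re (f x) \<ge> 0 \<and> Im (f x) = 0}"

lemma cone_L1: "f \<in> cone \<Longrightarrow> f \<in> L1" and cone_Re: "f \<in> cone \<Longrightarrow> 0 \<le> Re (f x)"
  and cone_Im: "f \<in> cone \<Longrightarrow> Im (f x) = 0"
  by (simp_all add: cone_def)

lemma cone_eq: "f \<in> cone \<Longrightarrow> f x = complex_of_real (Re (f x))"
  by (simp add: complex_eq_iff cone_Im)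

lemma cone_zero: "(\<lambda>x. 0) \<in> cone" by (simp add: cone_def L1_zero)

lemma N_zero: "N (\<lambda>x. 0) = 0" by (simp add: N_def)

lemma cone_add: "f \<in> cone \<Longrightarrow> g \<in> cone \<Longrightarrow> (\<lambda>x. f x + g x) \<in> cone"
  by (simp add: cone_def L1_add)

lemma cone_cmult: "f \<in> cone \<Longrightarrow> c \<ge> 0 \<Longrightarrow> (\<lambda>x. complex_of_real c * f x) \<in> cone"
  by (simp add: cone_def L1_cmult)

lemma cone_lt: "f \<in> cone \<Longrightarrow> lt u f \<in> cone"
  using lt_L1[of f u] by (simp add: cone_def) (simp add: lt_def)

lemma cone_rt: "f \<in> cone \<Longrightarrow> rt u f \<in> cone"
  using rt_L1[of f u] modular_pos[of "- u"] by (simp add: cone_def) (simp add: rt_def)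

lemma N_cone_add: "f \<in> cone \<Longrightarrow> g \<in> cone \<Longrightarrow> N (\<lambda>x. f x + g x) = N f + N g"
proof -
  assume f: "f \<in> cone" and g: "g \<in> cone"
  have "norm (f x + g x) = norm (f x) + norm (g x)" for x
    using cone_eq[OF f, of x] cone_eq[OF g, of x] cone_Re[OF f, of x] cone_Re[OF g, of x]
    by (metis abs_of_nonneg add_nonneg_nonneg norm_of_real of_real_add)
  then show ?thesis using cone_L1[OF f] cone_L1[OF g] by (simp add: N_def L1_def)
qed

text \<open>The Riesz decomposition property in explicit form: \<open>r\<close> is divided in the
  ratio of \<open>p\<close> to \<open>q\<close>. The share is additive in \<open>r\<close>, so it
  can be applied piece by piece to a decomposition. Where \<open>p + q = 0\<close> the quotient is
  \<open>0\<close> by default, which is correct because \<open>r\<close> also vanishes there when it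
  is dominated by \<open>p + q\<close>.\<close>

definition share :: "('g \<Rightarrow> complex) \<Rightarrow> ('g \<Rightarrow> complex) \<Rightarrow> ('g \<Rightarrow> complex) \<Rightarrow> 'g \<Rightarrow> complex" where
  "share p q r = (\<lambda>x. complex_of_real (Re (r x) * (Re (p x) / (Re (p x) + Re (q x)))))"

lemma share_cone: assumes p: "p \<in> cone" and q: "q \<in> cone" and r: "r \<in> cone" shows "share p q r \<in> cone"
proof -
  have [measurable]: "p \<in> borel_measurable \<mu>" "q \<in> borel_measurable \<mu>" "r \<in> borel_measurable \<mu>"
    using cone_L1[OF p] cone_L1[OF q] cone_L1[OF r] by (auto simp: L1_def)
  have 1: "0 \<le> Re (p x) / (Re (p x) + Re (q x))" "Re (p x) / (Re (p x) + Re (q x)) \<le> 1" for x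
    using cone_Re[OF p, of x] cone_Re[OF q, of x] by (auto simp: divide_le_eq_1)
  have "integrable \<mu> (share p q r)"
  proof (rule Bochner_Integration.integrable_bound[OF L1_integrable[OF cone_L1[OF r]]])
    show "share p q r \<in> borel_measurable \<mu>" unfolding share_def by measurable
    have "norm (share p q r x) \<le> norm (r x)" for x
    proof -
      have "norm (share p q r x) = \<bar>Re (r x)\<bar> * (Re (p x) / (Re (p x) + Re (q x)))"
        unfolding share_def using 1(1)[of x] by (simp only: norm_of_real abs_mult abs_of_nonneg)
      also have "\<dots> \<le> \<bar>Re (r x)\<bar> * 1" by (intro mult_left_mono 1) simp
      finally show ?thesis using abs_Re_le_cmod[of "r x"] by simp
    qed
    then show "AE x in \<mu>. norm (share p q r x) \<le> norm (r x)" by simp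
  qed
  moreover have "0 \<le> Re (share p q r x)" "Im (share p q r x) = 0" for x
    unfolding share_def Re_complex_of_real Im_complex_of_real by (intro mult_nonneg_nonneg 1 cone_Re[OF r]) simp
  ultimately show ?thesis by (simp add: cone_def L1_def)
qed

lemma share_sum:
  assumes p: "p \<in> cone" and q: "q \<in> cone" and r: "r \<in> cone" and le: "Re (r x) \<le> Re (p x) + Re (q x)"
  shows "share p q r x + share q p r x = r x"
proof (cases "Re (p x) + Re (q x) = 0")
  case True
  then have "Re (r x) = 0" using le cone_Re[OF r, of x] by simp
  then show ?thesis using cone_eq[OF r, of x] by (simp add: share_def)
next
  case False
  then have "Re (r x) * (Re (p x) / (Re (p x) + Re (q x))) + Re (r x) * (Re (q x) / (Re (q x) + Re (p x))) = Re (r x)"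
    by (simp add: add.commute[of "Re (q x)"] distrib_left[symmetric] add_divide_distrib[symmetric])
  then show ?thesis unfolding share_def of_real_add[symmetric] by (simp only: cone_eq[OF r, symmetric])
qed

text \<open>Decompositions of \<open>p\<close> within the cone, each piece tagged with the group
  element whose functional will be evaluated on it.\<close>

definition dec :: "('g \<times> ('g \<Rightarrow> complex)) list \<Rightarrow> ('g \<Rightarrow> complex) \<Rightarrow> bool" where
  "dec l p \<longleftrightarrow> (\<forall>z\<in>set l. snd z \<in> cone) \<and> p = (\<lambda>x. \<Sum>z\<leftarrow>l. snd z x)"

lemma dec_Nil: "dec [] p \<longleftrightarrow> p = (\<lambda>x. 0)" by (simp add: dec_def)

lemma dec_Cons: "dec (z # l) p \<longleftrightarrow> (\<exists>p'. snd z \<in> cone \<and> dec l p' \<and> p = (\<lambda>x. snd z x + p' x))"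
  by (auto simp: dec_def)

lemma dec_cone: "dec l p \<Longrightarrow> p \<in> cone"
  by (induction l arbitrary: p) (auto simp: dec_Nil dec_Cons cone_zero intro: cone_add)

lemma dec_append: "dec l p \<Longrightarrow> dec m q \<Longrightarrow> dec (l @ m) (\<lambda>x. p x + q x)"
  by (auto simp: dec_def)

lemma dec_map:
  assumes d: "dec l p" and c: "\<And>q. q \<in> cone \<Longrightarrow> T q \<in> cone" and z: "T (\<lambda>x. 0) = (\<lambda>x. 0)"
    and a: "\<And>q r. q \<in> cone \<Longrightarrow> r \<in> cone \<Longrightarrow> T (\<lambda>x. q x + r x) = (\<lambda>x. T q x + T r x)"
  shows "dec (map (\<lambda>z. (g (fst z), T (snd z))) l) (T p)"
  using d
proof (induction l arbitrary: p)
  case Nil then show ?case by (simp add: dec_Nil z)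
next
  case (Cons y l)
  then obtain p' where p': "snd y \<in> cone" "dec l p'" "p = (\<lambda>x. snd y x + p' x)" by (auto simp: dec_Cons)
  show ?case using Cons.IH[OF p'(2)] p'(1) a[OF p'(1) dec_cone[OF p'(2)]] c by (auto simp: dec_Cons p'(3))
qed

text \<open>The product of \<open>f\<close> with the point mass at \<open>- u\<close> on the left
  and at \<open>u\<close> on the right. It is an action from the right, see
  \<open>conj_by_conj_by\<close>, and preserves the cone because the modular function is
  positive.\<close>

definition conj_by :: "'g \<Rightarrow> ('g \<Rightarrow> complex) \<Rightarrow> 'g \<Rightarrow> complex" where
  "conj_by u f = lt (- u) (rt u f)"

lemma conj_by_cone: "f \<in> cone \<Longrightarrow> conj_by u f \<in> cone"
  by (simp add: conj_by_def cone_lt cone_rt)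

lemma conj_by_conj_by: "conj_by v (conj_by u f) = conj_by (u + v) f"
  by (simp add: conj_by_def lt_rt lt_lt rt_rt minus_add)

lemma conj_by_inverse: "conj_by u (conj_by (- u) f) = f" "conj_by (- u) (conj_by u f) = f"
  by (simp_all add: conj_by_conj_by) (simp_all add: conj_by_def)

lemma conj_by_add: "conj_by u (\<lambda>x. f x + g x) = (\<lambda>x. conj_by u f x + conj_by u g x)"
  and conj_by_zero: "conj_by u (\<lambda>x. 0) = (\<lambda>x. 0)"
  by (simp_all add: conj_by_def lt_def rt_def distrib_left)

text \<open>
  The supremum of the functionals \<open>R v\<close> in the order dual of the lattice \<open>L\<^sup>1\<close> (Riesz and
  Kantorovich). It exists because the \<open>R v\<close> are dominated by a multiple of the norm, which is
  additive on the cone, and a cocycle \<open>R\<close> moves it by \<open>R u\<close>.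
\<close>

lemma riesz_sup:
  assumes add: "\<And>v p q. p \<in> cone \<Longrightarrow> q \<in> cone \<Longrightarrow> R v (\<lambda>x. p x + q x) = R v p + R v q"
    and hom: "\<And>v p c. p \<in> cone \<Longrightarrow> c \<ge> 0 \<Longrightarrow> R v (\<lambda>x. complex_of_real c * p x) = c * R v p"
    and bd: "\<And>v p. p \<in> cone \<Longrightarrow> \<bar>R v p\<bar> \<le> C * N p"
    and coc: "\<And>u v p. p \<in> cone \<Longrightarrow> R (u + v) p = R v (conj_by u p) + R u p"
  obtains s :: "('g \<Rightarrow> complex) \<Rightarrow> real" where
    "\<And>p q. p \<in> cone \<Longrightarrow> q \<in> cone \<Longrightarrow> s (\<lambda>x. p x + q x) = s p + s q"
    "\<And>c p. p \<in> cone \<Longrightarrow> c \<ge> 0 \<Longrightarrow> s (\<lambda>x. complex_of_real c * p x) = c * s p"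
    "\<And>p. p \<in> cone \<Longrightarrow> \<bar>s p\<bar> \<le> C * N p"
    "\<And>u p. p \<in> cone \<Longrightarrow> s p = s (conj_by u p) + R u p"
proof -
  define val where "val l = (\<Sum>z\<leftarrow>l. R (fst z) (snd z))" for l
  \<comment> \<open>The Riesz-Kantorovich formula: the supremum over all ways of distributing
    \<open>p\<close> among finitely many of the functionals.\<close>
  define s where "s p = Sup {val l | l. dec l p}" for p
  have R0: "R v (\<lambda>x. 0) = 0" for v using bd[OF cone_zero, of v] by (simp add: N_zero)
  have val_app: "val (l @ m) = val l + val m" for l m by (simp add: val_def)
  have val_le: "val l \<le> C * N p" if "dec l p" for l p
    using that
  proof (induction l arbitrary: p)
    case Nil then show ?case by (simp add: val_def dec_Nil N_zero)
  next
    case (Cons y l)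
    then obtain p' where p': "snd y \<in> cone" "dec l p'" "p = (\<lambda>x. snd y x + p' x)" by (auto simp: dec_Cons)
    have "val (y # l) \<le> C * N (snd y) + C * N p'"
      using Cons.IH[OF p'(2)] bd[OF p'(1), of "fst y"] by (simp add: val_def)
    then show ?case by (simp add: p'(3) N_cone_add[OF p'(1) dec_cone[OF p'(2)]] distrib_left)
  qed
  have R_dec: "(\<Sum>z\<leftarrow>l. R u (snd z)) = R u p" if "dec l p" for l p u
    using that
  proof (induction l arbitrary: p)
    case Nil then show ?case by (simp add: dec_Nil R0)
  next
    case (Cons y l)
    then obtain p' where p': "snd y \<in> cone" "dec l p'" "p = (\<lambda>x. snd y x + p' x)" by (auto simp: dec_Cons)
    then show ?case using Cons.IH[OF p'(2)] add[OF p'(1) dec_cone[OF p'(2)]] by simp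
  qed
  have single: "dec [(v, p)] p" if "p \<in> cone" for v p using that by (simp add: dec_def)
  have bdd: "bdd_above {val l | l. dec l p}" for p by (rule bdd_aboveI[of _ "C * N p"]) (use val_le in blast)
  have upper: "val l \<le> s p" if "dec l p" for l p
    unfolding s_def by (rule cSup_upper[OF _ bdd]) (use that in blast)
  have least: "s p \<le> B" if "p \<in> cone" "\<And>l. dec l p \<Longrightarrow> val l \<le> B" for p B
    unfolding s_def by (rule cSup_least) (use that single in blast)+
  have s_add: "s (\<lambda>x. p x + q x) = s p + s q" if p: "p \<in> cone" and q: "q \<in> cone" for p q
  proof (rule antisym)
    show "s (\<lambda>x. p x + q x) \<le> s p + s q"
    proof (rule least[OF cone_add[OF p q]])
      fix l assume d: "dec l (\<lambda>x. p x + q x)"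
      \<comment> \<open>Stated for every \<open>r\<close> below \<open>p + q\<close>, since the tail
        of a decomposition sums to less than the whole. Each piece is shared between
        \<open>p\<close> and \<open>q\<close>, and additivity of \<open>share\<close> in its last
        argument makes the shares add up again.\<close>
      have split: "\<exists>l1 l2. dec l1 (share p q r) \<and> dec l2 (share q p r) \<and> val l = val l1 + val l2"
        if "dec l r" "\<And>x. Re (r x) \<le> Re (p x) + Re (q x)" for l r
        using that
      proof (induction l arbitrary: r)
        case Nil
        then have "r = (\<lambda>x. 0)" by (simp add: dec_Nil)
        then have "dec [] (share p q r)" "dec [] (share q p r)" by (simp_all add: dec_Nil share_def)
        then show ?case by (intro exI[of _ "[]"]) (simp add: val_def)
      next
        case (Cons y l)
        then obtain r' where r': "snd y \<in> cone" "dec l r'" "r = (\<lambda>x. snd y x + r' x)" by (auto simp: dec_Cons)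
        note r'c = dec_cone[OF r'(2)]
        have le: "Re (r' x) \<le> Re (p x) + Re (q x)" "Re (snd y x) \<le> Re (p x) + Re (q x)" for x
          using Cons.prems(2)[of x] cone_Re[OF r'(1), of x] cone_Re[OF r'c, of x] by (simp_all add: r'(3))
        obtain l1 l2 where l: "dec l1 (share p q r')" "dec l2 (share q p r')" "val l = val l1 + val l2"
          using Cons.IH[OF r'(2) le(1)] by blast
        have y: "share p q (snd y) \<in> cone" "share q p (snd y) \<in> cone" using share_cone p q r'(1) by blast+
        have "share a b r = (\<lambda>x. share a b (snd y) x + share a b r' x)" for a b
          by (simp add: share_def r'(3) distrib_right add_divide_distrib)
        then have "dec ((fst y, share p q (snd y)) # l1) (share p q r)" "dec ((fst y, share q p (snd y)) # l2) (share q p r)"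
          using l y by (auto simp: dec_Cons)
        moreover have "R (fst y) (snd y) = R (fst y) (share p q (snd y)) + R (fst y) (share q p (snd y))"
          using add[OF y, of "fst y"] by (simp only: share_sum[OF p q r'(1) le(2)])
        then have "val (y # l) = val ((fst y, share p q (snd y)) # l1) + val ((fst y, share q p (snd y)) # l2)"
          using l(3) by (simp add: val_def)
        ultimately show ?case by blast
      qed
      have e: "share a b (\<lambda>x. p x + q x) = a" if "a \<in> cone" "b \<in> cone" "\<And>x. p x + q x = a x + b x" for a b
      proof
        fix x
        show "share a b (\<lambda>x. p x + q x) x = a x"
          using cone_eq[OF that(1), of x] cone_Re[OF that(1), of x] cone_Re[OF that(2), of x]
          by (cases "Re (a x) + Re (b x) = 0") (auto simp: share_def that(3) add_nonneg_eq_0_iff)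
      qed
      obtain l1 l2 where l: "dec l1 p" "dec l2 q" "val l = val l1 + val l2"
        using split[OF d] e[OF p q] e[OF q p] by (auto simp: add.commute)
      show "val l \<le> s p + s q" using upper[OF l(1)] upper[OF l(2)] l(3) by simp
    qed
    \<comment> \<open>For the other inequality, decompositions of \<open>p\<close> and of
      \<open>q\<close> are concatenated.\<close>
    have "s p \<le> s (\<lambda>x. p x + q x) - val m" if m: "dec m q" for m
    proof (rule least[OF p])
      show "val l \<le> s (\<lambda>x. p x + q x) - val m" if l: "dec l p" for l
        using upper[OF dec_append[OF l m]] by (simp add: val_app)
    qed
    then have "s q \<le> s (\<lambda>x. p x + q x) - s p" by (intro least[OF q]) (simp add: algebra_simps)
    then show "s p + s q \<le> s (\<lambda>x. p x + q x)" by simp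
  qed
  have s_hom_le: "c * s p \<le> s (\<lambda>x. complex_of_real c * p x)" if p: "p \<in> cone" and c: "c > 0" for c p
  proof -
    have "s p \<le> s (\<lambda>x. complex_of_real c * p x) / c"
    proof (rule least[OF p])
      fix l assume d: "dec l p"
      have dc: "dec (map (\<lambda>z. (id (fst z), (\<lambda>q x. complex_of_real c * q x) (snd z))) l) (\<lambda>x. complex_of_real c * p x)"
        by (rule dec_map[OF d, of "\<lambda>q x. complex_of_real c * q x"]) (use c in \<open>simp_all add: cone_cmult distrib_left\<close>)
      have "val (map (\<lambda>z. (id (fst z), (\<lambda>q x. complex_of_real c * q x) (snd z))) l) = (\<Sum>z\<leftarrow>l. c * R (fst z) (snd z))"
        unfolding val_def map_map o_def fst_conv snd_conv id_apply
        by (rule arg_cong[where f=sum_list], rule map_cong[OF refl]) (use d c hom in \<open>simp add: dec_def\<close>)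
      also have "\<dots> = c * val l" unfolding val_def by (rule sum_list_const_mult)
      finally show "val l \<le> s (\<lambda>x. complex_of_real c * p x) / c" using upper[OF dc] c by (simp add: pos_le_divide_eq mult.commute)
    qed
    then show ?thesis using c by (simp add: pos_le_divide_eq mult.commute)
  qed
  have s_bd: "\<bar>s p\<bar> \<le> C * N p" if p: "p \<in> cone" for p
  proof -
    have "R 0 p \<le> s p" using upper[OF single[OF p, of 0]] by (simp add: val_def)
    then show ?thesis using least[OF p val_le] bd[OF p, of 0] by fastforce
  qed
  have s_hom: "s (\<lambda>x. complex_of_real c * p x) = c * s p" if p: "p \<in> cone" and c: "c \<ge> 0" for c p
  proof (cases "c = 0")
    case True then show ?thesis using s_bd[OF cone_zero] by (simp add: N_zero)
  next
    case False
    then have c': "c > 0" using c by simp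
    \<comment> \<open>The inequality already proved, used for the inverse scalar, is the reverse
      one.\<close>
    have "1 / c * s (\<lambda>x. complex_of_real c * p x) \<le> s (\<lambda>x. complex_of_real (1 / c) * (complex_of_real c * p x))"
      by (rule s_hom_le[OF cone_cmult[OF p c]]) (use c' in simp)
    also have "(\<lambda>x. complex_of_real (1 / c) * (complex_of_real c * p x)) = p" using c' by simp
    finally have "s (\<lambda>x. complex_of_real c * p x) \<le> c * s p" using c' by (simp add: field_simps)
    then show ?thesis using s_hom_le[OF p c'] by simp
  qed
  \<comment> \<open>Replacing each tag \<open>v\<close> by \<open>u + v\<close> and each piece by
    its conjugate under \<open>- u\<close> changes the value by a sum of terms \<open>R u\<close>,
    which by additivity depends on the sum of the pieces only.\<close>
  have shift: "val (map (\<lambda>z. (u + fst z, conj_by (- u) (snd z))) l) = val l + R u (conj_by (- u) p)" if d: "dec l p" for u l p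
  proof -
    have "val (map (\<lambda>z. (u + fst z, conj_by (- u) (snd z))) l) = (\<Sum>z\<leftarrow>l. R (fst z) (snd z) + R u (conj_by (- u) (snd z)))"
      unfolding val_def map_map o_def fst_conv snd_conv
    proof (rule arg_cong[where f=sum_list], rule map_cong[OF refl])
      fix z assume "z \<in> set l"
      then have "conj_by (- u) (snd z) \<in> cone" using d by (simp add: dec_def conj_by_cone)
      from coc[OF this] show "R (u + fst z) (conj_by (- u) (snd z)) = R (fst z) (snd z) + R u (conj_by (- u) (snd z))"
        by (simp only: conj_by_inverse)
    qed
    also have "\<dots> = val l + (\<Sum>z\<leftarrow>l. R u (conj_by (- u) (snd z)))" by (simp add: val_def sum_list_addf)
    also have "(\<Sum>z\<leftarrow>l. R u (conj_by (- u) (snd z))) = R u (conj_by (- u) p)"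
    proof -
      have "dec (map (\<lambda>z. (id (fst z), conj_by (- u) (snd z))) l) (conj_by (- u) p)"
        by (rule dec_map[OF d conj_by_cone conj_by_zero conj_by_add])
      from R_dec[OF this, of u] show ?thesis by (simp add: o_def)
    qed
    finally show ?thesis .
  qed
  have s_le: "s (conj_by u p) + R u p \<le> s p" if p: "p \<in> cone" for u p
  proof -
    have "s (conj_by u p) \<le> s p - R u p"
    proof (rule least[OF conj_by_cone[OF p]])
      fix l assume d: "dec l (conj_by u p)"
      have "dec (map (\<lambda>z. (u + fst z, conj_by (- u) (snd z))) l) (conj_by (- u) (conj_by u p))"
        by (rule dec_map[OF d conj_by_cone conj_by_zero conj_by_add])
      from upper[OF this] show "val l \<le> s p - R u p" using shift[OF d, of u] by (simp add: conj_by_inverse)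
    qed
    then show ?thesis by simp
  qed
  \<comment> \<open>The previous inequality for \<open>- u\<close> at the point
    \<open>conj_by u p\<close> is the reverse one: the cocycle identity at (0, 0) gives
    \<open>R 0 p = 0\<close>, and at (u, - u) then
    \<open>R (- u) (conj_by u p) = - R u p\<close>.\<close>
  have s_eq: "s p = s (conj_by u p) + R u p" if p: "p \<in> cone" for u p
  proof -
    have "R (u + (- u)) p = R (- u) (conj_by u p) + R u p" by (rule coc[OF p])
    moreover have "R (0 + 0) p = R 0 (conj_by 0 p) + R 0 p" by (rule coc[OF p])
    moreover have "conj_by 0 p = p" by (simp add: conj_by_def)
    ultimately have "R (- u) (conj_by u p) = - R u p" by simp
    then show ?thesis using s_le[OF p, of u] s_le[OF conj_by_cone[OF p, of u], of "- u"] by (simp add: conj_by_inverse)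
  qed
  show thesis by (rule that[of s]) (fact s_add s_hom s_bd s_eq)+
qed

section \<open>Extension of functionals from the cone\<close>

definition pos_part :: "('g \<Rightarrow> real) \<Rightarrow> 'g \<Rightarrow> complex" where
  "pos_part h = (\<lambda>x. complex_of_real (max 0 (h x)))"

lemma pos_part_cone: "integrable \<mu> h \<Longrightarrow> pos_part h \<in> cone"
  by (simp add: pos_part_def cone_def L1_def)

lemma N_pos_part: "integrable \<mu> h \<Longrightarrow> N (pos_part h) \<le> (\<integral>x. \<bar>h x\<bar> \<partial>\<mu>)"
  unfolding N_def pos_part_def by (rule integral_mono) auto

lemma L1_split:
  "f x = (pos_part (\<lambda>x. Re (f x)) x - pos_part (\<lambda>x. - Re (f x)) x) + \<i> * (pos_part (\<lambda>x. Im (f x)) x - pos_part (\<lambda>x. - Im (f x)) x)"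
  by (auto simp: pos_part_def complex_eq_iff max_def)

lemma bdd_lin_eq_cone:
  assumes v: "bdd_lin v" and w: "bdd_lin w" and e: "\<And>p. p \<in> cone \<Longrightarrow> v p = w p" and f: "f \<in> L1"
  shows "v f = w f"
proof -
  have i: "integrable \<mu> (\<lambda>x. Re (f x))" "integrable \<mu> (\<lambda>x. - Re (f x))" "integrable \<mu> (\<lambda>x. Im (f x))" "integrable \<mu> (\<lambda>x. - Im (f x))"
    using f by (simp_all add: L1_def)
  note c = pos_part_cone[OF i(1)] pos_part_cone[OF i(2)] pos_part_cone[OF i(3)] pos_part_cone[OF i(4)]
  have u: "u f = (u (pos_part (\<lambda>x. Re (f x))) - u (pos_part (\<lambda>x. - Re (f x)))) + \<i> * (u (pos_part (\<lambda>x. Im (f x))) - u (pos_part (\<lambda>x. - Im (f x))))"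
    if b: "bdd_lin u" for u
  proof -
    note L = c[THEN cone_L1]
    have "u f = u (\<lambda>x. (pos_part (\<lambda>x. Re (f x)) x - pos_part (\<lambda>x. - Re (f x)) x) + \<i> * (pos_part (\<lambda>x. Im (f x)) x - pos_part (\<lambda>x. - Im (f x)) x))"
      by (rule arg_cong[where f=u], rule ext, rule L1_split)
    then show ?thesis
      by (simp only: bdd_lin_add[OF b L1_diff[OF L(1,2)] L1_cmult[OF L1_diff[OF L(3,4)]]] bdd_lin_cmult[OF b L1_diff[OF L(3,4)]]
        bdd_lin_diff[OF b L(1,2)] bdd_lin_diff[OF b L(3,4)])
  qed
  show ?thesis unfolding u[OF v] u[OF w] by (simp only: e c)
qed

lemma bdd_lin_plus: assumes "bdd_lin v" "bdd_lin w" shows "bdd_lin (\<lambda>f. v f + w f)"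
proof -
  have "bdd_lin (\<lambda>f. (w f - w f) - w f)" by (intro bdd_lin_minus assms)
  from bdd_lin_minus[OF assms(1) this] show ?thesis by simp
qed

lemma cone_extend:
  assumes add: "\<And>p q. p \<in> cone \<Longrightarrow> q \<in> cone \<Longrightarrow> \<sigma> (\<lambda>x. p x + q x) = \<sigma> p + \<sigma> q"
    and hom: "\<And>c p. p \<in> cone \<Longrightarrow> c \<ge> 0 \<Longrightarrow> \<sigma> (\<lambda>x. complex_of_real c * p x) = complex_of_real c * \<sigma> p"
    and bd: "\<And>p. p \<in> cone \<Longrightarrow> norm (\<sigma> p) \<le> C * N p"
  shows "\<exists>\<omega>. bdd_lin \<omega> \<and> (\<forall>p\<in>cone. \<omega> p = \<sigma> p)"
proof -
  define A where "A h = \<sigma> (pos_part h) - \<sigma> (pos_part (\<lambda>x. - h x))" for h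
  define \<omega> where "\<omega> f = A (\<lambda>x. Re (f x)) + \<i> * A (\<lambda>x. Im (f x))" for f
  have C: "norm (\<sigma> p) \<le> \<bar>C\<bar> * N p" if "p \<in> cone" for p
    using bd[OF that] mult_right_mono[OF abs_ge_self[of C] N_nonneg[of p]] by simp
  have \<sigma>0: "\<sigma> (\<lambda>x. 0) = 0" using C[OF cone_zero] by (simp add: N_zero)
  have A_minus: "A (\<lambda>x. - h x) = - A h" for h by (simp add: A_def)
  have A_add: "A (\<lambda>x. h x + k x) = A h + A k" if h: "integrable \<mu> h" and k: "integrable \<mu> k" for h k
  proof -
    have i: "integrable \<mu> (\<lambda>x. h x + k x)" "integrable \<mu> (\<lambda>x. - h x)" "integrable \<mu> (\<lambda>x. - k x)" "integrable \<mu> (\<lambda>x. - (h x + k x))"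
      using h k by simp_all
    \<comment> \<open>The identity \<open>(h + k)^+ + h^- + k^- = (h + k)^- + h^+ + k^+\<close>. All
      its terms lie in the cone, where \<open>\<sigma>\<close> is additive.\<close>
    have "(\<lambda>x. pos_part (\<lambda>x. h x + k x) x + (pos_part (\<lambda>x. - h x) x + pos_part (\<lambda>x. - k x) x)) =
        (\<lambda>x. pos_part (\<lambda>x. - (h x + k x)) x + (pos_part h x + pos_part k x))"
      by (rule ext) (simp add: pos_part_def complex_eq_iff max_def)
    from arg_cong[where f=\<sigma>, OF this] show ?thesis
      by (simp add: A_def add pos_part_cone h k i cone_add algebra_simps)
  qed
  have A_pos: "A (\<lambda>x. c * h x) = complex_of_real c * A h" if h: "integrable \<mu> h" and c: "c \<ge> 0" for c h
  proof -
    have "pos_part (\<lambda>x. c * k x) = (\<lambda>x. complex_of_real c * pos_part k x)" for k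
      using c by (auto simp: pos_part_def max_mult_distrib_left simp flip: of_real_mult)
    from this[of h] this[of "\<lambda>x. - h x"] show ?thesis using h c by (simp add: A_def hom pos_part_cone right_diff_distrib)
  qed
  have A_cmult: "A (\<lambda>x. c * h x) = complex_of_real c * A h" if h: "integrable \<mu> h" for c h
  proof (cases "c \<ge> 0")
    case True then show ?thesis by (rule A_pos[OF h])
  next
    case False
    then have "A (\<lambda>x. (- c) * h x) = complex_of_real (- c) * A h" by (intro A_pos[OF h]) simp
    then show ?thesis using A_minus[of "\<lambda>x. c * h x"] by simp
  qed
  have A_bd: "norm (A h) \<le> \<bar>C\<bar> * (2 * (\<integral>x. \<bar>h x\<bar> \<partial>\<mu>))" if h: "integrable \<mu> h" for h
  proof -
    have "norm (A h) \<le> \<bar>C\<bar> * N (pos_part h) + \<bar>C\<bar> * N (pos_part (\<lambda>x. - h x))"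
      unfolding A_def using h by (intro order_trans[OF norm_triangle_ineq4] add_mono C pos_part_cone) simp_all
    also have "\<dots> = \<bar>C\<bar> * (N (pos_part h) + N (pos_part (\<lambda>x. - h x)))" by (simp add: distrib_left)
    also have "\<dots> \<le> \<bar>C\<bar> * (2 * (\<integral>x. \<bar>h x\<bar> \<partial>\<mu>))"
      using N_pos_part[OF h] N_pos_part[of "\<lambda>x. - h x"] h by (intro mult_left_mono) simp_all
    finally show ?thesis .
  qed
  have "bdd_lin \<omega>"
  proof (rule bdd_linI)
    fix f g assume "f \<in> L1" "g \<in> L1"
    then show "\<omega> (\<lambda>x. f x + g x) = \<omega> f + \<omega> g" by (simp add: \<omega>_def L1_def A_add algebra_simps)
  next
    fix c f assume f: "f \<in> L1"
    define a b where "a = (\<lambda>x. Re (f x))" and "b = (\<lambda>x. Im (f x))"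
    have i: "integrable \<mu> a" "integrable \<mu> b" using f by (simp_all add: L1_def a_def b_def)
    have r: "A (\<lambda>x. Re (c * f x)) = complex_of_real (Re c) * A a - complex_of_real (Im c) * A b"
    proof -
      have "A (\<lambda>x. Re (c * f x)) = A (\<lambda>x. Re c * a x + (- Im c) * b x)" by (simp add: a_def b_def)
      also have "\<dots> = A (\<lambda>x. Re c * a x) + A (\<lambda>x. (- Im c) * b x)" by (rule A_add) (simp_all add: i)
      finally show ?thesis by (simp only: A_cmult i) simp
    qed
    have m: "A (\<lambda>x. Im (c * f x)) = complex_of_real (Re c) * A b + complex_of_real (Im c) * A a"
    proof -
      have "A (\<lambda>x. Im (c * f x)) = A (\<lambda>x. Re c * b x + Im c * a x)" by (simp add: a_def b_def)
      also have "\<dots> = A (\<lambda>x. Re c * b x) + A (\<lambda>x. Im c * a x)" by (rule A_add) (simp_all add: i)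
      finally show ?thesis by (simp only: A_cmult i)
    qed
    have c: "c = complex_of_real (Re c) + \<i> * complex_of_real (Im c)" by (simp add: complex_eq_iff)
    have "\<omega> (\<lambda>x. c * f x) = (complex_of_real (Re c) + \<i> * complex_of_real (Im c)) * (A a + \<i> * A b)"
      unfolding \<omega>_def r m by (simp add: algebra_simps)
    then show "\<omega> (\<lambda>x. c * f x) = c * \<omega> f" unfolding c[symmetric] by (simp only: \<omega>_def a_def b_def)
  next
    fix f assume f: "f \<in> L1"
    have i: "integrable \<mu> (\<lambda>x. Re (f x))" "integrable \<mu> (\<lambda>x. Im (f x))" "integrable \<mu> (\<lambda>x. norm (f x))" using f by (simp_all add: L1_def)
    have "norm (\<omega> f) \<le> norm (A (\<lambda>x. Re (f x))) + norm (A (\<lambda>x. Im (f x)))"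
      unfolding \<omega>_def by (rule order_trans[OF norm_triangle_ineq]) (simp add: norm_mult)
    also have "\<dots> \<le> \<bar>C\<bar> * (2 * (\<integral>x. \<bar>Re (f x)\<bar> \<partial>\<mu>)) + \<bar>C\<bar> * (2 * (\<integral>x. \<bar>Im (f x)\<bar> \<partial>\<mu>))"
      by (intro add_mono A_bd i)
    also have "\<dots> \<le> \<bar>C\<bar> * (2 * N f) + \<bar>C\<bar> * (2 * N f)"
      unfolding N_def using i by (intro add_mono mult_left_mono integral_mono) (simp_all add: abs_Re_le_cmod abs_Im_le_cmod)
    finally show "norm (\<omega> f) \<le> (4 * \<bar>C\<bar>) * N f" by simp
  qed
  moreover have "\<omega> p = \<sigma> p" if p: "p \<in> cone" for p
  proof -
    have "pos_part (\<lambda>x. Re (p x)) = p" "pos_part (\<lambda>x. - Re (p x)) = (\<lambda>x. 0)" "pos_part (\<lambda>x. Im (p x)) = (\<lambda>x. 0)" "pos_part (\<lambda>x. - Im (p x)) = (\<lambda>x. 0)"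
      by (rule ext; simp add: pos_part_def complex_eq_iff cone_Re[OF p] cone_Im[OF p])+
    then show ?thesis by (simp add: \<omega>_def A_def \<sigma>0)
  qed
  ultimately show ?thesis by blast
qed

text \<open>Conjugation preserves the cone, so the real and the imaginary part of \<open>E\<close>
  are real cocycles on it. Each is trivialized by its own supremum, finite because the bound is
  uniform in \<open>u\<close>, and the two suprema are recombined to a complex functional.\<close>

lemma bounded_cocycle_trivial:
  assumes bdd_lin: "\<And>u. bdd_lin (E u)" and bd: "\<And>u f. f \<in> L1 \<Longrightarrow> norm (E u f) \<le> C * N f"
    and coc: "\<And>u v f. f \<in> L1 \<Longrightarrow> E (u + v) f = E v (conj_by u f) + E u f"
  shows "\<exists>\<omega>. bdd_lin \<omega> \<and> (\<forall>u. \<forall>f\<in>L1. E u f = \<omega> f - \<omega> (conj_by u f))"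
proof -
  obtain r where r: "\<And>p q. p \<in> cone \<Longrightarrow> q \<in> cone \<Longrightarrow> r (\<lambda>x. p x + q x) = r p + r q"
      "\<And>c p. p \<in> cone \<Longrightarrow> c \<ge> 0 \<Longrightarrow> r (\<lambda>x. complex_of_real c * p x) = c * r p"
      "\<And>p. p \<in> cone \<Longrightarrow> \<bar>r p\<bar> \<le> C * N p"
      "\<And>u p. p \<in> cone \<Longrightarrow> r p = r (conj_by u p) + Re (E u p)"
  proof (rule riesz_sup[of "\<lambda>u p. Re (E u p)" C])
    show "\<bar>Re (E v p)\<bar> \<le> C * N p" if "p \<in> cone" for v p
      using abs_Re_le_cmod[of "E v p"] bd[OF cone_L1[OF that], of v] by simp
  qed ((simp add: bdd_lin_add[OF bdd_lin] bdd_lin_cmult[OF bdd_lin] cone_L1 coc; fail) | (rule that; assumption))+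
  obtain m where m: "\<And>p q. p \<in> cone \<Longrightarrow> q \<in> cone \<Longrightarrow> m (\<lambda>x. p x + q x) = m p + m q"
      "\<And>c p. p \<in> cone \<Longrightarrow> c \<ge> 0 \<Longrightarrow> m (\<lambda>x. complex_of_real c * p x) = c * m p"
      "\<And>p. p \<in> cone \<Longrightarrow> \<bar>m p\<bar> \<le> C * N p"
      "\<And>u p. p \<in> cone \<Longrightarrow> m p = m (conj_by u p) + Im (E u p)"
  proof (rule riesz_sup[of "\<lambda>u p. Im (E u p)" C])
    show "\<bar>Im (E v p)\<bar> \<le> C * N p" if "p \<in> cone" for v p
      using abs_Im_le_cmod[of "E v p"] bd[OF cone_L1[OF that], of v] by simp
  qed ((simp add: bdd_lin_add[OF bdd_lin] bdd_lin_cmult[OF bdd_lin] cone_L1 coc; fail) | (rule that; assumption))+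
  have "\<exists>\<omega>. bdd_lin \<omega> \<and> (\<forall>p\<in>cone. \<omega> p = Complex (r p) (m p))"
  proof (rule cone_extend)
    show "norm (Complex (r p) (m p)) \<le> (2 * C) * N p" if "p \<in> cone" for p
      using cmod_le[of "Complex (r p) (m p)"] r(3)[OF that] m(3)[OF that] by simp
  qed (simp_all add: r(1,2) m(1,2) complex_eq_iff)
  then obtain \<omega> where \<omega>: "bdd_lin \<omega>" "\<And>p. p \<in> cone \<Longrightarrow> \<omega> p = Complex (r p) (m p)" by blast
  have b: "bdd_lin (\<lambda>f. \<omega> f - \<omega> (conj_by u f))" for u
    unfolding conj_by_def by (intro bdd_lin_minus \<omega>(1) bdd_lin_comp_rt[of "\<lambda>f. \<omega> (lt (- u) f)"] bdd_lin_comp_lt)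
  have "E u f = \<omega> f - \<omega> (conj_by u f)" if "f \<in> L1" for u f
    by (rule bdd_lin_eq_cone[OF bdd_lin b _ that])
      (use r(4) m(4) in \<open>simp add: \<omega>(2) conj_by_cone complex_eq_iff add_diff_eq eq_diff_eq add.commute\<close>)
  then show ?thesis using \<omega>(1) by blast
qed

section \<open>From the cocycle to the commutator form\<close>

lemma comm_zero_form:
  assumes \<phi>: "bdd_bilin \<phi> C" "comm_zero \<phi>"
  shows "\<exists>\<omega>. bdd_lin \<omega> \<and> (\<forall>f\<in>L1. \<forall>y\<in>L1. \<phi> f y = \<omega> (conv f y) - \<omega> (conv y f))"
proof -
  note L = bdd_bilin_left[OF \<phi>(1)] and R = bdd_bilin_right[OF \<phi>(1)]
  have "\<exists>D. bdd_lin D \<and> (\<forall>z\<in>L1. norm (D z) \<le> (2 * C) * N z) \<and> (\<forall>a\<in>L1. \<forall>y\<in>L1. D (conv a y) = defect \<phi> u a y)" for u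
    by (rule balanced_factor[OF bdd_bilin_defect[OF \<phi>(1)] defect_balanced[OF \<phi>]]) (simp_all)
  then obtain D where D: "\<And>u. bdd_lin (D u)" "\<And>u z. z \<in> L1 \<Longrightarrow> norm (D u z) \<le> (2 * C) * N z"
      "\<And>u a y. a \<in> L1 \<Longrightarrow> y \<in> L1 \<Longrightarrow> D u (conv a y) = defect \<phi> u a y" by metis
  \<comment> \<open>On products the two defects telescope: the terms
    \<open>\<phi> (lt v a) (rt u y)\<close> cancel. Density of products does the rest.\<close>
  have D_add: "D (u + v) z = D u (lt v z) + D v (rt u z)" if z: "z \<in> L1" for u v z
  proof (rule bdd_lin_eq_products[OF D(1) _ _ z])
    show "bdd_lin (\<lambda>z. D u (lt v z) + D v (rt u z))"
      using bdd_lin_plus[OF bdd_lin_comp_lt[OF D(1)] bdd_lin_comp_rt[OF D(1)]] .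
    fix a y assume a: "a \<in> L1" and y: "y \<in> L1"
    have "D u (lt v (conv a y)) + D v (rt u (conv a y)) = defect \<phi> u (lt v a) y + defect \<phi> v a (rt u y)"
      using D(3)[OF lt_L1[OF a] y, of u v] D(3)[OF a rt_L1[OF y], of v u] by (simp add: conv_lt[OF a y] conv_rt)
    also have "\<dots> = defect \<phi> (u + v) a y" by (simp add: defect_def lt_lt rt_rt)
    finally show "D (u + v) (conv a y) = D u (lt v (conv a y)) + D v (rt u (conv a y))" by (simp add: D(3)[OF a y])
  qed
  \<comment> \<open>Undoing the left translation by \<open>u\<close> turns the two-sided rule
    \<open>D_add\<close> into a cocycle identity for conjugation.\<close>
  define E where "E u y = D u (lt (- u) y)" for u y
  have "\<exists>\<omega>. bdd_lin \<omega> \<and> (\<forall>u. \<forall>f\<in>L1. E u f = \<omega> f - \<omega> (conj_by u f))"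
  proof (rule bounded_cocycle_trivial)
    show "bdd_lin (E u)" for u using bdd_lin_comp_lt[OF D(1)] by (simp add: E_def[abs_def])
    show "norm (E u f) \<le> (2 * C) * N f" if "f \<in> L1" for u f
      using D(2)[OF lt_L1[OF that], of u "- u"] by (simp add: E_def N_lt[OF that])
    show "E (u + v) f = E v (conj_by u f) + E u f" if f: "f \<in> L1" for u v f
    proof -
      have 1: "lt v (lt (- (u + v)) f) = lt (- u) f" by (simp only: lt_lt minus_add add_minus_cancel)
      have 2: "rt u (lt (- (u + v)) f) = lt (- v) (conj_by u f)" by (simp only: conj_by_def lt_lt minus_add lt_rt)
      show ?thesis using D_add[OF lt_L1[OF f], of u v "- (u + v)"] by (simp only: 1 2 E_def add.commute)
    qed
  qed
  then obtain \<omega> where \<omega>: "bdd_lin \<omega>" "\<And>u f. f \<in> L1 \<Longrightarrow> E u f = \<omega> f - \<omega> (conj_by u f)" by blast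
  define \<kappa> where "\<kappa> f y = \<phi> f y - \<omega> (conv f y) + \<omega> (conv y f)" for f y
  have defect: "defect \<phi> u b y = \<omega> (lt u (conv b y)) - \<omega> (rt u (conv b y))" if b: "b \<in> L1" and y: "y \<in> L1" for u b y
  proof -
    have "defect \<phi> u b y = E u (lt u (conv b y))" by (simp add: D(3)[OF b y, symmetric] E_def lt_lt)
    then show ?thesis by (simp add: \<omega>(2) lt_L1 conv_L1 b y conj_by_def lt_lt lt_rt)
  qed
  \<comment> \<open>Subtracting \<open>\<omega> (conv f y)\<close> from \<open>\<phi> f y\<close>
    leaves a form without defect. Averaging this over \<open>v\<close> with density \<open>a\<close>
    carries \<open>a\<close> from the left of \<open>b\<close> to the right of
    \<open>y\<close>.\<close>
  have move: "\<phi> (conv a b) y - \<omega> (conv (conv a b) y) = \<phi> b (conv y a) - \<omega> (conv b (conv y a))"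
    if a: "a \<in> L1" and b: "b \<in> L1" and y: "y \<in> L1" for a b y
  proof -
    have w1: "bdd_lin (\<lambda>f. \<phi> f y - \<omega> (conv f y))" and w2: "bdd_lin (\<lambda>f. \<phi> b f - \<omega> (conv b f))"
      by (intro bdd_lin_minus L R bdd_lin_comp_conv \<omega> b y)+
    have "\<phi> (lt v b) y - \<omega> (conv (lt v b) y) = \<phi> b (rt v y) - \<omega> (conv b (rt v y))" for v
      using defect[OF b y, of v] unfolding conv_lt[OF b y] conv_rt defect_def by (simp add: algebra_simps)
    then show ?thesis using bdd_lin_conv_left(1)[OF w1 a b] bdd_lin_conv_right(1)[OF w2 a y] by simp
  qed
  have skew: "\<phi> y f = - \<phi> f y" if f: "f \<in> L1" and y: "y \<in> L1" for f y
  proof -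
    \<comment> \<open>Every element commutes with itself; skew-symmetry follows by
      polarization.\<close>
    have z: "\<phi> g g = 0" if "g \<in> L1" for g using \<phi>(2) that by (simp add: comm_zero_def)
    have "\<phi> (\<lambda>x. f x + y x) (\<lambda>x. f x + y x) = \<phi> f f + \<phi> f y + (\<phi> y f + \<phi> y y)"
      by (simp add: bdd_lin_add[OF L] bdd_lin_add[OF R] f y L1_add)
    then show ?thesis using z[OF L1_add[OF f y]] z[OF f] z[OF y] by (simp add: eq_neg_iff_add_eq_0 add.commute)
  qed
  have \<kappa>_skew: "\<kappa> y f = - \<kappa> f y" if "f \<in> L1" "y \<in> L1" for f y
    using skew[OF that] by (simp add: \<kappa>_def)
  have \<kappa>_move: "\<kappa> (conv a b) y = \<kappa> b (conv y a)" if "a \<in> L1" "b \<in> L1" "y \<in> L1" for a b y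
    using move[OF that] bdd_lin_conv_assoc[OF \<omega>(1)] that by (simp add: \<kappa>_def)
  have "\<kappa> f y = 0" if f: "f \<in> L1" and y: "y \<in> L1" for f y
  proof -
    have "bdd_lin (\<lambda>f. \<kappa> f y)"
      unfolding \<kappa>_def by (intro bdd_lin_plus bdd_lin_minus L bdd_lin_comp_conv \<omega>(1) y)
    moreover have "bdd_lin (\<lambda>f. 0)" using bdd_lin_minus[OF \<omega>(1) \<omega>(1)] by simp
    moreover have "\<kappa> (conv a b) y = 0" if a: "a \<in> L1" and b: "b \<in> L1" for a b
    proof -
      \<comment> \<open>Three applications of \<open>\<kappa>_move\<close> and three of
        skew-symmetry lead back to the start, so the value equals its negative.\<close>
      have "\<kappa> (conv a b) y = - \<kappa> (conv y a) b" using \<kappa>_move[OF a b y] \<kappa>_skew[OF conv_L1[OF y a] b] by simp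
      also have "\<dots> = - \<kappa> a (conv b y)" using \<kappa>_move[OF y a b] by simp
      also have "\<dots> = \<kappa> (conv b y) a" using \<kappa>_skew[OF a conv_L1[OF b y]] by simp
      also have "\<dots> = \<kappa> y (conv a b)" by (rule \<kappa>_move[OF b y a])
      also have "\<dots> = - \<kappa> (conv a b) y" by (rule \<kappa>_skew[OF conv_L1[OF a b] y])
      finally show ?thesis by simp
    qed
    ultimately show ?thesis using f by (rule bdd_lin_eq_products)
  qed
  then show ?thesis using \<omega>(1) by (intro exI[of _ \<omega>]) (simp add: \<kappa>_def algebra_simps)
qed

section \<open>The algebra of classes\<close>

lemma conv_cong_AE:
  assumes f: "f \<in> L1" "f' \<in> L1" "AE x in \<mu>. f x = f' x" and h: "h \<in> L1" "h' \<in> L1" "AE x in \<mu>. h x = h' x"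
  shows "AE x in \<mu>. conv f h x = conv f' h' x"
proof (rule pairing_eqI[OF conv_L1[OF f(1) h(1)] conv_L1[OF f(2) h(2)]])
  fix k assume "k \<in> test"
  note w = pairing_bdd_lin[OF this]
  have "pairing k (conv f h) = pairing k (conv f' h)" by (rule bdd_lin_cong_AE[OF bdd_lin_comp_conv(1)[OF w h(1)] f])
  also have "\<dots> = pairing k (conv f' h')" by (rule bdd_lin_cong_AE[OF bdd_lin_comp_conv(2)[OF w f(2)] h])
  finally show "pairing k (conv f h) = pairing k (conv f' h')" .
qed

lemma L1_complete:
  assumes f: "\<And>n::nat. f n \<in> L1" and cauchy: "\<And>e. e > 0 \<Longrightarrow> \<exists>M. \<forall>m\<ge>M. \<forall>n\<ge>M. N (\<lambda>x. f m x - f n x) < e"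
  shows "\<exists>a\<in>L1. (\<lambda>n. N (\<lambda>x. f n x - a x)) \<longlonglongrightarrow> 0"
proof -
  have "\<forall>k. \<exists>M. \<forall>m\<ge>M. \<forall>n\<ge>M. N (\<lambda>x. f m x - f n x) < (1 / 2) ^ k" using cauchy by simp
  then obtain M where M: "\<And>k m n. m \<ge> M k \<Longrightarrow> n \<ge> M k \<Longrightarrow> N (\<lambda>x. f m x - f n x) < (1 / 2) ^ k" by metis
  \<comment> \<open>A monotone choice of indices beyond the stages \<open>M k\<close>, so that the
    successive differences of the subsequence are dominated by a geometric series.\<close>
  define r where "r k = (\<Sum>i\<le>k. M i)" for k
  have r_mono: "r k \<le> r m" if "k \<le> m" for k m unfolding r_def by (rule sum_mono2) (use that in auto)
  have rM: "M k \<le> r m" if "k \<le> m" for k m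
  proof -
    have "M k \<le> r k" unfolding r_def by (rule member_le_sum) auto
    then show ?thesis using r_mono[OF that] by simp
  qed
  let ?g = "\<lambda>k x. f (r (Suc k)) x - f (r k) x"
  have gL: "?g k \<in> L1" for k by (rule L1_diff[OF f f])
  have "summable (\<lambda>k. N (?g k))"
  proof (rule summable_comparison_test'[of "\<lambda>k. (1 / 2) ^ k" 0])
    show "summable (\<lambda>k. (1 / 2 :: real) ^ k)" by (rule summable_geometric) simp
    show "norm (N (?g k)) \<le> (1 / 2) ^ k" for k
      using M[OF rM rM, of k "Suc k" k] N_nonneg[of "?g k"] by simp
  qed
  from L1_series[of ?g, OF gL this] obtain z where z: "z \<in> L1" "(\<lambda>n. N (\<lambda>x. (\<Sum>k<n. ?g k x) - z x)) \<longlonglongrightarrow> 0" by blast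
  define a where "a = (\<lambda>x. z x + f (r 0) x)"
  have a: "a \<in> L1" unfolding a_def by (rule L1_add[OF z(1) f])
  have "(\<Sum>k<n. ?g k x) - z x = f (r n) x - a x" for n x
    unfolding a_def by (subst sum_lessThan_telescope[of "\<lambda>n. f (r n) x"]) simp
  then have l: "(\<lambda>n. N (\<lambda>x. f (r n) x - a x)) \<longlonglongrightarrow> 0" using z(2) by simp
  have "(\<lambda>n. N (\<lambda>x. f n x - a x)) \<longlonglongrightarrow> 0"
  proof (rule LIMSEQ_I)
    fix e :: real assume e: "e > 0"
    then obtain K where K: "(1 / 2) ^ K < e / 2" using real_arch_pow_inv[of "e / 2" "1 / 2"] by auto
    have "eventually (\<lambda>m. N (\<lambda>x. f (r m) x - a x) < e / 2 \<and> K \<le> m) sequentially"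
      by (intro eventually_conj order_tendstoD(2)[OF l] eventually_ge_at_top) (use e in simp)
    then obtain m where m: "N (\<lambda>x. f (r m) x - a x) < e / 2" "K \<le> m" by (auto simp: eventually_sequentially)
    show "\<exists>n0. \<forall>n\<ge>n0. norm (N (\<lambda>x. f n x - a x) - 0) < e"
    proof (intro exI[of _ "M K"] allI impI)
      fix n assume n: "M K \<le> n"
      have "N (\<lambda>x. f n x - a x) = N (\<lambda>x. (f n x - f (r m) x) + (f (r m) x - a x))" by simp
      also have "\<dots> \<le> N (\<lambda>x. f n x - f (r m) x) + N (\<lambda>x. f (r m) x - a x)" by (intro N_triangle L1_diff f a)
      also have "\<dots> < e" using M[OF n rM[OF m(2)]] K m(1) by linarith
      finally show "norm (N (\<lambda>x. f n x - a x) - 0) < e" by (simp add: N_nonneg)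
    qed
  qed
  then show ?thesis using a by blast
qed

abbreviation cls :: "('g \<Rightarrow> complex) \<Rightarrow> ('g \<Rightarrow> complex) set" where "cls \<equiv> ae_class \<mu>"

abbreviation L1A :: "('g \<Rightarrow> complex) set normed_alg" where "L1A \<equiv> L1_group_algebra \<mu>"

lemma mem_cls: "f \<in> L1 \<Longrightarrow> h \<in> cls f \<longleftrightarrow> h \<in> L1 \<and> (AE x in \<mu>. f x = h x)"
  by (auto simp: ae_class_def ae_rel_def L1_def)

lemma cls_eq_iff: assumes f: "f \<in> L1" and h: "h \<in> L1" shows "cls f = cls h \<longleftrightarrow> (AE x in \<mu>. f x = h x)"
proof
  assume "cls f = cls h"
  then show "AE x in \<mu>. f x = h x" using mem_cls[OF f, of h] mem_cls[OF h, of h] h by simp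
next
  assume e: "AE x in \<mu>. f x = h x"
  have "(AE x in \<mu>. f x = k x) \<longleftrightarrow> (AE x in \<mu>. h x = k x)" for k
  proof
    assume "AE x in \<mu>. f x = k x" with e show "AE x in \<mu>. h x = k x" by eventually_elim simp
  next
    assume "AE x in \<mu>. h x = k x" with e show "AE x in \<mu>. f x = k x" by eventually_elim simp
  qed
  then show "cls f = cls h" by (intro set_eqI) (simp only: mem_cls[OF f] mem_cls[OF h])
qed

lemma rep_cls: assumes f: "f \<in> L1" shows "rep (cls f) \<in> L1" "AE x in \<mu>. rep (cls f) x = f x"
proof -
  have "rep (cls f) \<in> cls f" unfolding rep_def by (rule someI[of _ f]) (simp add: mem_cls f)
  then show "rep (cls f) \<in> L1" "AE x in \<mu>. rep (cls f) x = f x" by (simp_all add: mem_cls[OF f] eq_commute)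
qed

lemma carrier_L1A: "carrier L1A = cls ` L1"
  by (auto simp: L1_group_algebra_def L1_def quotient_def ae_class_def)

lemma cls_carrier: "f \<in> L1 \<Longrightarrow> cls f \<in> carrier L1A" by (simp add: carrier_L1A)

lemma zero_L1A: "zero L1A = cls (\<lambda>x. 0)" by (simp add: L1_group_algebra_def)

lemma add_cls: assumes f: "f \<in> L1" and h: "h \<in> L1" shows "add L1A (cls f) (cls h) = cls (\<lambda>x. f x + h x)"
  unfolding L1_group_algebra_def normed_alg.simps cls_eq_iff[OF L1_add[OF rep_cls(1)[OF f] rep_cls(1)[OF h]] L1_add[OF f h]]
  using rep_cls(2)[OF f] rep_cls(2)[OF h] by eventually_elim simp

lemma smult_cls: assumes f: "f \<in> L1" shows "smult L1A c (cls f) = cls (\<lambda>x. c * f x)"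
  unfolding L1_group_algebra_def normed_alg.simps cls_eq_iff[OF L1_cmult[OF rep_cls(1)[OF f]] L1_cmult[OF f]]
  using rep_cls(2)[OF f] by eventually_elim simp

lemma sub_cls: assumes f: "f \<in> L1" and h: "h \<in> L1" shows "sub L1A (cls f) (cls h) = cls (\<lambda>x. f x - h x)"
  unfolding sub_def smult_cls[OF h] add_cls[OF f L1_cmult[OF h]] by simp

lemma mult_cls: assumes f: "f \<in> L1" and h: "h \<in> L1" shows "mult L1A (cls f) (cls h) = cls (conv f h)"
  unfolding L1_group_algebra_def normed_alg.simps cls_eq_iff[OF conv_L1[OF rep_cls(1)[OF f] rep_cls(1)[OF h]] conv_L1[OF f h]]
  by (rule conv_cong_AE[OF rep_cls(1)[OF f] f rep_cls(2)[OF f] rep_cls(1)[OF h] h rep_cls(2)[OF h]])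

lemma nrm_cls: assumes f: "f \<in> L1" shows "nrm L1A (cls f) = N f"
  using N_cong_AE[OF rep_cls(1)[OF f] f rep_cls(2)[OF f]] by (simp add: L1_group_algebra_def N_def)

lemmas cls_ops = add_cls smult_cls sub_cls mult_cls nrm_cls zero_L1A

text \<open>The laws of convolution are known in weak form, after applying a bounded functional, and
  these functionals detect equality almost everywhere.\<close>

lemma cls_conv_eqI:
  assumes "f \<in> L1" "h \<in> L1" "\<And>w. bdd_lin w \<Longrightarrow> w f = w h"
  shows "cls f = cls h"
  unfolding cls_eq_iff[OF assms(1,2)] by (rule pairing_eqI[OF assms(1,2)]) (rule assms(3)[OF pairing_bdd_lin])

lemma complex_banach_algebra_L1A: "complex_banach_algebra L1A"
proof
  fix s :: "nat \<Rightarrow> ('g \<Rightarrow> complex) set"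
  assume s: "\<And>n. s n \<in> carrier L1A"
    and c: "\<And>e. e > 0 \<Longrightarrow> \<exists>N. \<forall>m\<ge>N. \<forall>n\<ge>N. nrm L1A (sub L1A (s m) (s n)) < e"
  have "\<forall>n. \<exists>f. f \<in> L1 \<and> s n = cls f" using s by (auto simp: carrier_L1A)
  then obtain f where f: "\<And>n. f n \<in> L1" "\<And>n. s n = cls (f n)" by metis
  have "\<exists>a\<in>L1. (\<lambda>n. N (\<lambda>x. f n x - a x)) \<longlonglongrightarrow> 0"
    by (rule L1_complete[OF f(1)]) (use c in \<open>simp add: f cls_ops L1_diff\<close>)
  then obtain a where a: "a \<in> L1" "(\<lambda>n. N (\<lambda>x. f n x - a x)) \<longlonglongrightarrow> 0" by blast
  show "\<exists>a\<in>carrier L1A. (\<lambda>n. nrm L1A (sub L1A (s n) a)) \<longlonglongrightarrow> 0"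
    by (rule bexI[OF _ cls_carrier[OF a(1)]]) (use a in \<open>simp add: f cls_ops L1_diff\<close>)
next
  show "\<And>a b d. \<lbrakk>a \<in> carrier L1A; b \<in> carrier L1A; d \<in> carrier L1A\<rbrakk> \<Longrightarrow>
      mult L1A (mult L1A a b) d = mult L1A a (mult L1A b d)"
    by (clarsimp simp: carrier_L1A cls_ops conv_L1) (rule cls_conv_eqI; simp add: bdd_lin_conv_assoc conv_L1)
  show "\<And>a b d. \<lbrakk>a \<in> carrier L1A; b \<in> carrier L1A; d \<in> carrier L1A\<rbrakk> \<Longrightarrow>
      mult L1A d (add L1A a b) = add L1A (mult L1A d a) (mult L1A d b)"
    by (clarsimp simp: carrier_L1A cls_ops conv_L1 L1_add) (rule cls_conv_eqI; simp add: bdd_lin_conv_add_right bdd_lin_add conv_L1 L1_add L1_cmult)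
  show "\<And>a b d. \<lbrakk>a \<in> carrier L1A; b \<in> carrier L1A; d \<in> carrier L1A\<rbrakk> \<Longrightarrow>
      mult L1A (add L1A a b) d = add L1A (mult L1A a d) (mult L1A b d)"
    by (clarsimp simp: carrier_L1A cls_ops conv_L1 L1_add) (rule cls_conv_eqI; simp add: bdd_lin_conv_add_left bdd_lin_add conv_L1 L1_add L1_cmult)
  show "\<And>a b c. \<lbrakk>a \<in> carrier L1A; b \<in> carrier L1A\<rbrakk> \<Longrightarrow> mult L1A (smult L1A c a) b = smult L1A c (mult L1A a b)"
    by (clarsimp simp: carrier_L1A cls_ops conv_L1 L1_cmult) (rule cls_conv_eqI; simp add: bdd_lin_conv_cmult_left bdd_lin_cmult conv_L1 L1_add L1_cmult)
  show "\<And>a b c. \<lbrakk>a \<in> carrier L1A; b \<in> carrier L1A\<rbrakk> \<Longrightarrow> mult L1A a (smult L1A c b) = smult L1A c (mult L1A a b)"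
    by (clarsimp simp: carrier_L1A cls_ops conv_L1 L1_cmult) (rule cls_conv_eqI; simp add: bdd_lin_conv_cmult_right bdd_lin_cmult conv_L1 L1_add L1_cmult)
  show "\<And>a. a \<in> carrier L1A \<Longrightarrow> (nrm L1A a = 0) = (a = zero L1A)"
    by (clarsimp simp: carrier_L1A cls_ops) (simp add: cls_eq_iff L1_zero N_eq_0_iff)
qed (auto simp: carrier_L1A cls_ops L1_zero L1_add L1_cmult conv_L1 L1_diff N_nonneg N_cmult
    N_triangle N_conv algebra_simps)

section \<open>Transfer between classes and functions\<close>

definition pull :: "(('g \<Rightarrow> complex) set \<Rightarrow> ('g \<Rightarrow> complex) set \<Rightarrow> complex) \<Rightarrow> ('g \<Rightarrow> complex) \<Rightarrow> ('g \<Rightarrow> complex) \<Rightarrow> complex"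
  where "pull \<phi> f h = \<phi> (cls f) (cls h)"

lemma bdd_bilin_pull:
  assumes bil: "bilinear_functional L1A \<phi>" and cont: "jointly_continuous L1A \<phi>"
  shows "\<exists>C. bdd_bilin (pull \<phi>) C"
proof -
  have al: "pull \<phi> (\<lambda>x. f x + g x) h = pull \<phi> f h + pull \<phi> g h" and ar: "pull \<phi> h (\<lambda>x. f x + g x) = pull \<phi> h f + pull \<phi> h g"
    if "f \<in> L1" "g \<in> L1" "h \<in> L1" for f g h
    using bil cls_carrier[OF that(1)] cls_carrier[OF that(2)] cls_carrier[OF that(3)]
    unfolding bilinear_functional_def pull_def by (metis add_cls[OF that(1,2)])+
  have sl: "pull \<phi> (\<lambda>x. c * f x) h = c * pull \<phi> f h" and sr: "pull \<phi> f (\<lambda>x. c * h x) = c * pull \<phi> f h"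
    if "f \<in> L1" "h \<in> L1" for c f h
    using bil cls_carrier[OF that(1)] cls_carrier[OF that(2)]
    unfolding bilinear_functional_def pull_def by (metis smult_cls[OF that(1)], metis smult_cls[OF that(2)])
  have zl: "pull \<phi> (\<lambda>x. 0) h = 0" and zr: "pull \<phi> h (\<lambda>x. 0) = 0" if "h \<in> L1" for h
    using sl[OF L1_zero that, of 0] sr[OF that L1_zero, of 0] by simp_all
  note z = cls_carrier[OF L1_zero]
  \<comment> \<open>Continuity at the pair of zero elements, at scale 1, is combined with
    homogeneity to give the global bound.\<close>
  obtain d where d: "d > 0" "\<And>a' b'. a' \<in> carrier L1A \<Longrightarrow> b' \<in> carrier L1A \<Longrightarrow> nrm L1A (sub L1A a' (cls (\<lambda>x. 0))) < d \<Longrightarrow>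
      nrm L1A (sub L1A b' (cls (\<lambda>x. 0))) < d \<Longrightarrow> cmod (\<phi> a' b' - \<phi> (cls (\<lambda>x. 0)) (cls (\<lambda>x. 0))) < 1"
    using cont[unfolded jointly_continuous_def, rule_format, OF z z, of 1] by auto
  have small: "norm (pull \<phi> f h) < 1" if "f \<in> L1" "h \<in> L1" "N f < d" "N h < d" for f h
    using d(2)[OF cls_carrier[OF that(1)] cls_carrier[OF that(2)]] that zl[OF L1_zero]
    by (simp add: sub_cls L1_zero nrm_cls L1_diff pull_def)
  have bound: "norm (pull \<phi> f h) \<le> (4 / d\<^sup>2) * N f * N h" if f: "f \<in> L1" and h: "h \<in> L1" for f h
  proof (cases "N f = 0 \<or> N h = 0")
    case True
    then have "cls f = cls (\<lambda>x. 0) \<or> cls h = cls (\<lambda>x. 0)"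
      using f h by (auto simp: cls_eq_iff L1_zero N_eq_0_iff)
    then have "pull \<phi> f h = 0" using zl[OF h] zr[OF f] by (auto simp: pull_def)
    then show ?thesis using N_nonneg[of f] N_nonneg[of h] by simp
  next
    case False
    then have pos: "N f > 0" "N h > 0" using N_nonneg[of f] N_nonneg[of h] by auto
    \<comment> \<open>Both arguments are scaled to norm \<open>d / 2\<close>, whence the constant
      \<open>4 / d^2\<close>.\<close>
    define s t where "s = d / (2 * N f)" and "t = d / (2 * N h)"
    have st: "s > 0" "t > 0" "s * N f < d" "t * N h < d" using pos d(1) by (simp_all add: s_def t_def)
    have "norm (pull \<phi> (\<lambda>x. complex_of_real s * f x) (\<lambda>x. complex_of_real t * h x)) < 1"
      by (rule small[OF L1_cmult[OF f] L1_cmult[OF h]]) (use st in \<open>simp_all add: N_cmult\<close>)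
    then have "s * t * norm (pull \<phi> f h) < 1"
      using st by (simp add: sl[OF f L1_cmult[OF h]] sr[OF f h] norm_mult mult.assoc)
    then have "norm (pull \<phi> f h) \<le> 1 / (s * t)" using st by (simp add: pos_le_divide_eq mult.commute)
    also have "1 / (s * t) = (4 / d\<^sup>2) * N f * N h" by (simp add: s_def t_def power2_eq_square)
    finally show ?thesis .
  qed
  have "bdd_bilin (pull \<phi>) (4 / d\<^sup>2)"
    unfolding bdd_bilin_def
  proof (intro conjI ballI)
    fix h assume h: "h \<in> L1"
    show "bdd_lin (\<lambda>f. pull \<phi> f h)"
      by (rule bdd_linI[where C="4 / d\<^sup>2 * N h"]) (use al sl h bound[OF _ h] in \<open>simp_all add: mult.commute mult.left_commute\<close>)
    show "bdd_lin (\<lambda>f. pull \<phi> h f)"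
      by (rule bdd_linI[where C="4 / d\<^sup>2 * N h"]) (use ar sr h bound[OF h] in simp_all)
  qed (use bound in simp_all)
  then show ?thesis ..
qed

lemma dual_space_rep:
  assumes w: "bdd_lin w" shows "(\<lambda>F. w (rep F)) \<in> dual_space L1A"
proof -
  have w_cls: "w (rep (cls f)) = w f" if "f \<in> L1" for f by (rule bdd_lin_cong_AE[OF w rep_cls(1)[OF that] that rep_cls(2)[OF that]])
  obtain C where C: "C \<ge> 0" "\<And>f. f \<in> L1 \<Longrightarrow> norm (w f) \<le> C * N f" using bdd_lin_bound[OF w] by blast
  have "\<exists>d>0. \<forall>h\<in>L1. N (\<lambda>x. h x - f x) < d \<longrightarrow> cmod (w h - w f) < e" if f: "f \<in> L1" and e: "e > 0" for f and e :: real
  proof (intro exI[of _ "e / (C + 1)"] conjI ballI impI)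
    show "e / (C + 1) > 0" using e C(1) by simp
    fix h assume h: "h \<in> L1" and l: "N (\<lambda>x. h x - f x) < e / (C + 1)"
    have "cmod (w h - w f) \<le> C * N (\<lambda>x. h x - f x)" using C(2)[OF L1_diff[OF h f]] by (simp add: bdd_lin_diff[OF w h f])
    also have "\<dots> \<le> (C + 1) * N (\<lambda>x. h x - f x)" by (intro mult_right_mono) (simp_all add: N_nonneg)
    also have "\<dots> < e" using l C(1) by (simp add: pos_less_divide_eq mult.commute)
    finally show "cmod (w h - w f) < e" .
  qed
  then show ?thesis
    by (simp add: dual_space_def carrier_L1A cls_ops w_cls L1_add L1_cmult L1_diff bdd_lin_add[OF w] bdd_lin_cmult[OF w])
qed

lemma zero_Lie_product_determined_L1A: "zero_Lie_product_determined_banach_algebra L1A"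
  unfolding zero_Lie_product_determined_banach_algebra_def
proof (intro conjI allI impI, rule complex_banach_algebra_L1A)
  fix \<phi>
  assume "bilinear_functional L1A \<phi> \<and> jointly_continuous L1A \<phi> \<and>
    (\<forall>a\<in>carrier L1A. \<forall>b\<in>carrier L1A. mult L1A a b = mult L1A b a \<longrightarrow> \<phi> a b = 0)"
  then have bil: "bilinear_functional L1A \<phi>" and cont: "jointly_continuous L1A \<phi>"
    and zero: "\<And>a b. a \<in> carrier L1A \<Longrightarrow> b \<in> carrier L1A \<Longrightarrow> mult L1A a b = mult L1A b a \<Longrightarrow> \<phi> a b = 0" by blast+
  obtain C where C: "bdd_bilin (pull \<phi>) C" using bdd_bilin_pull[OF bil cont] by blast
  have "comm_zero (pull \<phi>)"
    unfolding comm_zero_def pull_def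
  proof (intro ballI impI)
    fix a b assume "a \<in> L1" "b \<in> L1" "AE x in \<mu>. conv a b x = conv b a x"
    then show "\<phi> (cls a) (cls b) = 0" by (intro zero cls_carrier) (simp_all add: mult_cls cls_eq_iff conv_L1)
  qed
  from comm_zero_form[OF C this] obtain \<omega> where \<omega>: "bdd_lin \<omega>"
    "\<And>f y. f \<in> L1 \<Longrightarrow> y \<in> L1 \<Longrightarrow> pull \<phi> f y = \<omega> (conv f y) - \<omega> (conv y f)" by blast
  show "\<exists>\<omega>\<in>dual_space L1A. \<forall>a\<in>carrier L1A. \<forall>b\<in>carrier L1A. \<phi> a b = \<omega> (sub L1A (mult L1A a b) (mult L1A b a))"
  proof (rule bexI[OF _ dual_space_rep[OF \<omega>(1)]], intro ballI)
    fix a b assume "a \<in> carrier L1A" "b \<in> carrier L1A"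
    then obtain f y where f: "f \<in> L1" "a = cls f" and y: "y \<in> L1" "b = cls y" by (auto simp: carrier_L1A)
    have d: "(\<lambda>x. conv f y x - conv y f x) \<in> L1" by (intro L1_diff conv_L1 f y)
    have "\<omega> (rep (cls (\<lambda>x. conv f y x - conv y f x))) = \<omega> (conv f y) - \<omega> (conv y f)"
      using bdd_lin_cong_AE[OF \<omega>(1) rep_cls(1)[OF d] d rep_cls(2)[OF d]]
      by (simp add: bdd_lin_diff[OF \<omega>(1) conv_L1[OF f(1) y(1)] conv_L1[OF y(1) f(1)]])
    then show "\<phi> a b = \<omega> (rep (sub L1A (mult L1A a b) (mult L1A b a)))"
      using \<omega>(2)[OF f(1) y(1)] by (simp add: f y mult_cls sub_cls conv_L1 pull_def)
  qed
qed

end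

theorem corollary2p10:
  fixes \<mu> :: "'g::{topological_group_add, t2_space} measure"
  assumes "locally_compact_space (euclidean :: 'g topology)"
    and "left_Haar_measure \<mu>"
  shows "zero_Lie_product_determined_banach_algebra (L1_group_algebra \<mu>)"
proof -
  interpret haar_group \<mu> using assms by unfold_locales
  show ?thesis by (rule zero_Lie_product_determined_L1A)
qed

end
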